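(* Let $\mathcal V$ be a category with finite limits, regarded as a cartesian monoidal category. Let $\eta_!\colon \mathcal V\text{-}\mathsf{Cat}\to \mathsf{Fam}(\mathcal V)\text{-}\mathsf{Cat}$ be the change-of-base functor induced by the inclusion $\eta\colon\mathcal V\to\mathsf{Fam}(\mathcal V)$ of $\mathcal V$ into its free coproduct completion. Then $\eta_!$ reflects effective descent morphisms: if $F$ is a $\mathcal V$-functor between small $\mathcal V$-categories such that $\eta_!F$ is an effective descent morphism in $\mathsf{Fam}(\mathcal V)\text{-}\mathsf{Cat}$, then $F$ is an effective descent morphism in $\mathcal V\text{-}\mathsf{Cat}$.
   Context: Free coproduct completion: $\mathsf{Fam}(\mathcal V)$ has as objects set-indexed families $(X_j)_{j\in J}$ of objects of $\mathcal V$; a morphism $(X_j)_{j\in J}\to(Y_k)_{k\in K}$ is a function $f\colon J\to K$ together with morphisms $\phi_j\colon X_j\to Y_{f(j)}$ in $\mathcal V$ for all $j\in J$. If $\mathcal V$ has finite limits, so does $\mathsf{Fam}(\mathcal V)$, and it is regarded as cartesian monoidal. The functor $\eta$ sends $X$ to the one-member family $(X)$; it preserves finite products. For a cartesian monoidal category $\mathcal W$ with finite limits, $\mathcal W\text{-}\mathsf{Cat}$ is the category of small $\mathcal W$-enriched categories and $\mathcal W$-functors (it has pullbacks). $\eta_!$ leaves the set of objects unchanged and applies $\eta$ to hom-objects. Effective descent: let $\mathcal C$ be a category with pullbacks and $p\colon e\to b$ a morphism. Let $p^*\colon \mathcal C/b\to\mathcal C/e$ be the pullback functor, $p_!\dashv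 p^*$ its left adjoint (composition with $p$), $T^p$ the induced monad on $\mathcal C/e$, and $\mathcal K^p\colon\mathcal C/b\to T^p\text{-}\mathsf{Alg}$ the Eilenberg–Moore comparison functor. Then $p$ is an effective descent morphism if $\mathcal K^p$ is an equivalence. *)

theory Defs
  imports "HOL-Library.FuncSet"
begin

section \<open>Categories, functors, natural isomorphisms, equivalences\<close>

record ('o, 'a) cat =
  Obj  :: "'o set"
  Arr  :: "'a set"
  Dom  :: "'a \<Rightarrow> 'o"
  Cod  :: "'a \<Rightarrow> 'o"
  Ide  :: "'o \<Rightarrow> 'a"
  Comp :: "'a \<Rightarrow> 'a \<Rightarrow> 'a"  (infixr "\<cdot>\<index>" 70)

definition Hom :: "('o, 'a) cat \<Rightarrow> 'o \<Rightarrow> 'o \<Rightarrow> 'a set" where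
  "Hom C x y = {f \<in> Arr C. Dom C f = x \<and> Cod C f = y}"

locale category =
  fixes C :: "('o, 'a) cat" (structure)
  assumes Dom_Obj: "f \<in> Arr C \<Longrightarrow> Dom C f \<in> Obj C"
    and Cod_Obj: "f \<in> Arr C \<Longrightarrow> Cod C f \<in> Obj C"
    and Ide_Hom: "x \<in> Obj C \<Longrightarrow> Ide C x \<in> Hom C x x"
    and Comp_Hom: "f \<in> Hom C x y \<Longrightarrow> g \<in> Hom C y z \<Longrightarrow> g \<cdot> f \<in> Hom C x z"
    and Comp_Ide: "f \<in> Hom C x y \<Longrightarrow> f \<cdot> Ide C x = f"
    and Ide_Comp: "f \<in> Hom C x y \<Longrightarrow> Ide C y \<cdot> f = f"
    and Comp_assoc: "f \<in> Hom C w x \<Longrightarrow> g \<in> Hom C x y \<Longrightarrow> h \<in> Hom C y z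
                       \<Longrightarrow> (h \<cdot> g) \<cdot> f = h \<cdot> (g \<cdot> f)"

definition inverse_arrows :: "('o, 'a) cat \<Rightarrow> 'a \<Rightarrow> 'a \<Rightarrow> bool" where
  "inverse_arrows C f g \<longleftrightarrow>
     f \<in> Arr C \<and> g \<in> Hom C (Cod C f) (Dom C f)
     \<and> g \<cdot>\<^bsub>C\<^esub> f = Ide C (Dom C f) \<and> f \<cdot>\<^bsub>C\<^esub> g = Ide C (Cod C f)"

definition iso_arrow :: "('o, 'a) cat \<Rightarrow> 'a \<Rightarrow> bool" where
  "iso_arrow C f \<longleftrightarrow> (\<exists>g. inverse_arrows C f g)"

definition inv_arrow :: "('o, 'a) cat \<Rightarrow> 'a \<Rightarrow> 'a" where
  "inv_arrow C f = (THE g. inverse_arrows C f g)"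

record ('o, 'a, 'p, 'b) ftr =
  FObj :: "'o \<Rightarrow> 'p"
  FArr :: "'a \<Rightarrow> 'b"

definition is_functor :: "('o, 'a) cat \<Rightarrow> ('p, 'b) cat \<Rightarrow> ('o, 'a, 'p, 'b) ftr \<Rightarrow> bool" where
  "is_functor C D F \<longleftrightarrow>
     category C \<and> category D
     \<and> (\<forall>x\<in>Obj C. FObj F x \<in> Obj D)
     \<and> (\<forall>f\<in>Arr C. FArr F f \<in> Hom D (FObj F (Dom C f)) (FObj F (Cod C f)))
     \<and> (\<forall>x\<in>Obj C. FArr F (Ide C x) = Ide D (FObj F x))
     \<and> (\<forall>f\<in>Arr C. \<forall>g\<in>Arr C. Dom C g = Cod C f \<longrightarrow>
            FArr F (g \<cdot>\<^bsub>C\<^esub> f) = FArr F g \<cdot>\<^bsub>D\<^esub> FArr F f)"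

definition id_ftr :: "('o, 'a, 'o, 'a) ftr" where
  "id_ftr = \<lparr>FObj = (\<lambda>x. x), FArr = (\<lambda>f. f)\<rparr>"

definition comp_ftr :: "('p, 'b, 'q, 'c) ftr \<Rightarrow> ('o, 'a, 'p, 'b) ftr \<Rightarrow> ('o, 'a, 'q, 'c) ftr" where
  "comp_ftr G F = \<lparr>FObj = (\<lambda>x. FObj G (FObj F x)), FArr = (\<lambda>f. FArr G (FArr F f))\<rparr>"

definition nat_isomorphism ::
    "('o, 'a) cat \<Rightarrow> ('p, 'b) cat \<Rightarrow> ('o, 'a, 'p, 'b) ftr \<Rightarrow> ('o, 'a, 'p, 'b) ftr \<Rightarrow> ('o \<Rightarrow> 'b) \<Rightarrow> bool" where
  "nat_isomorphism C D F G t \<longleftrightarrow>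
     is_functor C D F \<and> is_functor C D G
     \<and> (\<forall>x\<in>Obj C. t x \<in> Hom D (FObj F x) (FObj G x) \<and> iso_arrow D (t x))
     \<and> (\<forall>f\<in>Arr C. t (Cod C f) \<cdot>\<^bsub>D\<^esub> FArr F f = FArr G f \<cdot>\<^bsub>D\<^esub> t (Dom C f))"

definition is_equivalence :: "('o, 'a) cat \<Rightarrow> ('p, 'b) cat \<Rightarrow> ('o, 'a, 'p, 'b) ftr \<Rightarrow> bool" where
  "is_equivalence C D F \<longleftrightarrow>
     is_functor C D F
     \<and> (\<exists>G s t. is_functor D C G
            \<and> nat_isomorphism C C id_ftr (comp_ftr G F) s
            \<and> nat_isomorphism D D (comp_ftr F G) id_ftr t)"

section \<open>Limits\<close>

definition is_cone ::
    "('i, 'k) cat \<Rightarrow> ('o, 'a) cat \<Rightarrow> ('i, 'k, 'o, 'a) ftr \<Rightarrow> 'o \<Rightarrow> ('i \<Rightarrow> 'a) \<Rightarrow> bool" where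
  "is_cone J C D x c \<longleftrightarrow>
     x \<in> Obj C \<and> (\<forall>i\<in>Obj J. c i \<in> Hom C x (FObj D i))
     \<and> (\<forall>k\<in>Arr J. FArr D k \<cdot>\<^bsub>C\<^esub> c (Dom J k) = c (Cod J k))"

definition is_limit ::
    "('i, 'k) cat \<Rightarrow> ('o, 'a) cat \<Rightarrow> ('i, 'k, 'o, 'a) ftr \<Rightarrow> 'o \<Rightarrow> ('i \<Rightarrow> 'a) \<Rightarrow> bool" where
  "is_limit J C D l p \<longleftrightarrow>
     is_cone J C D l p
     \<and> (\<forall>x c. is_cone J C D x c \<longrightarrow>
            (\<exists>!h. h \<in> Hom C x l \<and> (\<forall>i\<in>Obj J. p i \<cdot>\<^bsub>C\<^esub> h = c i)))"

text \<open>Every finite category is isomorphic to one whose objects and arrows are natural numbers,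
  so it suffices to let the shapes of diagrams range over those.\<close>

definition has_finite_limits :: "('o, 'a) cat \<Rightarrow> bool" where
  "has_finite_limits C \<longleftrightarrow>
     (\<forall>(J :: (nat, nat) cat) D.
        finite (Obj J) \<and> finite (Arr J) \<and> is_functor J C D \<longrightarrow> (\<exists>l p. is_limit J C D l p))"

definition is_terminal :: "('o, 'a) cat \<Rightarrow> 'o \<Rightarrow> bool" where
  "is_terminal C t \<longleftrightarrow> t \<in> Obj C \<and> (\<forall>x\<in>Obj C. \<exists>!h. h \<in> Hom C x t)"

definition is_product :: "('o, 'a) cat \<Rightarrow> 'o \<Rightarrow> 'o \<Rightarrow> 'o \<Rightarrow> 'a \<Rightarrow> 'a \<Rightarrow> bool" where
  "is_product C x y z p q \<longleftrightarrow>
     p \<in> Hom C z x \<and> q \<in> Hom C z y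
     \<and> (\<forall>w f g. f \<in> Hom C w x \<and> g \<in> Hom C w y \<longrightarrow>
            (\<exists>!h. h \<in> Hom C w z \<and> p \<cdot>\<^bsub>C\<^esub> h = f \<and> q \<cdot>\<^bsub>C\<^esub> h = g))"

definition is_pullback :: "('o, 'a) cat \<Rightarrow> 'a \<Rightarrow> 'a \<Rightarrow> 'a \<Rightarrow> 'a \<Rightarrow> bool" where
  "is_pullback C f g q r \<longleftrightarrow>
     q \<in> Hom C (Dom C q) (Dom C f) \<and> r \<in> Hom C (Dom C q) (Dom C g)
     \<and> f \<cdot>\<^bsub>C\<^esub> q = g \<cdot>\<^bsub>C\<^esub> r
     \<and> (\<forall>w u v. u \<in> Hom C w (Dom C f) \<and> v \<in> Hom C w (Dom C g) \<and> f \<cdot>\<^bsub>C\<^esub> u = g \<cdot>\<^bsub>C\<^esub> v \<longrightarrow>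
            (\<exists>!h. h \<in> Hom C w (Dom C q) \<and> q \<cdot>\<^bsub>C\<^esub> h = u \<and> r \<cdot>\<^bsub>C\<^esub> h = v))"

definition has_pullbacks :: "('o, 'a) cat \<Rightarrow> bool" where
  "has_pullbacks C \<longleftrightarrow>
     (\<forall>f\<in>Arr C. \<forall>g\<in>Arr C. Cod C f = Cod C g \<longrightarrow> (\<exists>q r. is_pullback C f g q r))"

section \<open>Monads and the Eilenberg-Moore comparison functor\<close>

record ('o, 'a) monad =
  Endo :: "('o, 'a, 'o, 'a) ftr"
  Unit :: "'o \<Rightarrow> 'a"
  Mult :: "'o \<Rightarrow> 'a"

text \<open>The objects of the Eilenberg-Moore category are the algebras \<open>(x, a)\<close> with
  structure map \<open>a : T x \<rightarrow> x\<close>; arrows carry their source and target algebra.\<close>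

definition algebras :: "('o, 'a) cat \<Rightarrow> ('o, 'a) monad \<Rightarrow> ('o \<times> 'a) set" where
  "algebras C T = {(x, a). x \<in> Obj C \<and> a \<in> Hom C (FObj (Endo T) x) x
     \<and> a \<cdot>\<^bsub>C\<^esub> Unit T x = Ide C x
     \<and> a \<cdot>\<^bsub>C\<^esub> FArr (Endo T) a = a \<cdot>\<^bsub>C\<^esub> Mult T x}"

definition EM :: "('o, 'a) cat \<Rightarrow> ('o, 'a) monad
                   \<Rightarrow> ('o \<times> 'a, ('o \<times> 'a) \<times> 'a \<times> ('o \<times> 'a)) cat" where
  "EM C T = \<lparr>
     Obj = algebras C T,
     Arr = {(X, h, Y). X \<in> algebras C T \<and> Y \<in> algebras C T \<and> h \<in> Hom C (fst X) (fst Y)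
                \<and> h \<cdot>\<^bsub>C\<^esub> snd X = snd Y \<cdot>\<^bsub>C\<^esub> FArr (Endo T) h},
     Dom = (\<lambda>(X, h, Y). X),
     Cod = (\<lambda>(X, h, Y). Y),
     Ide = (\<lambda>X. (X, Ide C (fst X), X)),
     Comp = (\<lambda>(Y', k, Z) (X, h, Y). (X, k \<cdot>\<^bsub>C\<^esub> h, Z))\<rparr>"

text \<open>The two definitions below are applied to a right adjoint \<open>R : D \<rightarrow> C\<close> of \<open>L : C \<rightarrow> D\<close>,
  with unit \<open>e\<close> and counit \<open>c\<close>.\<close>

definition adj_monad ::
    "('o, 'a, 'p, 'b) ftr \<Rightarrow> ('p, 'b, 'o, 'a) ftr \<Rightarrow> ('o \<Rightarrow> 'a) \<Rightarrow> ('p \<Rightarrow> 'b) \<Rightarrow> ('o, 'a) monad" where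
  "adj_monad L R e c =
     \<lparr>Endo = comp_ftr R L, Unit = e, Mult = (\<lambda>x. FArr R (c (FObj L x)))\<rparr>"

definition em_comparison ::
    "('p, 'b) cat \<Rightarrow> ('p, 'b, 'o, 'a) ftr \<Rightarrow> ('p \<Rightarrow> 'b)
      \<Rightarrow> ('p, 'b, 'o \<times> 'a, ('o \<times> 'a) \<times> 'a \<times> ('o \<times> 'a)) ftr" where
  "em_comparison D R c =
     (let K = (\<lambda>d. (FObj R d, FArr R (c d)))
      in \<lparr>FObj = K, FArr = (\<lambda>f. (K (Dom D f), FArr R f, K (Cod D f)))\<rparr>)"

section \<open>Effective descent morphisms\<close>

text \<open>An object of the slice \<open>C / b\<close> is an arrow of \<open>C\<close> with codomain \<open>b\<close>; an arrow
  \<open>(f, h, g)\<close> from \<open>f\<close> to \<open>g\<close> is given by \<open>h\<close> with \<open>g \<cdot> h = f\<close>.\<close>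

definition slice :: "('o, 'a) cat \<Rightarrow> 'o \<Rightarrow> ('a, 'a \<times> 'a \<times> 'a) cat" where
  "slice C b = \<lparr>
     Obj = {f \<in> Arr C. Cod C f = b},
     Arr = {(f, h, g). f \<in> Arr C \<and> Cod C f = b \<and> g \<in> Arr C \<and> Cod C g = b
                \<and> h \<in> Hom C (Dom C f) (Dom C g) \<and> g \<cdot>\<^bsub>C\<^esub> h = f},
     Dom = (\<lambda>(f, h, g). f),
     Cod = (\<lambda>(f, h, g). g),
     Ide = (\<lambda>f. (f, Ide C (Dom C f), f)),
     Comp = (\<lambda>(g', k, l) (f, h, g). (f, k \<cdot>\<^bsub>C\<^esub> h, l))\<rparr>"

text \<open>A chosen pullback of \<open>f\<close> along \<open>p\<close>; \<open>pb_base C p f\<close> is its leg into the domain of \<open>p\<close>.\<close>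

definition pb :: "('o, 'a) cat \<Rightarrow> 'a \<Rightarrow> 'a \<Rightarrow> 'a \<times> 'a" where
  "pb C p f = (SOME qr. is_pullback C p f (fst qr) (snd qr))"

definition pb_base :: "('o, 'a) cat \<Rightarrow> 'a \<Rightarrow> 'a \<Rightarrow> 'a" where
  "pb_base C p f = fst (pb C p f)"

definition pb_top :: "('o, 'a) cat \<Rightarrow> 'a \<Rightarrow> 'a \<Rightarrow> 'a" where
  "pb_top C p f = snd (pb C p f)"

definition pb_induced :: "('o, 'a) cat \<Rightarrow> 'a \<Rightarrow> 'a \<Rightarrow> 'a \<Rightarrow> 'a \<Rightarrow> 'a" where
  "pb_induced C p f u v =
     (THE h. h \<in> Hom C (Dom C u) (Dom C (pb_base C p f))
             \<and> pb_base C p f \<cdot>\<^bsub>C\<^esub> h = u \<and> pb_top C p f \<cdot>\<^bsub>C\<^esub> h = v)"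

definition pullback_ftr ::
    "('o, 'a) cat \<Rightarrow> 'a \<Rightarrow> ('a, 'a \<times> 'a \<times> 'a, 'a, 'a \<times> 'a \<times> 'a) ftr" where
  "pullback_ftr C p = \<lparr>
     FObj = pb_base C p,
     FArr = (\<lambda>(f, h, g). (pb_base C p f,
                          pb_induced C p g (pb_base C p f) (h \<cdot>\<^bsub>C\<^esub> pb_top C p f),
                          pb_base C p g))\<rparr>"

definition postcomp_ftr ::
    "('o, 'a) cat \<Rightarrow> 'a \<Rightarrow> ('a, 'a \<times> 'a \<times> 'a, 'a, 'a \<times> 'a \<times> 'a) ftr" where
  "postcomp_ftr C p = \<lparr>
     FObj = (\<lambda>f. p \<cdot>\<^bsub>C\<^esub> f),
     FArr = (\<lambda>(f, h, g). (p \<cdot>\<^bsub>C\<^esub> f, h, p \<cdot>\<^bsub>C\<^esub> g))\<rparr>"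

definition descent_unit :: "('o, 'a) cat \<Rightarrow> 'a \<Rightarrow> 'a \<Rightarrow> 'a \<times> 'a \<times> 'a" where
  "descent_unit C p f =
     (f, pb_induced C p (p \<cdot>\<^bsub>C\<^esub> f) f (Ide C (Dom C f)), pb_base C p (p \<cdot>\<^bsub>C\<^esub> f))"

definition descent_counit :: "('o, 'a) cat \<Rightarrow> 'a \<Rightarrow> 'a \<Rightarrow> 'a \<times> 'a \<times> 'a" where
  "descent_counit C p g = (p \<cdot>\<^bsub>C\<^esub> pb_base C p g, pb_top C p g, g)"

definition descent_monad :: "('o, 'a) cat \<Rightarrow> 'a \<Rightarrow> ('a, 'a \<times> 'a \<times> 'a) monad" where
  "descent_monad C p =
     adj_monad (postcomp_ftr C p) (pullback_ftr C p) (descent_unit C p) (descent_counit C p)"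

text \<open>The notion is meant for categories with pullbacks; \<open>pb\<close> is unspecified in others, which
  are therefore excluded by the definition.\<close>

definition effective_descent :: "('o, 'a) cat \<Rightarrow> 'a \<Rightarrow> bool" where
  "effective_descent C p \<longleftrightarrow>
     category C \<and> has_pullbacks C \<and> p \<in> Arr C
     \<and> is_equivalence (slice C (Cod C p)) (EM (slice C (Dom C p)) (descent_monad C p))
         (em_comparison (slice C (Cod C p)) (pullback_ftr C p) (descent_counit C p))"

section \<open>Cartesian monoidal structure\<close>

text \<open>Products and the terminal object are chosen arbitrarily.\<close>

definition prd :: "('o, 'a) cat \<Rightarrow> 'o \<Rightarrow> 'o \<Rightarrow> 'o \<times> 'a \<times> 'a" where
  "prd C x y = (SOME (z, p, q). is_product C x y z p q)"

definition prd_obj :: "('o, 'a) cat \<Rightarrow> 'o \<Rightarrow> 'o \<Rightarrow> 'o" where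
  "prd_obj C x y = fst (prd C x y)"

definition proj1 :: "('o, 'a) cat \<Rightarrow> 'o \<Rightarrow> 'o \<Rightarrow> 'a" where
  "proj1 C x y = fst (snd (prd C x y))"

definition proj2 :: "('o, 'a) cat \<Rightarrow> 'o \<Rightarrow> 'o \<Rightarrow> 'a" where
  "proj2 C x y = snd (snd (prd C x y))"

definition pairing :: "('o, 'a) cat \<Rightarrow> 'a \<Rightarrow> 'a \<Rightarrow> 'a" where
  "pairing C f g =
     (THE h. h \<in> Hom C (Dom C f) (prd_obj C (Cod C f) (Cod C g))
             \<and> proj1 C (Cod C f) (Cod C g) \<cdot>\<^bsub>C\<^esub> h = f
             \<and> proj2 C (Cod C f) (Cod C g) \<cdot>\<^bsub>C\<^esub> h = g)"

definition prd_arr :: "('o, 'a) cat \<Rightarrow> 'a \<Rightarrow> 'a \<Rightarrow> 'a" where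
  "prd_arr C f g = pairing C (f \<cdot>\<^bsub>C\<^esub> proj1 C (Dom C f) (Dom C g)) (g \<cdot>\<^bsub>C\<^esub> proj2 C (Dom C f) (Dom C g))"

definition associator :: "('o, 'a) cat \<Rightarrow> 'o \<Rightarrow> 'o \<Rightarrow> 'o \<Rightarrow> 'a" where
  "associator C x y z =
     pairing C (proj1 C x y \<cdot>\<^bsub>C\<^esub> proj1 C (prd_obj C x y) z)
               (pairing C (proj2 C x y \<cdot>\<^bsub>C\<^esub> proj1 C (prd_obj C x y) z) (proj2 C (prd_obj C x y) z))"

definition trm :: "('o, 'a) cat \<Rightarrow> 'o" where
  "trm C = (SOME t. is_terminal C t)"

definition bang :: "('o, 'a) cat \<Rightarrow> 'o \<Rightarrow> 'a" where
  "bang C x = (THE h. h \<in> Hom C x (trm C))"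

section \<open>Set universes\<close>

text \<open>``Set'' is read as ``small set'', i.e. as an element of a fixed universe of subsets of a
  type. Only closure under subsets, images and disjoint unions is required (which gives finite
  products and unions). This covers the universe of all subsets of an arbitrary infinite type as
  well as Grothendieck universes, i.e. the sets of cardinality below that of a type of
  inaccessible cardinality.\<close>

locale set_universe =
  fixes small :: "'u set \<Rightarrow> bool"
  assumes small_two: "\<exists>x y. x \<noteq> y \<and> small {x, y}"
    and small_subset: "\<And>A B. small A \<Longrightarrow> B \<subseteq> A \<Longrightarrow> small B"
    and small_image: "\<And>A f. small A \<Longrightarrow> small (f ` A)"
    and small_Sigma: "\<And>A B. small A \<Longrightarrow> (\<And>a. a \<in> A \<Longrightarrow> small (B a))
                       \<Longrightarrow> \<exists>h :: 'u \<times> 'u \<Rightarrow> 'u. inj_on h (Sigma A B) \<and> small (h ` Sigma A B)"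

section \<open>The free coproduct completion\<close>

record ('u, 'o) fam =
  Idx :: "'u set"
  Mem :: "'u \<Rightarrow> 'o"

record ('u, 'o, 'a) fam_arr =
  Src  :: "('u, 'o) fam"
  Tgt  :: "('u, 'o) fam"
  IFun :: "'u \<Rightarrow> 'u"
  AFun :: "'u \<Rightarrow> 'a"

definition families :: "('u set \<Rightarrow> bool) \<Rightarrow> ('o, 'a) cat \<Rightarrow> ('u, 'o) fam set" where
  "families small V = {X. small (Idx X) \<and> Mem X \<in> Idx X \<rightarrow>\<^sub>E Obj V}"

definition Fam :: "('u set \<Rightarrow> bool) \<Rightarrow> ('o, 'a) cat \<Rightarrow> (('u, 'o) fam, ('u, 'o, 'a) fam_arr) cat" where
  "Fam small V = \<lparr>
     Obj = families small V,
     Arr = {F. Src F \<in> families small V \<and> Tgt F \<in> families small V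
               \<and> IFun F \<in> Idx (Src F) \<rightarrow>\<^sub>E Idx (Tgt F)
               \<and> AFun F \<in> (\<Pi>\<^sub>E j \<in> Idx (Src F). Hom V (Mem (Src F) j) (Mem (Tgt F) (IFun F j)))},
     Dom = Src,
     Cod = Tgt,
     Ide = (\<lambda>X. \<lparr>Src = X, Tgt = X, IFun = (\<lambda>j\<in>Idx X. j), AFun = (\<lambda>j\<in>Idx X. Ide V (Mem X j))\<rparr>),
     Comp = (\<lambda>G F. \<lparr>Src = Src F, Tgt = Tgt G,
                    IFun = (\<lambda>j\<in>Idx (Src F). IFun G (IFun F j)),
                    AFun = (\<lambda>j\<in>Idx (Src F). AFun G (IFun F j) \<cdot>\<^bsub>V\<^esub> AFun F j)\<rparr>)\<rparr>"

text \<open>The index set of a one-member family is \<open>{undefined}\<close>: \<open>undefined\<close> is used here as a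
  fixed but arbitrary element of the type.\<close>

definition one_member :: "'o \<Rightarrow> ('u, 'o) fam" where
  "one_member x = \<lparr>Idx = {undefined}, Mem = (\<lambda>j\<in>{undefined}. x)\<rparr>"

definition fam_eta :: "('o, 'a) cat \<Rightarrow> ('o, 'a, ('u, 'o) fam, ('u, 'o, 'a) fam_arr) ftr" where
  "fam_eta V = \<lparr>
     FObj = one_member,
     FArr = (\<lambda>f. \<lparr>Src = one_member (Dom V f), Tgt = one_member (Cod V f),
                  IFun = (\<lambda>j\<in>{undefined}. j), AFun = (\<lambda>j\<in>{undefined}. f)\<rparr>)\<rparr>"

section \<open>Enriched categories\<close>

text \<open>\<open>EComp A x y z : A(y, z) \<times> A(x, y) \<rightarrow> A(x, z)\<close> and \<open>EIde A x : 1 \<rightarrow> A(x, x)\<close>.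
  The values of these functions outside the set of objects are fixed to be \<open>undefined\<close>, so that
  equality of records is equality of enriched categories (and of enriched functors).\<close>

record ('u, 'o, 'a) ecat =
  EObj  :: "'u set"
  EHom  :: "'u \<Rightarrow> 'u \<Rightarrow> 'o"
  EComp :: "'u \<Rightarrow> 'u \<Rightarrow> 'u \<Rightarrow> 'a"
  EIde  :: "'u \<Rightarrow> 'a"

record ('u, 'o, 'a) eftr =
  ESrc  :: "('u, 'o, 'a) ecat"
  ETgt  :: "('u, 'o, 'a) ecat"
  EFObj :: "'u \<Rightarrow> 'u"
  EFHom :: "'u \<Rightarrow> 'u \<Rightarrow> 'a"

definition enriched_category :: "('o, 'a) cat \<Rightarrow> ('u, 'o, 'a) ecat \<Rightarrow> bool" where
  "enriched_category W A \<longleftrightarrow>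
     (\<forall>x\<in>EObj A. \<forall>y\<in>EObj A. EHom A x y \<in> Obj W)
     \<and> (\<forall>x\<in>EObj A. \<forall>y\<in>EObj A. \<forall>z\<in>EObj A.
          EComp A x y z \<in> Hom W (prd_obj W (EHom A y z) (EHom A x y)) (EHom A x z))
     \<and> (\<forall>x\<in>EObj A. EIde A x \<in> Hom W (trm W) (EHom A x x))
     \<and> (\<forall>w\<in>EObj A. \<forall>x\<in>EObj A. \<forall>y\<in>EObj A. \<forall>z\<in>EObj A.
          EComp A w x z \<cdot>\<^bsub>W\<^esub> prd_arr W (EComp A x y z) (Ide W (EHom A w x))
          = EComp A w y z \<cdot>\<^bsub>W\<^esub> (prd_arr W (Ide W (EHom A y z)) (EComp A w x y)
              \<cdot>\<^bsub>W\<^esub> associator W (EHom A y z) (EHom A x y) (EHom A w x)))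
     \<and> (\<forall>x\<in>EObj A. \<forall>y\<in>EObj A.
          EComp A x y y \<cdot>\<^bsub>W\<^esub> prd_arr W (EIde A y) (Ide W (EHom A x y)) = proj2 W (trm W) (EHom A x y)
          \<and> EComp A x x y \<cdot>\<^bsub>W\<^esub> prd_arr W (Ide W (EHom A x y)) (EIde A x) = proj1 W (EHom A x y) (trm W))
     \<and> (\<forall>x y. \<not> (x \<in> EObj A \<and> y \<in> EObj A) \<longrightarrow> EHom A x y = undefined)
     \<and> (\<forall>x y z. \<not> (x \<in> EObj A \<and> y \<in> EObj A \<and> z \<in> EObj A) \<longrightarrow> EComp A x y z = undefined)
     \<and> (\<forall>x. x \<notin> EObj A \<longrightarrow> EIde A x = undefined)"

definition enriched_functor :: "('o, 'a) cat \<Rightarrow> ('u, 'o, 'a) eftr \<Rightarrow> bool" where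
  "enriched_functor W F \<longleftrightarrow> (let A = ESrc F; B = ETgt F in
     EFObj F \<in> EObj A \<rightarrow>\<^sub>E EObj B
     \<and> (\<forall>x\<in>EObj A. \<forall>y\<in>EObj A. EFHom F x y \<in> Hom W (EHom A x y) (EHom B (EFObj F x) (EFObj F y)))
     \<and> (\<forall>x\<in>EObj A. \<forall>y\<in>EObj A. \<forall>z\<in>EObj A.
          EFHom F x z \<cdot>\<^bsub>W\<^esub> EComp A x y z
          = EComp B (EFObj F x) (EFObj F y) (EFObj F z) \<cdot>\<^bsub>W\<^esub> prd_arr W (EFHom F y z) (EFHom F x y))
     \<and> (\<forall>x\<in>EObj A. EFHom F x x \<cdot>\<^bsub>W\<^esub> EIde A x = EIde B (EFObj F x))
     \<and> (\<forall>x y. \<not> (x \<in> EObj A \<and> y \<in> EObj A) \<longrightarrow> EFHom F x y = undefined))"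

definition small_ecats :: "('u set \<Rightarrow> bool) \<Rightarrow> ('o, 'a) cat \<Rightarrow> ('u, 'o, 'a) ecat set" where
  "small_ecats small W = {A. enriched_category W A \<and> small (EObj A)}"

definition ECat ::
    "('u set \<Rightarrow> bool) \<Rightarrow> ('o, 'a) cat \<Rightarrow> (('u, 'o, 'a) ecat, ('u, 'o, 'a) eftr) cat" where
  "ECat small W = \<lparr>
     Obj = small_ecats small W,
     Arr = {F. ESrc F \<in> small_ecats small W \<and> ETgt F \<in> small_ecats small W \<and> enriched_functor W F},
     Dom = ESrc,
     Cod = ETgt,
     Ide = (\<lambda>A. \<lparr>ESrc = A, ETgt = A, EFObj = (\<lambda>x\<in>EObj A. x),
                 EFHom = (\<lambda>x y. if x \<in> EObj A \<and> y \<in> EObj A then Ide W (EHom A x y) else undefined)\<rparr>),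
     Comp = (\<lambda>G F. \<lparr>ESrc = ESrc F, ETgt = ETgt G,
                    EFObj = (\<lambda>x\<in>EObj (ESrc F). EFObj G (EFObj F x)),
                    EFHom = (\<lambda>x y. if x \<in> EObj (ESrc F) \<and> y \<in> EObj (ESrc F)
                                    then EFHom G (EFObj F x) (EFObj F y) \<cdot>\<^bsub>W\<^esub> EFHom F x y
                                    else undefined)\<rparr>)\<rparr>"

text \<open>Change of base along a functor \<open>H : V \<rightarrow> W\<close> preserving finite products. Such an \<open>H\<close> is
  monoidal through the inverses of the canonical arrows \<open>H (x \<times> y) \<rightarrow> H x \<times> H y\<close> and \<open>H 1 \<rightarrow> 1\<close>.\<close>

definition prd_comparison ::
    "('o, 'a) cat \<Rightarrow> ('p, 'b) cat \<Rightarrow> ('o, 'a, 'p, 'b) ftr \<Rightarrow> 'o \<Rightarrow> 'o \<Rightarrow> 'b" where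
  "prd_comparison V W H x y = pairing W (FArr H (proj1 V x y)) (FArr H (proj2 V x y))"

definition base_ecat ::
    "('o, 'a) cat \<Rightarrow> ('p, 'b) cat \<Rightarrow> ('o, 'a, 'p, 'b) ftr \<Rightarrow> ('u, 'o, 'a) ecat \<Rightarrow> ('u, 'p, 'b) ecat" where
  "base_ecat V W H A = \<lparr>
     EObj = EObj A,
     EHom = (\<lambda>x y. if x \<in> EObj A \<and> y \<in> EObj A then FObj H (EHom A x y) else undefined),
     EComp = (\<lambda>x y z. if x \<in> EObj A \<and> y \<in> EObj A \<and> z \<in> EObj A
                then FArr H (EComp A x y z)
                       \<cdot>\<^bsub>W\<^esub> inv_arrow W (prd_comparison V W H (EHom A y z) (EHom A x y))
                else undefined),
     EIde = (\<lambda>x. if x \<in> EObj A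
                then FArr H (EIde A x) \<cdot>\<^bsub>W\<^esub> inv_arrow W (bang W (FObj H (trm V)))
                else undefined)\<rparr>"

definition base_eftr ::
    "('o, 'a) cat \<Rightarrow> ('p, 'b) cat \<Rightarrow> ('o, 'a, 'p, 'b) ftr \<Rightarrow> ('u, 'o, 'a) eftr \<Rightarrow> ('u, 'p, 'b) eftr" where
  "base_eftr V W H F = \<lparr>
     ESrc = base_ecat V W H (ESrc F),
     ETgt = base_ecat V W H (ETgt F),
     EFObj = EFObj F,
     EFHom = (\<lambda>x y. if x \<in> EObj (ESrc F) \<and> y \<in> EObj (ESrc F) then FArr H (EFHom F x y) else undefined)\<rparr>"

definition change_of_base ::
    "('o, 'a) cat \<Rightarrow> ('p, 'b) cat \<Rightarrow> ('o, 'a, 'p, 'b) ftr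
      \<Rightarrow> (('u, 'o, 'a) ecat, ('u, 'o, 'a) eftr, ('u, 'p, 'b) ecat, ('u, 'p, 'b) eftr) ftr" where
  "change_of_base V W H = \<lparr>FObj = base_ecat V W H, FArr = base_eftr V W H\<rparr>"

end

theory Submission
  imports Defs
begin

text \<open>Effective descent of \<open>p\<close> is rephrased without chosen pullbacks: every descent datum on
  \<open>r : x \<rightarrow> e\<close> comes from a pullback square of some \<open>f\<close> along \<open>p\<close>, and arrows over the base correspond
  to arrows of the pullbacks that respect the kernel pairs. In this form both conditions transfer along
  a fully faithful functor \<open>U\<close> that preserves pullbacks, provided that \<open>f\<close> has its domain in the
  essential image of \<open>U\<close> whenever the pullback of \<open>f\<close> along \<open>U p\<close> is in the image.

  For \<open>U = \<eta>\<^sub>!\<close> this last condition is met. First, \<open>F\<close> is surjective on objects: otherwise pulling back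
  along \<open>F\<close> cannot tell the full subcategory on a missed object from the empty category. Hence every
  hom-object \<open>Z\<close> of the domain of \<open>f\<close> occurs in a pullback square along an arrow between one-member
  families whose vertex is a one-member family; then \<open>Z\<close> has exactly one member.

  Enriched categories are handled through generalized elements: the hom-sets \<open>W(w, A(x, y))\<close> form an
  ordinary category, naturally in \<open>w\<close>, which replaces the coherence diagrams by associativity and unit
  laws.\<close>

section \<open>Categories and functors\<close>

text \<open>The comparison functor of \<open>effective_descent\<close> is built from pullbacks
  chosen by \<open>SOME\<close>, and change of base respects neither these choices nor the chosen
  products. Hence the criteria quantify over all pullback squares, and an isomorphism of algebras is
  absorbed into the freedom of choosing the square.

  The criteria also quantify over all test objects, and a test object of the larger category need
  not come from the smaller one. Universal instances overcome this: a kernel pair, or the pullback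
  on which the two sides of a law are compared, exists in the smaller category, is preserved, and
  controls every test object of the larger one. The same device serves enriched categories, where
  the projections of a product are the universal pair of generalized elements.

  What does not transfer formally is the object to which a datum descends: its hom-objects could
  have several members or none. Pulling back a family along an arrow between one-member families
  keeps its number of members, and this settles the matter.\<close>

context category
begin

lemma comp_arr [simp]:
  assumes "f \<in> Arr C" "g \<in> Arr C" "Dom C g = Cod C f"
  shows "g \<cdot> f \<in> Arr C" "Dom C (g \<cdot> f) = Dom C f" "Cod C (g \<cdot> f) = Cod C g"
  using Comp_Hom[of f "Dom C f" "Cod C f" g "Cod C g"] assms by (auto simp: Hom_def)

lemma comp_assoc [simp]:
  assumes "f \<in> Arr C" "g \<in> Arr C" "h \<in> Arr C" "Dom C g = Cod C f" "Dom C h = Cod C g"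
  shows "(h \<cdot> g) \<cdot> f = h \<cdot> (g \<cdot> f)"
  using Comp_assoc assms by (auto simp: Hom_def)

text \<open>Composites are normalized to the right by \<open>comp_assoc\<close>, so the left side of
  a known equation no longer occurs as a subterm of a longer composite. This form makes the equation
  applicable there.\<close>

lemma reassoc:
  assumes "g \<cdot> f = k" "f \<in> Arr C" "g \<in> Arr C" "Dom C g = Cod C f" "h \<in> Arr C" "Dom C f = Cod C h"
  shows "g \<cdot> (f \<cdot> h) = k \<cdot> h"
  using assms comp_assoc by metis

lemma ide_arr [simp]:
  assumes "x \<in> Obj C"
  shows "Ide C x \<in> Arr C" "Dom C (Ide C x) = x" "Cod C (Ide C x) = x"
  using Ide_Hom[OF assms] by (auto simp: Hom_def)

lemma comp_ide [simp]: "f \<in> Arr C \<Longrightarrow> Dom C f = x \<Longrightarrow> f \<cdot> Ide C x = f"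
  using Comp_Ide by (auto simp: Hom_def)

lemma ide_comp [simp]: "f \<in> Arr C \<Longrightarrow> Cod C f = x \<Longrightarrow> Ide C x \<cdot> f = f"
  using Ide_Comp by (auto simp: Hom_def)

lemma dom_obj [simp]: "f \<in> Arr C \<Longrightarrow> Dom C f \<in> Obj C"
  and cod_obj [simp]: "f \<in> Arr C \<Longrightarrow> Cod C f \<in> Obj C"
  by (rule Dom_Obj Cod_Obj; assumption)+

lemma iso_cancel_left:
  assumes "iso_arrow C i" "i \<cdot> f = i \<cdot> g" "f \<in> Arr C" "g \<in> Arr C" "i \<in> Arr C"
    "Dom C i = Cod C f" "Dom C i = Cod C g"
  shows "f = g"
proof -
  obtain j where j: "j \<in> Arr C" "Dom C j = Cod C i" "j \<cdot> i = Ide C (Dom C i)"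
    using assms(1) by (auto simp: iso_arrow_def inverse_arrows_def Hom_def)
  have "f = (j \<cdot> i) \<cdot> f" using assms j by simp
  also have "\<dots> = j \<cdot> (i \<cdot> f)" using assms j(1,2) by simp
  also have "\<dots> = (j \<cdot> i) \<cdot> g" using assms j(1,2) by simp
  also have "\<dots> = g" using assms j by simp
  finally show ?thesis .
qed

lemma iso_cancel_right:
  assumes "iso_arrow C i" "f \<cdot> i = g \<cdot> i" "f \<in> Arr C" "g \<in> Arr C" "i \<in> Arr C"
    "Dom C f = Cod C i" "Dom C g = Cod C i"
  shows "f = g"
proof -
  obtain j where j: "j \<in> Arr C" "Dom C j = Cod C i" "Cod C j = Dom C i" "i \<cdot> j = Ide C (Cod C i)"
    using assms(1) by (auto simp: iso_arrow_def inverse_arrows_def Hom_def)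
  have "f = (f \<cdot> i) \<cdot> j" using assms(3-) j by simp
  also have "\<dots> = (g \<cdot> i) \<cdot> j" using assms(2) by simp
  also have "\<dots> = g" using assms(3-) j by simp
  finally show ?thesis .
qed

lemma iso_arrowI:
  assumes "f \<in> Hom C x y" "g \<in> Hom C y x" "g \<cdot> f = Ide C x" "f \<cdot> g = Ide C y"
  shows "iso_arrow C f"
  using assms by (auto simp: iso_arrow_def inverse_arrows_def Hom_def)

lemma iso_arrowE:
  assumes "iso_arrow C f"
  obtains g where "f \<in> Arr C" "g \<in> Arr C" "Dom C g = Cod C f" "Cod C g = Dom C f"
    "g \<cdot> f = Ide C (Dom C f)" "f \<cdot> g = Ide C (Cod C f)"
  using assms by (auto simp: iso_arrow_def inverse_arrows_def Hom_def)

lemma inverse_arrows_unique: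
  assumes "inverse_arrows C f g" "inverse_arrows C f h"
  shows "g = h"
proof -
  have a: "f \<in> Arr C" "g \<in> Hom C (Cod C f) (Dom C f)" "g \<cdot> f = Ide C (Dom C f)"
    "h \<in> Hom C (Cod C f) (Dom C f)" "f \<cdot> h = Ide C (Cod C f)"
    using assms by (auto simp: inverse_arrows_def)
  have "g = g \<cdot> (f \<cdot> h)" using a by (simp add: Hom_def)
  also have "\<dots> = (g \<cdot> f) \<cdot> h" using a(1,2,4) by (simp add: Hom_def)
  also have "\<dots> = h" using a by (simp add: Hom_def)
  finally show ?thesis .
qed

lemma inv_arrow:
  assumes "iso_arrow C f"
  shows "inv_arrow C f \<in> Arr C" "Dom C (inv_arrow C f) = Cod C f" "Cod C (inv_arrow C f) = Dom C f"
    "inv_arrow C f \<cdot> f = Ide C (Dom C f)" "f \<cdot> inv_arrow C f = Ide C (Cod C f)"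
proof -
  have "\<exists>!g. inverse_arrows C f g"
    using assms inverse_arrows_unique by (auto simp: iso_arrow_def)
  then have "inverse_arrows C f (inv_arrow C f)"
    unfolding inv_arrow_def by (rule theI')
  then show "inv_arrow C f \<in> Arr C" "Dom C (inv_arrow C f) = Cod C f" "Cod C (inv_arrow C f) = Dom C f"
    "inv_arrow C f \<cdot> f = Ide C (Dom C f)" "f \<cdot> inv_arrow C f = Ide C (Cod C f)"
    by (auto simp: inverse_arrows_def Hom_def)
qed

end

lemma is_functorD:
  assumes "is_functor C D F"
  shows "category C" "category D" "x \<in> Obj C \<Longrightarrow> FObj F x \<in> Obj D"
    "f \<in> Arr C \<Longrightarrow> FArr F f \<in> Arr D" "f \<in> Arr C \<Longrightarrow> Dom D (FArr F f) = FObj F (Dom C f)"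
    "f \<in> Arr C \<Longrightarrow> Cod D (FArr F f) = FObj F (Cod C f)"
    "x \<in> Obj C \<Longrightarrow> FArr F (Ide C x) = Ide D (FObj F x)"
    "f \<in> Arr C \<Longrightarrow> g \<in> Arr C \<Longrightarrow> Dom C g = Cod C f \<Longrightarrow>
      FArr F (g \<cdot>\<^bsub>C\<^esub> f) = FArr F g \<cdot>\<^bsub>D\<^esub> FArr F f"
  using assms unfolding is_functor_def Hom_def by auto

lemma is_functor_comp:
  assumes "is_functor C D F" "is_functor D E G"
  shows "is_functor C E (comp_ftr G F)"
  using is_functorD[OF assms(1)] is_functorD[OF assms(2)]
  unfolding is_functor_def[of C E] comp_ftr_def Hom_def by simp

lemma is_functor_id: "category C \<Longrightarrow> is_functor C C id_ftr"
  unfolding is_functor_def id_ftr_def by (simp add: Hom_def category.dom_obj)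

definition fully_faithful :: "('o, 'a) cat \<Rightarrow> ('p, 'b) cat \<Rightarrow> ('o, 'a, 'p, 'b) ftr \<Rightarrow> bool" where
  "fully_faithful C D F \<longleftrightarrow>
     (\<forall>x\<in>Obj C. \<forall>y\<in>Obj C. \<forall>g\<in>Hom D (FObj F x) (FObj F y). \<exists>!f. f \<in> Hom C x y \<and> FArr F f = g)"

definition essentially_surjective :: "('o, 'a) cat \<Rightarrow> ('p, 'b) cat \<Rightarrow> ('o, 'a, 'p, 'b) ftr \<Rightarrow> bool" where
  "essentially_surjective C D F \<longleftrightarrow>
     (\<forall>d\<in>Obj D. \<exists>x\<in>Obj C. \<exists>i\<in>Hom D (FObj F x) d. iso_arrow D i)"

lemma fully_faithful_full:
  assumes "fully_faithful C D F" "x \<in> Obj C" "y \<in> Obj C" "g \<in> Arr D"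
    "Dom D g = FObj F x" "Cod D g = FObj F y"
  shows "\<exists>f. f \<in> Arr C \<and> Dom C f = x \<and> Cod C f = y \<and> FArr F f = g"
proof -
  have "g \<in> Hom D (FObj F x) (FObj F y)" using assms by (simp add: Hom_def)
  then have "\<exists>!f. f \<in> Hom C x y \<and> FArr F f = g"
    using assms(1-3) unfolding fully_faithful_def by blast
  then show ?thesis by (auto simp: Hom_def)
qed

lemma fully_faithful_faithful:
  assumes "is_functor C D F" "fully_faithful C D F" "f \<in> Arr C" "g \<in> Arr C"
    "Dom C f = Dom C g" "Cod C f = Cod C g" "FArr F f = FArr F g"
  shows "f = g"
proof -
  note F = is_functorD[OF assms(1)]
  interpret C: category C by (rule F)
  have "FArr F f \<in> Hom D (FObj F (Dom C f)) (FObj F (Cod C f))" using F assms by (simp add: Hom_def)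
  then have "\<exists>!h. h \<in> Hom C (Dom C f) (Cod C f) \<and> FArr F h = FArr F f"
    using assms(2,3) unfolding fully_faithful_def by simp
  then show ?thesis using assms by (auto simp: Hom_def)
qed

text \<open>Naturality of \<open>s\<close> recovers \<open>f\<close> from its image under
  \<open>F\<close> followed by \<open>G\<close>, and naturality of \<open>t\<close> does the same
  for \<open>G\<close> followed by \<open>F\<close>; so both functors are faithful. Fullness of
  \<open>F\<close> then comes from faithfulness of \<open>G\<close>.\<close>

lemma equivalence_imp_ff_es:
  assumes "is_equivalence C D F"
  shows "fully_faithful C D F" "essentially_surjective C D F"
proof -
  obtain G s t where F: "is_functor C D F" and G: "is_functor D C G"
    and s: "nat_isomorphism C C id_ftr (comp_ftr G F) s"
    and t: "nat_isomorphism D D (comp_ftr F G) id_ftr t"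
    using assms unfolding is_equivalence_def by blast
  note F' = is_functorD[OF F] and G' = is_functorD[OF G]
  interpret C: category C by (rule F')
  interpret D: category D by (rule F')
  have s: "\<And>x. x \<in> Obj C \<Longrightarrow> s x \<in> Arr C \<and> Dom C (s x) = x \<and> Cod C (s x) = FObj G (FObj F x) \<and> iso_arrow C (s x)"
    "\<And>f. f \<in> Arr C \<Longrightarrow> s (Cod C f) \<cdot>\<^bsub>C\<^esub> f = FArr G (FArr F f) \<cdot>\<^bsub>C\<^esub> s (Dom C f)"
    using s unfolding nat_isomorphism_def id_ftr_def comp_ftr_def Hom_def by auto
  have t: "\<And>x. x \<in> Obj D \<Longrightarrow> t x \<in> Arr D \<and> Cod D (t x) = x \<and> Dom D (t x) = FObj F (FObj G x) \<and> iso_arrow D (t x)"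
    "\<And>f. f \<in> Arr D \<Longrightarrow> t (Cod D f) \<cdot>\<^bsub>D\<^esub> FArr F (FArr G f) = f \<cdot>\<^bsub>D\<^esub> t (Dom D f)"
    using t unfolding nat_isomorphism_def id_ftr_def comp_ftr_def Hom_def by auto
  have faithful: "f = g" if "f \<in> Arr C" "g \<in> Arr C" "Dom C f = Dom C g" "Cod C f = Cod C g" "FArr F f = FArr F g" for f g
  proof -
    have eq: "s (Cod C f) \<cdot>\<^bsub>C\<^esub> f = s (Cod C f) \<cdot>\<^bsub>C\<^esub> g"
      using that s(2)[of f] s(2)[of g] by simp
    show ?thesis
      by (rule C.iso_cancel_left[OF _ eq]) (use that s(1)[of "Cod C f"] in auto)
  qed
  have faithfulG: "f = g" if "f \<in> Arr D" "g \<in> Arr D" "Dom D f = Dom D g" "Cod D f = Cod D g" "FArr G f = FArr G g" for f g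
  proof -
    have eq: "f \<cdot>\<^bsub>D\<^esub> t (Dom D f) = g \<cdot>\<^bsub>D\<^esub> t (Dom D f)"
      using that t(2)[of f] t(2)[of g] by simp
    show ?thesis
      by (rule D.iso_cancel_right[OF _ eq]) (use that t(1)[of "Dom D f"] in auto)
  qed
  show "fully_faithful C D F"
    unfolding fully_faithful_def
  proof (intro ballI)
    fix x y g
    assume x: "x \<in> Obj C" and y: "y \<in> Obj C" and g: "g \<in> Hom D (FObj F x) (FObj F y)"
    define k where "k = inv_arrow C (s y)"
    define l where "l = inv_arrow C (s x)"
    have k: "k \<in> Arr C" "Dom C k = Cod C (s y)" "Cod C k = y"
      "k \<cdot>\<^bsub>C\<^esub> s y = Ide C y" "s y \<cdot>\<^bsub>C\<^esub> k = Ide C (Cod C (s y))"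
      unfolding k_def using C.inv_arrow[of "s y"] s(1)[of y] y by auto
    have l: "l \<in> Arr C" "Dom C l = Cod C (s x)" "Cod C l = x"
      "s x \<cdot>\<^bsub>C\<^esub> l = Ide C (Cod C (s x))"
      unfolding l_def using C.inv_arrow[of "s x"] s(1)[of x] x by auto
    note sx = s(1)[OF x] and sy = s(1)[OF y]
    \<comment> \<open>Naturality of \<open>s\<close> forces the preimage of \<open>g\<close>: it is
      \<open>FArr G g\<close> conjugated by the components of \<open>s\<close> at \<open>x\<close>
      and \<open>y\<close>.\<close>
    let ?f = "k \<cdot>\<^bsub>C\<^esub> (FArr G g \<cdot>\<^bsub>C\<^esub> s x)"
    have g': "g \<in> Arr D" "Dom D g = FObj F x" "Cod D g = FObj F y" using g by (auto simp: Hom_def)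
    note gG = G'(4-6)[OF g'(1)]
    have f: "?f \<in> Arr C" "Dom C ?f = x" "Cod C ?f = y"
      using sx sy k g' gG by auto
    have "FArr G (FArr F ?f) \<cdot>\<^bsub>C\<^esub> s x = s y \<cdot>\<^bsub>C\<^esub> ?f" using s(2)[OF f(1)] f by simp
    also have "\<dots> = FArr G g \<cdot>\<^bsub>C\<^esub> s x"
      using sx sy k g' gG by (simp add: C.reassoc[OF k(5)])
    finally have e: "FArr G (FArr F ?f) \<cdot>\<^bsub>C\<^esub> s x = FArr G g \<cdot>\<^bsub>C\<^esub> s x" .
    have "(FArr G (FArr F ?f) \<cdot>\<^bsub>C\<^esub> s x) \<cdot>\<^bsub>C\<^esub> l = (FArr G g \<cdot>\<^bsub>C\<^esub> s x) \<cdot>\<^bsub>C\<^esub> l"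
      using e by simp
    then have GG: "FArr G (FArr F ?f) = FArr G g"
      using l sx g' gG f F'(4-6)[OF f(1)] G'(4-6)[OF F'(4)[OF f(1)]]
      by simp
    have "FArr F ?f = g"
      by (rule faithfulG[OF _ _ _ _ GG]) (use F'(4-6)[OF f(1)] f g' in simp_all)
    then show "\<exists>!f. f \<in> Hom C x y \<and> FArr F f = g"
      using f faithful by (intro ex1I[of _ ?f]) (auto simp: Hom_def)
  qed
  show "essentially_surjective C D F"
    unfolding essentially_surjective_def
  proof
    fix d assume d: "d \<in> Obj D"
    show "\<exists>x\<in>Obj C. \<exists>i\<in>Hom D (FObj F x) d. iso_arrow D i"
      using t(1)[OF d] G'(3)[OF d] by (auto simp: Hom_def)
  qed
qed

text \<open>Essential surjectivity chooses \<open>g d\<close> and \<open>t d\<close>. The inverse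
  sends an arrow to the unique lift of its conjugate by \<open>t\<close>, so functoriality and
  naturality can all be checked after applying the faithful \<open>F\<close>.\<close>

lemma ff_es_imp_equivalence:
  assumes F: "is_functor C D F" and ff: "fully_faithful C D F" and es: "essentially_surjective C D F"
  shows "is_equivalence C D F"
proof -
  note F' = is_functorD[OF F]
  interpret C: category C by (rule F')
  interpret D: category D by (rule F')
  obtain g t where gt: "\<And>d. d \<in> Obj D \<Longrightarrow> g d \<in> Obj C \<and> t d \<in> Hom D (FObj F (g d)) d \<and> iso_arrow D (t d)"
    using es unfolding essentially_surjective_def by metis
  have t: "t d \<in> Arr D" "Dom D (t d) = FObj F (g d)" "Cod D (t d) = d" "iso_arrow D (t d)" "g d \<in> Obj C"
    if "d \<in> Obj D" for d using gt[OF that] by (auto simp: Hom_def)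
  define t' where "t' d = inv_arrow D (t d)" for d
  have t': "t' d \<in> Arr D" "Dom D (t' d) = d" "Cod D (t' d) = FObj F (g d)"
    "t' d \<cdot>\<^bsub>D\<^esub> t d = Ide D (FObj F (g d))" "t d \<cdot>\<^bsub>D\<^esub> t' d = Ide D d" if "d \<in> Obj D" for d
    using D.inv_arrow[OF t(4)[OF that]] t(1-3)[OF that] unfolding t'_def by simp_all
  define ga where "ga k = (THE f. f \<in> Hom C (g (Dom D k)) (g (Cod D k)) \<and>
     FArr F f = t' (Cod D k) \<cdot>\<^bsub>D\<^esub> (k \<cdot>\<^bsub>D\<^esub> t (Dom D k)))" for k
  have ga: "ga k \<in> Hom C (g (Dom D k)) (g (Cod D k)) \<and>
     FArr F (ga k) = t' (Cod D k) \<cdot>\<^bsub>D\<^esub> (k \<cdot>\<^bsub>D\<^esub> t (Dom D k))" if k: "k \<in> Arr D" for k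
  proof -
    have "t' (Cod D k) \<cdot>\<^bsub>D\<^esub> (k \<cdot>\<^bsub>D\<^esub> t (Dom D k)) \<in> Hom D (FObj F (g (Dom D k))) (FObj F (g (Cod D k)))"
      using k t t' by (simp add: Hom_def)
    then have "\<exists>!f. f \<in> Hom C (g (Dom D k)) (g (Cod D k)) \<and>
     FArr F f = t' (Cod D k) \<cdot>\<^bsub>D\<^esub> (k \<cdot>\<^bsub>D\<^esub> t (Dom D k))"
      using ff k t unfolding fully_faithful_def by simp
    then show ?thesis unfolding ga_def by (rule theI')
  qed
  have ga': "ga k \<in> Arr C" "Dom C (ga k) = g (Dom D k)" "Cod C (ga k) = g (Cod D k)"
    "FArr F (ga k) = t' (Cod D k) \<cdot>\<^bsub>D\<^esub> (k \<cdot>\<^bsub>D\<^esub> t (Dom D k))" if "k \<in> Arr D" for k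
    using ga[OF that] by (auto simp: Hom_def)
  note faithful = fully_faithful_faithful[OF F ff]
  define G where "G = \<lparr>FObj = g, FArr = ga\<rparr>"
  have ga_ide: "ga (Ide D x) = Ide C (g x)" if x: "x \<in> Obj D" for x
    apply (rule faithful)
    using x ga' t t' F' by simp_all
  have ga_comp: "ga (k \<cdot>\<^bsub>D\<^esub> f) = ga k \<cdot>\<^bsub>C\<^esub> ga f" if f: "f \<in> Arr D" and k: "k \<in> Arr D" "Dom D k = Cod D f" for f k
  proof (rule faithful)
    have r: "t (Cod D f) \<cdot>\<^bsub>D\<^esub> (t' (Cod D f) \<cdot>\<^bsub>D\<^esub> (f \<cdot>\<^bsub>D\<^esub> t (Dom D f))) = f \<cdot>\<^bsub>D\<^esub> t (Dom D f)"
      using f t t' by (simp add: D.reassoc[OF t'(5)[of "Cod D f"]])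
    show "FArr F (ga (k \<cdot>\<^bsub>D\<^esub> f)) = FArr F (ga k \<cdot>\<^bsub>C\<^esub> ga f)"
      using f k t t' ga' F'(8)[of "ga f" "ga k"] r by simp
  qed (use f k ga' in simp_all)
  have G: "is_functor D C G"
    unfolding is_functor_def G_def
    using ga' ga_ide ga_comp t C.category_axioms D.category_axioms by (simp add: Hom_def)
  \<comment> \<open>The unit lifts the inverse of \<open>t\<close>, which makes one triangle
    identity hold by construction.\<close>
  define s where "s x = (THE f. f \<in> Hom C x (g (FObj F x)) \<and> FArr F f = t' (FObj F x))" for x
  have s: "s x \<in> Arr C \<and> Dom C (s x) = x \<and> Cod C (s x) = g (FObj F x) \<and> FArr F (s x) = t' (FObj F x)" if x: "x \<in> Obj C" for x
  proof -
    have "t' (FObj F x) \<in> Hom D (FObj F x) (FObj F (g (FObj F x)))"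
      using x t' F' by (simp add: Hom_def)
    then have "\<exists>!f. f \<in> Hom C x (g (FObj F x)) \<and> FArr F f = t' (FObj F x)"
      using ff x t F' unfolding fully_faithful_def by simp
    then have "s x \<in> Hom C x (g (FObj F x)) \<and> FArr F (s x) = t' (FObj F x)"
      unfolding s_def by (rule theI')
    then show ?thesis by (auto simp: Hom_def)
  qed
  have s_iso: "iso_arrow C (s x)" if x: "x \<in> Obj C" for x
  proof -
    have Fx: "FObj F x \<in> Obj D" using x F' by simp
    obtain k where k: "k \<in> Arr C" "Dom C k = g (FObj F x)" "Cod C k = x" "FArr F k = t (FObj F x)"
      using fully_faithful_full[OF ff, of "g (FObj F x)" x "t (FObj F x)"] t[OF Fx] x by auto
    have 1: "k \<cdot>\<^bsub>C\<^esub> s x = Ide C x"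
      apply (rule faithful) using k s[OF x] x t'[OF Fx] F'(7)[OF x] F'(8)[of "s x" k] by simp_all
    have 2: "s x \<cdot>\<^bsub>C\<^esub> k = Ide C (g (FObj F x))"
      apply (rule faithful) using k s[OF x] x t'[OF Fx] t[OF Fx] F'(7)[of "g (FObj F x)"] F'(8)[of k "s x"] by simp_all
    show ?thesis
      apply (rule C.iso_arrowI[of _ x "g (FObj F x)" k])
      using 1 2 k s[OF x] by (auto simp: Hom_def)
  qed
  have s_nat: "s (Cod C f) \<cdot>\<^bsub>C\<^esub> f = ga (FArr F f) \<cdot>\<^bsub>C\<^esub> s (Dom C f)" if f: "f \<in> Arr C" for f
  proof (rule faithful)
    have d: "FObj F (Dom C f) \<in> Obj D" "FObj F (Cod C f) \<in> Obj D" using f F' by auto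
    note Ff = F'(4-6)[OF f] and sd = s[OF C.dom_obj[OF f]] and sc = s[OF C.cod_obj[OF f]]
    show "FArr F (s (Cod C f) \<cdot>\<^bsub>C\<^esub> f) = FArr F (ga (FArr F f) \<cdot>\<^bsub>C\<^esub> s (Dom C f))"
      using f d Ff sd sc ga'[OF Ff(1)] t[OF d(1)] t[OF d(2)] t'[OF d(1)] t'[OF d(2)]
        F'(8)[of f "s (Cod C f)"] F'(8)[of "s (Dom C f)" "ga (FArr F f)"] by simp
  qed (use f s F' ga' in simp_all)
  have "nat_isomorphism C C id_ftr (comp_ftr G F) s"
    unfolding nat_isomorphism_def
    using is_functor_id[OF C.category_axioms] is_functor_comp[OF F G] s s_iso s_nat
    by (simp add: id_ftr_def comp_ftr_def G_def Hom_def)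
  moreover have "nat_isomorphism D D (comp_ftr F G) id_ftr t"
  proof -
    have "t (Cod D f) \<cdot>\<^bsub>D\<^esub> FArr F (ga f) = f \<cdot>\<^bsub>D\<^esub> t (Dom D f)" if f: "f \<in> Arr D" for f
      using f ga'[OF f] t t' by (simp add: D.reassoc[OF t'(5)[of "Cod D f"]])
    then show ?thesis
      unfolding nat_isomorphism_def
      using is_functor_id[OF D.category_axioms] is_functor_comp[OF G F] t
      by (simp add: id_ftr_def comp_ftr_def G_def Hom_def)
  qed
  ultimately show ?thesis unfolding is_equivalence_def using F G by blast
qed

section \<open>Pullbacks\<close>

context category
begin

lemma pullbackD:
  assumes "is_pullback C f g q r"
  shows "q \<in> Arr C" "Cod C q = Dom C f" "r \<in> Arr C" "Dom C r = Dom C q" "Cod C r = Dom C g"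
    "f \<cdot> q = g \<cdot> r"
  using assms unfolding is_pullback_def Hom_def by auto

lemma pullback_ex:
  assumes "is_pullback C f g q r" "u \<in> Arr C" "v \<in> Arr C" "Dom C u = w" "Dom C v = w"
    "Cod C u = Dom C f" "Cod C v = Dom C g" "f \<cdot> u = g \<cdot> v"
  shows "\<exists>h. h \<in> Arr C \<and> Dom C h = w \<and> Cod C h = Dom C q \<and> q \<cdot> h = u \<and> r \<cdot> h = v"
proof -
  have "u \<in> Hom C w (Dom C f)" "v \<in> Hom C w (Dom C g)" using assms by (auto simp: Hom_def)
  then have "\<exists>!h. h \<in> Hom C w (Dom C q) \<and> q \<cdot> h = u \<and> r \<cdot> h = v"
    using assms(1,8) unfolding is_pullback_def by blast
  then show ?thesis by (auto simp: Hom_def)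
qed

lemma pullback_unique:
  assumes "is_pullback C f g q r" "f \<in> Arr C" "g \<in> Arr C" "h \<in> Arr C" "h' \<in> Arr C"
    "Dom C h = Dom C h'" "Cod C h = Dom C q" "Cod C h' = Dom C q" "q \<cdot> h = q \<cdot> h'" "r \<cdot> h = r \<cdot> h'"
  shows "h = h'"
proof -
  note pb = pullbackD[OF assms(1)]
  have "q \<cdot> h \<in> Hom C (Dom C h) (Dom C f)" "r \<cdot> h \<in> Hom C (Dom C h) (Dom C g)"
    using assms(4-8) pb by (auto simp: Hom_def)
  moreover have "f \<cdot> (q \<cdot> h) = g \<cdot> (r \<cdot> h)"
    using assms(2-8) pb by (simp add: reassoc[OF pb(6)])
  ultimately have "\<exists>!k. k \<in> Hom C (Dom C h) (Dom C q) \<and> q \<cdot> k = q \<cdot> h \<and> r \<cdot> k = r \<cdot> h"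
    using assms(1) unfolding is_pullback_def by blast
  then show ?thesis using assms by (auto simp: Hom_def)
qed

lemma pullbackI:
  assumes "q \<in> Arr C" "Cod C q = Dom C f" "r \<in> Arr C" "Dom C r = Dom C q" "Cod C r = Dom C g"
    "f \<cdot> q = g \<cdot> r"
    and ex: "\<And>u v. u \<in> Arr C \<Longrightarrow> v \<in> Arr C \<Longrightarrow> Dom C v = Dom C u \<Longrightarrow> Cod C u = Dom C f \<Longrightarrow>
      Cod C v = Dom C g \<Longrightarrow> f \<cdot> u = g \<cdot> v \<Longrightarrow>
      \<exists>h. h \<in> Arr C \<and> Dom C h = Dom C u \<and> Cod C h = Dom C q \<and> q \<cdot> h = u \<and> r \<cdot> h = v"
    and un: "\<And>h h'. h \<in> Arr C \<Longrightarrow> h' \<in> Arr C \<Longrightarrow> Dom C h' = Dom C h \<Longrightarrow> Cod C h = Dom C q \<Longrightarrow>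
      Cod C h' = Dom C q \<Longrightarrow> q \<cdot> h = q \<cdot> h' \<Longrightarrow> r \<cdot> h = r \<cdot> h' \<Longrightarrow> h = h'"
  shows "is_pullback C f g q r"
  unfolding is_pullback_def
proof (intro conjI allI impI)
  fix w u v
  assume a: "u \<in> Hom C w (Dom C f) \<and> v \<in> Hom C w (Dom C g) \<and> f \<cdot> u = g \<cdot> v"
  then obtain h where h: "h \<in> Arr C \<and> Dom C h = Dom C u \<and> Cod C h = Dom C q \<and> q \<cdot> h = u \<and> r \<cdot> h = v"
    using ex[of u v] by (auto simp: Hom_def)
  show "\<exists>!h. h \<in> Hom C w (Dom C q) \<and> q \<cdot> h = u \<and> r \<cdot> h = v"
    using h a un by (intro ex1I[of _ h]) (auto simp: Hom_def)
qed (use assms in \<open>auto simp: Hom_def\<close>)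

text \<open>This is how a pullback square is replaced by another one over the same cospan with a
  prescribed leg.\<close>

lemma pullback_iso:
  assumes pb: "is_pullback C f g q r" and f: "f \<in> Arr C" and g: "g \<in> Arr C"
    and i: "i \<in> Arr C" "j \<in> Arr C" "Dom C j = Cod C i" "Cod C j = Dom C i"
      "Cod C i = Dom C q" "i \<cdot> j = Ide C (Cod C i)" "j \<cdot> i = Ide C (Dom C i)"
  shows "is_pullback C f g (q \<cdot> i) (r \<cdot> i)"
proof -
  note p = pullbackD[OF pb]
  show ?thesis
  proof (rule pullbackI)
    show "f \<cdot> (q \<cdot> i) = g \<cdot> (r \<cdot> i)" using p i f g by (simp add: reassoc[OF p(6)])
    fix u v
    assume u: "u \<in> Arr C" "v \<in> Arr C" "Dom C v = Dom C u" "Cod C u = Dom C f"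
      "Cod C v = Dom C g" "f \<cdot> u = g \<cdot> v"
    obtain h where h: "h \<in> Arr C" "Dom C h = Dom C u" "Cod C h = Dom C q" "q \<cdot> h = u" "r \<cdot> h = v"
      using pullback_ex[OF pb u(1,2), of "Dom C u"] u by auto
    show "\<exists>h. h \<in> Arr C \<and> Dom C h = Dom C u \<and> Cod C h = Dom C (q \<cdot> i) \<and> (q \<cdot> i) \<cdot> h = u \<and> (r \<cdot> i) \<cdot> h = v"
      using h u p i by (intro exI[of _ "j \<cdot> h"]) (simp add: reassoc[OF i(6)])
  next
    fix h h'
    assume h: "h \<in> Arr C" "h' \<in> Arr C" "Dom C h' = Dom C h" "Cod C h = Dom C (q \<cdot> i)"
      "Cod C h' = Dom C (q \<cdot> i)" "(q \<cdot> i) \<cdot> h = (q \<cdot> i) \<cdot> h'" "(r \<cdot> i) \<cdot> h = (r \<cdot> i) \<cdot> h'"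
    have "i \<cdot> h = i \<cdot> h'"
      by (rule pullback_unique[OF pb f g]) (use h p i in \<open>auto\<close>)
    then have "j \<cdot> (i \<cdot> h) = j \<cdot> (i \<cdot> h')" by simp
    then show "h = h'" using h p i by (simp add: reassoc[OF i(7)])
  qed (use p i f g in simp_all)
qed

lemma pullback_compare:
  assumes pb: "is_pullback C f g q r" and pb': "is_pullback C f g q' r'"
    and f: "f \<in> Arr C" and g: "g \<in> Arr C"
  shows "\<exists>i j. i \<in> Arr C \<and> j \<in> Arr C \<and> Dom C i = Dom C q \<and> Cod C i = Dom C q' \<and>
    Dom C j = Dom C q' \<and> Cod C j = Dom C q \<and> q' \<cdot> i = q \<and> r' \<cdot> i = r \<and> q \<cdot> j = q' \<and> r \<cdot> j = r' \<and>
    i \<cdot> j = Ide C (Dom C q') \<and> j \<cdot> i = Ide C (Dom C q)"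
proof -
  note p = pullbackD[OF pb] and p' = pullbackD[OF pb']
  obtain i where i: "i \<in> Arr C" "Dom C i = Dom C q" "Cod C i = Dom C q'" "q' \<cdot> i = q" "r' \<cdot> i = r"
    using pullback_ex[OF pb', of q r "Dom C q"] p by auto
  obtain j where j: "j \<in> Arr C" "Dom C j = Dom C q'" "Cod C j = Dom C q" "q \<cdot> j = q'" "r \<cdot> j = r'"
    using pullback_ex[OF pb, of q' r' "Dom C q'"] p' by auto
  have "i \<cdot> j = Ide C (Dom C q')"
    by (rule pullback_unique[OF pb' f g]) (use i j p p' in \<open>auto simp: reassoc[OF i(4)] reassoc[OF i(5)]\<close>)
  moreover have "j \<cdot> i = Ide C (Dom C q)"
    by (rule pullback_unique[OF pb f g]) (use i j p p' in \<open>auto simp: reassoc[OF j(4)] reassoc[OF j(5)]\<close>)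
  ultimately show ?thesis using i j by blast
qed

end

section \<open>Descent without chosen pullbacks\<close>

text \<open>Full faithfulness of the comparison functor, with a morphism of algebras between free
  descent data rephrased as an arrow that identifies the kernel pair of \<open>t\<close>.\<close>

definition descent_ff :: "('o, 'a) cat \<Rightarrow> 'a \<Rightarrow> bool" where
  "descent_ff C p \<longleftrightarrow> (\<forall>f\<in>Arr C. \<forall>g\<in>Arr C. \<forall>q t k.
     Cod C f = Cod C p \<and> Cod C g = Cod C p \<and> is_pullback C p f q t \<and> k \<in> Hom C (Dom C q) (Dom C g)
     \<and> g \<cdot>\<^bsub>C\<^esub> k = f \<cdot>\<^bsub>C\<^esub> t
     \<and> (\<forall>u v. u \<in> Arr C \<and> v \<in> Arr C \<and> Dom C v = Dom C u \<and> Cod C u = Dom C q \<and> Cod C v = Dom C q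
          \<and> t \<cdot>\<^bsub>C\<^esub> u = t \<cdot>\<^bsub>C\<^esub> v \<longrightarrow> k \<cdot>\<^bsub>C\<^esub> u = k \<cdot>\<^bsub>C\<^esub> v)
     \<longrightarrow> (\<exists>!h. h \<in> Hom C (Dom C f) (Dom C g) \<and> g \<cdot>\<^bsub>C\<^esub> h = f \<and> h \<cdot>\<^bsub>C\<^esub> t = k))"

text \<open>An algebra structure \<open>a\<close> on \<open>r : x \<rightarrow> e\<close>. In generalized elements, \<open>a\<close> assigns to \<open>u\<close> in \<open>e\<close> and
  \<open>s\<close> in \<open>x\<close> with \<open>p u = p r s\<close> an element \<open>u * s\<close> of \<open>x\<close> over \<open>u\<close>; the last two conditions say
  \<open>r(s) * s = s\<close> and \<open>u' * (u * s) = u' * s\<close>.\<close>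

definition descent_datum :: "('o, 'a) cat \<Rightarrow> 'a \<Rightarrow> 'a \<Rightarrow> 'a \<Rightarrow> 'a \<Rightarrow> 'a \<Rightarrow> bool" where
  "descent_datum C p r q1 q2 a \<longleftrightarrow>
     r \<in> Arr C \<and> Cod C r = Dom C p \<and> is_pullback C p (p \<cdot>\<^bsub>C\<^esub> r) q1 q2 \<and> a \<in> Hom C (Dom C q1) (Dom C r)
     \<and> r \<cdot>\<^bsub>C\<^esub> a = q1
     \<and> (\<forall>d. d \<in> Arr C \<and> Cod C d = Dom C q1 \<and> q1 \<cdot>\<^bsub>C\<^esub> d = r \<cdot>\<^bsub>C\<^esub> (q2 \<cdot>\<^bsub>C\<^esub> d) \<longrightarrow> a \<cdot>\<^bsub>C\<^esub> d = q2 \<cdot>\<^bsub>C\<^esub> d)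
     \<and> (\<forall>m n n'. m \<in> Arr C \<and> n \<in> Arr C \<and> n' \<in> Arr C \<and> Dom C n = Dom C m \<and> Dom C n' = Dom C m
          \<and> Cod C m = Dom C q1 \<and> Cod C n = Dom C q1 \<and> Cod C n' = Dom C q1
          \<and> q2 \<cdot>\<^bsub>C\<^esub> n = a \<cdot>\<^bsub>C\<^esub> m \<and> q1 \<cdot>\<^bsub>C\<^esub> n' = q1 \<cdot>\<^bsub>C\<^esub> n \<and> q2 \<cdot>\<^bsub>C\<^esub> n' = q2 \<cdot>\<^bsub>C\<^esub> m
          \<longrightarrow> a \<cdot>\<^bsub>C\<^esub> n = a \<cdot>\<^bsub>C\<^esub> n')"

text \<open>Essential surjectivity of the comparison functor. As any pullback of \<open>f\<close>
  may be taken, the leg can be \<open>r\<close> itself; what remains of the isomorphism of algebras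
  is that \<open>t\<close> does not distinguish the action \<open>a\<close> from the projection
  \<open>q2\<close>.\<close>

definition descent_es :: "('o, 'a) cat \<Rightarrow> 'a \<Rightarrow> bool" where
  "descent_es C p \<longleftrightarrow> (\<forall>r q1 q2 a. descent_datum C p r q1 q2 a \<longrightarrow>
     (\<exists>f t. f \<in> Arr C \<and> Cod C f = Cod C p \<and> is_pullback C p f r t \<and> t \<cdot>\<^bsub>C\<^esub> a = t \<cdot>\<^bsub>C\<^esub> q2))"

section \<open>Slices and Eilenberg-Moore categories\<close>

lemma slice_simps [simp]:
  "Obj (slice C b) = {f \<in> Arr C. Cod C f = b}"
  "Dom (slice C b) (f, h, g) = f"
  "Cod (slice C b) (f, h, g) = g"
  "Ide (slice C b) f = (f, Ide C (Dom C f), f)"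
  "Comp (slice C b) (g', k, l) (f, h, g) = (f, k \<cdot>\<^bsub>C\<^esub> h, l)"
  "(f, h, g) \<in> Arr (slice C b) \<longleftrightarrow> f \<in> Arr C \<and> Cod C f = b \<and> g \<in> Arr C \<and> Cod C g = b \<and>
     h \<in> Arr C \<and> Dom C h = Dom C f \<and> Cod C h = Dom C g \<and> g \<cdot>\<^bsub>C\<^esub> h = f"
  by (auto simp: slice_def Hom_def)

lemma slice_HomE:
  assumes "H \<in> Hom (slice C b) f g"
  obtains h where "H = (f, h, g)" "f \<in> Arr C" "Cod C f = b" "g \<in> Arr C" "Cod C g = b"
    "h \<in> Arr C" "Dom C h = Dom C f" "Cod C h = Dom C g" "g \<cdot>\<^bsub>C\<^esub> h = f"
proof (cases H)
  case (fields x h y)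
  then show ?thesis using assms that by (auto simp: Hom_def)
qed

lemma slice_Hom [simp]:
  "(f', h, g') \<in> Hom (slice C b) f g \<longleftrightarrow> f' = f \<and> g' = g \<and> f \<in> Arr C \<and> Cod C f = b \<and> g \<in> Arr C \<and>
     Cod C g = b \<and> h \<in> Arr C \<and> Dom C h = Dom C f \<and> Cod C h = Dom C g \<and> g \<cdot>\<^bsub>C\<^esub> h = f"
  by (auto simp: Hom_def)

lemma (in category) category_slice: "category (slice C b)"
proof
  fix f x y g z h w
  { assume f: "f \<in> Hom (slice C b) x y"
    show "f \<cdot>\<^bsub>slice C b\<^esub> Ide (slice C b) x = f" "Ide (slice C b) y \<cdot>\<^bsub>slice C b\<^esub> f = f"
      by (rule slice_HomE[OF f], simp)+
    assume g: "g \<in> Hom (slice C b) y z"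
    show "g \<cdot>\<^bsub>slice C b\<^esub> f \<in> Hom (slice C b) x z"
      by (rule slice_HomE[OF f], rule slice_HomE[OF g]) (auto simp: reassoc)
    assume h: "h \<in> Hom (slice C b) z w"
    show "(h \<cdot>\<^bsub>slice C b\<^esub> g) \<cdot>\<^bsub>slice C b\<^esub> f = h \<cdot>\<^bsub>slice C b\<^esub> (g \<cdot>\<^bsub>slice C b\<^esub> f)"
      by (rule slice_HomE[OF f], rule slice_HomE[OF g], rule slice_HomE[OF h]) simp }
next
  fix f assume "f \<in> Arr (slice C b)"
  then show "Dom (slice C b) f \<in> Obj (slice C b)" "Cod (slice C b) f \<in> Obj (slice C b)"
    by (cases f; simp)+
qed simp

lemma EM_simps [simp]:
  "Obj (EM C T) = algebras C T"
  "Dom (EM C T) (X, h, Y) = X"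
  "Cod (EM C T) (X, h, Y) = Y"
  "Ide (EM C T) X = (X, Ide C (fst X), X)"
  "Comp (EM C T) (Y', k, Z) (X, h, Y) = (X, k \<cdot>\<^bsub>C\<^esub> h, Z)"
  "(X, h, Y) \<in> Arr (EM C T) \<longleftrightarrow> X \<in> algebras C T \<and> Y \<in> algebras C T \<and> h \<in> Hom C (fst X) (fst Y)
                \<and> h \<cdot>\<^bsub>C\<^esub> snd X = snd Y \<cdot>\<^bsub>C\<^esub> FArr (Endo T) h"
  by (auto simp: EM_def)

lemma EM_HomE:
  assumes "H \<in> Hom (EM C T) X Y"
  obtains h where "H = (X, h, Y)" "(X, h, Y) \<in> Arr (EM C T)"
proof (cases H)
  case (fields x h y)
  then show ?thesis using assms that by (auto simp: Hom_def)
qed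

lemma algebrasD:
  assumes "X \<in> algebras C T"
  shows "fst X \<in> Obj C" "snd X \<in> Arr C" "Dom C (snd X) = FObj (Endo T) (fst X)" "Cod C (snd X) = fst X"
  using assms unfolding algebras_def by (auto simp: Hom_def)

lemma category_EM:
  assumes T: "is_functor C C (Endo T)"
  shows "category (EM C T)"
proof -
  note T' = is_functorD[OF T]
  interpret category C by (rule T')
  have arr: "h \<in> Arr C" "Dom C h = fst X" "Cod C h = fst Y" "h \<cdot>\<^bsub>C\<^esub> snd X = snd Y \<cdot>\<^bsub>C\<^esub> FArr (Endo T) h"
    "X \<in> algebras C T" "Y \<in> algebras C T"
    if "(X, h, Y) \<in> Arr (EM C T)" for X h Y using that by (auto simp: Hom_def)
  show ?thesis
  proof
    fix f X Y g Z h W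
    { assume f: "f \<in> Hom (EM C T) X Y"
      obtain f' where f': "f = (X, f', Y)" "(X, f', Y) \<in> Arr (EM C T)" by (rule EM_HomE[OF f])
      note f'' = arr[OF f'(2)]
      show "f \<cdot>\<^bsub>EM C T\<^esub> Ide (EM C T) X = f" "Ide (EM C T) Y \<cdot>\<^bsub>EM C T\<^esub> f = f"
        using f' f'' by simp_all
      assume g: "g \<in> Hom (EM C T) Y Z"
      obtain g' where g': "g = (Y, g', Z)" "(Y, g', Z) \<in> Arr (EM C T)" by (rule EM_HomE[OF g])
      note g'' = arr[OF g'(2)]
      have "(g' \<cdot>\<^bsub>C\<^esub> f') \<cdot>\<^bsub>C\<^esub> snd X = snd Z \<cdot>\<^bsub>C\<^esub> FArr (Endo T) (g' \<cdot>\<^bsub>C\<^esub> f')"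
        using f''(1-4) g''(1-4) algebrasD[OF f''(5)] algebrasD[OF f''(6)] algebrasD[OF g''(6)] T'(4-6)[OF f''(1)]
          T'(4-6)[OF g''(1)] T'(8)[of f' g']
        by (simp add: reassoc[OF g''(4)])
      then show "g \<cdot>\<^bsub>EM C T\<^esub> f \<in> Hom (EM C T) X Z"
        using f' g' f'' g'' unfolding Hom_def[of "EM C T"] by (simp add: Hom_def)
      assume h: "h \<in> Hom (EM C T) Z W"
      obtain h' where h': "h = (Z, h', W)" "(Z, h', W) \<in> Arr (EM C T)" by (rule EM_HomE[OF h])
      show "(h \<cdot>\<^bsub>EM C T\<^esub> g) \<cdot>\<^bsub>EM C T\<^esub> f = h \<cdot>\<^bsub>EM C T\<^esub> (g \<cdot>\<^bsub>EM C T\<^esub> f)"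
        using f' g' h' f'' g'' arr[OF h'(2)] by simp }
  next
    fix X assume "X \<in> Obj (EM C T)"
    then show "Ide (EM C T) X \<in> Hom (EM C T) X X"
      using algebrasD[of X C T] T'(7)[of "fst X"] by (simp add: Hom_def)
  next
    fix f assume "f \<in> Arr (EM C T)"
    then show "Dom (EM C T) f \<in> Obj (EM C T)" "Cod (EM C T) f \<in> Obj (EM C T)"
      by (cases f; simp)+
  qed
qed

text \<open>The inverse \<open>j\<close> inherits the homomorphism equation: compose that of
  \<open>i\<close> with \<open>j\<close> on the left and with the image of \<open>j\<close> under
  the endofunctor on the right.\<close>

lemma EM_iso:
  assumes T: "is_functor C C (Endo T)" and i: "(X, i, Y) \<in> Arr (EM C T)" "iso_arrow C i"
  shows "iso_arrow (EM C T) (X, i, Y)"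
proof -
  note T' = is_functorD[OF T]
  interpret category C by (rule T')
  interpret E: category "EM C T" by (rule category_EM[OF T])
  have i': "i \<in> Arr C" "Dom C i = fst X" "Cod C i = fst Y" "i \<cdot>\<^bsub>C\<^esub> snd X = snd Y \<cdot>\<^bsub>C\<^esub> FArr (Endo T) i"
    and X: "X \<in> algebras C T" and Y: "Y \<in> algebras C T" using i by (auto simp: Hom_def)
  obtain j where j: "j \<in> Arr C" "Dom C j = fst Y" "Cod C j = fst X"
    "j \<cdot>\<^bsub>C\<^esub> i = Ide C (fst X)" "i \<cdot>\<^bsub>C\<^esub> j = Ide C (fst Y)"
    using iso_arrowE[OF i(2)] i' by metis
  note X' = algebrasD[OF X] and Y' = algebrasD[OF Y]
  have Tij: "FArr (Endo T) i \<cdot>\<^bsub>C\<^esub> FArr (Endo T) j = Ide C (FObj (Endo T) (fst Y))"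
    using T'(8)[of j i] T'(7)[OF Y'(1)] i' j by simp
  have "j \<cdot>\<^bsub>C\<^esub> snd Y = j \<cdot>\<^bsub>C\<^esub> (snd Y \<cdot>\<^bsub>C\<^esub> (FArr (Endo T) i \<cdot>\<^bsub>C\<^esub> FArr (Endo T) j))"
    using Tij j Y' by simp
  also have "\<dots> = j \<cdot>\<^bsub>C\<^esub> ((snd Y \<cdot>\<^bsub>C\<^esub> FArr (Endo T) i) \<cdot>\<^bsub>C\<^esub> FArr (Endo T) j)"
    using j i' Y' T'(4-6)[OF i'(1)] T'(4-6)[OF j(1)] by simp
  also have "\<dots> = j \<cdot>\<^bsub>C\<^esub> ((i \<cdot>\<^bsub>C\<^esub> snd X) \<cdot>\<^bsub>C\<^esub> FArr (Endo T) j)" using i'(4) by simp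
  also have "\<dots> = snd X \<cdot>\<^bsub>C\<^esub> FArr (Endo T) j"
    using j(1-3) i'(1-3) X' T'(4-6)[OF j(1)] by (simp add: reassoc[OF j(4)])
  finally have "(Y, j, X) \<in> Arr (EM C T)" using X Y j by (simp add: Hom_def)
  then show ?thesis
    using i j by (intro E.iso_arrowI[of _ X Y "(Y, j, X)"]) (auto simp: Hom_def)
qed

lemma slice_iso:
  assumes "category C" "(f, i, g) \<in> Arr (slice C b)" "iso_arrow C i"
  shows "iso_arrow (slice C b) (f, i, g)"
proof -
  interpret category C by fact
  interpret S: category "slice C b" by (rule category_slice)
  obtain j where j: "j \<in> Arr C" "Dom C j = Dom C g" "Cod C j = Dom C f"
    "j \<cdot>\<^bsub>C\<^esub> i = Ide C (Dom C f)" "i \<cdot>\<^bsub>C\<^esub> j = Ide C (Dom C g)"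
    using iso_arrowE[OF assms(3)] assms(2) by (metis slice_simps(6))
  have "f \<cdot>\<^bsub>C\<^esub> j = g"
  proof -
    have "f \<cdot>\<^bsub>C\<^esub> j = (g \<cdot>\<^bsub>C\<^esub> i) \<cdot>\<^bsub>C\<^esub> j" using assms(2) by simp
    also have "\<dots> = g \<cdot>\<^bsub>C\<^esub> (i \<cdot>\<^bsub>C\<^esub> j)" using assms(2) j by (intro comp_assoc) auto
    also have "\<dots> = g" using assms(2) j by simp
    finally show ?thesis .
  qed
  then show ?thesis
    using assms(2) j by (intro S.iso_arrowI[of _ f g "(g, j, f)"]) auto
qed

text \<open>The legs \<open>r\<close> and \<open>t\<close> are jointly monic, so the laws are tested
  after each of them. After \<open>r\<close> the action is \<open>q1\<close>; after \<open>t\<close>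
  it is \<open>t \<cdot> q2\<close>, which does not involve the acting element.\<close>

lemma pullback_datum:
  assumes "category C" and p: "p \<in> Arr C" and f: "f \<in> Arr C" and pb: "is_pullback C p f r t"
    and q: "is_pullback C p (p \<cdot>\<^bsub>C\<^esub> r) q1 q2"
    and a: "a \<in> Arr C" "Dom C a = Dom C q1" "Cod C a = Dom C r" "r \<cdot>\<^bsub>C\<^esub> a = q1" "t \<cdot>\<^bsub>C\<^esub> a = t \<cdot>\<^bsub>C\<^esub> q2"
  shows "descent_datum C p r q1 q2 a"
proof -
  interpret category C by fact
  note b = pullbackD[OF pb]
  have q': "q1 \<in> Arr C" "Cod C q1 = Dom C p" "q2 \<in> Arr C" "Dom C q2 = Dom C q1" "Cod C q2 = Dom C r"
    using pullbackD[OF q] b(1-5) p by auto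
  show ?thesis
    unfolding descent_datum_def
  proof (intro conjI allI impI)
    fix d assume d: "d \<in> Arr C \<and> Cod C d = Dom C q1 \<and> q1 \<cdot>\<^bsub>C\<^esub> d = r \<cdot>\<^bsub>C\<^esub> (q2 \<cdot>\<^bsub>C\<^esub> d)"
    show "a \<cdot>\<^bsub>C\<^esub> d = q2 \<cdot>\<^bsub>C\<^esub> d"
      by (rule pullback_unique[OF pb p f])
        (use d a(1-3) b(1-5) q' in \<open>simp_all add: reassoc[OF a(4)] reassoc[OF a(5)]\<close>)
  next
    fix m n n'
    assume d: "m \<in> Arr C \<and> n \<in> Arr C \<and> n' \<in> Arr C \<and> Dom C n = Dom C m \<and> Dom C n' = Dom C m
          \<and> Cod C m = Dom C q1 \<and> Cod C n = Dom C q1 \<and> Cod C n' = Dom C q1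
          \<and> q2 \<cdot>\<^bsub>C\<^esub> n = a \<cdot>\<^bsub>C\<^esub> m \<and> q1 \<cdot>\<^bsub>C\<^esub> n' = q1 \<cdot>\<^bsub>C\<^esub> n \<and> q2 \<cdot>\<^bsub>C\<^esub> n' = q2 \<cdot>\<^bsub>C\<^esub> m"
    show "a \<cdot>\<^bsub>C\<^esub> n = a \<cdot>\<^bsub>C\<^esub> n'"
      by (rule pullback_unique[OF pb p f])
        (use d a(1-3) b(1-5) q' in \<open>simp_all add: reassoc[OF a(4)] reassoc[OF a(5)]\<close>)
  qed (use a b q q' in \<open>auto simp: Hom_def\<close>)
qed

section \<open>The descent monad and its algebras\<close>

definition pb_map :: "('o, 'a) cat \<Rightarrow> 'a \<Rightarrow> 'a \<Rightarrow> 'a \<Rightarrow> 'a \<Rightarrow> 'a" where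
  "pb_map C p f h g = pb_induced C p g (pb_base C p f) (h \<cdot>\<^bsub>C\<^esub> pb_top C p f)"

lemma pullback_ftr_simps [simp]:
  "FObj (pullback_ftr C p) = pb_base C p"
  "FArr (pullback_ftr C p) (f, h, g) = (pb_base C p f, pb_map C p f h g, pb_base C p g)"
  by (simp_all add: pullback_ftr_def pb_map_def)

lemma postcomp_ftr_simps [simp]:
  "FObj (postcomp_ftr C p) f = p \<cdot>\<^bsub>C\<^esub> f"
  "FArr (postcomp_ftr C p) (f, h, g) = (p \<cdot>\<^bsub>C\<^esub> f, h, p \<cdot>\<^bsub>C\<^esub> g)"
  by (simp_all add: postcomp_ftr_def)

lemma descent_monad_simps [simp]:
  "FObj (Endo (descent_monad C p)) r = pb_base C p (p \<cdot>\<^bsub>C\<^esub> r)"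
  "FArr (Endo (descent_monad C p)) (f, h, g) =
     (pb_base C p (p \<cdot>\<^bsub>C\<^esub> f), pb_map C p (p \<cdot>\<^bsub>C\<^esub> f) h (p \<cdot>\<^bsub>C\<^esub> g), pb_base C p (p \<cdot>\<^bsub>C\<^esub> g))"
  "Unit (descent_monad C p) = descent_unit C p"
  "Mult (descent_monad C p) r = (pb_base C p (p \<cdot>\<^bsub>C\<^esub> pb_base C p (p \<cdot>\<^bsub>C\<^esub> r)),
     pb_map C p (p \<cdot>\<^bsub>C\<^esub> pb_base C p (p \<cdot>\<^bsub>C\<^esub> r)) (pb_top C p (p \<cdot>\<^bsub>C\<^esub> r)) (p \<cdot>\<^bsub>C\<^esub> r), pb_base C p (p \<cdot>\<^bsub>C\<^esub> r))"
  by (simp_all add: descent_monad_def adj_monad_def comp_ftr_def descent_counit_def)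

locale pullback_category = category +
  fixes p
  assumes pbs: "has_pullbacks C" and p: "p \<in> Arr C"
begin

abbreviation base :: "'b \<Rightarrow> 'b" where "base f \<equiv> pb_base C p f"
abbreviation top :: "'b \<Rightarrow> 'b" where "top f \<equiv> pb_top C p f"
abbreviation M where "M \<equiv> descent_monad C p"
abbreviation K where "K \<equiv> em_comparison (slice C (Cod C p)) (pullback_ftr C p) (descent_counit C p)"

lemma pb: "f \<in> Arr C \<Longrightarrow> Cod C f = Cod C p \<Longrightarrow> is_pullback C p f (base f) (top f)"
proof -
  assume "f \<in> Arr C" "Cod C f = Cod C p"
  then have "\<exists>qr. is_pullback C p f (fst qr) (snd qr)"
    using pbs p unfolding has_pullbacks_def by simp
  then have "is_pullback C p f (fst (pb C p f)) (snd (pb C p f))"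
    unfolding pb_def by (rule someI_ex)
  then show ?thesis by (simp add: pb_base_def pb_top_def)
qed

lemma pb_simps [simp]:
  assumes "f \<in> Arr C" "Cod C f = Cod C p"
  shows "base f \<in> Arr C" "Cod C (base f) = Dom C p" "top f \<in> Arr C" "Dom C (top f) = Dom C (base f)"
    "Cod C (top f) = Dom C f"
  using pullbackD[OF pb[OF assms]] by auto

lemma pb_commute:
  assumes "f \<in> Arr C" "Cod C f = Cod C p"
  shows "p \<cdot> base f = f \<cdot> top f"
  using pullbackD[OF pb[OF assms]] by auto

lemma pb_joint:
  assumes "base f \<cdot> h = base f \<cdot> h'" "top f \<cdot> h = top f \<cdot> h'" "f \<in> Arr C" "Cod C f = Cod C p" "h \<in> Arr C" "h' \<in> Arr C"
    "Dom C h = Dom C h'" "Cod C h = Dom C (base f)" "Cod C h' = Dom C (base f)"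
  shows "h = h'"
  by (rule pullback_unique[OF pb[OF assms(3,4)] p assms(3)]) (use assms in auto)

lemma pb_induced:
  assumes "f \<in> Arr C" "Cod C f = Cod C p" "u \<in> Arr C" "v \<in> Arr C" "Dom C v = Dom C u"
    "Cod C u = Dom C p" "Cod C v = Dom C f" "p \<cdot> u = f \<cdot> v"
  shows "pb_induced C p f u v \<in> Arr C" "Dom C (pb_induced C p f u v) = Dom C u"
    "Cod C (pb_induced C p f u v) = Dom C (base f)"
    "base f \<cdot> pb_induced C p f u v = u" "top f \<cdot> pb_induced C p f u v = v"
proof -
  have "u \<in> Hom C (Dom C u) (Dom C p)" "v \<in> Hom C (Dom C u) (Dom C f)"
    using assms by (auto simp: Hom_def)
  then have "\<exists>!h. h \<in> Hom C (Dom C u) (Dom C (base f)) \<and> base f \<cdot> h = u \<and> top f \<cdot> h = v"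
    using pb[OF assms(1,2)] assms(8) unfolding is_pullback_def by blast
  then have "pb_induced C p f u v \<in> Hom C (Dom C u) (Dom C (base f)) \<and> base f \<cdot> pb_induced C p f u v = u
    \<and> top f \<cdot> pb_induced C p f u v = v"
    unfolding pb_induced_def by (rule theI')
  then show "pb_induced C p f u v \<in> Arr C" "Dom C (pb_induced C p f u v) = Dom C u"
    "Cod C (pb_induced C p f u v) = Dom C (base f)"
    "base f \<cdot> pb_induced C p f u v = u" "top f \<cdot> pb_induced C p f u v = v"
    by (auto simp: Hom_def)
qed

lemma pb_map [simp]:
  assumes "f \<in> Arr C" "Cod C f = Cod C p" "g \<in> Arr C" "Cod C g = Cod C p" "h \<in> Arr C"
    "Dom C h = Dom C f" "Cod C h = Dom C g" "g \<cdot> h = f"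
  shows "pb_map C p f h g \<in> Arr C" "Dom C (pb_map C p f h g) = Dom C (base f)"
    "Cod C (pb_map C p f h g) = Dom C (base g)" "base g \<cdot> pb_map C p f h g = base f"
    "top g \<cdot> pb_map C p f h g = h \<cdot> top f"
proof -
  have "p \<cdot> base f = g \<cdot> (h \<cdot> top f)"
    using assms(1-7) pb_commute[OF assms(1,2)] by (simp add: reassoc[OF assms(8)])
  then show "pb_map C p f h g \<in> Arr C" "Dom C (pb_map C p f h g) = Dom C (base f)"
    "Cod C (pb_map C p f h g) = Dom C (base g)" "base g \<cdot> pb_map C p f h g = base f"
    "top g \<cdot> pb_map C p f h g = h \<cdot> top f"
    unfolding pb_map_def using pb_induced[of g "base f" "h \<cdot> top f"] assms(1-7) by auto
qed

lemma pb_map_reassoc: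
  assumes "f \<in> Arr C" "Cod C f = Cod C p" "g \<in> Arr C" "Cod C g = Cod C p" "h \<in> Arr C"
    "Dom C h = Dom C f" "Cod C h = Dom C g" "g \<cdot> h = f" "k \<in> Arr C" "Cod C k = Dom C (base f)"
  shows "base g \<cdot> (pb_map C p f h g \<cdot> k) = base f \<cdot> k"
    "top g \<cdot> (pb_map C p f h g \<cdot> k) = h \<cdot> (top f \<cdot> k)"
  using assms(1-7,9,10) pb_map[OF assms(1-8)]
  by (simp_all add: reassoc[OF pb_map(4)[OF assms(1-8)]] reassoc[OF pb_map(5)[OF assms(1-8)]])

lemma pullback_functor: "is_functor (slice C (Cod C p)) (slice C (Dom C p)) (pullback_ftr C p)"
proof -
  have ide: "pb_map C p f (Ide C (Dom C f)) f = Ide C (Dom C (base f))" if "f \<in> Arr C" "Cod C f = Cod C p" for f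
    by (rule pb_joint[of f]) (use that in simp_all)
  have comp: "pb_map C p f (k \<cdot> h) l = pb_map C p g k l \<cdot> pb_map C p f h g"
    if "(f, h, g) \<in> Arr (slice C (Cod C p))" "(g, k, l) \<in> Arr (slice C (Cod C p))" for f h g k l
  proof -
    have l: "l \<cdot> (k \<cdot> h) = f" using that by (simp add: reassoc[of l k g])
    show ?thesis by (rule pb_joint[of l]) (use that l in \<open>simp_all add: pb_map_reassoc reassoc[of "top l" "pb_map C p g k l" "k \<cdot> top g"]\<close>)
  qed
  show ?thesis
    unfolding is_functor_def
  proof (intro conjI ballI impI)
    fix F G assume FG: "F \<in> Arr (slice C (Cod C p))" "G \<in> Arr (slice C (Cod C p))" 
      "Dom (slice C (Cod C p)) G = Cod (slice C (Cod C p)) F"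
    then show "FArr (pullback_ftr C p) (G \<cdot>\<^bsub>slice C (Cod C p)\<^esub> F) =
      FArr (pullback_ftr C p) G \<cdot>\<^bsub>slice C (Dom C p)\<^esub> FArr (pullback_ftr C p) F"
    proof (cases F; cases G)
      fix f h g g' k l assume e: "F = (f, h, g)" "G = (g', k, l)"
      show ?thesis using comp[of f h g k l] FG unfolding e by simp
    qed
  next
    fix F assume F: "F \<in> Arr (slice C (Cod C p))"
    then show "FArr (pullback_ftr C p) F \<in> Hom (slice C (Dom C p)) (FObj (pullback_ftr C p) (Dom (slice C (Cod C p)) F))
      (FObj (pullback_ftr C p) (Cod (slice C (Cod C p)) F))"
      by (cases F) simp
  qed (use ide category_slice in \<open>simp_all\<close>)
qed

lemma postcomp_functor: "is_functor (slice C (Dom C p)) (slice C (Cod C p)) (postcomp_ftr C p)"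
  unfolding is_functor_def
proof (intro conjI ballI impI)
  fix F G assume FG: "F \<in> Arr (slice C (Dom C p))" "G \<in> Arr (slice C (Dom C p))" 
    "Dom (slice C (Dom C p)) G = Cod (slice C (Dom C p)) F"
  then show "FArr (postcomp_ftr C p) (G \<cdot>\<^bsub>slice C (Dom C p)\<^esub> F) =
    FArr (postcomp_ftr C p) G \<cdot>\<^bsub>slice C (Cod C p)\<^esub> FArr (postcomp_ftr C p) F"
    by (cases F; cases G) simp
next
  fix F assume F: "F \<in> Arr (slice C (Dom C p))"
  then show "FArr (postcomp_ftr C p) F \<in> Hom (slice C (Cod C p)) (FObj (postcomp_ftr C p) (Dom (slice C (Dom C p)) F))
    (FObj (postcomp_ftr C p) (Cod (slice C (Dom C p)) F))"
    using p by (cases F) simp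
qed (use category_slice p in \<open>simp_all\<close>)

lemma monad_functor: "is_functor (slice C (Dom C p)) (slice C (Dom C p)) (Endo M)"
  unfolding descent_monad_def adj_monad_def
  using is_functor_comp[OF postcomp_functor pullback_functor] by simp

text \<open>The two algebra laws are the instances of the two laws of a descent datum at universal
  test arrows: the unit of the monad, and the pair formed by its multiplication and the image of
  \<open>a\<close>. Every other test situation factors through these.\<close>

lemma algebra_iff:
  "(r, \<alpha>) \<in> algebras (slice C (Dom C p)) M \<longleftrightarrow>
    (\<exists>a. \<alpha> = (base (p \<cdot> r), a, r) \<and> descent_datum C p r (base (p \<cdot> r)) (top (p \<cdot> r)) a)"
proof (cases "r \<in> Arr C \<and> Cod C r = Dom C p")
  case False
  then show ?thesis by (auto simp: algebras_def descent_datum_def)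
next
  case r: True
  let ?q1 = "base (p \<cdot> r)" and ?q2 = "top (p \<cdot> r)"
  let ?s1 = "base (p \<cdot> ?q1)" and ?s2 = "top (p \<cdot> ?q1)"
  have pr: "p \<cdot> r \<in> Arr C" "Cod C (p \<cdot> r) = Cod C p" "Dom C (p \<cdot> r) = Dom C r" using r p by auto
  have pq: "p \<cdot> ?q1 \<in> Arr C" "Cod C (p \<cdot> ?q1) = Cod C p" "Dom C (p \<cdot> ?q1) = Dom C ?q1" using pr p by auto
  have q: "?q1 \<in> Arr C" "Cod C ?q1 = Dom C p" "?q2 \<in> Arr C" "Dom C ?q2 = Dom C ?q1" "Cod C ?q2 = Dom C r"
    using pr by simp_all
  have s: "?s1 \<in> Arr C" "Cod C ?s1 = Dom C p" "?s2 \<in> Arr C" "Dom C ?s2 = Dom C ?s1" "Cod C ?s2 = Dom C ?q1"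
    using pq by simp_all
  have "p \<cdot> r = (p \<cdot> r) \<cdot> Ide C (Dom C r)" using pr by simp
  note u = pb_induced[OF pr(1,2), of r "Ide C (Dom C r)", OF _ _ _ _ _ this]
  \<comment> \<open>The unit of the monad at \<open>r\<close>; in elements, \<open>s\<close> is sent
    to \<open>(r(s), s)\<close>.\<close>
  let ?u = "pb_induced C p (p \<cdot> r) r (Ide C (Dom C r))"
  have u: "?u \<in> Arr C" "Dom C ?u = Dom C r" "Cod C ?u = Dom C ?q1" "?q1 \<cdot> ?u = r" "?q2 \<cdot> ?u = Ide C (Dom C r)"
    using u r pr by auto
  have eq2: "(p \<cdot> r) \<cdot> ?q2 = p \<cdot> ?q1" using pb_commute[OF pr(1,2)] by simp
  \<comment> \<open>The multiplication at \<open>r\<close>: it sends \<open>(u', (u, s))\<close> to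
    \<open>(u', s)\<close>.\<close>
  let ?n' = "pb_map C p (p \<cdot> ?q1) ?q2 (p \<cdot> r)"
  have n': "?n' \<in> Arr C" "Dom C ?n' = Dom C ?s1" "Cod C ?n' = Dom C ?q1" "?q1 \<cdot> ?n' = ?s1" "?q2 \<cdot> ?n' = ?q2 \<cdot> ?s2"
    using pb_map[OF pq(1,2) pr(1,2), of ?q2] q eq2 pq pr by simp_all
  have alg: "(r, (?q1, a, r)) \<in> algebras (slice C (Dom C p)) M \<longleftrightarrow>
     a \<in> Arr C \<and> Dom C a = Dom C ?q1 \<and> Cod C a = Dom C r \<and> r \<cdot> a = ?q1 \<and> a \<cdot> ?u = Ide C (Dom C r)
     \<and> a \<cdot> pb_map C p (p \<cdot> ?q1) a (p \<cdot> r) = a \<cdot> ?n'" for a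
    using r q unfolding algebras_def by (auto simp: descent_unit_def)
  have "(r, (?q1, a, r)) \<in> algebras (slice C (Dom C p)) M \<longleftrightarrow> descent_datum C p r ?q1 ?q2 a" (is "?L \<longleftrightarrow> ?R") for a
  proof (cases "a \<in> Arr C \<and> Dom C a = Dom C ?q1 \<and> Cod C a = Dom C r \<and> r \<cdot> a = ?q1")
    case False
    then show ?thesis unfolding alg by (auto simp: descent_datum_def Hom_def)
  next
    case a: True
    \<comment> \<open>The image of \<open>a\<close> under the monad: it sends
      \<open>(u', (u, s))\<close> to \<open>(u', u * s)\<close>.\<close>
    let ?n = "pb_map C p (p \<cdot> ?q1) a (p \<cdot> r)"
    have "(p \<cdot> r) \<cdot> a = p \<cdot> ?q1" using a r p by simp
    then have n: "?n \<in> Arr C" "Dom C ?n = Dom C ?s1" "Cod C ?n = Dom C ?q1" "?q1 \<cdot> ?n = ?s1" "?q2 \<cdot> ?n = a \<cdot> ?s2"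
      using pb_map[OF pq(1,2) pr(1,2), of a] q a pq pr by simp_all
    show ?thesis
    proof
      assume ?R
      then have unit: "\<And>d. d \<in> Arr C \<Longrightarrow> Cod C d = Dom C ?q1 \<Longrightarrow> ?q1 \<cdot> d = r \<cdot> (?q2 \<cdot> d) \<Longrightarrow> a \<cdot> d = ?q2 \<cdot> d"
        and assoc: "\<And>m n n'. m \<in> Arr C \<Longrightarrow> n \<in> Arr C \<Longrightarrow> n' \<in> Arr C \<Longrightarrow> Dom C n = Dom C m \<Longrightarrow> Dom C n' = Dom C m
          \<Longrightarrow> Cod C m = Dom C ?q1 \<Longrightarrow> Cod C n = Dom C ?q1 \<Longrightarrow> Cod C n' = Dom C ?q1
          \<Longrightarrow> ?q2 \<cdot> n = a \<cdot> m \<Longrightarrow> ?q1 \<cdot> n' = ?q1 \<cdot> n \<Longrightarrow> ?q2 \<cdot> n' = ?q2 \<cdot> m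
          \<Longrightarrow> a \<cdot> n = a \<cdot> n'"
        unfolding descent_datum_def by blast+
      show ?L
        unfolding alg
        using a unit[of ?u] u assoc[of ?s2 ?n ?n'] n n' s r by simp
    next
      assume ?L
      then have L: "a \<cdot> ?u = Ide C (Dom C r)" "a \<cdot> ?n = a \<cdot> ?n'" unfolding alg by auto
      show ?R
        unfolding descent_datum_def
      proof (intro conjI allI impI)
        show "is_pullback C p (p \<cdot> r) ?q1 ?q2" by (rule pb[OF pr(1,2)])
        fix d assume d: "d \<in> Arr C \<and> Cod C d = Dom C ?q1 \<and> ?q1 \<cdot> d = r \<cdot> (?q2 \<cdot> d)"
        \<comment> \<open>An element \<open>d = (u, s)\<close> with \<open>u = r(s)\<close> is a
          value of the unit.\<close>
        have "?u \<cdot> (?q2 \<cdot> d) = d"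
          by (rule pb_joint[OF _ _ pr(1,2)])
            (use d u(1-3) q r in \<open>simp_all add: reassoc[OF u(4)] reassoc[OF u(5)]\<close>)
        then have "a \<cdot> d = a \<cdot> (?u \<cdot> (?q2 \<cdot> d))" by simp
        also have "\<dots> = ?q2 \<cdot> d" using a d u(1-3) q r by (simp add: reassoc[OF L(1)])
        finally show "a \<cdot> d = ?q2 \<cdot> d" .
      next
        fix m k k'
        assume d: "m \<in> Arr C \<and> k \<in> Arr C \<and> k' \<in> Arr C \<and> Dom C k = Dom C m \<and> Dom C k' = Dom C m
          \<and> Cod C m = Dom C ?q1 \<and> Cod C k = Dom C ?q1 \<and> Cod C k' = Dom C ?q1
          \<and> ?q2 \<cdot> k = a \<cdot> m \<and> ?q1 \<cdot> k' = ?q1 \<cdot> k \<and> ?q2 \<cdot> k' = ?q2 \<cdot> m"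
        have "p \<cdot> (?q1 \<cdot> k) = (p \<cdot> r) \<cdot> (?q2 \<cdot> k)"
          using d q pr p eq2 by (metis comp_assoc)
        also have "\<dots> = (p \<cdot> ?q1) \<cdot> m" using d a r p q by (simp add: reassoc[of r a ?q1])
        finally have e: "p \<cdot> (?q1 \<cdot> k) = (p \<cdot> ?q1) \<cdot> m" .
        \<comment> \<open>The triple \<open>m\<close>, \<open>k\<close>, \<open>k'\<close> is
          classified by one element of the iterated monad: \<open>m\<close> is the pair
          \<open>(u, s)\<close>, and the first component of \<open>k\<close> is \<open>u'\<close>.
          Then \<open>?n\<close> and \<open>?n'\<close> return \<open>k\<close> and
          \<open>k'\<close>.\<close>
        let ?j = "pb_induced C p (p \<cdot> ?q1) (?q1 \<cdot> k) m"
        have j: "?j \<in> Arr C" "Dom C ?j = Dom C m" "Cod C ?j = Dom C ?s1" "?s1 \<cdot> ?j = ?q1 \<cdot> k" "?s2 \<cdot> ?j = m"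
          using pb_induced[OF pq(1,2) _ _ _ _ _ e] d q pq by auto
        have 1: "?n \<cdot> ?j = k"
          by (rule pb_joint[OF _ _ pr(1,2)])
            (use d n(1-3) j q s a in \<open>simp_all add: reassoc[OF n(4)] reassoc[OF n(5)]\<close>)
        have 2: "?n' \<cdot> ?j = k'"
          by (rule pb_joint[OF _ _ pr(1,2)])
            (use d n'(1-3) j q s a in \<open>simp_all add: reassoc[OF n'(4)] reassoc[OF n'(5)]\<close>)
        have "a \<cdot> k = (a \<cdot> ?n) \<cdot> ?j" using 1 a n j by simp
        also have "\<dots> = a \<cdot> k'" unfolding L(2) using 2 a n' j by simp
        finally show "a \<cdot> k = a \<cdot> k'" .
      qed (use a r in \<open>auto simp: Hom_def\<close>)
    qed
  qed
  moreover have "\<exists>a. \<alpha> = (?q1, a, r)" if "(r, \<alpha>) \<in> algebras (slice C (Dom C p)) M"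
    using that unfolding algebras_def by (auto elim!: slice_HomE)
  ultimately show ?thesis by blast
qed

end

lemma iso_arrow_HomE:
  assumes "iso_arrow C f" "f \<in> Hom C x y"
  obtains g where "g \<in> Hom C y x" "g \<cdot>\<^bsub>C\<^esub> f = Ide C x" "f \<cdot>\<^bsub>C\<^esub> g = Ide C y"
  using assms unfolding iso_arrow_def inverse_arrows_def by (auto simp: Hom_def)

text \<open>In the situations below, compatibility of \<open>h\<close> with the actions \<open>af\<close> and \<open>ag\<close> reduces to
  \<open>k = tg h\<close> identifying \<open>af\<close> and \<open>qf2\<close>, since \<open>(bg, tg)\<close> is jointly monic.\<close>

lemma (in category) action_hom:
  assumes pb: "is_pullback C p g bg tg" "p \<in> Arr C" "g \<in> Arr C"
    and af: "af \<in> Arr C" "bf \<in> Arr C" "Dom C bf = Cod C af" "bf \<cdot> af = qf1" "qf2 \<in> Arr C" "Dom C qf2 = Dom C af" "Cod C qf2 = Cod C af"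
    and ag: "ag \<in> Arr C" "Cod C ag = Dom C bg" "bg \<cdot> ag = qg1" "tg \<cdot> ag = tg \<cdot> qg2" "qg2 \<in> Arr C" "Dom C qg2 = Dom C ag" "Cod C qg2 = Dom C bg"
    and h: "h \<in> Arr C" "Dom C h = Cod C af" "Cod C h = Dom C bg" "bg \<cdot> h = bf" "tg \<cdot> h = k"
    and Th: "Th \<in> Arr C" "Dom C Th = Dom C af" "Cod C Th = Dom C ag" "qg1 \<cdot> Th = qf1" "qg2 \<cdot> Th = h \<cdot> qf2"
    and k: "k \<cdot> af = k \<cdot> qf2"
  shows "h \<cdot> af = ag \<cdot> Th"
proof (rule pullback_unique[OF pb])
  note b = pullbackD(1-5)[OF pb(1)]
  show "bg \<cdot> (h \<cdot> af) = bg \<cdot> (ag \<cdot> Th)"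
    using b af(1-3,5-7) h(1-3) ag(1,2,5-7) Th(1-3)
    by (simp add: reassoc[OF h(4)] reassoc[OF ag(3)] af(4) Th(4))
  have "tg \<cdot> (h \<cdot> af) = tg \<cdot> (h \<cdot> qf2)"
    using b af(1-3,5-7) h(1-3) by (simp add: reassoc[OF h(5)] k)
  also have "\<dots> = tg \<cdot> (ag \<cdot> Th)"
    using b ag(1,2,5-7) Th(1-3) by (simp add: reassoc[OF ag(4)] Th(5))
  finally show "tg \<cdot> (h \<cdot> af) = tg \<cdot> (ag \<cdot> Th)" .
qed (use pullbackD(1-5)[OF pb(1)] af ag h Th in simp_all)

section \<open>The comparison functor and the two criteria\<close>

context pullback_category
begin

lemmas [simp del] = pb_simps pb_map

text \<open>The structure map of the algebra that \<open>K\<close> assigns to \<open>g\<close>. In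
  elements, the pullback consists of pairs \<open>(u, y)\<close>, and \<open>u'\<close> acts by
  \<open>u' * (u, y) = (u', y)\<close>.\<close>

abbreviation str :: "'b \<Rightarrow> 'b" where "str g \<equiv> pb_map C p (p \<cdot> base g) (top g) g"

lemma K_simps [simp]:
  "FObj K g = (base g, (base (p \<cdot> base g), str g, base g))"
  "FArr K (f, h, g) = (FObj K f, (base f, pb_map C p f h g, base g), FObj K g)"
  by (simp_all add: em_comparison_def descent_counit_def Let_def)

lemma str:
  assumes "g \<in> Arr C" "Cod C g = Cod C p"
  shows "p \<cdot> base g \<in> Arr C" "Cod C (p \<cdot> base g) = Cod C p" "Dom C (p \<cdot> base g) = Dom C (base g)"
    "base (p \<cdot> base g) \<in> Arr C" "Cod C (base (p \<cdot> base g)) = Dom C p" "top (p \<cdot> base g) \<in> Arr C"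
    "Dom C (top (p \<cdot> base g)) = Dom C (base (p \<cdot> base g))" "Cod C (top (p \<cdot> base g)) = Dom C (base g)"
    "str g \<in> Arr C" "Dom C (str g) = Dom C (base (p \<cdot> base g))" "Cod C (str g) = Dom C (base g)"
    "base g \<cdot> str g = base (p \<cdot> base g)" "top g \<cdot> str g = top g \<cdot> top (p \<cdot> base g)"
proof -
  note bg = pb_simps[OF assms]
  show pg: "p \<cdot> base g \<in> Arr C" "Cod C (p \<cdot> base g) = Cod C p" and pg': "Dom C (p \<cdot> base g) = Dom C (base g)"
    using bg p by auto
  show "base (p \<cdot> base g) \<in> Arr C" "Cod C (base (p \<cdot> base g)) = Dom C p" "top (p \<cdot> base g) \<in> Arr C"
    "Dom C (top (p \<cdot> base g)) = Dom C (base (p \<cdot> base g))" "Cod C (top (p \<cdot> base g)) = Dom C (base g)"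
    by (fact pb_simps[OF pg, unfolded pg'])+
  note P = pb_map[OF pg assms bg(3), unfolded pg', OF bg(4,5) pb_commute[OF assms, symmetric]]
  show "str g \<in> Arr C" "Dom C (str g) = Dom C (base (p \<cdot> base g))" "Cod C (str g) = Dom C (base g)"
    "base g \<cdot> str g = base (p \<cdot> base g)" "top g \<cdot> str g = top g \<cdot> top (p \<cdot> base g)"
    by (fact P)+
qed

lemma str_datum:
  assumes "g \<in> Arr C" "Cod C g = Cod C p"
  shows "descent_datum C p (base g) (base (p \<cdot> base g)) (top (p \<cdot> base g)) (str g)"
  using str[OF assms]
  by (intro pullback_datum[OF category_axioms p assms(1) pb[OF assms] pb]) simp_all

lemma K_algebra:
  assumes "g \<in> Arr C" "Cod C g = Cod C p"
  shows "FObj K g \<in> algebras (slice C (Dom C p)) M"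
  using str_datum[OF assms] algebra_iff by simp

lemma descent_datumD:
  assumes "descent_datum C p r q1 q2 a"
  shows "r \<in> Arr C" "Cod C r = Dom C p" "is_pullback C p (p \<cdot> r) q1 q2" "a \<in> Arr C" "Dom C a = Dom C q1"
    "Cod C a = Dom C r" "r \<cdot> a = q1"
    "\<And>d. d \<in> Arr C \<Longrightarrow> Cod C d = Dom C q1 \<Longrightarrow> q1 \<cdot> d = r \<cdot> (q2 \<cdot> d) \<Longrightarrow> a \<cdot> d = q2 \<cdot> d"
    "\<And>m n n'. m \<in> Arr C \<Longrightarrow> n \<in> Arr C \<Longrightarrow> n' \<in> Arr C \<Longrightarrow> Dom C n = Dom C m \<Longrightarrow> Dom C n' = Dom C m
      \<Longrightarrow> Cod C m = Dom C q1 \<Longrightarrow> Cod C n = Dom C q1 \<Longrightarrow> Cod C n' = Dom C q1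
      \<Longrightarrow> q2 \<cdot> n = a \<cdot> m \<Longrightarrow> q1 \<cdot> n' = q1 \<cdot> n \<Longrightarrow> q2 \<cdot> n' = q2 \<cdot> m \<Longrightarrow> a \<cdot> n = a \<cdot> n'"
  using assms unfolding descent_datum_def Hom_def by blast+

lemma em_arr_iff:
  "((r, (x, a, y)), H, (r', (x', a', y'))) \<in> Arr (EM (slice C (Dom C p)) M) \<longleftrightarrow>
    (\<exists>h. H = (r, h, r') \<and> (r, (x, a, y)) \<in> algebras (slice C (Dom C p)) M
      \<and> (r', (x', a', y')) \<in> algebras (slice C (Dom C p)) M
      \<and> h \<in> Arr C \<and> Dom C h = Dom C r \<and> Cod C h = Dom C r' \<and> r' \<cdot> h = r
      \<and> h \<cdot> a = a' \<cdot> pb_map C p (p \<cdot> r) h (p \<cdot> r'))" (is "?L \<longleftrightarrow> ?R")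
proof
  assume L: ?L
  then have H: "H \<in> Hom (slice C (Dom C p)) r r'" by simp
  obtain h where "H = (r, h, r')" by (rule slice_HomE[OF H])
  then show ?R using L by auto
next
  assume R: ?R
  then obtain h where h: "H = (r, h, r')" "(r, (x, a, y)) \<in> algebras (slice C (Dom C p)) M"
    "(r', (x', a', y')) \<in> algebras (slice C (Dom C p)) M"
    "h \<in> Arr C" "Dom C h = Dom C r" "Cod C h = Dom C r'" "r' \<cdot> h = r"
    "h \<cdot> a = a' \<cdot> pb_map C p (p \<cdot> r) h (p \<cdot> r')" by blast
  have e: "y = r" "y' = r'" "x = base (p \<cdot> r)" "r \<in> Arr C" "r' \<in> Arr C" "Cod C r = Dom C p" "Cod C r' = Dom C p"
    using h(2,3) algebra_iff[of r] algebra_iff[of r'] descent_datumD(1,2) by blast+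
  show ?L
    unfolding h(1) EM_simps(6) fst_conv snd_conv slice_Hom descent_monad_simps slice_simps(5)
    using h(2-) e by blast
qed

lemma K_arr:
  assumes F: "(f, h, g) \<in> Arr (slice C (Cod C p))"
  shows "FArr K (f, h, g) \<in> Arr (EM (slice C (Dom C p)) M)"
proof -
  have f: "f \<in> Arr C" "Cod C f = Cod C p" and g: "g \<in> Arr C" "Cod C g = Cod C p"
    and h: "h \<in> Arr C" "Dom C h = Dom C f" "Cod C h = Dom C g" "g \<cdot> h = f" using F by auto
  note P = pb_map[OF f g h] and bf = pb_simps[OF f] and bg = pb_simps[OF g] and sf = str[OF f] and sg = str[OF g]
  have e: "(p \<cdot> base g) \<cdot> pb_map C p f h g = p \<cdot> base f" using P(1-4) bg p by simp
  note Q = pb_map[OF sf(1,2) sg(1,2) P(1), unfolded sf(3) sg(3), OF P(2,3) e]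
  \<comment> \<open>The arrow \<open>h \<cdot> top f\<close> ignores the first component of a pair,
    which is the only one that the action changes. This is the condition on \<open>k\<close> in
    \<open>action_hom\<close>.\<close>
  have k: "(h \<cdot> top f) \<cdot> str f = (h \<cdot> top f) \<cdot> top (p \<cdot> base f)"
    using h(1-3) bf sf(3-11) by (simp add: sf(13))
  have "pb_map C p f h g \<cdot> str f = str g \<cdot> pb_map C p (p \<cdot> base f) (pb_map C p f h g) (p \<cdot> base g)"
    by (rule action_hom[OF pb[OF g] p g(1) _ _ _ sf(12) _ _ _ _ _ sg(12,13) _ _ _ _ _ _ P(4,5) _ _ _ Q(4,5) k])
      (use bf bg sf(3-11) sg(3-11) P(1-3) Q(1-3) in simp_all)
  then show ?thesis
    using K_algebra[OF f] K_algebra[OF g] P(1-4) unfolding K_simps em_arr_iff by blast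
qed

lemma K_functor: "is_functor (slice C (Cod C p)) (EM (slice C (Dom C p)) M) K"
proof -
  note R = is_functorD[OF pullback_functor]
  show ?thesis
    unfolding is_functor_def
  proof (intro conjI ballI impI)
    fix F G assume FG: "F \<in> Arr (slice C (Cod C p))" "G \<in> Arr (slice C (Cod C p))" 
      "Dom (slice C (Cod C p)) G = Cod (slice C (Cod C p)) F"
    then show "FArr K (G \<cdot>\<^bsub>slice C (Cod C p)\<^esub> F) =
      FArr K G \<cdot>\<^bsub>EM (slice C (Dom C p)) M\<^esub> FArr K F"
      using R(8)[OF FG] by (cases F; cases G) simp
  next
    fix F assume F: "F \<in> Arr (slice C (Cod C p))"
    then show "FArr K F \<in> Hom (EM (slice C (Dom C p)) M) (FObj K (Dom (slice C (Cod C p)) F))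
      (FObj K (Cod (slice C (Cod C p)) F))"
    proof (cases F)
      case (fields f h g)
      show ?thesis using K_arr[of f h g] F unfolding fields Hom_def[of "EM _ _"] by (simp del: EM_simps(6))
    qed
  next
    fix x assume x: "x \<in> Obj (slice C (Cod C p))"
    then show "FArr K (Ide (slice C (Cod C p)) x) = Ide (EM (slice C (Dom C p)) M) (FObj K x)"
      using R(7)[OF x] by simp
  next
    fix x assume x: "x \<in> Obj (slice C (Cod C p))"
    then show "FObj K x \<in> Obj (EM (slice C (Dom C p)) M)"
      using K_algebra[of x] by (simp del: K_simps)
  qed (use category_slice category_EM[OF monad_functor] in auto)
qed

text \<open>The arrow \<open>k\<close> and the base leg together induce an arrow between the two
  pullbacks. It respects the actions because \<open>k\<close> identifies whatever \<open>t\<close>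
  identifies, in particular the action and the projection. Fullness of \<open>K\<close> descends it,
  and faithfulness gives uniqueness.\<close>

lemma ff_imp_descent_ff:
  assumes ff: "fully_faithful (slice C (Cod C p)) (EM (slice C (Dom C p)) M) K"
  shows "descent_ff C p"
  unfolding descent_ff_def
proof (intro ballI allI impI)
  fix f g q t k
  assume f: "f \<in> Arr C" and g: "g \<in> Arr C" and a: "Cod C f = Cod C p \<and> Cod C g = Cod C p \<and>
     is_pullback C p f q t \<and> k \<in> Hom C (Dom C q) (Dom C g)
     \<and> g \<cdot> k = f \<cdot> t
     \<and> (\<forall>u v. u \<in> Arr C \<and> v \<in> Arr C \<and> Dom C v = Dom C u \<and> Cod C u = Dom C q \<and> Cod C v = Dom C q
          \<and> t \<cdot> u = t \<cdot> v \<longrightarrow> k \<cdot> u = k \<cdot> v)"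
  then have f': "Cod C f = Cod C p" and g': "Cod C g = Cod C p" and qt: "is_pullback C p f q t"
    and k: "k \<in> Arr C" "Dom C k = Dom C q" "Cod C k = Dom C g" "g \<cdot> k = f \<cdot> t"
    and eq: "\<And>u v. u \<in> Arr C \<Longrightarrow> v \<in> Arr C \<Longrightarrow> Dom C v = Dom C u \<Longrightarrow> Cod C u = Dom C q \<Longrightarrow> Cod C v = Dom C q
      \<Longrightarrow> t \<cdot> u = t \<cdot> v \<Longrightarrow> k \<cdot> u = k \<cdot> v" unfolding Hom_def by blast+
  note qt_facts = pullbackD[OF qt]
  \<comment> \<open>The given square need not be the chosen one, so \<open>k\<close> is moved to the
    chosen vertex along \<open>j\<close>.\<close>
  obtain i j where ij: "i \<in> Arr C" "j \<in> Arr C" "Dom C i = Dom C q" "Cod C i = Dom C (base f)"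
    "Dom C j = Dom C (base f)" "Cod C j = Dom C q" "base f \<cdot> i = q" "top f \<cdot> i = t" "q \<cdot> j = base f" "t \<cdot> j = top f"
    "i \<cdot> j = Ide C (Dom C (base f))" "j \<cdot> i = Ide C (Dom C q)"
    using pullback_compare[OF qt pb[OF f f'] p f] by blast
  note bf = pb_simps[OF f f'] and bg = pb_simps[OF g g']
  have "p \<cdot> base f = g \<cdot> (k \<cdot> j)"
    using ij(1-6) k(1-3) qt_facts(1-5) f f' g by (simp add: reassoc[OF k(4)] ij(10) pb_commute[OF f f'])
  note H = pb_induced[OF g g', of "base f" "k \<cdot> j", OF _ _ _ _ _ this]
  let ?h = "pb_induced C p g (base f) (k \<cdot> j)"
  have h: "?h \<in> Arr C" "Dom C ?h = Dom C (base f)" "Cod C ?h = Dom C (base g)"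
    "base g \<cdot> ?h = base f" "top g \<cdot> ?h = k \<cdot> j" using H bf ij(1-6) k(1-3) by simp_all
  note sf = str[OF f f'] and sg = str[OF g g']
  have e: "(p \<cdot> base g) \<cdot> ?h = p \<cdot> base f" using h(1-4) bg p by simp
  note Q = pb_map[OF sf(1,2) sg(1,2) h(1), unfolded sf(3) sg(3), OF h(2,3) e]
  \<comment> \<open>The hypothesis on \<open>k\<close> is applied to the pair consisting of the
    action and the projection, which \<open>t\<close> identifies after \<open>j\<close>.\<close>
  have kj: "k \<cdot> (j \<cdot> str f) = k \<cdot> (j \<cdot> top (p \<cdot> base f))"
    by (rule eq) (use ij(1-6) qt_facts(1-5) sf(3-11) in \<open>simp_all add: reassoc[OF ij(10)] sf(13)\<close>)
  then have kj: "(k \<cdot> j) \<cdot> str f = (k \<cdot> j) \<cdot> top (p \<cdot> base f)"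
    using k(1-3) ij(1-6) sf(3-11) by simp
  have "?h \<cdot> str f = str g \<cdot> pb_map C p (p \<cdot> base f) ?h (p \<cdot> base g)"
    by (rule action_hom[OF pb[OF g g'] p g _ _ _ sf(12) _ _ _ _ _ sg(12,13) _ _ _ _ _ _ h(4,5) _ _ _ Q(4,5) kj])
      (use bf bg sf(3-11) sg(3-11) h(1-3) Q(1-3) in simp_all)
  then have HE: "(FObj K f, (base f, ?h, base g), FObj K g) \<in> Hom (EM (slice C (Dom C p)) M) (FObj K f) (FObj K g)"
    using K_algebra[OF f f'] K_algebra[OF g g'] h(1-4)
    unfolding K_simps Hom_def[of "EM _ _"] mem_Collect_eq em_arr_iff EM_simps(2,3) by blast
  then have "\<exists>!F. F \<in> Hom (slice C (Cod C p)) f g \<and> FArr K F = (FObj K f, (base f, ?h, base g), FObj K g)"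
    using ff f f' g g' unfolding fully_faithful_def by (simp del: K_simps)
  then obtain F where F: "F \<in> Hom (slice C (Cod C p)) f g" "FArr K F = (FObj K f, (base f, ?h, base g), FObj K g)"
    and uniq: "\<And>F'. F' \<in> Hom (slice C (Cod C p)) f g \<Longrightarrow> FArr K F' = (FObj K f, (base f, ?h, base g), FObj K g) \<Longrightarrow> F' = F"
    by blast
  obtain x where x: "F = (f, x, g)" "x \<in> Arr C" "Dom C x = Dom C f" "Cod C x = Dom C g" "g \<cdot> x = f"
    using slice_HomE[OF F(1)] by metis
  have px: "pb_map C p f x g = ?h" using F(2) x by simp
  have "x \<cdot> top f = k \<cdot> j" using pb_map(5)[OF f f' g g' x(2-5)] px h by simp
  then have xt: "x \<cdot> t = k"
  proof -
    assume xk: "x \<cdot> top f = k \<cdot> j"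
    have "x \<cdot> t = (x \<cdot> top f) \<cdot> i" using x(2-4) ij(1-6,8) bf by simp
    also have "\<dots> = k" unfolding xk using k ij by simp
    finally show ?thesis .
  qed
  show "\<exists>!h. h \<in> Hom C (Dom C f) (Dom C g) \<and> g \<cdot> h = f \<and> h \<cdot> t = k"
  proof (intro ex1I[of _ x] conjI)
    show "x \<in> Hom C (Dom C f) (Dom C g)" "g \<cdot> x = f" "x \<cdot> t = k" using x xt by (auto simp: Hom_def)
    fix y assume y: "y \<in> Hom C (Dom C f) (Dom C g) \<and> g \<cdot> y = f \<and> y \<cdot> t = k"
    then have y': "y \<in> Arr C" "Dom C y = Dom C f" "Cod C y = Dom C g" "g \<cdot> y = f" "y \<cdot> t = k" unfolding Hom_def by blast+
    have yt: "y \<cdot> top f = k \<cdot> j" using y' qt_facts(1-5) ij(1-6) by (simp add: ij(10)[symmetric] reassoc[OF y'(5)])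
    have "pb_map C p f y g = ?h"
      unfolding pb_map_def yt ..
    then have "(f, y, g) = F" using uniq[of "(f, y, g)"] y' f f' g g' by simp
    then show "y = x" using x by simp
  qed
qed

text \<open>A homomorphism \<open>h\<close> between pullbacks yields
  \<open>k = top g \<cdot> h\<close>. Two elements with the same image under \<open>top f\<close>
  differ by the action, with which \<open>h\<close> commutes and which \<open>top g\<close> does not
  see; so \<open>k\<close> takes the same value on both.\<close>

lemma descent_ff_imp_ff:
  assumes ff: "descent_ff C p"
  shows "fully_faithful (slice C (Cod C p)) (EM (slice C (Dom C p)) M) K"
  unfolding fully_faithful_def
proof (intro ballI)
  fix f g H
  assume "f \<in> Obj (slice C (Cod C p))" "g \<in> Obj (slice C (Cod C p))"
    and H: "H \<in> Hom (EM (slice C (Dom C p)) M) (FObj K f) (FObj K g)"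
  then have f: "f \<in> Arr C" and f': "Cod C f = Cod C p" and g: "g \<in> Arr C" and g': "Cod C g = Cod C p" by auto
  obtain H' where H': "H = (FObj K f, H', FObj K g)" "(FObj K f, H', FObj K g) \<in> Arr (EM (slice C (Dom C p)) M)"
    by (rule EM_HomE[OF H])
  obtain h where h: "H' = (base f, h, base g)" "h \<in> Arr C" "Dom C h = Dom C (base f)" "Cod C h = Dom C (base g)"
    "base g \<cdot> h = base f" "h \<cdot> str f = str g \<cdot> pb_map C p (p \<cdot> base f) h (p \<cdot> base g)"
    using H'(2) unfolding K_simps em_arr_iff by blast
  note bf = pb_simps[OF f f'] and bg = pb_simps[OF g g']
  let ?k = "top g \<cdot> h"
  have k: "?k \<in> Arr C" "Dom C ?k = Dom C (base f)" "Cod C ?k = Dom C g" using h bg by auto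
  have gk: "g \<cdot> ?k = f \<cdot> top f"
    using h(2-5) g g' bg bf p
    by (simp add: reassoc[OF pb_commute[OF g g', symmetric]] pb_commute[OF f f', symmetric])
  note sf = str[OF f f'] and sg = str[OF g g']
  have e: "(p \<cdot> base g) \<cdot> h = p \<cdot> base f" using h(2-5) bg p by simp
  note Q = pb_map[OF sf(1,2) sg(1,2) h(2), unfolded sf(3) sg(3), OF h(3,4) e]
  have eq: "?k \<cdot> u = ?k \<cdot> v" if uv: "u \<in> Arr C" "v \<in> Arr C" "Dom C v = Dom C u" "Cod C u = Dom C (base f)"
    "Cod C v = Dom C (base f)" "top f \<cdot> u = top f \<cdot> v" for u v
  proof -
    have "p \<cdot> (base f \<cdot> u) = (p \<cdot> base f) \<cdot> v"
      using uv(1-5) bf f f' p by (simp add: reassoc[OF pb_commute[OF f f']] uv(6))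
    note J = pb_induced[OF sf(1,2), of "base f \<cdot> u" v, OF _ _ _ _ _ this]
    \<comment> \<open>In elements, \<open>u\<close> and \<open>v\<close> are pairs with the same
      second component, so the first component of \<open>u\<close> acting on \<open>v\<close> gives
      \<open>u\<close>. The arrow \<open>?j\<close> is this acting pair.\<close>
    let ?j = "pb_induced C p (p \<cdot> base f) (base f \<cdot> u) v"
    let ?Th = "pb_map C p (p \<cdot> base f) h (p \<cdot> base g)"
    have j: "?j \<in> Arr C" "Dom C ?j = Dom C u" "Cod C ?j = Dom C (base (p \<cdot> base f))"
      "base (p \<cdot> base f) \<cdot> ?j = base f \<cdot> u" "top (p \<cdot> base f) \<cdot> ?j = v"
      using J uv bf sf(3) by auto
    have u: "str f \<cdot> ?j = u"
    proof (rule pb_joint[OF _ _ f f'])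
      show "base f \<cdot> (str f \<cdot> ?j) = base f \<cdot> u"
        using j(1-3) bf sf(4-11) by (simp add: reassoc[OF sf(12)] j(4))
      show "top f \<cdot> (str f \<cdot> ?j) = top f \<cdot> u"
        using j(1-3) bf sf(4-11) uv(1-5) by (simp add: reassoc[OF sf(13)] j(5) uv(6))
    qed (use j(1-3) uv sf in simp_all)
    have "?k \<cdot> u = top g \<cdot> (h \<cdot> (str f \<cdot> ?j))" unfolding u using uv(1-5) h(2-4) bg by simp
    also have "\<dots> = top g \<cdot> ((str g \<cdot> ?Th) \<cdot> ?j)"
      unfolding h(6)[symmetric] using h(2-4) j(1-3) sf(4-11) by simp
    also have "\<dots> = top g \<cdot> (top (p \<cdot> base g) \<cdot> (?Th \<cdot> ?j))"
      using j(1-3) bg sg(4-11) Q(1-3) by (simp add: reassoc[OF sg(13)])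
    also have "\<dots> = ?k \<cdot> v"
      using uv(1-5) j(1-3) bg sg(4-11) sf(4-11) Q(1-3) h(2-4) by (simp add: reassoc[OF Q(5)] j(5))
    finally show ?thesis .
  qed
  have "\<exists>!x. x \<in> Hom C (Dom C f) (Dom C g) \<and> g \<cdot> x = f \<and> x \<cdot> top f = ?k"
    using ff[unfolded descent_ff_def, rule_format, OF f g, of "base f" "top f" ?k] f' g' pb[OF f f'] k gk eq
    unfolding Hom_def by blast
  then obtain x where x: "x \<in> Arr C" "Dom C x = Dom C f" "Cod C x = Dom C g" "g \<cdot> x = f" "x \<cdot> top f = ?k"
    and uniq: "\<And>y. y \<in> Arr C \<Longrightarrow> Dom C y = Dom C f \<Longrightarrow> Cod C y = Dom C g \<Longrightarrow> g \<cdot> y = f \<Longrightarrow> y \<cdot> top f = ?k \<Longrightarrow> y = x"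
    unfolding Hom_def by blast
  have px: "pb_map C p f x g = h"
    by (rule pb_joint[OF _ _ g g']) (use pb_map[OF f f' g g' x(1-4)] x(5) h(2-5) in simp_all)
  show "\<exists>!F. F \<in> Hom (slice C (Cod C p)) f g \<and> FArr K F = H"
  proof (intro ex1I[of _ "(f, x, g)"] conjI)
    show "(f, x, g) \<in> Hom (slice C (Cod C p)) f g" using x f f' g g' by simp
    show "FArr K (f, x, g) = H" using px h H' by simp
    fix F assume F: "F \<in> Hom (slice C (Cod C p)) f g \<and> FArr K F = H"
    then obtain y where y: "F = (f, y, g)" "y \<in> Arr C" "Dom C y = Dom C f" "Cod C y = Dom C g" "g \<cdot> y = f"
      using slice_HomE[of F] by metis
    have "pb_map C p f y g = h" using F y h H' by simp
    then have "y \<cdot> top f = ?k" using pb_map(5)[OF f f' g g' y(2-5)] by simp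
    then show "F = (f, x, g)" using uniq y by simp
  qed
qed

text \<open>The datum is moved to the chosen pullback, where it is an algebra isomorphic to some
  \<open>K g\<close>. The underlying isomorphism turns the chosen square of \<open>g\<close> into
  one with leg \<open>r\<close>, and the homomorphism equation becomes the equation for
  \<open>t\<close>.\<close>

lemma es_imp_descent_es:
  assumes es: "essentially_surjective (slice C (Cod C p)) (EM (slice C (Dom C p)) M) K"
  shows "descent_es C p"
  unfolding descent_es_def
proof (intro allI impI)
  fix r q1' q2' a'
  assume datum': "descent_datum C p r q1' q2' a'"
  note D' = descent_datumD[OF datum']
  have pr: "p \<cdot> r \<in> Arr C" "Cod C (p \<cdot> r) = Cod C p" "Dom C (p \<cdot> r) = Dom C r" using D' p by auto
  let ?q1 = "base (p \<cdot> r)" and ?q2 = "top (p \<cdot> r)"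
  note q = pb_simps[OF pr(1,2)] and q' = pullbackD[OF D'(3)]
  obtain i j where ij: "i \<in> Arr C" "j \<in> Arr C" "Dom C i = Dom C q1'" "Cod C i = Dom C ?q1"
    "Dom C j = Dom C ?q1" "Cod C j = Dom C q1'" "?q1 \<cdot> i = q1'" "?q2 \<cdot> i = q2'" "q1' \<cdot> j = ?q1" "q2' \<cdot> j = ?q2"
    "i \<cdot> j = Ide C (Dom C ?q1)" "j \<cdot> i = Ide C (Dom C q1')"
    using pullback_compare[OF D'(3) pb[OF pr(1,2)] p pr(1)] by blast
  \<comment> \<open>The action of the datum, transported to the chosen pullback of
    \<open>p \<cdot> r\<close>.\<close>
  let ?a = "a' \<cdot> j"
  have a: "?a \<in> Arr C" "Dom C ?a = Dom C ?q1" "Cod C ?a = Dom C r" "r \<cdot> ?a = ?q1"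
    using D'(1-6) ij(1-6,9) by (simp_all add: reassoc[OF D'(7)])
  have datum: "descent_datum C p r ?q1 ?q2 ?a"
    unfolding descent_datum_def
  proof (intro conjI allI impI)
    show "is_pullback C p (p \<cdot> r) ?q1 ?q2" by (rule pb[OF pr(1,2)])
    fix d assume d: "d \<in> Arr C \<and> Cod C d = Dom C ?q1 \<and> ?q1 \<cdot> d = r \<cdot> (?q2 \<cdot> d)"
    then show "?a \<cdot> d = ?q2 \<cdot> d"
      using D'(8)[of "j \<cdot> d"] d ij(1-6) D'(1-6) q q'(1-5) by (simp add: reassoc[OF ij(9)] reassoc[OF ij(10)])
  next
    fix m n n'
    assume d: "m \<in> Arr C \<and> n \<in> Arr C \<and> n' \<in> Arr C \<and> Dom C n = Dom C m \<and> Dom C n' = Dom C m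
          \<and> Cod C m = Dom C ?q1 \<and> Cod C n = Dom C ?q1 \<and> Cod C n' = Dom C ?q1
          \<and> ?q2 \<cdot> n = ?a \<cdot> m \<and> ?q1 \<cdot> n' = ?q1 \<cdot> n \<and> ?q2 \<cdot> n' = ?q2 \<cdot> m"
    then show "?a \<cdot> n = ?a \<cdot> n'"
      using D'(9)[of "j \<cdot> m" "j \<cdot> n" "j \<cdot> n'"] d ij(1-6) D'(1-6) q q'(1-5)
      by (simp add: reassoc[OF ij(9)] reassoc[OF ij(10)])
  qed (use a D' in \<open>auto simp: Hom_def\<close>)
  then have alg: "(r, (?q1, ?a, r)) \<in> algebras (slice C (Dom C p)) M"
    using algebra_iff by blast
  then obtain g I where g: "g \<in> Arr C" "Cod C g = Cod C p"
    and I: "I \<in> Hom (EM (slice C (Dom C p)) M) (FObj K g) (r, (?q1, ?a, r))"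
    and iso: "iso_arrow (EM (slice C (Dom C p)) M) I"
    using es unfolding essentially_surjective_def by fastforce
  obtain J where J: "J \<in> Hom (EM (slice C (Dom C p)) M) (r, (?q1, ?a, r)) (FObj K g)"
    and JI: "J \<cdot>\<^bsub>EM (slice C (Dom C p)) M\<^esub> I = Ide (EM (slice C (Dom C p)) M) (FObj K g)"
      "I \<cdot>\<^bsub>EM (slice C (Dom C p)) M\<^esub> J = Ide (EM (slice C (Dom C p)) M) (r, (?q1, ?a, r))"
    by (rule iso_arrow_HomE[OF iso I])
  obtain I' where I': "I = (FObj K g, I', (r, (?q1, ?a, r)))" "(FObj K g, I', (r, (?q1, ?a, r))) \<in> Arr (EM (slice C (Dom C p)) M)"
    by (rule EM_HomE[OF I])
  obtain J' where J': "J = ((r, (?q1, ?a, r)), J', FObj K g)" "((r, (?q1, ?a, r)), J', FObj K g) \<in> Arr (EM (slice C (Dom C p)) M)"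
    by (rule EM_HomE[OF J])
  obtain l where l: "I' = (base g, l, r)" "l \<in> Arr C" "Dom C l = Dom C (base g)" "Cod C l = Dom C r"
    "r \<cdot> l = base g" "l \<cdot> str g = ?a \<cdot> pb_map C p (p \<cdot> base g) l (p \<cdot> r)"
    using I'(2) unfolding K_simps em_arr_iff by blast
  obtain m where m: "J' = (r, m, base g)" "m \<in> Arr C" "Dom C m = Dom C r" "Cod C m = Dom C (base g)"
    "base g \<cdot> m = r"
    using J'(2) unfolding K_simps em_arr_iff by blast
  have lm: "m \<cdot> l = Ide C (Dom C (base g))" "l \<cdot> m = Ide C (Dom C r)"
    using JI unfolding I' J' l m by auto
  note bg = pb_simps[OF g]
  \<comment> \<open>Precomposition with \<open>m\<close>, the inverse of \<open>l\<close>, replaces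
    the leg \<open>base g\<close> by \<open>r\<close> and the leg \<open>top g\<close> by
    \<open>?t\<close>.\<close>
  let ?t = "top g \<cdot> m"
  note sg = str[OF g]
  have rt: "is_pullback C p g r ?t"
    using pullback_iso[OF pb[OF g] p g(1), of m l] m lm l by simp
  let ?L = "pb_map C p (p \<cdot> base g) l (p \<cdot> r)" and ?N = "pb_map C p (p \<cdot> r) m (p \<cdot> base g)"
  have e: "(p \<cdot> r) \<cdot> l = p \<cdot> base g" using l(2-5) D'(1,2) p by simp
  have e': "(p \<cdot> base g) \<cdot> m = p \<cdot> r" using m(2-5) bg p by simp
  note Q = pb_map[OF sg(1,2) pr(1,2) l(2), unfolded pr(3) sg(3), OF l(3,4) e]
    and Q' = pb_map[OF pr(1,2) sg(1,2) m(2), unfolded pr(3) sg(3), OF m(3,4) e']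
  \<comment> \<open>The arrow \<open>?L\<close> is the image of the isomorphism \<open>l\<close>
    under the monad. Its right inverse \<open>?N\<close> allows \<open>?L\<close> to be cancelled
    from the equation for \<open>?t\<close> below.\<close>
  have L: "?L \<cdot> ?N = Ide C (Dom C ?q1)"
  proof (rule pb_joint[OF _ _ pr(1,2)])
    show "?q1 \<cdot> (?L \<cdot> ?N) = ?q1 \<cdot> Ide C (Dom C ?q1)"
      using q Q(1-3) Q'(1-3) by (simp add: reassoc[OF Q(4)] Q'(4))
    show "?q2 \<cdot> (?L \<cdot> ?N) = ?q2 \<cdot> Ide C (Dom C ?q1)"
      using q Q(1-3) Q'(1-3) l(2-4) m(2-4) sg(3-11) pr(3)
      by (simp add: reassoc[OF Q(5)] Q'(5) reassoc[OF lm(2)])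
  qed (use q Q Q' in simp_all)
  have tl: "?t \<cdot> l = top g" using m(2-4) bg l(2-4) lm by simp
  have ta: "?t \<cdot> ?a = ?t \<cdot> ?q2"
  proof -
    have t: "?t \<in> Arr C" "Dom C ?t = Dom C r" using m(2-4) bg by auto
    have "?t \<cdot> (?a \<cdot> ?L) = (?t \<cdot> l) \<cdot> str g"
      unfolding l(6)[symmetric] using l(2-4) t sg(4-11) by simp
    also have "\<dots> = (?t \<cdot> l) \<cdot> top (p \<cdot> base g)" unfolding tl by (fact sg(13))
    also have "\<dots> = ?t \<cdot> (l \<cdot> top (p \<cdot> base g))" using l(2-4) t sg(4-11) by simp
    also have "\<dots> = ?t \<cdot> (?q2 \<cdot> ?L)" unfolding Q(5) ..
    finally have e: "(?t \<cdot> ?a) \<cdot> ?L = (?t \<cdot> ?q2) \<cdot> ?L"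
      using a(1-3) q Q(1-3) t pr(3) by (simp del: comp_assoc add: comp_assoc[of _ _ ?t])
    have "(?t \<cdot> ?a) = ((?t \<cdot> ?a) \<cdot> ?L) \<cdot> ?N"
      using a(1-3) Q(1-3) Q'(1-3) t D'(4-6) ij(1-6) by (simp add: L)
    also have "\<dots> = ((?t \<cdot> ?q2) \<cdot> ?L) \<cdot> ?N" unfolding e ..
    also have "\<dots> = ?t \<cdot> ?q2"
      using q pr(3) Q(1-3) Q'(1-3) t by (simp add: L)
    finally show ?thesis .
  qed
  have "?t \<cdot> a' = ?t \<cdot> q2'"
  proof -
    have t: "?t \<in> Arr C" "Dom C ?t = Dom C r" using m bg by auto
    have "?t \<cdot> a' = (?t \<cdot> ?a) \<cdot> i" using ij t D'(1-6) by simp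
    also have "\<dots> = ?t \<cdot> q2'" unfolding ta using ij(1-8) t q pr by simp
    finally show ?thesis .
  qed
  then show "\<exists>f t. f \<in> Arr C \<and> Cod C f = Cod C p \<and> is_pullback C p f r t \<and> t \<cdot> a' = t \<cdot> q2'"
    using g rt by blast
qed

text \<open>The comparison \<open>i\<close> between the chosen pullback of \<open>f\<close> and the
  given one is the required isomorphism of algebras. It respects the actions because neither action
  is visible to the leg into the domain of \<open>f\<close>.\<close>

lemma descent_es_imp_es:
  assumes es: "descent_es C p"
  shows "essentially_surjective (slice C (Cod C p)) (EM (slice C (Dom C p)) M) K"
  unfolding essentially_surjective_def
proof
  fix X assume X: "X \<in> Obj (EM (slice C (Dom C p)) M)"
  obtain r \<alpha> where r: "X = (r, \<alpha>)" by (cases X)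
  let ?q1 = "base (p \<cdot> r)" and ?q2 = "top (p \<cdot> r)"
  obtain a where a: "\<alpha> = (?q1, a, r)" and datum: "descent_datum C p r ?q1 ?q2 a"
    using X algebra_iff unfolding r by auto
  note D = descent_datumD[OF datum]
  obtain f t where f: "f \<in> Arr C" "Cod C f = Cod C p" and rt: "is_pullback C p f r t" and ta: "t \<cdot> a = t \<cdot> ?q2"
    using es datum unfolding descent_es_def by blast
  obtain i j where ij: "i \<in> Arr C" "j \<in> Arr C" "Dom C i = Dom C (base f)" "Cod C i = Dom C r"
    "Dom C j = Dom C r" "Cod C j = Dom C (base f)" "r \<cdot> i = base f" "t \<cdot> i = top f" 
    "i \<cdot> j = Ide C (Dom C r)" "j \<cdot> i = Ide C (Dom C (base f))"
    using pullback_compare[OF pb[OF f] rt p f(1)] by blast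
  note bf = pb_simps[OF f] and rt' = pullbackD[OF rt]
  have pr: "p \<cdot> r \<in> Arr C" "Cod C (p \<cdot> r) = Cod C p" "Dom C (p \<cdot> r) = Dom C r" using D p by auto
  note sf = str[OF f]
  have e: "(p \<cdot> r) \<cdot> i = p \<cdot> base f" using ij(1-7) D(1,2) p by simp
  note Q = pb_map[OF sf(1,2) pr(1,2) ij(1), unfolded pr(3) sf(3), OF ij(3,4) e]
  have "i \<cdot> str f = a \<cdot> pb_map C p (p \<cdot> base f) i (p \<cdot> r)"
    by (rule action_hom[OF rt p f(1) _ _ _ sf(12) _ _ _ _ _ D(7) ta _ _ _ _ _ _ ij(7,8) _ _ _ Q(4,5) sf(13)])
      (use bf rt' pr(3) pb_simps[OF pr(1,2)] sf(3-11) ij(1-6) D(1-6) Q(1-3) in simp_all)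
  then have E: "(FObj K f, (base f, i, r), X) \<in> Arr (EM (slice C (Dom C p)) M)"
    using K_algebra[OF f] X ij(1-7) unfolding r a K_simps em_arr_iff EM_simps(1) by blast
  have "iso_arrow C i" by (rule iso_arrowI[of _ "Dom C (base f)" "Dom C r" j]) (use ij in \<open>auto simp: Hom_def\<close>)
  then have "iso_arrow (slice C (Dom C p)) (base f, i, r)"
    by (intro slice_iso[OF category_axioms]) (use ij bf D in auto)
  then have "iso_arrow (EM (slice C (Dom C p)) M) (FObj K f, (base f, i, r), X)"
    by (rule EM_iso[OF monad_functor E])
  then show "\<exists>x\<in>Obj (slice C (Cod C p)). \<exists>I\<in>Hom (EM (slice C (Dom C p)) M) (FObj K x) X.
      iso_arrow (EM (slice C (Dom C p)) M) I"
    using f E by (intro bexI[of _ f] bexI[of _ "(FObj K f, (base f, i, r), X)"]) (simp_all only: Hom_def, auto)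
qed

end

text \<open>This removes chosen pullbacks and algebras from the problem; the rest of the proof uses
  effective descent in this form.\<close>

theorem effective_descent_iff:
  "effective_descent C p \<longleftrightarrow>
    category C \<and> has_pullbacks C \<and> p \<in> Arr C \<and> descent_ff C p \<and> descent_es C p"
proof (cases "category C \<and> has_pullbacks C \<and> p \<in> Arr C")
  case True
  then interpret pullback_category C p
    by (simp add: pullback_category_def pullback_category_axioms_def)
  show ?thesis
    unfolding effective_descent_def
    using True equivalence_imp_ff_es ff_imp_descent_ff es_imp_descent_es
      ff_es_imp_equivalence[OF K_functor descent_ff_imp_ff descent_es_imp_es] by blast
qed (auto simp: effective_descent_def)

section \<open>Transfer of descent along a fully faithful functor\<close>

text \<open>This serves to replace the domain of the descended arrow \<open>f\<close> by an
  isomorphic object in the image of \<open>U\<close>.\<close>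

lemma (in category) pullback_iso_right:
  assumes pb: "is_pullback C p f r t" and p: "p \<in> Arr C" and f: "f \<in> Arr C" "Cod C f = Cod C p"
    and i: "i \<in> Arr C" "j \<in> Arr C" "Dom C j = Cod C i" "Cod C j = Dom C i" "Cod C i = Dom C f"
      "i \<cdot> j = Ide C (Cod C i)" "j \<cdot> i = Ide C (Dom C i)"
  shows "is_pullback C p (f \<cdot> i) r (j \<cdot> t)"
proof (rule pullbackI)
  note b = pullbackD[OF pb]
  have c: "i \<cdot> (j \<cdot> t) = t" using b(1-5) i(1-5) by (simp add: reassoc[OF i(6)])
  show "p \<cdot> r = (f \<cdot> i) \<cdot> (j \<cdot> t)" using b i(1-5) f by (simp add: c)
  fix u v
  assume u: "u \<in> Arr C" "v \<in> Arr C" "Dom C v = Dom C u" "Cod C u = Dom C p" "Cod C v = Dom C (f \<cdot> i)"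
    "p \<cdot> u = (f \<cdot> i) \<cdot> v"
  obtain h where h: "h \<in> Arr C" "Dom C h = Dom C u" "Cod C h = Dom C r" "r \<cdot> h = u" "t \<cdot> h = i \<cdot> v"
    using pullback_ex[OF pb u(1), of "i \<cdot> v" "Dom C u"] u i f by auto
  have "(j \<cdot> t) \<cdot> h = v"
    using h(1-3) b(1-5) i(1-5) u(1-5) f by (simp add: h(5) reassoc[OF i(7)])
  then show "\<exists>h. h \<in> Arr C \<and> Dom C h = Dom C u \<and> Cod C h = Dom C r \<and> r \<cdot> h = u \<and> (j \<cdot> t) \<cdot> h = v"
    using h by blast
next
  note b = pullbackD[OF pb]
  have c: "i \<cdot> (j \<cdot> t) = t" using b(1-5) i(1-5) by (simp add: reassoc[OF i(6)])
  fix h h'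
  assume h: "h \<in> Arr C" "h' \<in> Arr C" "Dom C h' = Dom C h" "Cod C h = Dom C r"
      "Cod C h' = Dom C r" "r \<cdot> h = r \<cdot> h'" "(j \<cdot> t) \<cdot> h = (j \<cdot> t) \<cdot> h'"
  have "i \<cdot> ((j \<cdot> t) \<cdot> h) = i \<cdot> ((j \<cdot> t) \<cdot> h')" unfolding h(7) ..
  then have "t \<cdot> h = t \<cdot> h'"
    using h(1-5) b(1-5) i(1-5) by (simp add: reassoc[OF i(6)])
  then show "h = h'"
    by (intro pullback_unique[OF pb p f(1), of h h']) (use h in simp_all)
qed (use pullbackD(1-5)[OF pb] i f in simp_all)

text \<open>A mediating arrow found in \<open>D\<close> runs between objects in the image of
  \<open>U\<close> and is therefore the image of an arrow of \<open>C\<close>; faithfulness reflects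
  the equations.\<close>

lemma reflect_pullback:
  assumes U: "is_functor C D U" and ff: "fully_faithful C D U"
    and c: "p \<in> Arr C" "f \<in> Arr C" "Cod C f = Cod C p" "r \<in> Arr C" "Cod C r = Dom C p" "t \<in> Arr C"
      "Dom C t = Dom C r" "Cod C t = Dom C f"
    and pb: "is_pullback D (FArr U p) (FArr U f) (FArr U r) (FArr U t)"
  shows "is_pullback C p f r t"
proof -
  note U' = is_functorD[OF U]
  note faithful = fully_faithful_faithful[OF U ff] and full = fully_faithful_full[OF ff]
  interpret C: category C by (rule U')
  interpret D: category D by (rule U')
  note b = D.pullbackD[OF pb]
  note Up = U'(4-6)[OF c(1)] and Uf = U'(4-6)[OF c(2)] and Ur = U'(4-6)[OF c(4)] and Ut = U'(4-6)[OF c(6)]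
  show ?thesis
  proof (rule C.pullbackI)
    show "p \<cdot>\<^bsub>C\<^esub> r = f \<cdot>\<^bsub>C\<^esub> t"
      by (rule faithful) (use c b U'(8)[of r p] U'(8)[of t f] in simp_all)
    fix u v
    assume u: "u \<in> Arr C" "v \<in> Arr C" "Dom C v = Dom C u" "Cod C u = Dom C p" "Cod C v = Dom C f"
      "p \<cdot>\<^bsub>C\<^esub> u = f \<cdot>\<^bsub>C\<^esub> v"
    note Uu = U'(4-6)[OF u(1)] and Uv = U'(4-6)[OF u(2)]
    have "FArr U p \<cdot>\<^bsub>D\<^esub> FArr U u = FArr U f \<cdot>\<^bsub>D\<^esub> FArr U v"
      using U'(8)[of u p] U'(8)[of v f] u c by simp
    then obtain h where h: "h \<in> Arr D" "Dom D h = FObj U (Dom C u)" "Cod D h = FObj U (Dom C r)"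
      "FArr U r \<cdot>\<^bsub>D\<^esub> h = FArr U u" "FArr U t \<cdot>\<^bsub>D\<^esub> h = FArr U v"
      using D.pullback_ex[OF pb Uu(1) Uv(1), of "FObj U (Dom C u)"] u Uu Uv Up Uf Ur by auto
    obtain k where k: "k \<in> Arr C" "Dom C k = Dom C u" "Cod C k = Dom C r" "FArr U k = h"
      using full[OF _ _ h(1-3)] u(1) c(4) by auto
    have "r \<cdot>\<^bsub>C\<^esub> k = u" "t \<cdot>\<^bsub>C\<^esub> k = v"
      by (rule faithful; use c u k h U'(8)[of k r] U'(8)[of k t] in simp)+
    then show "\<exists>h. h \<in> Arr C \<and> Dom C h = Dom C u \<and> Cod C h = Dom C r \<and> r \<cdot>\<^bsub>C\<^esub> h = u \<and> t \<cdot>\<^bsub>C\<^esub> h = v"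
      using k by blast
  next
    fix h h'
    assume h: "h \<in> Arr C" "h' \<in> Arr C" "Dom C h' = Dom C h" "Cod C h = Dom C r"
      "Cod C h' = Dom C r" "r \<cdot>\<^bsub>C\<^esub> h = r \<cdot>\<^bsub>C\<^esub> h'" "t \<cdot>\<^bsub>C\<^esub> h = t \<cdot>\<^bsub>C\<^esub> h'"
    have "FArr U r \<cdot>\<^bsub>D\<^esub> FArr U h = FArr U r \<cdot>\<^bsub>D\<^esub> FArr U h'"
      using U'(8)[of h r] U'(8)[of h' r] h c by simp
    moreover have "FArr U t \<cdot>\<^bsub>D\<^esub> FArr U h = FArr U t \<cdot>\<^bsub>D\<^esub> FArr U h'"
      using U'(8)[of h t] U'(8)[of h' t] h c by simp
    ultimately have "FArr U h = FArr U h'"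
      by (intro D.pullback_unique[OF pb Up(1) Uf(1), of "FArr U h" "FArr U h'"])
        (use h U'(4-6)[OF h(1)] U'(4-6)[OF h(2)] Ur in simp_all)
    then show "h = h'" by (intro faithful[of h h']) (use h in simp_all)
  qed (use c in simp_all)
qed

locale descent_transfer =
  fixes C :: "('o, 'a) cat" and D :: "('p, 'b) cat" and U p
  assumes U: "is_functor C D U" and ff: "fully_faithful C D U" and p: "p \<in> Arr C" and pbs: "has_pullbacks C"
    and pres: "\<And>f g q r. f \<in> Arr C \<Longrightarrow> g \<in> Arr C \<Longrightarrow> Cod C f = Cod C g \<Longrightarrow> is_pullback C f g q r \<Longrightarrow>
      is_pullback D (FArr U f) (FArr U g) (FArr U q) (FArr U r)"
begin

lemmas U' = is_functorD[OF U]
lemmas faithful = fully_faithful_faithful[OF U ff]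
lemmas full = fully_faithful_full[OF ff]
sublocale C: category C by (rule U')
sublocale D: category D by (rule U')

text \<open>Test objects of \<open>D\<close> need not come from \<open>C\<close>. So the hypothesis
  on \<open>k\<close> is concentrated in one equation on the kernel pair \<open>(u0, v0)\<close> of
  \<open>t\<close>; its square survives \<open>U\<close>, and every pair \<open>u\<close>,
  \<open>v\<close> in \<open>D\<close> factors through it.\<close>

lemma transfer_descent_ff:
  assumes Dff: "descent_ff D (FArr U p)"
  shows "descent_ff C p"
  unfolding descent_ff_def
proof (intro ballI allI impI)
  fix f g q t k
  assume f: "f \<in> Arr C" and g: "g \<in> Arr C" and a: "Cod C f = Cod C p \<and> Cod C g = Cod C p \<and>
     is_pullback C p f q t \<and> k \<in> Hom C (Dom C q) (Dom C g)
     \<and> g \<cdot>\<^bsub>C\<^esub> k = f \<cdot>\<^bsub>C\<^esub> t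
     \<and> (\<forall>u v. u \<in> Arr C \<and> v \<in> Arr C \<and> Dom C v = Dom C u \<and> Cod C u = Dom C q \<and> Cod C v = Dom C q
          \<and> t \<cdot>\<^bsub>C\<^esub> u = t \<cdot>\<^bsub>C\<^esub> v \<longrightarrow> k \<cdot>\<^bsub>C\<^esub> u = k \<cdot>\<^bsub>C\<^esub> v)"
  then have f': "Cod C f = Cod C p" and g': "Cod C g = Cod C p" and qt: "is_pullback C p f q t"
    and k: "k \<in> Arr C" "Dom C k = Dom C q" "Cod C k = Dom C g" "g \<cdot>\<^bsub>C\<^esub> k = f \<cdot>\<^bsub>C\<^esub> t"
    and eq: "\<And>u v. u \<in> Arr C \<Longrightarrow> v \<in> Arr C \<Longrightarrow> Dom C v = Dom C u \<Longrightarrow> Cod C u = Dom C q \<Longrightarrow> Cod C v = Dom C q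
      \<Longrightarrow> t \<cdot>\<^bsub>C\<^esub> u = t \<cdot>\<^bsub>C\<^esub> v \<Longrightarrow> k \<cdot>\<^bsub>C\<^esub> u = k \<cdot>\<^bsub>C\<^esub> v" unfolding Hom_def by blast+
  note b = C.pullbackD[OF qt]
  obtain u0 v0 where uv0: "is_pullback C t t u0 v0"
    using pbs b(3) unfolding has_pullbacks_def by blast
  note b0 = C.pullbackD[OF uv0]
  have k0: "k \<cdot>\<^bsub>C\<^esub> u0 = k \<cdot>\<^bsub>C\<^esub> v0" by (rule eq) (use b0 b in simp_all)
  note Uuv0 = pres[OF b(3) b(3) refl uv0]
  note Uk = U'(4-6)[OF k(1)] and Uf = U'(4-6)[OF f] and Ug = U'(4-6)[OF g] and Uq = U'(4-6)[OF b(1)]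
    and Ut = U'(4-6)[OF b(3)] and Uu0 = U'(4-6)[OF b0(1)] and Uv0 = U'(4-6)[OF b0(3)] and Up = U'(4-6)[OF p]
  have eqD: "FArr U k \<cdot>\<^bsub>D\<^esub> u = FArr U k \<cdot>\<^bsub>D\<^esub> v" if uv: "u \<in> Arr D" "v \<in> Arr D" "Dom D v = Dom D u"
    "Cod D u = FObj U (Dom C q)" "Cod D v = FObj U (Dom C q)" "FArr U t \<cdot>\<^bsub>D\<^esub> u = FArr U t \<cdot>\<^bsub>D\<^esub> v" for u v
  proof -
    obtain j where j: "j \<in> Arr D" "Dom D j = Dom D u" "Cod D j = FObj U (Dom C u0)"
      "FArr U u0 \<cdot>\<^bsub>D\<^esub> j = u" "FArr U v0 \<cdot>\<^bsub>D\<^esub> j = v"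
      using D.pullback_ex[OF Uuv0 uv(1,2), of "Dom D u"] uv b Ut Uu0 by auto
    have "FArr U k \<cdot>\<^bsub>D\<^esub> u = FArr U (k \<cdot>\<^bsub>C\<^esub> u0) \<cdot>\<^bsub>D\<^esub> j"
      unfolding j(4)[symmetric] U'(8)[OF b0(1) k(1), unfolded k(2) b0(2) b(4), OF refl]
      using Uk Uu0 j(1-3) k(1-3) b0(1,2) b(4) by simp
    also have "\<dots> = FArr U k \<cdot>\<^bsub>D\<^esub> v"
      unfolding k0 j(5)[symmetric] U'(8)[OF b0(3) k(1), unfolded k(2) b0(5) b(4), OF refl]
      using Uk Uv0 j(1-3) k(1-3) b0(3-5) b(4) by simp
    finally show ?thesis .
  qed
  have gk: "FArr U g \<cdot>\<^bsub>D\<^esub> FArr U k = FArr U f \<cdot>\<^bsub>D\<^esub> FArr U t"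
    using U'(8)[of k g] U'(8)[of t f] k b f g by simp
  have "\<exists>!h. h \<in> Hom D (Dom D (FArr U f)) (Dom D (FArr U g)) \<and> FArr U g \<cdot>\<^bsub>D\<^esub> h = FArr U f
      \<and> h \<cdot>\<^bsub>D\<^esub> FArr U t = FArr U k"
    using Dff[unfolded descent_ff_def, rule_format, OF Uf(1) Ug(1), of "FArr U q" "FArr U t" "FArr U k"]
      pres[OF p f f'[symmetric] qt] gk eqD f' g' Uf Ug Up Uk Uq k(2,3)
    unfolding Hom_def by simp
  then obtain h where h: "h \<in> Arr D" "Dom D h = FObj U (Dom C f)" "Cod D h = FObj U (Dom C g)"
      "FArr U g \<cdot>\<^bsub>D\<^esub> h = FArr U f" "h \<cdot>\<^bsub>D\<^esub> FArr U t = FArr U k"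
    and uniq: "\<And>h'. h' \<in> Arr D \<Longrightarrow> Dom D h' = FObj U (Dom C f) \<Longrightarrow> Cod D h' = FObj U (Dom C g) \<Longrightarrow>
      FArr U g \<cdot>\<^bsub>D\<^esub> h' = FArr U f \<Longrightarrow> h' \<cdot>\<^bsub>D\<^esub> FArr U t = FArr U k \<Longrightarrow> h' = h"
    unfolding Hom_def Uf(2) Ug(2) by blast
  obtain x where x: "x \<in> Arr C" "Dom C x = Dom C f" "Cod C x = Dom C g" "FArr U x = h"
    using full[OF _ _ h(1-3)] f g by auto
  have 1: "g \<cdot>\<^bsub>C\<^esub> x = f" by (rule faithful) (use x f g f' g' h U'(8)[of x g] in simp_all)
  have 2: "x \<cdot>\<^bsub>C\<^esub> t = k" by (rule faithful) (use x b f g h k U'(8)[of t x] in simp_all)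
  show "\<exists>!h. h \<in> Hom C (Dom C f) (Dom C g) \<and> g \<cdot>\<^bsub>C\<^esub> h = f \<and> h \<cdot>\<^bsub>C\<^esub> t = k"
  proof (intro ex1I[of _ x] conjI)
    show "x \<in> Hom C (Dom C f) (Dom C g)" using x by (simp add: Hom_def)
    fix y assume "y \<in> Hom C (Dom C f) (Dom C g) \<and> g \<cdot>\<^bsub>C\<^esub> y = f \<and> y \<cdot>\<^bsub>C\<^esub> t = k"
    then have y: "y \<in> Arr C" "Dom C y = Dom C f" "Cod C y = Dom C g" "g \<cdot>\<^bsub>C\<^esub> y = f" "y \<cdot>\<^bsub>C\<^esub> t = k"
      unfolding Hom_def by blast+
    have "FArr U y = h"
      by (rule uniq) (use y U'(4-6)[OF y(1)] U'(8)[of y g] U'(8)[of t y] g b in simp_all)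
    then show "y = x" by (intro faithful[of y x]) (use x y in simp_all)
  qed (fact 1 2)+
qed

text \<open>Each law is equivalent to its instance at one universal test situation. These situations
  are built in \<open>C\<close>, where \<open>datum\<close> applies, and they stay universal in
  \<open>D\<close> because the pullbacks defining them are preserved.\<close>

lemma transfer_datum:
  assumes datum: "descent_datum C p r q1 q2 a"
  shows "descent_datum D (FArr U p) (FArr U r) (FArr U q1) (FArr U q2) (FArr U a)"
proof -
  have r: "r \<in> Arr C" "Cod C r = Dom C p" and q: "is_pullback C p (p \<cdot>\<^bsub>C\<^esub> r) q1 q2"
    and a: "a \<in> Arr C" "Dom C a = Dom C q1" "Cod C a = Dom C r" "r \<cdot>\<^bsub>C\<^esub> a = q1"
    and unit: "\<And>d. d \<in> Arr C \<Longrightarrow> Cod C d = Dom C q1 \<Longrightarrow> q1 \<cdot>\<^bsub>C\<^esub> d = r \<cdot>\<^bsub>C\<^esub> (q2 \<cdot>\<^bsub>C\<^esub> d) \<Longrightarrow> a \<cdot>\<^bsub>C\<^esub> d = q2 \<cdot>\<^bsub>C\<^esub> d"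
    and assoc: "\<And>m n n'. m \<in> Arr C \<Longrightarrow> n \<in> Arr C \<Longrightarrow> n' \<in> Arr C \<Longrightarrow> Dom C n = Dom C m \<Longrightarrow> Dom C n' = Dom C m
      \<Longrightarrow> Cod C m = Dom C q1 \<Longrightarrow> Cod C n = Dom C q1 \<Longrightarrow> Cod C n' = Dom C q1
      \<Longrightarrow> q2 \<cdot>\<^bsub>C\<^esub> n = a \<cdot>\<^bsub>C\<^esub> m \<Longrightarrow> q1 \<cdot>\<^bsub>C\<^esub> n' = q1 \<cdot>\<^bsub>C\<^esub> n \<Longrightarrow> q2 \<cdot>\<^bsub>C\<^esub> n' = q2 \<cdot>\<^bsub>C\<^esub> m \<Longrightarrow> a \<cdot>\<^bsub>C\<^esub> n = a \<cdot>\<^bsub>C\<^esub> n'"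
    using datum unfolding descent_datum_def Hom_def by blast+
  have pr: "p \<cdot>\<^bsub>C\<^esub> r \<in> Arr C" "Dom C (p \<cdot>\<^bsub>C\<^esub> r) = Dom C r" "Cod C (p \<cdot>\<^bsub>C\<^esub> r) = Cod C p" using p r by auto
  note b = C.pullbackD[OF q, unfolded pr]
  note Up = U'(4-6)[OF p] and Ur = U'(4-6)[OF r(1)] and Ua = U'(4-6)[OF a(1)]
    and Uq1 = U'(4-6)[OF b(1)] and Uq2 = U'(4-6)[OF b(3)]
  note Upr = U'(8)[OF r(1) p r(2)[symmetric]]
  have Uq: "is_pullback D (FArr U p) (FArr U p \<cdot>\<^bsub>D\<^esub> FArr U r) (FArr U q1) (FArr U q2)"
    using pres[OF p pr(1) pr(3)[symmetric] q] unfolding Upr .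
  have Upr': "FArr U p \<cdot>\<^bsub>D\<^esub> FArr U r \<in> Arr D" using Up Ur r by simp
  have Ura: "FArr U r \<cdot>\<^bsub>D\<^esub> FArr U a = FArr U q1"
    using U'(8)[of a r] a r by simp
  show ?thesis
    unfolding descent_datum_def
  proof (intro conjI allI impI)
    show "FArr U a \<in> Hom D (Dom D (FArr U q1)) (Dom D (FArr U r))" using Ua Uq1 Ur a by (simp add: Hom_def)
    fix d assume "d \<in> Arr D \<and> Cod D d = Dom D (FArr U q1) \<and> FArr U q1 \<cdot>\<^bsub>D\<^esub> d = FArr U r \<cdot>\<^bsub>D\<^esub> (FArr U q2 \<cdot>\<^bsub>D\<^esub> d)"
    then have d: "d \<in> Arr D" "Cod D d = Dom D (FArr U q1)" "FArr U q1 \<cdot>\<^bsub>D\<^esub> d = FArr U r \<cdot>\<^bsub>D\<^esub> (FArr U q2 \<cdot>\<^bsub>D\<^esub> d)" by auto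
    \<comment> \<open>In elements, \<open>c\<close> sends \<open>s\<close> to
      \<open>(r(s), s)\<close>. Any \<open>d\<close> to which the unit law applies factors through
      the image of \<open>c\<close>.\<close>
    obtain c where c: "c \<in> Arr C" "Dom C c = Dom C r" "Cod C c = Dom C q1" "q1 \<cdot>\<^bsub>C\<^esub> c = r" "q2 \<cdot>\<^bsub>C\<^esub> c = Ide C (Dom C r)"
      using C.pullback_ex[OF q, of r "Ide C (Dom C r)" "Dom C r"] r pr by auto
    have ac: "a \<cdot>\<^bsub>C\<^esub> c = Ide C (Dom C r)" using unit[OF c(1,3)] c r by simp
    note Uc = U'(4-6)[OF c(1)]
    have Uq1c: "FArr U q1 \<cdot>\<^bsub>D\<^esub> FArr U c = FArr U r" using U'(8)[of c q1] b c by simp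
    have Uq2c: "FArr U q2 \<cdot>\<^bsub>D\<^esub> FArr U c = Ide D (FObj U (Dom C r))" using U'(8)[of c q2] U'(7)[of "Dom C r"] b c r by simp
    have Uac: "FArr U a \<cdot>\<^bsub>D\<^esub> FArr U c = Ide D (FObj U (Dom C r))" using U'(8)[of c a] U'(7)[of "Dom C r"] a ac c r by simp
    have "FArr U c \<cdot>\<^bsub>D\<^esub> (FArr U q2 \<cdot>\<^bsub>D\<^esub> d) = d"
      by (rule D.pullback_unique[OF Uq Up(1) Upr'])
        (use d Uc Uq1 Uq2 Ur b c(2,3) r(1) in \<open>simp_all add: D.reassoc[OF Uq1c] D.reassoc[OF Uq2c]\<close>)
    then have "FArr U a \<cdot>\<^bsub>D\<^esub> d = FArr U a \<cdot>\<^bsub>D\<^esub> (FArr U c \<cdot>\<^bsub>D\<^esub> (FArr U q2 \<cdot>\<^bsub>D\<^esub> d))" by simp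
    also have "\<dots> = FArr U q2 \<cdot>\<^bsub>D\<^esub> d"
      using d(1,2) Uc Uq1 Uq2 Ua b(1-5) c(2,3) a(2,3) by (simp add: D.reassoc[OF Uac])
    finally show "FArr U a \<cdot>\<^bsub>D\<^esub> d = FArr U q2 \<cdot>\<^bsub>D\<^esub> d" .
  next
    fix m n n'
    assume "m \<in> Arr D \<and> n \<in> Arr D \<and> n' \<in> Arr D \<and> Dom D n = Dom D m \<and> Dom D n' = Dom D m
          \<and> Cod D m = Dom D (FArr U q1) \<and> Cod D n = Dom D (FArr U q1) \<and> Cod D n' = Dom D (FArr U q1)
          \<and> FArr U q2 \<cdot>\<^bsub>D\<^esub> n = FArr U a \<cdot>\<^bsub>D\<^esub> m \<and> FArr U q1 \<cdot>\<^bsub>D\<^esub> n' = FArr U q1 \<cdot>\<^bsub>D\<^esub> n \<and> FArr U q2 \<cdot>\<^bsub>D\<^esub> n' = FArr U q2 \<cdot>\<^bsub>D\<^esub> m"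
    then have d: "m \<in> Arr D" "n \<in> Arr D" "n' \<in> Arr D" "Dom D n = Dom D m" "Dom D n' = Dom D m"
      "Cod D m = FObj U (Dom C q1)" "Cod D n = FObj U (Dom C q1)" "Cod D n' = FObj U (Dom C q1)"
      "FArr U q2 \<cdot>\<^bsub>D\<^esub> n = FArr U a \<cdot>\<^bsub>D\<^esub> m" "FArr U q1 \<cdot>\<^bsub>D\<^esub> n' = FArr U q1 \<cdot>\<^bsub>D\<^esub> n" "FArr U q2 \<cdot>\<^bsub>D\<^esub> n' = FArr U q2 \<cdot>\<^bsub>D\<^esub> m"
      unfolding Uq1(2) by blast+
    \<comment> \<open>the universal instance of the situation lives over the pullback of \<open>p\<close> and \<open>p q1\<close>\<close>
    have pq: "p \<cdot>\<^bsub>C\<^esub> q1 \<in> Arr C" "Dom C (p \<cdot>\<^bsub>C\<^esub> q1) = Dom C q1" "Cod C (p \<cdot>\<^bsub>C\<^esub> q1) = Cod C p" using p b(1-5) by auto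
    obtain s1 s2 where s: "is_pullback C p (p \<cdot>\<^bsub>C\<^esub> q1) s1 s2"
      using pbs p pq unfolding has_pullbacks_def by metis
    note c = C.pullbackD[OF s, unfolded pq]
    have e1: "p \<cdot>\<^bsub>C\<^esub> s1 = (p \<cdot>\<^bsub>C\<^esub> r) \<cdot>\<^bsub>C\<^esub> (a \<cdot>\<^bsub>C\<^esub> s2)"
      using c b(1-5) p a(1-3) r by (simp add: C.reassoc[OF a(4)])
    have e2: "p \<cdot>\<^bsub>C\<^esub> s1 = (p \<cdot>\<^bsub>C\<^esub> r) \<cdot>\<^bsub>C\<^esub> (q2 \<cdot>\<^bsub>C\<^esub> s2)"
      using c(1-5) b(1-5) p r C.reassoc[OF b(6)[symmetric], of s2] c(6) by (simp add: c(6))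
    \<comment> \<open>On an element \<open>(u', (u, s))\<close> of this vertex, \<open>n0\<close> is
      \<open>(u', u * s)\<close> and \<open>n1\<close> is \<open>(u', s)\<close>.\<close>
    obtain n0 where n0: "n0 \<in> Arr C" "Dom C n0 = Dom C s1" "Cod C n0 = Dom C q1" "q1 \<cdot>\<^bsub>C\<^esub> n0 = s1" "q2 \<cdot>\<^bsub>C\<^esub> n0 = a \<cdot>\<^bsub>C\<^esub> s2"
      using C.pullback_ex[OF q _ _ _ _ _ _ e1, of "Dom C s1"] c a r b pr by auto
    obtain n1 where n1: "n1 \<in> Arr C" "Dom C n1 = Dom C s1" "Cod C n1 = Dom C q1" "q1 \<cdot>\<^bsub>C\<^esub> n1 = s1" "q2 \<cdot>\<^bsub>C\<^esub> n1 = q2 \<cdot>\<^bsub>C\<^esub> s2"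
      using C.pullback_ex[OF q _ _ _ _ _ _ e2, of "Dom C s1"] c a r b pr by auto
    have an: "a \<cdot>\<^bsub>C\<^esub> n0 = a \<cdot>\<^bsub>C\<^esub> n1"
      by (rule assoc[of s2]) (use n0 n1 c b in simp_all)
    note Us1 = U'(4-6)[OF c(1)] and Us2 = U'(4-6)[OF c(3)] and Un0 = U'(4-6)[OF n0(1)] and Un1 = U'(4-6)[OF n1(1)]
    note Upq = U'(8)[OF b(1) p b(2)[symmetric]]
    have Us: "is_pullback D (FArr U p) (FArr U p \<cdot>\<^bsub>D\<^esub> FArr U q1) (FArr U s1) (FArr U s2)"
      using pres[OF p pq(1) pq(3)[symmetric] s] unfolding Upq .
    have "FArr U p \<cdot>\<^bsub>D\<^esub> (FArr U q1 \<cdot>\<^bsub>D\<^esub> n) = (FArr U p \<cdot>\<^bsub>D\<^esub> FArr U r) \<cdot>\<^bsub>D\<^esub> (FArr U q2 \<cdot>\<^bsub>D\<^esub> n)"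
      using d(1-8) Uq1 Uq2 Up Ur r b(1-5) D.reassoc[OF D.pullbackD(6)[OF Uq], of n] by simp
    also have "\<dots> = (FArr U p \<cdot>\<^bsub>D\<^esub> FArr U q1) \<cdot>\<^bsub>D\<^esub> m"
      unfolding d(9) using d(1-8) Uq1 Ua Up Ur r b(1-5) a(1-3) by (simp add: D.reassoc[OF Ura])
    finally have e: "FArr U p \<cdot>\<^bsub>D\<^esub> (FArr U q1 \<cdot>\<^bsub>D\<^esub> n) = (FArr U p \<cdot>\<^bsub>D\<^esub> FArr U q1) \<cdot>\<^bsub>D\<^esub> m" .
    obtain j where j: "j \<in> Arr D" "Dom D j = Dom D m" "Cod D j = FObj U (Dom C s1)"
      "FArr U s1 \<cdot>\<^bsub>D\<^esub> j = FArr U q1 \<cdot>\<^bsub>D\<^esub> n" "FArr U s2 \<cdot>\<^bsub>D\<^esub> j = m"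
      using D.pullback_ex[OF Us _ d(1) _ _ _ _ e, of "Dom D m"] d(1-8) Uq1 Up Us1 b(1,2) by auto
    have f0: "FArr U q1 \<cdot>\<^bsub>D\<^esub> FArr U n0 = FArr U s1" "FArr U q2 \<cdot>\<^bsub>D\<^esub> FArr U n0 = FArr U a \<cdot>\<^bsub>D\<^esub> FArr U s2"
      using U'(8)[of n0 q1] U'(8)[of n0 q2] U'(8)[of s2 a] n0 b c a by simp_all
    have f1: "FArr U q1 \<cdot>\<^bsub>D\<^esub> FArr U n1 = FArr U s1" "FArr U q2 \<cdot>\<^bsub>D\<^esub> FArr U n1 = FArr U q2 \<cdot>\<^bsub>D\<^esub> FArr U s2"
      using U'(8)[of n1 q1] U'(8)[of n1 q2] U'(8)[of s2 q2] n1 b c a by simp_all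
    have f2: "FArr U a \<cdot>\<^bsub>D\<^esub> FArr U n0 = FArr U a \<cdot>\<^bsub>D\<^esub> FArr U n1"
      using U'(8)[of n0 a] U'(8)[of n1 a] n0 n1 a an by simp
    have n: "FArr U n0 \<cdot>\<^bsub>D\<^esub> j = n"
      by (rule D.pullback_unique[OF Uq Up(1) Upr'])
        (use d(1-8) j(1-3) Un0 Uq1 Uq2 Ua Us1 Us2 b(1-5) c(1-5) a(1-3) n0(1-3) in
          \<open>simp_all add: D.reassoc[OF f0(1)] D.reassoc[OF f0(2)] j(4,5) d(9)\<close>)
    have n': "FArr U n1 \<cdot>\<^bsub>D\<^esub> j = n'"
      by (rule D.pullback_unique[OF Uq Up(1) Upr'])
        (use d(1-8) j(1-3) Un1 Uq1 Uq2 Ua Us1 Us2 b(1-5) c(1-5) a(1-3) n1(1-3) in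
          \<open>simp_all add: D.reassoc[OF f1(1)] D.reassoc[OF f1(2)] j(4,5) d(10,11)\<close>)
    show "FArr U a \<cdot>\<^bsub>D\<^esub> n = FArr U a \<cdot>\<^bsub>D\<^esub> n'"
      unfolding n[symmetric] n'[symmetric]
      using j(1-3) Un0 Un1 Ua a(2,3) n0(2,3) n1(2,3) by (simp add: D.reassoc[OF f2])
  qed (use Uq Ur Up r Ura in simp_all)
qed

text \<open>The descended arrow \<open>f'\<close> is found in \<open>D\<close>, and full
  faithfulness with preservation of pullbacks does not place its domain in the image of
  \<open>U\<close>. Once \<open>ess\<close> does so up to isomorphism, the square can be lifted by
  fullness and is a pullback by reflection.\<close>

lemma transfer_descent_es:
  assumes Des: "descent_es D (FArr U p)"
    and ess: "\<And>f r t. f \<in> Arr D \<Longrightarrow> Cod D f = FObj U (Cod C p) \<Longrightarrow> r \<in> Arr C \<Longrightarrow> Cod C r = Dom C p \<Longrightarrow>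
      is_pullback D (FArr U p) f (FArr U r) t \<Longrightarrow> \<exists>y\<in>Obj C. \<exists>i\<in>Hom D (FObj U y) (Dom D f). iso_arrow D i"
  shows "descent_es C p"
  unfolding descent_es_def
proof (intro allI impI)
  fix r q1 q2 a
  assume datum: "descent_datum C p r q1 q2 a"
  have r: "r \<in> Arr C" "Cod C r = Dom C p" and q: "is_pullback C p (p \<cdot>\<^bsub>C\<^esub> r) q1 q2"
    and a: "a \<in> Arr C" "Dom C a = Dom C q1" "Cod C a = Dom C r"
    using datum unfolding descent_datum_def Hom_def by blast+
  have pr: "p \<cdot>\<^bsub>C\<^esub> r \<in> Arr C" "Dom C (p \<cdot>\<^bsub>C\<^esub> r) = Dom C r" "Cod C (p \<cdot>\<^bsub>C\<^esub> r) = Cod C p" using p r by auto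
  note b = C.pullbackD(1-5)[OF q, unfolded pr]
  obtain f' t' where f': "f' \<in> Arr D" "Cod D f' = Cod D (FArr U p)" and rt': "is_pullback D (FArr U p) f' (FArr U r) t'"
    and ta': "t' \<cdot>\<^bsub>D\<^esub> FArr U a = t' \<cdot>\<^bsub>D\<^esub> FArr U q2"
    using Des transfer_datum[OF datum] unfolding descent_es_def by blast
  note c = D.pullbackD[OF rt']
  note Up = U'(4-6)[OF p] and Ur = U'(4-6)[OF r(1)] and Ua = U'(4-6)[OF a(1)]
    and Uq1 = U'(4-6)[OF b(1)] and Uq2 = U'(4-6)[OF b(3)]
  obtain y i where y: "y \<in> Obj C" and i: "i \<in> Hom D (FObj U y) (Dom D f')" and iso: "iso_arrow D i"
    using ess[OF f'(1) _ r rt'] f'(2) Up(3) by auto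
  obtain j where j: "j \<in> Hom D (Dom D f') (FObj U y)" "j \<cdot>\<^bsub>D\<^esub> i = Ide D (FObj U y)" "i \<cdot>\<^bsub>D\<^esub> j = Ide D (Dom D f')"
    by (rule iso_arrow_HomE[OF iso i])
  have i': "i \<in> Arr D" "Dom D i = FObj U y" "Cod D i = Dom D f'"
    and j': "j \<in> Arr D" "Dom D j = Dom D f'" "Cod D j = FObj U y" using i j by (auto simp: Hom_def)
  have b2: "Cod C p \<in> Obj C" "Dom C r \<in> Obj C" using p r by auto
  obtain f where f: "f \<in> Arr C" "Dom C f = y" "Cod C f = Cod C p" "FArr U f = f' \<cdot>\<^bsub>D\<^esub> i"
    using full[OF y b2(1), of "f' \<cdot>\<^bsub>D\<^esub> i"] f' i' Up(3) by auto
  obtain t where t: "t \<in> Arr C" "Dom C t = Dom C r" "Cod C t = y" "FArr U t = j \<cdot>\<^bsub>D\<^esub> t'"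
    using full[OF b2(2) y, of "j \<cdot>\<^bsub>D\<^esub> t'"] c(3-5) j' Ur(2) by auto
  have Upb: "is_pullback D (FArr U p) (FArr U f) (FArr U r) (FArr U t)"
    unfolding f t by (rule D.pullback_iso_right[OF rt' Up(1) f']) (use i' j' j in simp_all)
  have pb: "is_pullback C p f r t"
    by (rule reflect_pullback[OF U ff p f(1) _ r t(1) _ _ Upb]) (use f t in simp_all)
  have "t \<cdot>\<^bsub>C\<^esub> a = t \<cdot>\<^bsub>C\<^esub> q2"
  proof (rule faithful)
    show "FArr U (t \<cdot>\<^bsub>C\<^esub> a) = FArr U (t \<cdot>\<^bsub>C\<^esub> q2)"
      using U'(8)[of a t] U'(8)[of q2 t] t a b j' c(3-5) Ua Uq1 Uq2 Ur by (simp add: ta')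
  qed (use t a b in simp_all)
  then show "\<exists>f t. f \<in> Arr C \<and> Cod C f = Cod C p \<and> is_pullback C p f r t \<and> t \<cdot>\<^bsub>C\<^esub> a = t \<cdot>\<^bsub>C\<^esub> q2"
    using f pb by blast
qed

end

section \<open>Finite products\<close>

text \<open>The terminal object and pullbacks yield all limits used below, and they are easier to
  verify for \<open>Fam\<close> than limits of arbitrary finite diagrams.\<close>

locale finitely_complete = category +
  assumes ex_terminal: "\<exists>t. is_terminal C t" and pbs: "has_pullbacks C"
begin

lemma trm: "is_terminal C (trm C)"
  unfolding trm_def by (rule someI_ex[OF ex_terminal])

lemma trm_obj [simp]: "trm C \<in> Obj C"
  using trm by (simp add: is_terminal_def)

lemma bang [simp]:
  assumes "x \<in> Obj C"
  shows "bang C x \<in> Arr C" "Dom C (bang C x) = x" "Cod C (bang C x) = trm C"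
proof -
  have "\<exists>!h. h \<in> Hom C x (trm C)" using trm assms by (simp add: is_terminal_def)
  then have "bang C x \<in> Hom C x (trm C)" unfolding bang_def by (rule theI')
  then show "bang C x \<in> Arr C" "Dom C (bang C x) = x" "Cod C (bang C x) = trm C"
    by (auto simp: Hom_def)
qed

lemma terminal_unique:
  assumes "is_terminal C t" "f \<in> Arr C" "g \<in> Arr C" "Dom C f = Dom C g" "Cod C f = t" "Cod C g = t"
  shows "f = g"
proof -
  have "\<exists>!h. h \<in> Hom C (Dom C g) t" using assms(1,3) by (auto simp: is_terminal_def)
  then show ?thesis using assms by (auto simp: Hom_def)
qed

lemma bang_comp: "f \<in> Arr C \<Longrightarrow> Cod C f = x \<Longrightarrow> bang C x \<cdot> f = bang C (Dom C f)"
  by (rule terminal_unique[OF trm]) auto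

lemma product_pullback:
  assumes "is_terminal C t" "f \<in> Arr C" "g \<in> Arr C" "Cod C f = t" "Cod C g = t" "is_pullback C f g p q"
  shows "is_product C (Dom C f) (Dom C g) (Dom C p) p q"
  unfolding is_product_def
proof (intro conjI allI impI)
  fix w u v assume u: "u \<in> Hom C w (Dom C f) \<and> v \<in> Hom C w (Dom C g)"
  have "f \<cdot> u = g \<cdot> v"
    by (rule terminal_unique[OF assms(1)]) (use u assms in \<open>auto simp: Hom_def\<close>)
  then show "\<exists>!h. h \<in> Hom C w (Dom C p) \<and> p \<cdot> h = u \<and> q \<cdot> h = v"
    using assms(6) u unfolding is_pullback_def by blast
qed (use assms(6) in \<open>auto simp: is_pullback_def\<close>)

lemma prd: "x \<in> Obj C \<Longrightarrow> y \<in> Obj C \<Longrightarrow> is_product C x y (prd_obj C x y) (proj1 C x y) (proj2 C x y)"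
proof -
  assume xy: "x \<in> Obj C" "y \<in> Obj C"
  obtain p q where "is_pullback C (bang C x) (bang C y) p q"
    using pbs xy unfolding has_pullbacks_def by (metis bang(1,3))
  then have "is_product C x y (Dom C p) p q"
    using product_pullback[OF trm, of "bang C x" "bang C y"] xy by simp
  then have "\<exists>zpq. case zpq of (z, p, q) \<Rightarrow> is_product C x y z p q" by auto
  then have "case prd C x y of (z, p, q) \<Rightarrow> is_product C x y z p q"
    unfolding prd_def by (rule someI_ex)
  then show ?thesis by (simp add: prd_obj_def proj1_def proj2_def split: prod.splits)
qed

lemma proj [simp]:
  assumes "x \<in> Obj C" "y \<in> Obj C"
  shows "proj1 C x y \<in> Arr C" "Dom C (proj1 C x y) = prd_obj C x y" "Cod C (proj1 C x y) = x"
    "proj2 C x y \<in> Arr C" "Dom C (proj2 C x y) = prd_obj C x y" "Cod C (proj2 C x y) = y"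
    "prd_obj C x y \<in> Obj C"
proof -
  show p: "proj1 C x y \<in> Arr C" "Dom C (proj1 C x y) = prd_obj C x y" "Cod C (proj1 C x y) = x"
    "proj2 C x y \<in> Arr C" "Dom C (proj2 C x y) = prd_obj C x y" "Cod C (proj2 C x y) = y"
    using prd[OF assms] by (auto simp: is_product_def Hom_def)
  show "prd_obj C x y \<in> Obj C" using dom_obj[OF p(1)] p(2) by simp
qed

lemma product_ex:
  assumes "is_product C x y z p q" "f \<in> Arr C" "g \<in> Arr C" "Dom C g = Dom C f" "Cod C f = x" "Cod C g = y"
  shows "\<exists>h. h \<in> Arr C \<and> Dom C h = Dom C f \<and> Cod C h = z \<and> p \<cdot> h = f \<and> q \<cdot> h = g"
proof -
  have "f \<in> Hom C (Dom C f) x \<and> g \<in> Hom C (Dom C f) y" using assms by (simp add: Hom_def)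
  then have "\<exists>!h. h \<in> Hom C (Dom C f) z \<and> p \<cdot> h = f \<and> q \<cdot> h = g"
    using assms(1) unfolding is_product_def by blast
  then show ?thesis by (auto simp: Hom_def)
qed

lemma product_unique:
  assumes "is_product C x y z p q" "h \<in> Arr C" "h' \<in> Arr C" "Dom C h = Dom C h'" "Cod C h = z" "Cod C h' = z"
    "p \<cdot> h = p \<cdot> h'" "q \<cdot> h = q \<cdot> h'"
  shows "h = h'"
proof -
  have pq: "p \<in> Arr C" "Dom C p = z" "Cod C p = x" "q \<in> Arr C" "Dom C q = z" "Cod C q = y"
    using assms(1) by (auto simp: is_product_def Hom_def)
  have "p \<cdot> h \<in> Hom C (Dom C h) x \<and> q \<cdot> h \<in> Hom C (Dom C h) y" using assms(2-6) pq by (simp add: Hom_def)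
  then have "\<exists>!k. k \<in> Hom C (Dom C h) z \<and> p \<cdot> k = p \<cdot> h \<and> q \<cdot> k = q \<cdot> h"
    using assms(1) unfolding is_product_def by blast
  then show ?thesis using assms by (auto simp: Hom_def)
qed

lemma pairing [simp]:
  assumes "f \<in> Arr C" "g \<in> Arr C" "Dom C g = Dom C f"
  shows "pairing C f g \<in> Arr C" "Dom C (pairing C f g) = Dom C f"
    "Cod C (pairing C f g) = prd_obj C (Cod C f) (Cod C g)"
    and proj_pairing: "Cod C f = x \<Longrightarrow> Cod C g = y \<Longrightarrow> proj1 C x y \<cdot> pairing C f g = f"
      "Cod C f = x \<Longrightarrow> Cod C g = y \<Longrightarrow> proj2 C x y \<cdot> pairing C f g = g"
proof -
  have "f \<in> Hom C (Dom C f) (Cod C f) \<and> g \<in> Hom C (Dom C f) (Cod C g)" using assms by (simp add: Hom_def)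
  then have "\<exists>!h. h \<in> Hom C (Dom C f) (prd_obj C (Cod C f) (Cod C g)) \<and> proj1 C (Cod C f) (Cod C g) \<cdot> h = f
      \<and> proj2 C (Cod C f) (Cod C g) \<cdot> h = g"
    using prd[of "Cod C f" "Cod C g"] assms unfolding is_product_def by simp
  then have "pairing C f g \<in> Hom C (Dom C f) (prd_obj C (Cod C f) (Cod C g)) \<and> proj1 C (Cod C f) (Cod C g) \<cdot> pairing C f g = f
      \<and> proj2 C (Cod C f) (Cod C g) \<cdot> pairing C f g = g"
    unfolding pairing_def by (rule theI')
  then show "pairing C f g \<in> Arr C" "Dom C (pairing C f g) = Dom C f"
    "Cod C (pairing C f g) = prd_obj C (Cod C f) (Cod C g)"
    "Cod C f = x \<Longrightarrow> Cod C g = y \<Longrightarrow> proj1 C x y \<cdot> pairing C f g = f"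
    "Cod C f = x \<Longrightarrow> Cod C g = y \<Longrightarrow> proj2 C x y \<cdot> pairing C f g = g"
    by (auto simp: Hom_def)
qed

lemma proj_pairing_reassoc [simp]:
  assumes "f \<in> Arr C" "g \<in> Arr C" "Dom C g = Dom C f" "Cod C f = x" "Cod C g = y" "k \<in> Arr C" "Cod C k = Dom C f"
  shows "proj1 C x y \<cdot> (pairing C f g \<cdot> k) = f \<cdot> k" "proj2 C x y \<cdot> (pairing C f g \<cdot> k) = g \<cdot> k"
proof -
  have "x \<in> Obj C" "y \<in> Obj C" using assms by auto
  then show "proj1 C x y \<cdot> (pairing C f g \<cdot> k) = f \<cdot> k" "proj2 C x y \<cdot> (pairing C f g \<cdot> k) = g \<cdot> k"
    using assms reassoc[OF proj_pairing(1)[OF assms(1-5)], of k] reassoc[OF proj_pairing(2)[OF assms(1-5)], of k]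
    by auto
qed

lemma prd_joint:
  assumes "h \<in> Arr C" "h' \<in> Arr C" "Dom C h = Dom C h'" "Cod C h = prd_obj C x y" "Cod C h' = prd_obj C x y"
    "proj1 C x y \<cdot> h = proj1 C x y \<cdot> h'" "proj2 C x y \<cdot> h = proj2 C x y \<cdot> h'" "x \<in> Obj C" "y \<in> Obj C"
  shows "h = h'"
  using product_unique[OF prd] assms by metis

lemma pairing_comp:
  assumes "f \<in> Arr C" "g \<in> Arr C" "Dom C g = Dom C f" "k \<in> Arr C" "Cod C k = Dom C f"
  shows "pairing C f g \<cdot> k = pairing C (f \<cdot> k) (g \<cdot> k)"
  by (rule prd_joint[of _ _ "Cod C f" "Cod C g"]) (use assms in simp_all)

lemma pairing_eta:
  assumes "h \<in> Arr C" "Cod C h = prd_obj C x y" "x \<in> Obj C" "y \<in> Obj C"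
  shows "pairing C (proj1 C x y \<cdot> h) (proj2 C x y \<cdot> h) = h"
  by (rule prd_joint[of _ _ x y]) (use assms in simp_all)

lemma pairing_proj: "x \<in> Obj C \<Longrightarrow> y \<in> Obj C \<Longrightarrow> pairing C (proj1 C x y) (proj2 C x y) = Ide C (prd_obj C x y)"
  by (rule prd_joint[of _ _ x y]) simp_all

lemma prd_arr [simp]:
  assumes "f \<in> Arr C" "g \<in> Arr C"
  shows "prd_arr C f g \<in> Arr C" "Dom C (prd_arr C f g) = prd_obj C (Dom C f) (Dom C g)"
    "Cod C (prd_arr C f g) = prd_obj C (Cod C f) (Cod C g)"
  using assms by (simp_all add: prd_arr_def)

lemma prd_arr_pairing:
  assumes "f \<in> Arr C" "g \<in> Arr C" "a \<in> Arr C" "b \<in> Arr C" "Dom C b = Dom C a" "Cod C a = Dom C f" "Cod C b = Dom C g"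
  shows "prd_arr C f g \<cdot> pairing C a b = pairing C (f \<cdot> a) (g \<cdot> b)"
  unfolding prd_arr_def
  by (subst pairing_comp) (use assms in simp_all)

lemma associator [simp]:
  assumes "x \<in> Obj C" "y \<in> Obj C" "z \<in> Obj C"
  shows "associator C x y z \<in> Arr C" "Dom C (associator C x y z) = prd_obj C (prd_obj C x y) z"
    "Cod C (associator C x y z) = prd_obj C x (prd_obj C y z)"
  using assms by (simp_all add: associator_def)

lemma associator_pairing:
  assumes "h \<in> Arr C" "g \<in> Arr C" "f \<in> Arr C" "Dom C g = Dom C h" "Dom C f = Dom C h"
    "Cod C h = x" "Cod C g = y" "Cod C f = z"
  shows "associator C x y z \<cdot> pairing C (pairing C h g) f = pairing C h (pairing C g f)"
proof -
  have "x \<in> Obj C" "y \<in> Obj C" "z \<in> Obj C" using assms by auto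
  then show ?thesis
    unfolding associator_def using assms by (simp add: pairing_comp)
qed

end

section \<open>Enriched categories in terms of generalized elements\<close>

text \<open>Composition and identities of the ordinary category whose arrows \<open>x \<rightarrow> y\<close> are the arrows \<open>w \<rightarrow> A(x, y)\<close>.
  As these are natural in \<open>w\<close>, the axioms of enriched categories can be checked on them.\<close>

definition emul :: "('o, 'a) cat \<Rightarrow> ('u, 'o, 'a) ecat \<Rightarrow> 'u \<Rightarrow> 'u \<Rightarrow> 'u \<Rightarrow> 'a \<Rightarrow> 'a \<Rightarrow> 'a" where
  "emul W A x y z g f = EComp A x y z \<cdot>\<^bsub>W\<^esub> pairing W g f"

definition eunit :: "('o, 'a) cat \<Rightarrow> ('u, 'o, 'a) ecat \<Rightarrow> 'u \<Rightarrow> 'o \<Rightarrow> 'a" where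
  "eunit W A x w = EIde A x \<cdot>\<^bsub>W\<^esub> bang W w"

text \<open>The data without the axioms are enough to form \<open>emul\<close> and
  \<open>eunit\<close>; the axioms of each constructed enriched category are then verified in terms
  of these.\<close>

locale precat = finitely_complete +
  fixes A :: "('u, 'a, 'b) ecat"
  assumes ehom: "x \<in> EObj A \<Longrightarrow> y \<in> EObj A \<Longrightarrow> EHom A x y \<in> Obj C"
    and ecomp: "x \<in> EObj A \<Longrightarrow> y \<in> EObj A \<Longrightarrow> z \<in> EObj A \<Longrightarrow>
          EComp A x y z \<in> Hom C (prd_obj C (EHom A y z) (EHom A x y)) (EHom A x z)"
    and eide: "x \<in> EObj A \<Longrightarrow> EIde A x \<in> Hom C (trm C) (EHom A x x)"
begin

lemma ecomp_arr [simp]: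
  assumes "x \<in> EObj A" "y \<in> EObj A" "z \<in> EObj A"
  shows "EComp A x y z \<in> Arr C" "Dom C (EComp A x y z) = prd_obj C (EHom A y z) (EHom A x y)"
    "Cod C (EComp A x y z) = EHom A x z"
  using ecomp[OF assms] by (auto simp: Hom_def)

lemma eide_arr [simp]:
  assumes "x \<in> EObj A"
  shows "EIde A x \<in> Arr C" "Dom C (EIde A x) = trm C" "Cod C (EIde A x) = EHom A x x"
  using eide[OF assms] by (auto simp: Hom_def)

lemmas [simp] = ehom

lemma emul [simp]:
  assumes "x \<in> EObj A" "y \<in> EObj A" "z \<in> EObj A" "g \<in> Arr C" "f \<in> Arr C" "Dom C f = Dom C g"
    "Cod C g = EHom A y z" "Cod C f = EHom A x y"
  shows "emul C A x y z g f \<in> Arr C" "Dom C (emul C A x y z g f) = Dom C g" "Cod C (emul C A x y z g f) = EHom A x z"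
  using assms by (simp_all add: emul_def)

lemma eunit [simp]:
  assumes "x \<in> EObj A" "w \<in> Obj C"
  shows "eunit C A x w \<in> Arr C" "Dom C (eunit C A x w) = w" "Cod C (eunit C A x w) = EHom A x x"
  using assms by (simp_all add: eunit_def)

text \<open>This is naturality in the test object: what is known of a composite at one pair of
  elements passes to every pair that factors through it.\<close>

lemma emul_comp:
  assumes "x \<in> EObj A" "y \<in> EObj A" "z \<in> EObj A" "g \<in> Arr C" "f \<in> Arr C" "Dom C f = Dom C g"
    "Cod C g = EHom A y z" "Cod C f = EHom A x y" "k \<in> Arr C" "Cod C k = Dom C g"
  shows "emul C A x y z g f \<cdot> k = emul C A x y z (g \<cdot> k) (f \<cdot> k)"
  unfolding emul_def using assms by (simp add: pairing_comp)

lemma eunit_comp: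
  assumes "x \<in> EObj A" "k \<in> Arr C" "Cod C k = w"
  shows "eunit C A x w \<cdot> k = eunit C A x (Dom C k)"
proof -
  have "w \<in> Obj C" using assms by auto
  then show ?thesis unfolding eunit_def using assms by (simp add: bang_comp)
qed

text \<open>As in the Yoneda lemma, the composition arrow is recovered from its value at the
  universal composable pair, the two projections.\<close>

lemma ecomp_eq_emul:
  assumes "x \<in> EObj A" "y \<in> EObj A" "z \<in> EObj A"
  shows "EComp A x y z = emul C A x y z (proj1 C (EHom A y z) (EHom A x y)) (proj2 C (EHom A y z) (EHom A x y))"
  unfolding emul_def using assms by (simp add: pairing_proj)

lemma eide_eq_eunit: "x \<in> EObj A \<Longrightarrow> EIde A x = eunit C A x (trm C)"
proof -
  assume x: "x \<in> EObj A"
  have "bang C (trm C) = Ide C (trm C)" by (rule terminal_unique[OF trm]) auto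
  then show ?thesis using x by (simp add: eunit_def)
qed

text \<open>Evaluating the associativity axiom at a triple of elements leaves iterated composites,
  since the associator only regroups the triple.\<close>

lemma assoc_sides:
  assumes "w \<in> EObj A" "x \<in> EObj A" "y \<in> EObj A" "z \<in> EObj A" "h \<in> Arr C" "g \<in> Arr C" "f \<in> Arr C"
    "Dom C g = Dom C h" "Dom C f = Dom C h" "Cod C h = EHom A y z" "Cod C g = EHom A x y" "Cod C f = EHom A w x"
  shows "(EComp A w x z \<cdot> prd_arr C (EComp A x y z) (Ide C (EHom A w x))) \<cdot> pairing C (pairing C h g) f
      = emul C A w x z (emul C A x y z h g) f"
    and "(EComp A w y z \<cdot> (prd_arr C (Ide C (EHom A y z)) (EComp A w x y)
        \<cdot> associator C (EHom A y z) (EHom A x y) (EHom A w x))) \<cdot> pairing C (pairing C h g) f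
      = emul C A w y z h (emul C A w x y g f)"
  unfolding emul_def using assms by (simp_all add: prd_arr_pairing associator_pairing)

lemma unit_sides:
  assumes "x \<in> EObj A" "y \<in> EObj A" "f \<in> Arr C" "Cod C f = EHom A x y"
  shows "(EComp A x y y \<cdot> prd_arr C (EIde A y) (Ide C (EHom A x y))) \<cdot> pairing C (bang C (Dom C f)) f
      = emul C A x y y (eunit C A y (Dom C f)) f"
    and "(EComp A x x y \<cdot> prd_arr C (Ide C (EHom A x y)) (EIde A x)) \<cdot> pairing C f (bang C (Dom C f))
      = emul C A x x y f (eunit C A x (Dom C f))"
  unfolding emul_def eunit_def using assms by (simp_all add: prd_arr_pairing)

end

locale ecategory = precat +
  assumes emul_assoc: "\<And>w x y z h g f. w \<in> EObj A \<Longrightarrow> x \<in> EObj A \<Longrightarrow> y \<in> EObj A \<Longrightarrow> z \<in> EObj A \<Longrightarrow>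
      h \<in> Arr C \<Longrightarrow> g \<in> Arr C \<Longrightarrow> f \<in> Arr C \<Longrightarrow> Dom C g = Dom C h \<Longrightarrow> Dom C f = Dom C h \<Longrightarrow>
      Cod C h = EHom A y z \<Longrightarrow> Cod C g = EHom A x y \<Longrightarrow> Cod C f = EHom A w x \<Longrightarrow>
      emul C A w x z (emul C A x y z h g) f = emul C A w y z h (emul C A w x y g f)"
    and emul_eunit: "\<And>x y f. x \<in> EObj A \<Longrightarrow> y \<in> EObj A \<Longrightarrow> f \<in> Arr C \<Longrightarrow> Cod C f = EHom A x y \<Longrightarrow>
      emul C A x y y (eunit C A y (Dom C f)) f = f"
      "\<And>x y f. x \<in> EObj A \<Longrightarrow> y \<in> EObj A \<Longrightarrow> f \<in> Arr C \<Longrightarrow> Cod C f = EHom A x y \<Longrightarrow>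
      emul C A x x y f (eunit C A x (Dom C f)) = f"

definition extensional_ecat :: "('u, 'o, 'a) ecat \<Rightarrow> bool" where
  "extensional_ecat A \<longleftrightarrow> (\<forall>x y. \<not> (x \<in> EObj A \<and> y \<in> EObj A) \<longrightarrow> EHom A x y = undefined)
     \<and> (\<forall>x y z. \<not> (x \<in> EObj A \<and> y \<in> EObj A \<and> z \<in> EObj A) \<longrightarrow> EComp A x y z = undefined)
     \<and> (\<forall>x. x \<notin> EObj A \<longrightarrow> EIde A x = undefined)"

context finitely_complete
begin

text \<open>In one direction the diagrams are evaluated at arbitrary elements. In the other, the
  elementwise laws are applied to the projections, whose pairing is the identity, so that the
  diagrams themselves come back.\<close>

lemma enriched_category_iff:
  "enriched_category C A \<longleftrightarrow> ecategory C A \<and> extensional_ecat A"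
proof
  assume A: "enriched_category C A"
  interpret precat C A
    using A by unfold_locales (auto simp: enriched_category_def)
  show "ecategory C A \<and> extensional_ecat A"
  proof
    show "ecategory C A"
    proof
      fix w x y z h g f
      assume a: "w \<in> EObj A" "x \<in> EObj A" "y \<in> EObj A" "z \<in> EObj A" "h \<in> Arr C" "g \<in> Arr C" "f \<in> Arr C"
        "Dom C g = Dom C h" "Dom C f = Dom C h" "Cod C h = EHom A y z" "Cod C g = EHom A x y" "Cod C f = EHom A w x"
      have "EComp A w x z \<cdot> prd_arr C (EComp A x y z) (Ide C (EHom A w x))
          = EComp A w y z \<cdot> (prd_arr C (Ide C (EHom A y z)) (EComp A w x y)
              \<cdot> associator C (EHom A y z) (EHom A x y) (EHom A w x))"
        using A a(1-4) unfolding enriched_category_def by blast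
      then show "emul C A w x z (emul C A x y z h g) f = emul C A w y z h (emul C A w x y g f)"
        using assoc_sides[OF a] by metis
    next
      fix x y f assume a: "x \<in> EObj A" "y \<in> EObj A" "f \<in> Arr C" "Cod C f = EHom A x y"
      have "EComp A x y y \<cdot> prd_arr C (EIde A y) (Ide C (EHom A x y)) = proj2 C (trm C) (EHom A x y)"
        "EComp A x x y \<cdot> prd_arr C (Ide C (EHom A x y)) (EIde A x) = proj1 C (EHom A x y) (trm C)"
        using A a(1,2) unfolding enriched_category_def by blast+
      then show "emul C A x y y (eunit C A y (Dom C f)) f = f" "emul C A x x y f (eunit C A x (Dom C f)) = f"
        unfolding unit_sides[OF a, symmetric] using a by simp_all
    qed
    show "extensional_ecat A"
      using A unfolding enriched_category_def extensional_ecat_def by blast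
  qed
next
  assume A: "ecategory C A \<and> extensional_ecat A"
  then interpret ecategory C A by simp
  have assoc: "EComp A w x z \<cdot> prd_arr C (EComp A x y z) (Ide C (EHom A w x))
          = EComp A w y z \<cdot> (prd_arr C (Ide C (EHom A y z)) (EComp A w x y)
              \<cdot> associator C (EHom A y z) (EHom A x y) (EHom A w x))" (is "?l = ?r")
    if o: "w \<in> EObj A" "x \<in> EObj A" "y \<in> EObj A" "z \<in> EObj A" for w x y z
  proof -
    define a b c where "a = EHom A y z" and "b = EHom A x y" and "c = EHom A w x"
    have abc: "a \<in> Obj C" "b \<in> Obj C" "c \<in> Obj C" using o by (auto simp: a_def b_def c_def)
    \<comment> \<open>The universal composable triple, given by the three projections of the
      iterated product.\<close>
    define h g f where "h = proj1 C a b \<cdot> proj1 C (prd_obj C a b) c"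
      and "g = proj2 C a b \<cdot> proj1 C (prd_obj C a b) c" and "f = proj2 C (prd_obj C a b) c"
    have hgf: "h \<in> Arr C" "g \<in> Arr C" "f \<in> Arr C" "Dom C h = prd_obj C (prd_obj C a b) c"
      "Dom C g = Dom C h" "Dom C f = Dom C h" "Cod C h = a" "Cod C g = b" "Cod C f = c"
      unfolding h_def g_def f_def using abc by simp_all
    have one: "pairing C (pairing C h g) f = Ide C (prd_obj C (prd_obj C a b) c)"
      unfolding h_def g_def f_def using abc by (simp add: pairing_eta pairing_proj)
    have l: "?l \<in> Arr C" "Dom C ?l = prd_obj C (prd_obj C a b) c" and r: "?r \<in> Arr C" "Dom C ?r = prd_obj C (prd_obj C a b) c"
      using o by (simp_all add: a_def b_def c_def)
    note h' = hgf(1-3,5-9)[unfolded a_def b_def c_def]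
    have "?l \<cdot> pairing C (pairing C h g) f = ?r \<cdot> pairing C (pairing C h g) f"
      unfolding assoc_sides[OF o h'] by (rule emul_assoc[OF o h'])
    then show ?thesis unfolding one using l r by (metis comp_ide)
  qed
  have unit: "EComp A x y y \<cdot> prd_arr C (EIde A y) (Ide C (EHom A x y)) = proj2 C (trm C) (EHom A x y)" (is "?l = ?r")
    "EComp A x x y \<cdot> prd_arr C (Ide C (EHom A x y)) (EIde A x) = proj1 C (EHom A x y) (trm C)" (is "?l' = ?r'")
    if o: "x \<in> EObj A" "y \<in> EObj A" for x y
  proof -
    define a where "a = EHom A x y"
    have a: "a \<in> Obj C" using o by (simp add: a_def)
    \<comment> \<open>For the unit laws one element is universal, namely the projection onto the
      hom-object; paired with the arrow to the terminal object it is the identity.\<close>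
    have one: "pairing C (bang C (prd_obj C (trm C) a)) (proj2 C (trm C) a) = Ide C (prd_obj C (trm C) a)"
      by (rule prd_joint[of _ _ "trm C" a, OF _ _ _ _ _ terminal_unique[OF trm]]) (use a in simp_all)
    have "?l \<cdot> pairing C (bang C (Dom C (proj2 C (trm C) a))) (proj2 C (trm C) a) = ?r"
      unfolding a_def by (rule trans[OF unit_sides(1)[OF o] emul_eunit(1)[OF o]]) (use o in simp_all)
    then show "?l = ?r" using o a by (simp add: one a_def[symmetric])
    have one: "pairing C (proj1 C a (trm C)) (bang C (prd_obj C a (trm C))) = Ide C (prd_obj C a (trm C))"
      by (rule prd_joint[of _ _ a "trm C", OF _ _ _ _ _ _ terminal_unique[OF trm]]) (use a in simp_all)
    have "?l' \<cdot> pairing C (proj1 C a (trm C)) (bang C (Dom C (proj1 C a (trm C)))) = ?r'"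
      unfolding a_def by (rule trans[OF unit_sides(2)[OF o] emul_eunit(2)[OF o]]) (use o in simp_all)
    then show "?l' = ?r'" using o a by (simp add: one a_def[symmetric])
  qed
  show "enriched_category C A"
    unfolding enriched_category_def
    by (intro conjI ballI ehom ecomp eide assoc unit; use A in \<open>auto simp: extensional_ecat_def\<close>)
qed

end

text \<open>Composition is compared on elements, but identities on arrows: \<open>EIde A x\<close>
  is already the universal element for them.\<close>

locale efunctor = src: ecategory C A + tgt: ecategory C B
  for C :: "('o, 'a) cat" (structure) and A :: "('u, 'o, 'a) ecat" and B :: "('u, 'o, 'a) ecat" and F0 F1 +
  assumes F0: "x \<in> EObj A \<Longrightarrow> F0 x \<in> EObj B"
    and F1: "x \<in> EObj A \<Longrightarrow> y \<in> EObj A \<Longrightarrow> F1 x y \<in> Hom C (EHom A x y) (EHom B (F0 x) (F0 y))"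
    and F1_emul: "\<And>x y z g f. x \<in> EObj A \<Longrightarrow> y \<in> EObj A \<Longrightarrow> z \<in> EObj A \<Longrightarrow> g \<in> Arr C \<Longrightarrow> f \<in> Arr C \<Longrightarrow>
      Dom C f = Dom C g \<Longrightarrow> Cod C g = EHom A y z \<Longrightarrow> Cod C f = EHom A x y \<Longrightarrow>
      F1 x z \<cdot> emul C A x y z g f = emul C B (F0 x) (F0 y) (F0 z) (F1 y z \<cdot> g) (F1 x y \<cdot> f)"
    and F1_ide: "x \<in> EObj A \<Longrightarrow> F1 x x \<cdot> EIde A x = EIde B (F0 x)"
begin

lemma F1_arr [simp]:
  assumes "x \<in> EObj A" "y \<in> EObj A"
  shows "F1 x y \<in> Arr C" "Dom C (F1 x y) = EHom A x y" "Cod C (F1 x y) = EHom B (F0 x) (F0 y)"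
  using F1[OF assms] by (auto simp: Hom_def)

lemmas [simp] = F0

end

context finitely_complete
begin

text \<open>The diagram for composition is the elementwise law at the universal composable
  pair.\<close>

lemma enriched_functor_iff:
  assumes A: "enriched_category C (ESrc F)" and B: "enriched_category C (ETgt F)"
  shows "enriched_functor C F \<longleftrightarrow> efunctor C (ESrc F) (ETgt F) (EFObj F) (EFHom F)
     \<and> (\<forall>x. x \<notin> EObj (ESrc F) \<longrightarrow> EFObj F x = undefined)
     \<and> (\<forall>x y. \<not> (x \<in> EObj (ESrc F) \<and> y \<in> EObj (ESrc F)) \<longrightarrow> EFHom F x y = undefined)"
    (is "?L \<longleftrightarrow> ?R")
proof -
  define AA BB where "AA = ESrc F" and "BB = ETgt F"
  interpret A: ecategory C AA using A by (simp add: enriched_category_iff AA_def)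
  interpret B: ecategory C BB using B by (simp add: enriched_category_iff BB_def)
  show ?thesis
  proof
    assume L: ?L
    then have F0: "EFObj F \<in> EObj AA \<rightarrow>\<^sub>E EObj BB"
      and F1: "\<And>x y. x \<in> EObj AA \<Longrightarrow> y \<in> EObj AA \<Longrightarrow> EFHom F x y \<in> Arr C \<and> Dom C (EFHom F x y) = EHom AA x y
        \<and> Cod C (EFHom F x y) = EHom BB (EFObj F x) (EFObj F y)"
      and F2: "\<And>x y z. x \<in> EObj AA \<Longrightarrow> y \<in> EObj AA \<Longrightarrow> z \<in> EObj AA \<Longrightarrow> EFHom F x z \<cdot> EComp AA x y z
          = EComp BB (EFObj F x) (EFObj F y) (EFObj F z) \<cdot> prd_arr C (EFHom F y z) (EFHom F x y)"
      and F3: "\<And>x. x \<in> EObj AA \<Longrightarrow> EFHom F x x \<cdot> EIde AA x = EIde BB (EFObj F x)"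
      and F4: "\<forall>x y. \<not> (x \<in> EObj AA \<and> y \<in> EObj AA) \<longrightarrow> EFHom F x y = undefined"
      unfolding enriched_functor_def Let_def AA_def BB_def Hom_def by blast+
    have F0': "\<And>x. x \<in> EObj AA \<Longrightarrow> EFObj F x \<in> EObj BB" using F0 by blast
    have "efunctor C AA BB (EFObj F) (EFHom F)"
    proof
      fix x y z g f
      assume a: "x \<in> EObj AA" "y \<in> EObj AA" "z \<in> EObj AA" "g \<in> Arr C" "f \<in> Arr C"
        "Dom C f = Dom C g" "Cod C g = EHom AA y z" "Cod C f = EHom AA x y"
      show "EFHom F x z \<cdot> emul C AA x y z g f = emul C BB (EFObj F x) (EFObj F y) (EFObj F z) (EFHom F y z \<cdot> g) (EFHom F x y \<cdot> f)"
        unfolding emul_def using a F1 F0' by (simp add: reassoc[OF F2] prd_arr_pairing)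
    qed (use F0' F1 F3 in \<open>auto simp: Hom_def\<close>)
    then show ?R using F0 F4 by (auto simp: AA_def BB_def)
  next
    assume R: ?R
    then interpret F: efunctor C AA BB "EFObj F" "EFHom F" by (simp add: AA_def BB_def)
    have "EFHom F x z \<cdot> EComp AA x y z
        = EComp BB (EFObj F x) (EFObj F y) (EFObj F z) \<cdot> prd_arr C (EFHom F y z) (EFHom F x y)"
      if o: "x \<in> EObj AA" "y \<in> EObj AA" "z \<in> EObj AA" for x y z
    proof -
      have "EFHom F x z \<cdot> EComp AA x y z = emul C BB (EFObj F x) (EFObj F y) (EFObj F z)
          (EFHom F y z \<cdot> proj1 C (EHom AA y z) (EHom AA x y)) (EFHom F x y \<cdot> proj2 C (EHom AA y z) (EHom AA x y))"
        unfolding A.ecomp_eq_emul[OF o] by (rule F.F1_emul) (use o in simp_all)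
      then show ?thesis using o by (simp add: emul_def prd_arr_def)
    qed
    then show ?L
      using R F.F0 F.F1 F.F1_ide
      unfolding enriched_functor_def Let_def AA_def[symmetric] BB_def[symmetric]
      by (auto simp: PiE_iff extensional_def)
  qed
qed

end

section \<open>The category of enriched categories\<close>

text \<open>Arrows of \<open>ECat\<close> must be \<open>undefined\<close> outside the objects of
  their source; this brings raw data into that form.\<close>

definition mk_eftr :: "('u, 'o, 'a) ecat \<Rightarrow> ('u, 'o, 'a) ecat \<Rightarrow> ('u \<Rightarrow> 'u) \<Rightarrow> ('u \<Rightarrow> 'u \<Rightarrow> 'a) \<Rightarrow> ('u, 'o, 'a) eftr" where
  "mk_eftr A B F0 F1 = \<lparr>ESrc = A, ETgt = B, EFObj = (\<lambda>x\<in>EObj A. F0 x),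
     EFHom = (\<lambda>x y. if x \<in> EObj A \<and> y \<in> EObj A then F1 x y else undefined)\<rparr>"

lemma mk_eftr_simps [simp]:
  "ESrc (mk_eftr A B F0 F1) = A" "ETgt (mk_eftr A B F0 F1) = B"
  "x \<in> EObj A \<Longrightarrow> EFObj (mk_eftr A B F0 F1) x = F0 x"
  "x \<in> EObj A \<Longrightarrow> y \<in> EObj A \<Longrightarrow> EFHom (mk_eftr A B F0 F1) x y = F1 x y"
  by (simp_all add: mk_eftr_def)

lemma ECat_simps [simp]:
  "Obj (ECat small W) = small_ecats small W"
  "Dom (ECat small W) = ESrc" "Cod (ECat small W) = ETgt"
  "Ide (ECat small W) A = mk_eftr A A (\<lambda>x. x) (\<lambda>x y. Ide W (EHom A x y))"
  "G \<cdot>\<^bsub>ECat small W\<^esub> F = mk_eftr (ESrc F) (ETgt G) (\<lambda>x. EFObj G (EFObj F x))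
     (\<lambda>x y. EFHom G (EFObj F x) (EFObj F y) \<cdot>\<^bsub>W\<^esub> EFHom F x y)"
  by (simp_all add: ECat_def mk_eftr_def)

lemma eftr_eqI:
  assumes "F \<in> Arr (ECat small W)" "G \<in> Arr (ECat small W)" "ESrc F = ESrc G" "ETgt F = ETgt G"
    "\<And>x. x \<in> EObj (ESrc F) \<Longrightarrow> EFObj F x = EFObj G x"
    "\<And>x y. x \<in> EObj (ESrc F) \<Longrightarrow> y \<in> EObj (ESrc F) \<Longrightarrow> EFHom F x y = EFHom G x y"
  shows "F = G"
proof -
  have "EFObj F = EFObj G"
    using assms(1-5) by (auto simp: ECat_def enriched_functor_def Let_def PiE_iff extensional_def fun_eq_iff) metis
  moreover have "EFHom F = EFHom G"
    using assms(1-4,6) by (auto simp: ECat_def enriched_functor_def Let_def fun_eq_iff) metis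
  ultimately show ?thesis using assms(3,4) by simp
qed

context finitely_complete
begin

lemma small_ecats_iff: "A \<in> small_ecats small C \<longleftrightarrow> ecategory C A \<and> extensional_ecat A \<and> small (EObj A)"
  by (simp add: small_ecats_def enriched_category_iff)

lemma ECat_arrD:
  assumes "F \<in> Arr (ECat small C)"
  shows "efunctor C (ESrc F) (ETgt F) (EFObj F) (EFHom F)" "ESrc F \<in> small_ecats small C" "ETgt F \<in> small_ecats small C"
  using assms enriched_functor_iff[of F] by (auto simp: ECat_def small_ecats_def)

lemma ECat_arrI:
  assumes "efunctor C A B F0 F1" "A \<in> small_ecats small C" "B \<in> small_ecats small C"
  shows "mk_eftr A B F0 F1 \<in> Arr (ECat small C)"
proof -
  interpret F: efunctor C A B F0 F1 by fact
  have "efunctor C A B (\<lambda>x\<in>EObj A. F0 x) (\<lambda>x y. if x \<in> EObj A \<and> y \<in> EObj A then F1 x y else undefined)"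
    by unfold_locales (use F.F0 F.F1 F.F1_emul F.F1_ide in auto)
  then have "enriched_functor C (mk_eftr A B F0 F1)"
    using assms(2,3) by (subst enriched_functor_iff) (auto simp: mk_eftr_def small_ecats_def)
  then show ?thesis using assms(2,3) by (simp add: ECat_def)
qed

lemma efunctor_id:
  assumes "ecategory C A"
  shows "efunctor C A A (\<lambda>x. x) (\<lambda>x y. Ide C (EHom A x y))"
proof -
  interpret A: ecategory C A by fact
  show ?thesis by unfold_locales (auto simp: Hom_def)
qed

lemma efunctor_comp:
  assumes "efunctor C A B F0 F1" "efunctor C B D G0 G1"
  shows "efunctor C A D (\<lambda>x. G0 (F0 x)) (\<lambda>x y. G1 (F0 x) (F0 y) \<cdot> F1 x y)"
proof -
  interpret F: efunctor C A B F0 F1 by fact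
  interpret G: efunctor C B D G0 G1 by fact
  show ?thesis
  proof
    fix x y z g f
    assume a: "x \<in> EObj A" "y \<in> EObj A" "z \<in> EObj A" "g \<in> Arr C" "f \<in> Arr C"
        "Dom C f = Dom C g" "Cod C g = EHom A y z" "Cod C f = EHom A x y"
    have "(G1 (F0 x) (F0 z) \<cdot> F1 x z) \<cdot> emul C A x y z g f = G1 (F0 x) (F0 z) \<cdot> (F1 x z \<cdot> emul C A x y z g f)"
      using a by simp
    also have "\<dots> = emul C D (G0 (F0 x)) (G0 (F0 y)) (G0 (F0 z)) (G1 (F0 y) (F0 z) \<cdot> (F1 y z \<cdot> g)) (G1 (F0 x) (F0 y) \<cdot> (F1 x y \<cdot> f))"
      unfolding F.F1_emul[OF a] by (rule G.F1_emul) (use a in simp_all)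
    finally show "(G1 (F0 x) (F0 z) \<cdot> F1 x z) \<cdot> emul C A x y z g f
      = emul C D (G0 (F0 x)) (G0 (F0 y)) (G0 (F0 z)) ((G1 (F0 y) (F0 z) \<cdot> F1 y z) \<cdot> g) ((G1 (F0 x) (F0 y) \<cdot> F1 x y) \<cdot> f)"
      using a by simp
  next
    fix x assume a: "x \<in> EObj A"
    then have "(G1 (F0 x) (F0 x) \<cdot> F1 x x) \<cdot> EIde A x = G1 (F0 x) (F0 x) \<cdot> (F1 x x \<cdot> EIde A x)" by simp
    then show "(G1 (F0 x) (F0 x) \<cdot> F1 x x) \<cdot> EIde A x = EIde D (G0 (F0 x))"
      using a by (simp add: F.F1_ide G.F1_ide)
  qed (auto simp: Hom_def)
qed

lemma ECat_comp_arr: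
  assumes "F \<in> Arr (ECat small C)" "G \<in> Arr (ECat small C)" "ESrc G = ETgt F"
  shows "G \<cdot>\<^bsub>ECat small C\<^esub> F \<in> Arr (ECat small C)"
  unfolding ECat_simps
  by (rule ECat_arrI[OF efunctor_comp]) (use ECat_arrD[OF assms(1)] ECat_arrD[OF assms(2)] assms(3) in auto)

lemma ECat_ide_arr: "A \<in> small_ecats small C \<Longrightarrow> Ide (ECat small C) A \<in> Arr (ECat small C)"
  unfolding ECat_simps by (rule ECat_arrI[OF efunctor_id]) (auto simp: small_ecats_iff)

lemma category_ECat: "category (ECat small C)"
proof
  fix F A B G X H Y
  assume F: "F \<in> Hom (ECat small C) A B"
  then have F': "F \<in> Arr (ECat small C)" "ESrc F = A" "ETgt F = B" by (auto simp: Hom_def)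
  interpret F: efunctor C A B "EFObj F" "EFHom F" using ECat_arrD[OF F'(1)] F' by simp
  have AB: "A \<in> small_ecats small C" "B \<in> small_ecats small C" using ECat_arrD[OF F'(1)] F' by auto
  have "F \<cdot>\<^bsub>ECat small C\<^esub> Ide (ECat small C) A \<in> Arr (ECat small C)"
    "Ide (ECat small C) B \<cdot>\<^bsub>ECat small C\<^esub> F \<in> Arr (ECat small C)"
    using ECat_comp_arr[OF ECat_ide_arr[OF AB(1)] F'(1)] ECat_comp_arr[OF F'(1) ECat_ide_arr[OF AB(2)]] F'(2,3)
    by simp_all
  then show "F \<cdot>\<^bsub>ECat small C\<^esub> Ide (ECat small C) A = F" "Ide (ECat small C) B \<cdot>\<^bsub>ECat small C\<^esub> F = F"
    using F' by - (rule eftr_eqI; simp)+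
  assume G: "G \<in> Hom (ECat small C) B X"
  then have G': "G \<in> Arr (ECat small C)" "ESrc G = B" "ETgt G = X" by (auto simp: Hom_def)
  interpret G: efunctor C B X "EFObj G" "EFHom G" using ECat_arrD[OF G'(1)] G' by simp
  have X: "X \<in> small_ecats small C" using ECat_arrD[OF G'(1)] G' by auto
  have GF: "G \<cdot>\<^bsub>ECat small C\<^esub> F \<in> Arr (ECat small C)"
    using F' G' by (intro ECat_comp_arr) auto
  then show "G \<cdot>\<^bsub>ECat small C\<^esub> F \<in> Hom (ECat small C) A X"
    using F' G' by (simp add: Hom_def)
  assume H: "H \<in> Hom (ECat small C) X Y"
  then have H': "H \<in> Arr (ECat small C)" "ESrc H = X" "ETgt H = Y" by (auto simp: Hom_def)
  interpret H: efunctor C X Y "EFObj H" "EFHom H" using ECat_arrD[OF H'(1)] H' by simp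
  have Y: "Y \<in> small_ecats small C" using ECat_arrD[OF H'(1)] H' by auto
  show "(H \<cdot>\<^bsub>ECat small C\<^esub> G) \<cdot>\<^bsub>ECat small C\<^esub> F = H \<cdot>\<^bsub>ECat small C\<^esub> (G \<cdot>\<^bsub>ECat small C\<^esub> F)"
    using F' G' H' by (simp add: mk_eftr_def restrict_def fun_eq_iff)
next
  fix F assume "F \<in> Arr (ECat small C)"
  then show "Dom (ECat small C) F \<in> Obj (ECat small C)" "Cod (ECat small C) F \<in> Obj (ECat small C)"
    using ECat_arrD(2,3) by auto
next
  fix A assume "A \<in> Obj (ECat small C)"
  then show "Ide (ECat small C) A \<in> Hom (ECat small C) A A"
    by (auto simp: Hom_def small_ecats_iff intro!: ECat_arrI efunctor_id)
qed

section \<open>Pullbacks of enriched categories\<close>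

lemma ecat_arr_cases:
  assumes "F \<in> Arr (ECat small C)" "ESrc F = A" "ETgt F = B"
  shows "efunctor C A B (EFObj F) (EFHom F)" "A \<in> small_ecats small C" "B \<in> small_ecats small C"
  using ECat_arrD[OF assms(1)] assms by auto

text \<open>An explicit form of pullbacks: on objects in sets, on hom-objects in the base category.
  Unlike the universal property it can be carried along a change of base, and it yields pullback
  squares of hom-objects.\<close>

definition hom_pullback :: "('u, 'a, 'b) eftr \<Rightarrow> ('u, 'a, 'b) eftr \<Rightarrow> ('u, 'a, 'b) eftr \<Rightarrow> ('u, 'a, 'b) eftr \<Rightarrow> bool" where
  "hom_pullback F G Q R \<longleftrightarrow>
     ESrc R = ESrc Q \<and> ETgt Q = ESrc F \<and> ETgt R = ESrc G
     \<and> (\<forall>z\<in>EObj (ESrc Q). EFObj F (EFObj Q z) = EFObj G (EFObj R z))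
     \<and> (\<forall>a\<in>EObj (ESrc F). \<forall>b\<in>EObj (ESrc G). EFObj F a = EFObj G b \<longrightarrow>
          (\<exists>!z. z \<in> EObj (ESrc Q) \<and> EFObj Q z = a \<and> EFObj R z = b))
     \<and> (\<forall>z\<in>EObj (ESrc Q). \<forall>z'\<in>EObj (ESrc Q).
          is_pullback C (EFHom F (EFObj Q z) (EFObj Q z')) (EFHom G (EFObj R z) (EFObj R z')) (EFHom Q z z') (EFHom R z z'))"

text \<open>The mediating functor is given on objects and on each hom-object by the respective
  universal property. It preserves composition and identities because \<open>Q\<close> and
  \<open>R\<close> do and are jointly monic on hom-objects.\<close>

lemma hom_pullback_imp_pullback:
  assumes FG: "F \<in> Arr (ECat small C)" "G \<in> Arr (ECat small C)" "ETgt F = ETgt G"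
    and QR: "Q \<in> Arr (ECat small C)" "R \<in> Arr (ECat small C)" "hom_pullback F G Q R"
  shows "is_pullback (ECat small C) F G Q R"
proof -
  interpret E: category "ECat small C" by (rule category_ECat)
  define A B X P where "A = ESrc F" and "B = ESrc G" and "X = ETgt F" and "P = ESrc Q"
  have o: "ESrc F = A" "ESrc G = B" "ETgt F = X" "ETgt G = X" "ESrc Q = P" "ESrc R = P" "ETgt Q = A" "ETgt R = B"
    using FG(3) QR(3) by (auto simp: A_def B_def X_def P_def hom_pullback_def)
  interpret F: efunctor C A X "EFObj F" "EFHom F" using ecat_arr_cases[OF FG(1)] o by simp
  interpret G: efunctor C B X "EFObj G" "EFHom G" using ecat_arr_cases[OF FG(2)] o by simp
  interpret Q: efunctor C P A "EFObj Q" "EFHom Q" using ecat_arr_cases[OF QR(1)] o by simp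
  interpret R: efunctor C P B "EFObj R" "EFHom R" using ecat_arr_cases[OF QR(2)] o by simp
  have P: "P \<in> small_ecats small C" using ecat_arr_cases[OF QR(1)] o by auto
  have sq: "\<And>z. z \<in> EObj P \<Longrightarrow> EFObj F (EFObj Q z) = EFObj G (EFObj R z)"
    and ob: "\<And>a b. a \<in> EObj A \<Longrightarrow> b \<in> EObj B \<Longrightarrow> EFObj F a = EFObj G b \<Longrightarrow>
          \<exists>!z. z \<in> EObj P \<and> EFObj Q z = a \<and> EFObj R z = b"
    and hp: "\<And>z z'. z \<in> EObj P \<Longrightarrow> z' \<in> EObj P \<Longrightarrow> is_pullback C (EFHom F (EFObj Q z) (EFObj Q z')) (EFHom G (EFObj R z) (EFObj R z')) (EFHom Q z z') (EFHom R z z')"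
    using QR(3) unfolding hom_pullback_def o by blast+
  note joint = pullback_unique[OF hp]
  show ?thesis
  proof (rule E.pullbackI)
    show "F \<cdot>\<^bsub>ECat small C\<^esub> Q = G \<cdot>\<^bsub>ECat small C\<^esub> R"
    proof (rule eftr_eqI[of _ small C])
      fix x y assume "x \<in> EObj (ESrc (F \<cdot>\<^bsub>ECat small C\<^esub> Q))" "y \<in> EObj (ESrc (F \<cdot>\<^bsub>ECat small C\<^esub> Q))"
      then show "EFHom (F \<cdot>\<^bsub>ECat small C\<^esub> Q) x y = EFHom (G \<cdot>\<^bsub>ECat small C\<^esub> R) x y"
        using pullbackD(6)[OF hp] o by simp
    next
      show "F \<cdot>\<^bsub>ECat small C\<^esub> Q \<in> Arr (ECat small C)" "G \<cdot>\<^bsub>ECat small C\<^esub> R \<in> Arr (ECat small C)"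
        by (rule ECat_comp_arr; use FG QR o in simp)+
    qed (use o sq in simp_all)
    fix U V
    assume UV: "U \<in> Arr (ECat small C)" "V \<in> Arr (ECat small C)" "Dom (ECat small C) V = Dom (ECat small C) U"
      "Cod (ECat small C) U = Dom (ECat small C) F" "Cod (ECat small C) V = Dom (ECat small C) G"
      and eq: "F \<cdot>\<^bsub>ECat small C\<^esub> U = G \<cdot>\<^bsub>ECat small C\<^esub> V"
    define Y where "Y = ESrc U"
    have o': "ESrc U = Y" "ESrc V = Y" "ETgt U = A" "ETgt V = B" using UV(3-5) o by (auto simp: Y_def)
    interpret U: efunctor C Y A "EFObj U" "EFHom U" using ecat_arr_cases[OF UV(1)] o' by simp
    interpret V: efunctor C Y B "EFObj V" "EFHom V" using ecat_arr_cases[OF UV(2)] o' by simp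
    have Y: "Y \<in> small_ecats small C" using ecat_arr_cases[OF UV(1)] o' by auto
    have eq0: "EFObj F (EFObj U y) = EFObj G (EFObj V y)" if "y \<in> EObj Y" for y
      using arg_cong[OF eq, of "\<lambda>H. EFObj H y"] that o' by simp
    have eq1: "EFHom F (EFObj U y) (EFObj U y') \<cdot> EFHom U y y' = EFHom G (EFObj V y) (EFObj V y') \<cdot> EFHom V y y'"
      if "y \<in> EObj Y" "y' \<in> EObj Y" for y y'
      using arg_cong[OF eq, of "\<lambda>H. EFHom H y y'"] that o' by simp
    have "\<forall>y\<in>EObj Y. \<exists>z. z \<in> EObj P \<and> EFObj Q z = EFObj U y \<and> EFObj R z = EFObj V y"
      using ob eq0 U.F0 V.F0 by blast
    then obtain H0 where H0: "\<And>y. y \<in> EObj Y \<Longrightarrow> H0 y \<in> EObj P" "\<And>y. y \<in> EObj Y \<Longrightarrow> EFObj Q (H0 y) = EFObj U y"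
      "\<And>y. y \<in> EObj Y \<Longrightarrow> EFObj R (H0 y) = EFObj V y" by metis
    have "\<exists>h. h \<in> Arr C \<and> Dom C h = EHom Y y y' \<and> Cod C h = EHom P (H0 y) (H0 y')
      \<and> EFHom Q (H0 y) (H0 y') \<cdot> h = EFHom U y y' \<and> EFHom R (H0 y) (H0 y') \<cdot> h = EFHom V y y'"
      if y: "y \<in> EObj Y" "y' \<in> EObj Y" for y y'
      using pullback_ex[OF hp[OF H0(1)[OF y(1)] H0(1)[OF y(2)]], of "EFHom U y y'" "EFHom V y y'" "EHom Y y y'"]
        y H0 eq1[OF y] by simp
    then obtain H1 where H1: "\<And>y y'. y \<in> EObj Y \<Longrightarrow> y' \<in> EObj Y \<Longrightarrow> H1 y y' \<in> Arr C \<and> Dom C (H1 y y') = EHom Y y y'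
      \<and> Cod C (H1 y y') = EHom P (H0 y) (H0 y')
      \<and> EFHom Q (H0 y) (H0 y') \<cdot> H1 y y' = EFHom U y y' \<and> EFHom R (H0 y) (H0 y') \<cdot> H1 y y' = EFHom V y y'" by metis
    have H1a: "H1 y y' \<in> Arr C" "Dom C (H1 y y') = EHom Y y y'" "Cod C (H1 y y') = EHom P (H0 y) (H0 y')"
      "EFHom Q (H0 y) (H0 y') \<cdot> H1 y y' = EFHom U y y'" "EFHom R (H0 y) (H0 y') \<cdot> H1 y y' = EFHom V y y'"
      if "y \<in> EObj Y" "y' \<in> EObj Y" for y y' using H1[OF that] by auto
    have H: "efunctor C Y P H0 H1"
    proof
      fix x y z g f
      assume a: "x \<in> EObj Y" "y \<in> EObj Y" "z \<in> EObj Y" "g \<in> Arr C" "f \<in> Arr C"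
        "Dom C f = Dom C g" "Cod C g = EHom Y y z" "Cod C f = EHom Y x y"
      note h = H0(1)[OF a(1)] H0(1)[OF a(2)] H0(1)[OF a(3)]
      note gH = H1a[OF a(2,3)] and fH = H1a[OF a(1,2)] and gfH = H1a[OF a(1,3)]
      let ?gf = "emul C Y x y z g f"
      have e: "?gf \<in> Arr C" "Dom C ?gf = Dom C g" "Cod C ?gf = EHom Y x z" using a by simp_all
      have Hg: "H1 y z \<cdot> g \<in> Arr C" "Dom C (H1 y z \<cdot> g) = Dom C g" "Cod C (H1 y z \<cdot> g) = EHom P (H0 y) (H0 z)"
        and Hf: "H1 x y \<cdot> f \<in> Arr C" "Dom C (H1 x y \<cdot> f) = Dom C g" "Cod C (H1 x y \<cdot> f) = EHom P (H0 x) (H0 y)"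
        using a gH(1-3) fH(1-3) by simp_all
      have Hfg: "Dom C (H1 x y \<cdot> f) = Dom C (H1 y z \<cdot> g)" using Hg Hf by simp
      let ?HH = "emul C P (H0 x) (H0 y) (H0 z) (H1 y z \<cdot> g) (H1 x y \<cdot> f)"
      show "H1 x z \<cdot> ?gf = ?HH"
      proof (rule joint[OF h(1,3)])
        have "EFHom Q (H0 x) (H0 z) \<cdot> (H1 x z \<cdot> ?gf) = EFHom U x z \<cdot> ?gf"
          using h gfH(1-3) e by (simp add: reassoc[OF gfH(4)])
        also have "\<dots> = emul C A (EFObj U x) (EFObj U y) (EFObj U z) (EFHom U y z \<cdot> g) (EFHom U x y \<cdot> f)"
          by (rule U.F1_emul[OF a])
        also have "\<dots> = EFHom Q (H0 x) (H0 z) \<cdot> ?HH"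
          unfolding Q.F1_emul[OF h Hg(1) Hf(1) Hfg Hg(3) Hf(3)]
          using h a gH(1-3) fH(1-3) by (simp add: reassoc[OF gH(4)] reassoc[OF fH(4)] H0)
        finally show "EFHom Q (H0 x) (H0 z) \<cdot> (H1 x z \<cdot> ?gf) = EFHom Q (H0 x) (H0 z) \<cdot> ?HH" .
        have "EFHom R (H0 x) (H0 z) \<cdot> (H1 x z \<cdot> ?gf) = EFHom V x z \<cdot> ?gf"
          using h gfH(1-3) e by (simp add: reassoc[OF gfH(5)])
        also have "\<dots> = emul C B (EFObj V x) (EFObj V y) (EFObj V z) (EFHom V y z \<cdot> g) (EFHom V x y \<cdot> f)"
          by (rule V.F1_emul[OF a])
        also have "\<dots> = EFHom R (H0 x) (H0 z) \<cdot> ?HH"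
          unfolding R.F1_emul[OF h Hg(1) Hf(1) Hfg Hg(3) Hf(3)]
          using h a gH(1-3) fH(1-3) by (simp add: reassoc[OF gH(5)] reassoc[OF fH(5)] H0)
        finally show "EFHom R (H0 x) (H0 z) \<cdot> (H1 x z \<cdot> ?gf) = EFHom R (H0 x) (H0 z) \<cdot> ?HH" .
      qed (use h e Hg Hf gfH(1-3) in simp_all)
    next
      fix x assume x: "x \<in> EObj Y"
      note h = H0(1)[OF x] and H = H1a[OF x x]
      show "H1 x x \<cdot> EIde Y x = EIde P (H0 x)"
      proof (rule joint[OF h h])
        show "EFHom Q (H0 x) (H0 x) \<cdot> (H1 x x \<cdot> EIde Y x) = EFHom Q (H0 x) (H0 x) \<cdot> EIde P (H0 x)"
          using x h H(1-3) by (simp add: reassoc[OF H(4)] U.F1_ide Q.F1_ide H0)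
        show "EFHom R (H0 x) (H0 x) \<cdot> (H1 x x \<cdot> EIde Y x) = EFHom R (H0 x) (H0 x) \<cdot> EIde P (H0 x)"
          using x h H(1-3) by (simp add: reassoc[OF H(5)] V.F1_ide R.F1_ide H0)
      qed (use x h H(1-3) in simp_all)
    qed (use H0 H1a in \<open>auto simp: Hom_def\<close>)
    interpret H: efunctor C Y P H0 H1 by (rule H)
    let ?H = "mk_eftr Y P H0 H1"
    have HA: "?H \<in> Arr (ECat small C)" by (rule ECat_arrI[OF H Y P])
    have "Q \<cdot>\<^bsub>ECat small C\<^esub> ?H = U"
    proof (rule eftr_eqI[of _ small C])
      show "Q \<cdot>\<^bsub>ECat small C\<^esub> ?H \<in> Arr (ECat small C)" by (rule E.comp_arr(1)[OF HA QR(1)]) (simp add: o)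
    qed (use UV o o' H0 H1a in simp_all)
    moreover have "R \<cdot>\<^bsub>ECat small C\<^esub> ?H = V"
    proof (rule eftr_eqI[of _ small C])
      show "R \<cdot>\<^bsub>ECat small C\<^esub> ?H \<in> Arr (ECat small C)" by (rule E.comp_arr(1)[OF HA QR(2)]) (simp add: o)
    qed (use UV o o' H0 H1a in simp_all)
    ultimately show "\<exists>h. h \<in> Arr (ECat small C) \<and> Dom (ECat small C) h = Dom (ECat small C) U \<and>
        Cod (ECat small C) h = Dom (ECat small C) Q \<and> Q \<cdot>\<^bsub>ECat small C\<^esub> h = U \<and> R \<cdot>\<^bsub>ECat small C\<^esub> h = V"
      using HA o o' by (intro exI[of _ ?H]) (simp del: ECat_simps(5))
  next
    fix H H'
    assume HH: "H \<in> Arr (ECat small C)" "H' \<in> Arr (ECat small C)" "Dom (ECat small C) H' = Dom (ECat small C) H"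
      "Cod (ECat small C) H = Dom (ECat small C) Q" "Cod (ECat small C) H' = Dom (ECat small C) Q"
      and eq: "Q \<cdot>\<^bsub>ECat small C\<^esub> H = Q \<cdot>\<^bsub>ECat small C\<^esub> H'" "R \<cdot>\<^bsub>ECat small C\<^esub> H = R \<cdot>\<^bsub>ECat small C\<^esub> H'"
    define Y where "Y = ESrc H"
    have o': "ESrc H = Y" "ESrc H' = Y" "ETgt H = P" "ETgt H' = P" using HH(3-5) o by (auto simp: Y_def)
    interpret H: efunctor C Y P "EFObj H" "EFHom H" using ecat_arr_cases[OF HH(1)] o' by simp
    interpret H': efunctor C Y P "EFObj H'" "EFHom H'" using ecat_arr_cases[OF HH(2)] o' by simp
    have e0: "EFObj H y = EFObj H' y" if y: "y \<in> EObj Y" for y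
    proof -
      have "EFObj Q (EFObj H y) = EFObj Q (EFObj H' y)" "EFObj R (EFObj H y) = EFObj R (EFObj H' y)"
        using arg_cong[OF eq(1), of "\<lambda>H. EFObj H y"] arg_cong[OF eq(2), of "\<lambda>H. EFObj H y"] y o' by simp_all
      then show ?thesis
        using ob[of "EFObj Q (EFObj H y)" "EFObj R (EFObj H y)"] sq[of "EFObj H y"] H.F0[OF y] H'.F0[OF y] by auto
    qed
    show "H = H'"
    proof (rule eftr_eqI[OF HH(1,2)])
      fix x y assume "x \<in> EObj (ESrc H)" "y \<in> EObj (ESrc H)"
      then have xy: "x \<in> EObj Y" "y \<in> EObj Y" using o' by auto
      show "EFHom H x y = EFHom H' x y"
      proof (rule joint[OF H.F0[OF xy(1)] H.F0[OF xy(2)]])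
        show "EFHom Q (EFObj H x) (EFObj H y) \<cdot> EFHom H x y = EFHom Q (EFObj H x) (EFObj H y) \<cdot> EFHom H' x y"
          using arg_cong[OF eq(1), of "\<lambda>H. EFHom H x y"] xy o' e0 by simp
        show "EFHom R (EFObj H x) (EFObj H y) \<cdot> EFHom H x y = EFHom R (EFObj H x) (EFObj H y) \<cdot> EFHom H' x y"
          using arg_cong[OF eq(2), of "\<lambda>H. EFHom H x y"] xy o' e0 by simp
      qed (use xy e0[symmetric] in simp_all)
    qed (use o' e0 in auto)
  qed (use QR o in auto)
qed

end

text \<open>Objects and indices must be elements of \<open>'u\<close>, which pairs are not. The
  injection \<open>h\<close> codes the pairs needed for a pullback by elements of
  \<open>'u\<close>.\<close>

lemma set_universe_pairs:
  assumes "set_universe small" "small A" "small B"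
  shows "\<exists>h. inj_on h (Sigma A (\<lambda>a. {b \<in> B. R a b})) \<and> small (h ` Sigma A (\<lambda>a. {b \<in> B. R a b}))"
  using set_universe.small_Sigma[OF assms(1,2), of "\<lambda>a. {b \<in> B. R a b}"]
    set_universe.small_subset[OF assms(1,3)] by auto

context finitely_complete
begin

text \<open>The vertex \<open>P\<close> has codes of compatible pairs as objects and pullbacks as
  hom-objects, with composition and identities induced from \<open>A\<close> and \<open>B\<close>.
  The legs turn each law in \<open>P\<close> into the same law in \<open>A\<close> and in
  \<open>B\<close>, and they are jointly monic.\<close>

lemma hom_pullback_ex:
  assumes small: "set_universe small"
    and FG: "F \<in> Arr (ECat small C)" "G \<in> Arr (ECat small C)" "ETgt F = ETgt G"
  shows "\<exists>Q R. Q \<in> Arr (ECat small C) \<and> R \<in> Arr (ECat small C) \<and> hom_pullback F G Q R"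
proof -
  define A B X where "A = ESrc F" and "B = ESrc G" and "X = ETgt F"
  have o: "ESrc F = A" "ESrc G = B" "ETgt F = X" "ETgt G = X"
    using FG(3) by (auto simp: A_def B_def X_def)
  interpret F: efunctor C A X "EFObj F" "EFHom F" using ecat_arr_cases[OF FG(1)] o by simp
  interpret G: efunctor C B X "EFObj G" "EFHom G" using ecat_arr_cases[OF FG(2)] o by simp
  have AB: "A \<in> small_ecats small C" "B \<in> small_ecats small C"
    using ecat_arr_cases[OF FG(1)] ecat_arr_cases[OF FG(2)] o by auto
  let ?D = "Sigma (EObj A) (\<lambda>a. {b \<in> EObj B. EFObj F a = EFObj G b})"
  obtain e where e: "inj_on e ?D" "small (e ` ?D)"
    using set_universe_pairs[OF small, of "EObj A" "EObj B" "\<lambda>a b. EFObj F a = EFObj G b"] AB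
    by (auto simp: small_ecats_iff)
  define Z where "Z = e ` ?D"
  \<comment> \<open>These decode an object of the pullback into its two components.\<close>
  define d1 d2 where "d1 z = fst (inv_into ?D e z)" and "d2 z = snd (inv_into ?D e z)" for z
  have d: "d1 z \<in> EObj A" "d2 z \<in> EObj B" "EFObj F (d1 z) = EFObj G (d2 z)" "e (d1 z, d2 z) = z" if "z \<in> Z" for z
  proof -
    have "inv_into ?D e z \<in> ?D" "e (inv_into ?D e z) = z"
      using that unfolding Z_def by (auto intro: inv_into_into f_inv_into_f)
    then show "d1 z \<in> EObj A" "d2 z \<in> EObj B" "EFObj F (d1 z) = EFObj G (d2 z)" "e (d1 z, d2 z) = z"
      unfolding d1_def d2_def by (auto simp: mem_Sigma_iff split: prod.splits)
  qed
  have ed: "e (a, b) \<in> Z" "d1 (e (a, b)) = a" "d2 (e (a, b)) = b"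
    if "a \<in> EObj A" "b \<in> EObj B" "EFObj F a = EFObj G b" for a b
  proof -
    have ab: "(a, b) \<in> ?D" using that by simp
    then show "e (a, b) \<in> Z" unfolding Z_def by blast
    show "d1 (e (a, b)) = a" "d2 (e (a, b)) = b"
      unfolding d1_def d2_def by (simp_all only: inv_into_f_f[OF e(1) ab] fst_conv snd_conv)
  qed
  have "\<exists>q r. is_pullback C (EFHom F (d1 z) (d1 z')) (EFHom G (d2 z) (d2 z')) q r" if "z \<in> Z" "z' \<in> Z" for z z'
    using pbs that d unfolding has_pullbacks_def by simp
  then obtain q r where qr: "\<And>z z'. z \<in> Z \<Longrightarrow> z' \<in> Z \<Longrightarrow>
      is_pullback C (EFHom F (d1 z) (d1 z')) (EFHom G (d2 z) (d2 z')) (q z z') (r z z')" by metis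
  have q: "q z z' \<in> Arr C" "Cod C (q z z') = EHom A (d1 z) (d1 z')" "r z z' \<in> Arr C" "Dom C (r z z') = Dom C (q z z')"
      "Cod C (r z z') = EHom B (d2 z) (d2 z')" 
      "EFHom F (d1 z) (d1 z') \<cdot> q z z' = EFHom G (d2 z) (d2 z') \<cdot> r z z'" if "z \<in> Z" "z' \<in> Z" for z z'
    using pullbackD[OF qr[OF that]] d that by auto
  note joint = pullback_unique[OF qr]
  let ?p1 = "\<lambda>x y z. proj1 C (Dom C (q y z)) (Dom C (q x y))" and ?p2 = "\<lambda>x y z. proj2 C (Dom C (q y z)) (Dom C (q x y))"
  \<comment> \<open>Composition in \<open>P\<close> is induced by the composites, in
    \<open>A\<close> and in \<open>B\<close>, of the universal composable pair; they agree after
    \<open>F\<close> and \<open>G\<close> because both functors preserve composition.\<close>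
  have "\<exists>c. c \<in> Arr C \<and> Dom C c = prd_obj C (Dom C (q y z)) (Dom C (q x y)) \<and> Cod C c = Dom C (q x z)
    \<and> q x z \<cdot> c = emul C A (d1 x) (d1 y) (d1 z) (q y z \<cdot> ?p1 x y z) (q x y \<cdot> ?p2 x y z)
    \<and> r x z \<cdot> c = emul C B (d2 x) (d2 y) (d2 z) (r y z \<cdot> ?p1 x y z) (r x y \<cdot> ?p2 x y z)"
    if z: "x \<in> Z" "y \<in> Z" "z \<in> Z" for x y z
  proof (rule pullback_ex[OF qr[OF z(1,3)]])
    have "?p1 x y z \<in> Arr C" "?p2 x y z \<in> Arr C" "Dom C (?p1 x y z) = prd_obj C (Dom C (q y z)) (Dom C (q x y))"
      "Dom C (?p2 x y z) = prd_obj C (Dom C (q y z)) (Dom C (q x y))"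
      "Cod C (?p1 x y z) = Dom C (q y z)" "Cod C (?p2 x y z) = Dom C (q x y)"
      using q z by simp_all
    note P = this
    note d = d[OF z(1)] d[OF z(2)] d[OF z(3)] and qx = q[OF z(1,2)] q[OF z(2,3)] q[OF z(1,3)]
    show "EFHom F (d1 x) (d1 z) \<cdot> emul C A (d1 x) (d1 y) (d1 z) (q y z \<cdot> ?p1 x y z) (q x y \<cdot> ?p2 x y z)
      = EFHom G (d2 x) (d2 z) \<cdot> emul C B (d2 x) (d2 y) (d2 z) (r y z \<cdot> ?p1 x y z) (r x y \<cdot> ?p2 x y z)"
      using P d qx(1-5,7-11)
      by (simp add: F.F1_emul G.F1_emul reassoc[OF qx(6)] reassoc[OF qx(12)])
    show "emul C A (d1 x) (d1 y) (d1 z) (q y z \<cdot> ?p1 x y z) (q x y \<cdot> ?p2 x y z) \<in> Arr C"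
      "emul C B (d2 x) (d2 y) (d2 z) (r y z \<cdot> ?p1 x y z) (r x y \<cdot> ?p2 x y z) \<in> Arr C"
      using P d qx(1-5,7-11) by simp_all
    show "Dom C (emul C A (d1 x) (d1 y) (d1 z) (q y z \<cdot> ?p1 x y z) (q x y \<cdot> ?p2 x y z)) = prd_obj C (Dom C (q y z)) (Dom C (q x y))"
      "Dom C (emul C B (d2 x) (d2 y) (d2 z) (r y z \<cdot> ?p1 x y z) (r x y \<cdot> ?p2 x y z)) = prd_obj C (Dom C (q y z)) (Dom C (q x y))"
      using P d qx(1-5,7-11) by simp_all
    show "Cod C (emul C A (d1 x) (d1 y) (d1 z) (q y z \<cdot> ?p1 x y z) (q x y \<cdot> ?p2 x y z)) = Dom C (EFHom F (d1 x) (d1 z))"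
      "Cod C (emul C B (d2 x) (d2 y) (d2 z) (r y z \<cdot> ?p1 x y z) (r x y \<cdot> ?p2 x y z)) = Dom C (EFHom G (d2 x) (d2 z))"
      using P d qx(1-5,7-11) by simp_all
  qed
  then obtain c where c0: "\<And>x y z. x \<in> Z \<Longrightarrow> y \<in> Z \<Longrightarrow> z \<in> Z \<Longrightarrow>
    c x y z \<in> Arr C \<and> Dom C (c x y z) = prd_obj C (Dom C (q y z)) (Dom C (q x y)) \<and> Cod C (c x y z) = Dom C (q x z)
    \<and> q x z \<cdot> c x y z = emul C A (d1 x) (d1 y) (d1 z) (q y z \<cdot> ?p1 x y z) (q x y \<cdot> ?p2 x y z)
    \<and> r x z \<cdot> c x y z = emul C B (d2 x) (d2 y) (d2 z) (r y z \<cdot> ?p1 x y z) (r x y \<cdot> ?p2 x y z)" by metis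
  have c: "c x y z \<in> Arr C" "Dom C (c x y z) = prd_obj C (Dom C (q y z)) (Dom C (q x y))" "Cod C (c x y z) = Dom C (q x z)"
    "q x z \<cdot> c x y z = emul C A (d1 x) (d1 y) (d1 z) (q y z \<cdot> ?p1 x y z) (q x y \<cdot> ?p2 x y z)"
    "r x z \<cdot> c x y z = emul C B (d2 x) (d2 y) (d2 z) (r y z \<cdot> ?p1 x y z) (r x y \<cdot> ?p2 x y z)"
    if "x \<in> Z" "y \<in> Z" "z \<in> Z" for x y z using c0[OF that] by auto
  have "\<exists>i. i \<in> Arr C \<and> Dom C i = trm C \<and> Cod C i = Dom C (q x x) \<and> q x x \<cdot> i = EIde A (d1 x) \<and> r x x \<cdot> i = EIde B (d2 x)"
    if x: "x \<in> Z" for x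
    using pullback_ex[OF qr[OF x x], of "EIde A (d1 x)" "EIde B (d2 x)" "trm C"] d[OF x] F.F1_ide G.F1_ide by simp
  then obtain i where i0: "\<And>x. x \<in> Z \<Longrightarrow> i x \<in> Arr C \<and> Dom C (i x) = trm C \<and> Cod C (i x) = Dom C (q x x)
      \<and> q x x \<cdot> i x = EIde A (d1 x) \<and> r x x \<cdot> i x = EIde B (d2 x)" by metis
  have i: "i x \<in> Arr C" "Dom C (i x) = trm C" "Cod C (i x) = Dom C (q x x)" "q x x \<cdot> i x = EIde A (d1 x)" "r x x \<cdot> i x = EIde B (d2 x)"
    if "x \<in> Z" for x using i0[OF that] by auto
  define P where "P = \<lparr>EObj = Z, EHom = (\<lambda>x y. if x \<in> Z \<and> y \<in> Z then Dom C (q x y) else undefined),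
    EComp = (\<lambda>x y z. if x \<in> Z \<and> y \<in> Z \<and> z \<in> Z then c x y z else undefined),
    EIde = (\<lambda>x. if x \<in> Z then i x else undefined)\<rparr>"
  have P_simps [simp]: "EObj P = Z" "x \<in> Z \<Longrightarrow> y \<in> Z \<Longrightarrow> EHom P x y = Dom C (q x y)"
    "x \<in> Z \<Longrightarrow> y \<in> Z \<Longrightarrow> z \<in> Z \<Longrightarrow> EComp P x y z = c x y z" "x \<in> Z \<Longrightarrow> EIde P x = i x" for x y z
    by (simp_all add: P_def)
  interpret P: precat C P by unfold_locales (use c i q in \<open>auto simp: Hom_def\<close>)
  \<comment> \<open>By naturality the defining equations of \<open>c\<close> pass from the universal
    pair to all composable pairs.\<close>
  have q_emul: "q x z \<cdot> emul C P x y z g f = emul C A (d1 x) (d1 y) (d1 z) (q y z \<cdot> g) (q x y \<cdot> f)"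
    "r x z \<cdot> emul C P x y z g f = emul C B (d2 x) (d2 y) (d2 z) (r y z \<cdot> g) (r x y \<cdot> f)"
    if z: "x \<in> Z" "y \<in> Z" "z \<in> Z" and gf: "g \<in> Arr C" "f \<in> Arr C" "Dom C f = Dom C g" "Cod C g = Dom C (q y z)" "Cod C f = Dom C (q x y)"
    for x y z g f
  proof -
    note c = c[OF z] and qx = q[OF z(1,2)] q[OF z(2,3)] q[OF z(1,3)] and d = d[OF z(1)] d[OF z(2)] d[OF z(3)]
    have pg: "pairing C g f \<in> Arr C" "Dom C (pairing C g f) = Dom C g" "Cod C (pairing C g f) = prd_obj C (Dom C (q y z)) (Dom C (q x y))"
      using gf by simp_all
    have "q x z \<cdot> emul C P x y z g f = emul C A (d1 x) (d1 y) (d1 z) (q y z \<cdot> ?p1 x y z) (q x y \<cdot> ?p2 x y z) \<cdot> pairing C g f"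
      unfolding emul_def[of C P] using z by (simp, intro reassoc[OF c(4)]) (use c(1-3) pg qx in simp_all)
    also have "\<dots> = emul C A (d1 x) (d1 y) (d1 z) (q y z \<cdot> g) (q x y \<cdot> f)"
      by (subst F.src.emul_comp) (use gf qx d in simp_all)
    finally show "q x z \<cdot> emul C P x y z g f = emul C A (d1 x) (d1 y) (d1 z) (q y z \<cdot> g) (q x y \<cdot> f)" .
    have "r x z \<cdot> emul C P x y z g f = emul C B (d2 x) (d2 y) (d2 z) (r y z \<cdot> ?p1 x y z) (r x y \<cdot> ?p2 x y z) \<cdot> pairing C g f"
      unfolding emul_def[of C P] using z by (simp, intro reassoc[OF c(5)]) (use c(1-3) pg qx in simp_all)
    also have "\<dots> = emul C B (d2 x) (d2 y) (d2 z) (r y z \<cdot> g) (r x y \<cdot> f)"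
      by (subst G.src.emul_comp) (use gf qx d in simp_all)
    finally show "r x z \<cdot> emul C P x y z g f = emul C B (d2 x) (d2 y) (d2 z) (r y z \<cdot> g) (r x y \<cdot> f)" .
  qed
  have q_unit: "q x x \<cdot> eunit C P x w = eunit C A (d1 x) w" "r x x \<cdot> eunit C P x w = eunit C B (d2 x) w"
    if x: "x \<in> Z" and w: "w \<in> Obj C" for x w
    unfolding eunit_def using x w i[OF x] q[OF x x] d[OF x]
    by (simp_all add: reassoc[OF i(4)[OF x]] reassoc[OF i(5)[OF x]])
  interpret P: ecategory C P
  proof
    fix w x y z h g f
    assume "w \<in> EObj P" "x \<in> EObj P" "y \<in> EObj P" "z \<in> EObj P"
      and a: "h \<in> Arr C" "g \<in> Arr C" "f \<in> Arr C" "Dom C g = Dom C h" "Dom C f = Dom C h"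
      and co: "Cod C h = EHom P y z" "Cod C g = EHom P x y" "Cod C f = EHom P w x"
    then have z: "w \<in> Z" "x \<in> Z" "y \<in> Z" "z \<in> Z" by simp_all
    then have co: "Cod C h = Dom C (q y z)" "Cod C g = Dom C (q x y)" "Cod C f = Dom C (q w x)" using co by simp_all
    note d = d[OF z(1)] d[OF z(2)] d[OF z(3)] d[OF z(4)]
    have hg: "emul C P x y z h g \<in> Arr C" "Dom C (emul C P x y z h g) = Dom C h" "Cod C (emul C P x y z h g) = Dom C (q x z)"
      and gf: "emul C P w x y g f \<in> Arr C" "Dom C (emul C P w x y g f) = Dom C h" "Cod C (emul C P w x y g f) = Dom C (q w y)"
      using a co z by simp_all
    have hgf: "emul C P w x z (emul C P x y z h g) f \<in> Arr C" "Dom C (emul C P w x z (emul C P x y z h g) f) = Dom C h"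
        "Cod C (emul C P w x z (emul C P x y z h g) f) = Dom C (q w z)"
      and hgf': "emul C P w y z h (emul C P w x y g f) \<in> Arr C" "Dom C (emul C P w y z h (emul C P w x y g f)) = Dom C h"
        "Cod C (emul C P w y z h (emul C P w x y g f)) = Dom C (q w z)"
      using a co z hg gf by simp_all
    have qh: "q y z \<cdot> h \<in> Arr C" "Dom C (q y z \<cdot> h) = Dom C h" "Cod C (q y z \<cdot> h) = EHom A (d1 y) (d1 z)"
      "q x y \<cdot> g \<in> Arr C" "Dom C (q x y \<cdot> g) = Dom C h" "Cod C (q x y \<cdot> g) = EHom A (d1 x) (d1 y)"
      "q w x \<cdot> f \<in> Arr C" "Dom C (q w x \<cdot> f) = Dom C h" "Cod C (q w x \<cdot> f) = EHom A (d1 w) (d1 x)"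
      "r y z \<cdot> h \<in> Arr C" "Dom C (r y z \<cdot> h) = Dom C h" "Cod C (r y z \<cdot> h) = EHom B (d2 y) (d2 z)"
      "r x y \<cdot> g \<in> Arr C" "Dom C (r x y \<cdot> g) = Dom C h" "Cod C (r x y \<cdot> g) = EHom B (d2 x) (d2 y)"
      "r w x \<cdot> f \<in> Arr C" "Dom C (r w x \<cdot> f) = Dom C h" "Cod C (r w x \<cdot> f) = EHom B (d2 w) (d2 x)"
      using a co q[OF z(3,4)] q[OF z(2,3)] q[OF z(1,2)] by simp_all
    show "emul C P w x z (emul C P x y z h g) f = emul C P w y z h (emul C P w x y g f)"
    proof (rule joint[OF z(1,4)])
      show "q w z \<cdot> emul C P w x z (emul C P x y z h g) f = q w z \<cdot> emul C P w y z h (emul C P w x y g f)"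
        using a co z hg gf qh by (simp add: q_emul F.src.emul_assoc d)
      show "r w z \<cdot> emul C P w x z (emul C P x y z h g) f = r w z \<cdot> emul C P w y z h (emul C P w x y g f)"
        using a co z hg gf qh by (simp add: q_emul G.src.emul_assoc d)
    qed (use hgf hgf' d z in simp_all)
  next
    fix x y f
    assume "x \<in> EObj P" "y \<in> EObj P" and f: "f \<in> Arr C" "Cod C f = EHom P x y"
    then have z: "x \<in> Z" "y \<in> Z" by simp_all
    then have co: "Cod C f = Dom C (q x y)" "Dom C f \<in> Obj C" using f by simp_all
    note d = d[OF z(1)] d[OF z(2)]
    have qf: "q x y \<cdot> f \<in> Arr C" "Dom C (q x y \<cdot> f) = Dom C f" "Cod C (q x y \<cdot> f) = EHom A (d1 x) (d1 y)"
      "r x y \<cdot> f \<in> Arr C" "Dom C (r x y \<cdot> f) = Dom C f" "Cod C (r x y \<cdot> f) = EHom B (d2 x) (d2 y)"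
      using f(1) co q[OF z] by simp_all
    note u = F.src.emul_eunit[OF d(1,5) qf(1,3), unfolded qf(2)] G.src.emul_eunit[OF d(2,6) qf(4,6), unfolded qf(5)]
    have ux: "eunit C P x (Dom C f) \<in> Arr C" "Dom C (eunit C P x (Dom C f)) = Dom C f" "Cod C (eunit C P x (Dom C f)) = Dom C (q x x)"
      "eunit C P y (Dom C f) \<in> Arr C" "Dom C (eunit C P y (Dom C f)) = Dom C f" "Cod C (eunit C P y (Dom C f)) = Dom C (q y y)"
      using co z by simp_all
    have uf: "emul C P x y y (eunit C P y (Dom C f)) f \<in> Arr C" "Dom C (emul C P x y y (eunit C P y (Dom C f)) f) = Dom C f"
        "Cod C (emul C P x y y (eunit C P y (Dom C f)) f) = Dom C (q x y)"
      "emul C P x x y f (eunit C P x (Dom C f)) \<in> Arr C" "Dom C (emul C P x x y f (eunit C P x (Dom C f))) = Dom C f"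
        "Cod C (emul C P x x y f (eunit C P x (Dom C f))) = Dom C (q x y)"
      using f(1) co z ux by simp_all
    show "emul C P x y y (eunit C P y (Dom C f)) f = f"
      by (rule joint[OF z]) (use uf f(1) co z d ux u in \<open>simp_all add: q_emul q_unit\<close>)
    show "emul C P x x y f (eunit C P x (Dom C f)) = f"
      by (rule joint[OF z]) (use uf f(1) co z d ux u in \<open>simp_all add: q_emul q_unit\<close>)
  qed
  have P: "P \<in> small_ecats small C"
    unfolding small_ecats_iff using e(2) P.ecategory_axioms by (simp add: Z_def[symmetric] extensional_ecat_def P_def)
  have Q: "efunctor C P A d1 q"
    by unfold_locales (use d q q_emul i in \<open>auto simp: Hom_def\<close>)
  have R: "efunctor C P B d2 r"
    by unfold_locales (use d q q_emul i in \<open>auto simp: Hom_def\<close>)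
  have "hom_pullback F G (mk_eftr P A d1 q) (mk_eftr P B d2 r)"
    unfolding hom_pullback_def
  proof (intro conjI ballI impI)
    fix a b assume "a \<in> EObj (ESrc F)" "b \<in> EObj (ESrc G)" and ab: "EFObj F a = EFObj G b"
    then have "a \<in> EObj A" "b \<in> EObj B" using o by auto
    note e = ed[OF this ab]
    show "\<exists>!z. z \<in> EObj (ESrc (mk_eftr P A d1 q)) \<and> EFObj (mk_eftr P A d1 q) z = a \<and> EFObj (mk_eftr P B d2 r) z = b"
      by (rule ex1I[of _ "e (a, b)"]) (use e d in auto)
  qed (use d o qr in auto)
  then show ?thesis using ECat_arrI[OF Q P AB(1)] ECat_arrI[OF R P AB(2)] by blast
qed

lemma has_pullbacks_ECat: "set_universe small \<Longrightarrow> has_pullbacks (ECat small C)"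
  unfolding has_pullbacks_def using hom_pullback_ex hom_pullback_imp_pullback by (metis ECat_simps(3))

section \<open>Descent forces surjectivity on objects\<close>

definition empty_ecat :: "('u, 'a, 'b) ecat" where
  "empty_ecat = \<lparr>EObj = {}, EHom = (\<lambda>_ _. undefined), EComp = (\<lambda>_ _ _. undefined), EIde = (\<lambda>_. undefined)\<rparr>"

definition full_subcat :: "('u, 'a, 'b) ecat \<Rightarrow> 'u set \<Rightarrow> ('u, 'a, 'b) ecat" where
  "full_subcat B S = \<lparr>EObj = S, EHom = (\<lambda>x y. if x \<in> S \<and> y \<in> S then EHom B x y else undefined),
    EComp = (\<lambda>x y z. if x \<in> S \<and> y \<in> S \<and> z \<in> S then EComp B x y z else undefined),
    EIde = (\<lambda>x. if x \<in> S then EIde B x else undefined)\<rparr>"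

lemma full_subcat_functor:
  assumes "ecategory C B" "S \<subseteq> EObj B"
  shows "efunctor C (full_subcat B S) B (\<lambda>x. x) (\<lambda>x y. Ide C (EHom B x y))"
proof -
  interpret B: ecategory C B by fact
  have [simp]: "EObj (full_subcat B S) = S" "x \<in> S \<Longrightarrow> y \<in> S \<Longrightarrow> EHom (full_subcat B S) x y = EHom B x y"
    "x \<in> S \<Longrightarrow> y \<in> S \<Longrightarrow> z \<in> S \<Longrightarrow> EComp (full_subcat B S) x y z = EComp B x y z"
    "x \<in> S \<Longrightarrow> EIde (full_subcat B S) x = EIde B x" for x y z
    by (simp_all add: full_subcat_def)
  have sub: "\<And>x. x \<in> S \<Longrightarrow> x \<in> EObj B" using assms(2) by blast
  have [simp]: "x \<in> S \<Longrightarrow> y \<in> S \<Longrightarrow> z \<in> S \<Longrightarrow> emul C (full_subcat B S) x y z g f = emul C B x y z g f"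
    "x \<in> S \<Longrightarrow> eunit C (full_subcat B S) x w = eunit C B x w" for x y z g f w
    by (simp_all add: emul_def eunit_def)
  show ?thesis
    by unfold_locales (use sub B.emul_assoc B.emul_eunit in \<open>auto simp: Hom_def\<close>)
qed

text \<open>If \<open>b\<close> is not in the image of \<open>F\<close>, pulling back along \<open>F\<close> does not distinguish the full
  subcategory on \<open>b\<close> from the empty category.\<close>

lemma descent_ff_imp_surj:
  assumes small: "set_universe small" and F: "F \<in> Arr (ECat small C)" and ff: "descent_ff (ECat small C) F"
    and b: "b \<in> EObj (ETgt F)"
  shows "\<exists>e\<in>EObj (ESrc F). EFObj F e = b"
proof (rule ccontr)
  assume no: "\<not> (\<exists>e\<in>EObj (ESrc F). EFObj F e = b)"
  interpret E: category "ECat small C" by (rule category_ECat)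
  have pbE: "has_pullbacks (ECat small C)" by (rule has_pullbacks_ECat[OF small])
  define B where "B = ETgt F"
  have B: "B \<in> small_ecats small C" using ECat_arrD[OF F] by (simp add: B_def)
  then interpret B: ecategory C B by (simp add: small_ecats_iff)
  have sub: "{b} \<subseteq> EObj B" using b by (simp add: B_def)
  have small': "small {b}" "small {}"
    using set_universe.small_subset[OF small] B sub by (auto simp: small_ecats_iff)
  let ?X = "full_subcat B {b}" and ?f = "mk_eftr (full_subcat B {b}) B (\<lambda>x. x) (\<lambda>x y. Ide C (EHom B x y))"
  interpret X: efunctor C ?X B "\<lambda>x. x" "\<lambda>x y. Ide C (EHom B x y)"
    by (rule full_subcat_functor[OF B.ecategory_axioms sub])
  have X: "?X \<in> small_ecats small C"
    unfolding small_ecats_iff using X.src.ecategory_axioms small' by (simp add: extensional_ecat_def full_subcat_def)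
  have f: "?f \<in> Arr (ECat small C)" by (rule ECat_arrI[OF X.efunctor_axioms X B])
  have "ecategory C empty_ecat" by unfold_locales (auto simp: empty_ecat_def)
  then have O: "empty_ecat \<in> small_ecats small C"
    unfolding small_ecats_iff using small' by (simp add: extensional_ecat_def empty_ecat_def)
  have to_empty: "efunctor C empty_ecat B (\<lambda>x. x) (\<lambda>x y. Ide C (EHom B x y))"
    using O B unfolding efunctor_def efunctor_axioms_def small_ecats_iff by (simp add: empty_ecat_def)
  let ?g = "mk_eftr empty_ecat B (\<lambda>x. x) (\<lambda>x y. Ide C (EHom B x y))"
  have g: "?g \<in> Arr (ECat small C)" by (rule ECat_arrI[OF to_empty O B])
  obtain q t where qt: "is_pullback (ECat small C) F ?f q t"
    using pbE F f unfolding has_pullbacks_def by (metis B_def ECat_simps(3) mk_eftr_simps(2))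
  note qt' = E.pullbackD[OF qt, unfolded ECat_simps(2,3)]
  have P: "ESrc q \<in> small_ecats small C" using ECat_arrD[OF qt'(1)] by simp
  interpret q: efunctor C "ESrc q" "ESrc F" "EFObj q" "EFHom q" using ecat_arr_cases[OF qt'(1)] qt' by simp
  interpret t: efunctor C "ESrc q" ?X "EFObj t" "EFHom t" using ecat_arr_cases[OF qt'(3)] qt' by simp
  have "EObj (ESrc q) = {}"
  proof (rule equals0I)
    fix z assume z: "z \<in> EObj (ESrc q)"
    have "EFObj F (EFObj q z) = EFObj ?f (EFObj t z)"
      using arg_cong[OF qt'(6), of "\<lambda>H. EFObj H z"] z qt'(4) by simp
    also have "\<dots> = b" using t.F0[OF z] by (simp add: full_subcat_def)
    finally show False using no q.F0[OF z] by blast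
  qed
  \<comment> \<open>Extensionality leaves just one enriched category without objects, so the vertex
    is equal to \<open>empty_ecat\<close> and not merely isomorphic to it.\<close>
  then have Pe: "ESrc q = empty_ecat"
    using P unfolding small_ecats_iff extensional_ecat_def empty_ecat_def by (auto intro!: ecat.equality ext)
  \<comment> \<open>The identity of the empty category meets the hypotheses of
    \<open>descent_ff\<close>, since parallel arrows into an empty category have empty source and
    are equal. Descending it would give a functor from the full subcategory on \<open>b\<close> to
    the empty category.\<close>
  let ?k = "Ide (ECat small C) empty_ecat"
  have k: "?k \<in> Arr (ECat small C)" "ESrc ?k = empty_ecat" "ETgt ?k = empty_ecat" using ECat_ide_arr[OF O] by simp_all
  have empty_eq: "U = V" if "U \<in> Arr (ECat small C)" "V \<in> Arr (ECat small C)" "ESrc U = ESrc V" "ETgt U = ETgt V" "EObj (ESrc U) = {}" for U V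
    by (rule eftr_eqI[OF that(1,2)]) (use that in auto)
  have O_empty: "EObj empty_ecat = {}" by (simp add: empty_ecat_def)
  have "\<exists>!h. h \<in> Hom (ECat small C) (Dom (ECat small C) ?f) (Dom (ECat small C) ?g)
      \<and> ?g \<cdot>\<^bsub>ECat small C\<^esub> h = ?f \<and> h \<cdot>\<^bsub>ECat small C\<^esub> t = ?k"
  proof (rule ff[unfolded descent_ff_def, rule_format, OF f g, of q t], intro conjI allI impI)
    show "?g \<cdot>\<^bsub>ECat small C\<^esub> ?k = ?f \<cdot>\<^bsub>ECat small C\<^esub> t"
    proof (rule empty_eq)
      show "?g \<cdot>\<^bsub>ECat small C\<^esub> ?k \<in> Arr (ECat small C)" by (rule ECat_comp_arr[OF k(1) g]) simp
      show "?f \<cdot>\<^bsub>ECat small C\<^esub> t \<in> Arr (ECat small C)" by (rule ECat_comp_arr[OF qt'(3) f]) (use qt' in simp)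
    qed (use Pe qt' O_empty in simp_all)
    fix u v assume "u \<in> Arr (ECat small C) \<and> v \<in> Arr (ECat small C) \<and> Dom (ECat small C) v = Dom (ECat small C) u \<and>
      Cod (ECat small C) u = Dom (ECat small C) q \<and> Cod (ECat small C) v = Dom (ECat small C) q \<and>
      t \<cdot>\<^bsub>ECat small C\<^esub> u = t \<cdot>\<^bsub>ECat small C\<^esub> v"
    then have uv: "u \<in> Arr (ECat small C)" "v \<in> Arr (ECat small C)" "ESrc v = ESrc u"
      "ETgt u = empty_ecat" "ETgt v = empty_ecat"
      unfolding ECat_simps(2,3) Pe by blast+
    interpret u: efunctor C "ESrc u" empty_ecat "EFObj u" "EFHom u"
      using ecat_arr_cases(1)[OF uv(1) refl uv(4)] .
    have e: "EObj (ESrc u) = {}"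
    proof (rule equals0I)
      fix x assume "x \<in> EObj (ESrc u)"
      then show False using u.F0[of x] unfolding O_empty by simp
    qed
    show "?k \<cdot>\<^bsub>ECat small C\<^esub> u = ?k \<cdot>\<^bsub>ECat small C\<^esub> v"
    proof (rule empty_eq)
      show "?k \<cdot>\<^bsub>ECat small C\<^esub> u \<in> Arr (ECat small C)" "?k \<cdot>\<^bsub>ECat small C\<^esub> v \<in> Arr (ECat small C)"
        by (rule ECat_comp_arr[OF _ k(1)]; simp only: uv k(2))+
    qed (simp_all add: uv e)
  qed (use qt k Pe B_def in \<open>simp_all add: Hom_def\<close>)
  then obtain h where h: "h \<in> Arr (ECat small C)" "ESrc h = ?X" "ETgt h = empty_ecat"
    by (auto simp: Hom_def)
  interpret h: efunctor C ?X empty_ecat "EFObj h" "EFHom h" using ecat_arr_cases[OF h] by simp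
  have "b \<in> EObj ?X" by (simp add: full_subcat_def)
  then have "EFObj h b \<in> EObj empty_ecat" by (rule h.F0)
  then show False unfolding O_empty by simp
qed

end

section \<open>Change of base along a fully faithful functor\<close>

lemma (in finitely_complete) product_imp_pullback:
  assumes t: "is_terminal C t" and f: "f \<in> Arr C" "g \<in> Arr C" "Cod C f = t" "Cod C g = t"
    and pq: "is_product C (Dom C f) (Dom C g) z p q"
  shows "is_pullback C f g p q"
proof -
  have a: "p \<in> Arr C" "Dom C p = z" "Cod C p = Dom C f" "q \<in> Arr C" "Dom C q = z" "Cod C q = Dom C g"
    using pq by (auto simp: is_product_def Hom_def)
  have "f \<cdot> p = g \<cdot> q" by (rule terminal_unique[OF t]) (use f a in simp_all)
  then show ?thesis
    using pq a unfolding is_pullback_def is_product_def by (auto simp: Hom_def)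
qed

text \<open>A composite in \<open>B\<close> is the image under \<open>i\<close> of the composite in
  \<open>A\<close> of the elements transported by \<open>j\<close>; applying \<open>j\<close> shows
  that the family \<open>j\<close> is a functor.\<close>

lemma (in finitely_complete) iso_eftr:
  assumes F: "efunctor C A B (\<lambda>x. x) i" and A: "A \<in> small_ecats small C" and B: "B \<in> small_ecats small C"
    and o: "EObj A = EObj B"
    and j: "\<And>x y. x \<in> EObj A \<Longrightarrow> y \<in> EObj A \<Longrightarrow> j x y \<in> Hom C (EHom B x y) (EHom A x y)"
      "\<And>x y. x \<in> EObj A \<Longrightarrow> y \<in> EObj A \<Longrightarrow> i x y \<cdot> j x y = Ide C (EHom B x y)"
      "\<And>x y. x \<in> EObj A \<Longrightarrow> y \<in> EObj A \<Longrightarrow> j x y \<cdot> i x y = Ide C (EHom A x y)"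
  shows "iso_arrow (ECat small C) (mk_eftr A B (\<lambda>x. x) i)"
proof -
  interpret E: category "ECat small C" by (rule category_ECat)
  interpret F: efunctor C A B "\<lambda>x. x" i by fact
  have j': "j x y \<in> Arr C" "Dom C (j x y) = EHom B x y" "Cod C (j x y) = EHom A x y"
    if "x \<in> EObj B" "y \<in> EObj B" for x y using j(1) that o by (auto simp: Hom_def)
  have G: "efunctor C B A (\<lambda>x. x) j"
  proof
    fix x y z g f
    assume a: "x \<in> EObj B" "y \<in> EObj B" "z \<in> EObj B" "g \<in> Arr C" "f \<in> Arr C"
        "Dom C f = Dom C g" "Cod C g = EHom B y z" "Cod C f = EHom B x y"
    note a' = a(1-3)[folded o]
    have jg: "j y z \<cdot> g \<in> Arr C" "Dom C (j y z \<cdot> g) = Dom C g" "Cod C (j y z \<cdot> g) = EHom A y z"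
      and jf: "j x y \<cdot> f \<in> Arr C" "Dom C (j x y \<cdot> f) = Dom C g" "Cod C (j x y \<cdot> f) = EHom A x y"
      using a j'[OF a(2,3)] j'[OF a(1,2)] by simp_all
    have "i y z \<cdot> (j y z \<cdot> g) = g" "i x y \<cdot> (j x y \<cdot> f) = f"
      using a(4-8) a' j'[OF a(2,3)] j'[OF a(1,2)]
      by (simp_all add: reassoc[OF j(2)[OF a'(2,3)]] reassoc[OF j(2)[OF a'(1,2)]])
    then have "i x z \<cdot> emul C A x y z (j y z \<cdot> g) (j x y \<cdot> f) = emul C B x y z g f"
      using F.F1_emul[OF a' jg(1) jf(1)] jg jf by simp
    then have "j x z \<cdot> emul C B x y z g f = j x z \<cdot> (i x z \<cdot> emul C A x y z (j y z \<cdot> g) (j x y \<cdot> f))" by simp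
    also have "\<dots> = emul C A x y z (j y z \<cdot> g) (j x y \<cdot> f)"
      using a' jg jf j'[OF a(1,3)] by (simp add: reassoc[OF j(3)[OF a'(1,3)]])
    finally show "j x z \<cdot> emul C B x y z g f = emul C A x y z (j y z \<cdot> g) (j x y \<cdot> f)" .
  next
    fix x assume x: "x \<in> EObj B"
    note x' = x[folded o]
    have "j x x \<cdot> EIde B x = j x x \<cdot> (i x x \<cdot> EIde A x)" using F.F1_ide[OF x'] by simp
    also have "\<dots> = EIde A x" using x' j'[OF x x] by (simp add: reassoc[OF j(3)[OF x' x']])
    finally show "j x x \<cdot> EIde B x = EIde A x" .
  qed (use j' o in \<open>auto simp: Hom_def\<close>)
  note FA = ECat_arrI[OF F A B] and GA = ECat_arrI[OF G B A]
  show ?thesis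
  proof (rule E.iso_arrowI[of _ A B "mk_eftr B A (\<lambda>x. x) j"])
    show "mk_eftr B A (\<lambda>x. x) j \<cdot>\<^bsub>ECat small C\<^esub> mk_eftr A B (\<lambda>x. x) i = Ide (ECat small C) A"
      by (rule eftr_eqI[OF ECat_comp_arr[OF FA GA] ECat_ide_arr[OF A]]) (use o j in simp_all)
    show "mk_eftr A B (\<lambda>x. x) i \<cdot>\<^bsub>ECat small C\<^esub> mk_eftr B A (\<lambda>x. x) j = Ide (ECat small C) B"
      by (rule eftr_eqI[OF ECat_comp_arr[OF GA FA] ECat_ide_arr[OF B]]) (use o j in simp_all)
  qed (use FA GA in \<open>simp_all add: Hom_def\<close>)
qed

text \<open>These are the properties of \<open>fam_eta\<close> that do not mention families. They
  are phrased by universal properties because chosen limits are preserved only up to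
  isomorphism.\<close>

locale base_change = V: finitely_complete V + W: finitely_complete W
  for V :: "('o, 'a) cat" and W :: "('p, 'b) cat" +
  fixes H :: "('o, 'a, 'p, 'b) ftr"
  assumes H: "is_functor V W H" and ff: "fully_faithful V W H"
    and H_terminal: "is_terminal W (FObj H (trm V))"
    and H_pullback: "\<And>f g q r. f \<in> Arr V \<Longrightarrow> g \<in> Arr V \<Longrightarrow> Cod V f = Cod V g \<Longrightarrow> is_pullback V f g q r \<Longrightarrow>
      is_pullback W (FArr H f) (FArr H g) (FArr H q) (FArr H r)"
begin

abbreviation H0 :: "'o \<Rightarrow> 'p" where "H0 \<equiv> FObj H"
abbreviation H1 :: "'a \<Rightarrow> 'b" where "H1 \<equiv> FArr H"
abbreviation BE :: "('u, 'o, 'a) ecat \<Rightarrow> ('u, 'p, 'b) ecat" where "BE \<equiv> base_ecat V W H"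

lemmas H_simps [simp] = is_functorD(3-6)[OF H]
lemmas H_ide = is_functorD(7)[OF H]
lemmas H_comp = is_functorD(8)[OF H]
lemmas faithful = fully_faithful_faithful[OF H ff]
lemmas full = fully_faithful_full[OF ff]

text \<open>A product is a pullback over the terminal object, and \<open>H\<close> respects
  both.\<close>

lemma H_prd:
  assumes "x \<in> Obj V" "y \<in> Obj V"
  shows "is_product W (H0 x) (H0 y) (H0 (prd_obj V x y)) (H1 (proj1 V x y)) (H1 (proj2 V x y))"
proof -
  have "is_pullback V (bang V x) (bang V y) (proj1 V x y) (proj2 V x y)"
    by (rule V.product_imp_pullback[OF V.trm]) (use assms V.prd[OF assms] in simp_all)
  then have "is_pullback W (H1 (bang V x)) (H1 (bang V y)) (H1 (proj1 V x y)) (H1 (proj2 V x y))"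
    using assms by (intro H_pullback) simp_all
  from W.product_pullback[OF H_terminal _ _ _ _ this] show ?thesis using assms by simp
qed

text \<open>A pair of elements at an arbitrary test object of \<open>W\<close> factors through the
  image of the universal pair in \<open>V\<close>. This reduces laws over \<open>W\<close> to laws
  over \<open>V\<close>.\<close>

lemma factor2:
  assumes "x \<in> Obj V" "y \<in> Obj V" "s \<in> Arr W" "t \<in> Arr W" "Dom W t = Dom W s" "Cod W s = H0 x" "Cod W t = H0 y"
  shows "\<exists>k. k \<in> Arr W \<and> Dom W k = Dom W s \<and> Cod W k = H0 (prd_obj V x y)
    \<and> H1 (proj1 V x y) \<cdot>\<^bsub>W\<^esub> k = s \<and> H1 (proj2 V x y) \<cdot>\<^bsub>W\<^esub> k = t"
  using W.product_ex[OF H_prd[OF assms(1,2)] assms(3-7)] .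

lemma H_pairing:
  assumes "f \<in> Arr V" "g \<in> Arr V" "Dom V g = Dom V f"
  shows "prd_comparison V W H (Cod V f) (Cod V g) \<cdot>\<^bsub>W\<^esub> H1 (pairing V f g) = pairing W (H1 f) (H1 g)"
  unfolding prd_comparison_def using assms
  by (subst W.pairing_comp) (simp_all add: H_comp[symmetric])

lemma prd_comparison:
  assumes "x \<in> Obj V" "y \<in> Obj V"
  shows "prd_comparison V W H x y \<in> Arr W" "Dom W (prd_comparison V W H x y) = H0 (prd_obj V x y)"
    "Cod W (prd_comparison V W H x y) = prd_obj W (H0 x) (H0 y)" "iso_arrow W (prd_comparison V W H x y)"
proof -
  let ?c = "prd_comparison V W H x y"
  show c: "?c \<in> Arr W" "Dom W ?c = H0 (prd_obj V x y)" "Cod W ?c = prd_obj W (H0 x) (H0 y)"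
    unfolding prd_comparison_def using assms by simp_all
  obtain k where k: "k \<in> Arr W" "Dom W k = prd_obj W (H0 x) (H0 y)" "Cod W k = H0 (prd_obj V x y)"
    "H1 (proj1 V x y) \<cdot>\<^bsub>W\<^esub> k = proj1 W (H0 x) (H0 y)" "H1 (proj2 V x y) \<cdot>\<^bsub>W\<^esub> k = proj2 W (H0 x) (H0 y)"
    using factor2[OF assms, of "proj1 W (H0 x) (H0 y)" "proj2 W (H0 x) (H0 y)"] assms by auto
  have 1: "?c \<cdot>\<^bsub>W\<^esub> k = Ide W (prd_obj W (H0 x) (H0 y))"
    unfolding prd_comparison_def using assms k by (simp add: W.pairing_comp W.pairing_proj)
  have 2: "k \<cdot>\<^bsub>W\<^esub> ?c = Ide W (H0 (prd_obj V x y))"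
    by (rule W.product_unique[OF H_prd[OF assms]])
      (use assms k(1-3) c in \<open>simp_all add: W.reassoc[OF k(4)] W.reassoc[OF k(5)]\<close>,
       simp_all add: prd_comparison_def)
  show "iso_arrow W ?c"
    by (rule W.iso_arrowI[of _ "H0 (prd_obj V x y)" "prd_obj W (H0 x) (H0 y)" k])
      (use c k 1 2 in \<open>simp_all add: Hom_def\<close>)
qed

lemma unit_comparison: "iso_arrow W (bang W (H0 (trm V)))"
proof -
  have "\<exists>!h. h \<in> Hom W (trm W) (H0 (trm V))" using H_terminal W.trm_obj unfolding is_terminal_def by blast
  then obtain k where k: "k \<in> Arr W" "Dom W k = trm W" "Cod W k = H0 (trm V)" by (auto simp: Hom_def)
  show ?thesis
  proof (rule W.iso_arrowI[of _ "H0 (trm V)" "trm W" k])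
    show "k \<cdot>\<^bsub>W\<^esub> bang W (H0 (trm V)) = Ide W (H0 (trm V))"
      by (rule W.terminal_unique[OF H_terminal]) (use k in simp_all)
    show "bang W (H0 (trm V)) \<cdot>\<^bsub>W\<^esub> k = Ide W (trm W)"
      by (rule W.terminal_unique[OF W.trm]) (use k in simp_all)
  qed (use k in \<open>simp_all add: Hom_def\<close>)
qed

lemma H_bang:
  assumes "w \<in> Obj V"
  shows "inv_arrow W (bang W (H0 (trm V))) \<cdot>\<^bsub>W\<^esub> bang W (H0 w) = H1 (bang V w)"
  by (rule W.terminal_unique[OF H_terminal]) (use assms W.inv_arrow[OF unit_comparison] in simp_all)

lemma BE_simps [simp]:
  "EObj (BE A) = EObj A"
  "x \<in> EObj A \<Longrightarrow> y \<in> EObj A \<Longrightarrow> EHom (BE A) x y = H0 (EHom A x y)"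
  by (simp_all add: base_ecat_def)

end

section \<open>Change of base on enriched categories\<close>

locale base_ecategory = base_change V W H + A: ecategory V A
  for V :: "('o, 'a) cat" and W :: "('p, 'b) cat" and H and A :: "('u, 'o, 'a) ecat"
begin

sublocale B: precat W "BE A"
proof
  fix x y z assume o: "x \<in> EObj (BE A)" "y \<in> EObj (BE A)" "z \<in> EObj (BE A)"
  then have o': "EHom A y z \<in> Obj V" "EHom A x y \<in> Obj V" by simp_all
  note c = prd_comparison[OF o']
  show "EComp (BE A) x y z \<in> Hom W (prd_obj W (EHom (BE A) y z) (EHom (BE A) x y)) (EHom (BE A) x z)"
    using o c(1-3) W.inv_arrow(1-3)[OF c(4)] by (simp add: base_ecat_def Hom_def)
next
  fix x assume o: "x \<in> EObj (BE A)"
  show "EIde (BE A) x \<in> Hom W (trm W) (EHom (BE A) x x)"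
    using o W.inv_arrow(1-3)[OF unit_comparison] by (simp add: base_ecat_def Hom_def)
qed (simp)

text \<open>At elements in the image of \<open>H\<close>, the inverse comparison inside
  \<open>EComp (BE A)\<close> cancels against the comparison that relates the two pairings.\<close>

lemma emul_BE:
  assumes "x \<in> EObj A" "y \<in> EObj A" "z \<in> EObj A" "g \<in> Arr V" "f \<in> Arr V" "Dom V f = Dom V g"
    "Cod V g = EHom A y z" "Cod V f = EHom A x y"
  shows "emul W (BE A) x y z (H1 g) (H1 f) = H1 (emul V A x y z g f)"
proof -
  have o': "EHom A y z \<in> Obj V" "EHom A x y \<in> Obj V" using assms by simp_all
  note c = prd_comparison[OF o'] and i = W.inv_arrow[OF prd_comparison(4)[OF o']]
  let ?c = "prd_comparison V W H (EHom A y z) (EHom A x y)"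
  have p: "pairing V g f \<in> Arr V" "Dom V (pairing V g f) = Dom V g" "Cod V (pairing V g f) = prd_obj V (EHom A y z) (EHom A x y)"
    using assms by simp_all
  have "inv_arrow W ?c \<cdot>\<^bsub>W\<^esub> pairing W (H1 g) (H1 f) = inv_arrow W ?c \<cdot>\<^bsub>W\<^esub> (?c \<cdot>\<^bsub>W\<^esub> H1 (pairing V g f))"
    using H_pairing[OF assms(4,5,6)] assms(7,8) by simp
  also have "\<dots> = H1 (pairing V g f)"
    using c(1-3) i(1-3) p by (simp add: W.reassoc[OF i(4)])
  finally have e: "inv_arrow W ?c \<cdot>\<^bsub>W\<^esub> pairing W (H1 g) (H1 f) = H1 (pairing V g f)" .
  have q: "pairing W (H1 g) (H1 f) \<in> Arr W" "Cod W (pairing W (H1 g) (H1 f)) = prd_obj W (H0 (EHom A y z)) (H0 (EHom A x y))"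
    using assms by simp_all
  have "emul W (BE A) x y z (H1 g) (H1 f) = (H1 (EComp A x y z) \<cdot>\<^bsub>W\<^esub> inv_arrow W ?c) \<cdot>\<^bsub>W\<^esub> pairing W (H1 g) (H1 f)"
    unfolding emul_def using assms(1-3) by (simp add: base_ecat_def)
  also have "\<dots> = H1 (EComp A x y z) \<cdot>\<^bsub>W\<^esub> H1 (pairing V g f)"
    unfolding e[symmetric] using assms(1-3) c(1-3) i(1-3) q by simp
  finally show ?thesis unfolding emul_def using assms(1-3) p by (simp add: H_comp)
qed

text \<open>With \<open>factor2\<close> this reaches all elements: any composable pair in
  \<open>W\<close> has the form \<open>H1 g \<cdot> k\<close>, \<open>H1 f \<cdot> k\<close> with
  \<open>g\<close> and \<open>f\<close> projections in \<open>V\<close>.\<close>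

lemma emul_BE_comp:
  assumes "x \<in> EObj A" "y \<in> EObj A" "z \<in> EObj A" "g \<in> Arr V" "f \<in> Arr V" "Dom V f = Dom V g"
    "Cod V g = EHom A y z" "Cod V f = EHom A x y" "k \<in> Arr W" "Cod W k = H0 (Dom V g)"
  shows "emul W (BE A) x y z (H1 g \<cdot>\<^bsub>W\<^esub> k) (H1 f \<cdot>\<^bsub>W\<^esub> k) = H1 (emul V A x y z g f) \<cdot>\<^bsub>W\<^esub> k"
  unfolding emul_BE[OF assms(1-8), symmetric]
  by (rule B.emul_comp[symmetric]) (use assms in simp_all)

lemma EIde_BE: "x \<in> EObj A \<Longrightarrow> EIde (BE A) x = H1 (EIde A x) \<cdot>\<^bsub>W\<^esub> inv_arrow W (bang W (H0 (trm V)))"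
  by (simp add: base_ecat_def)

lemma eunit_BE:
  assumes "x \<in> EObj A" "w \<in> Obj V"
  shows "eunit W (BE A) x (H0 w) = H1 (eunit V A x w)"
proof -
  note i = W.inv_arrow(1-3)[OF unit_comparison]
  have "eunit W (BE A) x (H0 w) = H1 (EIde A x) \<cdot>\<^bsub>W\<^esub> H1 (bang V w)"
    unfolding eunit_def EIde_BE[OF assms(1)] H_bang[OF assms(2), symmetric]
    using assms i by simp
  then show ?thesis unfolding eunit_def using assms by (simp add: H_comp)
qed

sublocale B: ecategory W "BE A"
proof
  fix w x y z h g f
  assume "w \<in> EObj (BE A)" "x \<in> EObj (BE A)" "y \<in> EObj (BE A)" "z \<in> EObj (BE A)"
    and a: "h \<in> Arr W" "g \<in> Arr W" "f \<in> Arr W" "Dom W g = Dom W h" "Dom W f = Dom W h"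
    and co: "Cod W h = EHom (BE A) y z" "Cod W g = EHom (BE A) x y" "Cod W f = EHom (BE A) w x"
  then have o: "w \<in> EObj A" "x \<in> EObj A" "y \<in> EObj A" "z \<in> EObj A" by simp_all
  define X Y Z where "X = EHom A y z" and "Y = EHom A x y" and "Z = EHom A w x"
  have XYZ: "X \<in> Obj V" "Y \<in> Obj V" "Z \<in> Obj V" using o by (simp_all add: X_def Y_def Z_def)
  have co: "Cod W h = H0 X" "Cod W g = H0 Y" "Cod W f = H0 Z" using co o by (simp_all add: X_def Y_def Z_def)
  \<comment> \<open>Two uses of \<open>factor2\<close> write the triple as the image of the
    universal triple of \<open>V\<close> followed by \<open>l\<close>; associativity is then that of
    \<open>A\<close>.\<close>
  obtain k where k: "k \<in> Arr W" "Dom W k = Dom W h" "Cod W k = H0 (prd_obj V X Y)"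
    "H1 (proj1 V X Y) \<cdot>\<^bsub>W\<^esub> k = h" "H1 (proj2 V X Y) \<cdot>\<^bsub>W\<^esub> k = g"
    using factor2[OF XYZ(1,2) a(1,2,4) co(1,2)] by blast
  have XY: "prd_obj V X Y \<in> Obj V" using XYZ by simp
  obtain l where l: "l \<in> Arr W" "Dom W l = Dom W h" "Cod W l = H0 (prd_obj V (prd_obj V X Y) Z)"
    "H1 (proj1 V (prd_obj V X Y) Z) \<cdot>\<^bsub>W\<^esub> l = k" "H1 (proj2 V (prd_obj V X Y) Z) \<cdot>\<^bsub>W\<^esub> l = f"
    using factor2[OF XY XYZ(3) k(1) a(3) _ k(3) co(3)] a k by auto
  define h0 g0 f0 where "h0 = proj1 V X Y \<cdot>\<^bsub>V\<^esub> proj1 V (prd_obj V X Y) Z"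
    and "g0 = proj2 V X Y \<cdot>\<^bsub>V\<^esub> proj1 V (prd_obj V X Y) Z" and "f0 = proj2 V (prd_obj V X Y) Z"
  let ?P = "prd_obj V (prd_obj V X Y) Z"
  have t: "h0 \<in> Arr V" "g0 \<in> Arr V" "f0 \<in> Arr V" "Dom V h0 = ?P" "Dom V g0 = ?P" "Dom V f0 = ?P"
    "Cod V h0 = EHom A y z" "Cod V g0 = EHom A x y" "Cod V f0 = EHom A w x"
    unfolding h0_def g0_def f0_def X_def[symmetric] Y_def[symmetric] Z_def[symmetric] using XYZ by simp_all
  have e: "h = H1 h0 \<cdot>\<^bsub>W\<^esub> l" "g = H1 g0 \<cdot>\<^bsub>W\<^esub> l" "f = H1 f0 \<cdot>\<^bsub>W\<^esub> l"
    unfolding h0_def g0_def f0_def using XYZ l(1-3) k(4,5) l(4,5) by (simp_all add: H_comp)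
  have hg: "emul V A x y z h0 g0 \<in> Arr V" "Dom V (emul V A x y z h0 g0) = ?P" "Cod V (emul V A x y z h0 g0) = EHom A x z"
    and gf: "emul V A w x y g0 f0 \<in> Arr V" "Dom V (emul V A w x y g0 f0) = ?P" "Cod V (emul V A w x y g0 f0) = EHom A w y"
    using t o by simp_all
  have "emul W (BE A) w x z (emul W (BE A) x y z h g) f = H1 (emul V A w x z (emul V A x y z h0 g0) f0) \<cdot>\<^bsub>W\<^esub> l"
    unfolding e using t o l(1,3) hg by (simp add: emul_BE_comp)
  also have "\<dots> = H1 (emul V A w y z h0 (emul V A w x y g0 f0)) \<cdot>\<^bsub>W\<^esub> l"
    using A.emul_assoc[OF o t(1-3) _ _ t(7-9)] t(4-6) by simp
  also have "\<dots> = emul W (BE A) w y z h (emul W (BE A) w x y g f)"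
    unfolding e using t o l(1,3) gf by (simp add: emul_BE_comp)
  finally show "emul W (BE A) w x z (emul W (BE A) x y z h g) f = emul W (BE A) w y z h (emul W (BE A) w x y g f)" .
next
  fix x y f
  assume "x \<in> EObj (BE A)" "y \<in> EObj (BE A)" and f: "f \<in> Arr W" "Cod W f = EHom (BE A) x y"
  then have o: "x \<in> EObj A" "y \<in> EObj A" by simp_all
  let ?X = "EHom A x y"
  have X: "?X \<in> Obj V" and cf: "Cod W f = H0 ?X" using o f by simp_all
  \<comment> \<open>For the unit laws the universal element is the identity of the hom-object,
    through whose image \<open>f\<close> factors trivially.\<close>
  have 1: "f = H1 (Ide V ?X) \<cdot>\<^bsub>W\<^esub> f" using X f cf by (simp add: H_ide)
  have 2: "eunit W (BE A) x (Dom W f) = H1 (eunit V A x ?X) \<cdot>\<^bsub>W\<^esub> f"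
    "eunit W (BE A) y (Dom W f) = H1 (eunit V A y ?X) \<cdot>\<^bsub>W\<^esub> f"
    using o X f cf by (simp_all add: eunit_BE[symmetric] B.eunit_comp)
  have u: "emul V A x y y (eunit V A y ?X) (Ide V ?X) = Ide V ?X" "emul V A x x y (Ide V ?X) (eunit V A x ?X) = Ide V ?X"
    using A.emul_eunit[OF o, of "Ide V ?X"] X by simp_all
  have "emul W (BE A) x y y (eunit W (BE A) y (Dom W f)) f
      = emul W (BE A) x y y (H1 (eunit V A y ?X) \<cdot>\<^bsub>W\<^esub> f) (H1 (Ide V ?X) \<cdot>\<^bsub>W\<^esub> f)"
    unfolding 2 using 1 by simp
  also have "\<dots> = H1 (Ide V ?X) \<cdot>\<^bsub>W\<^esub> f"
    by (subst emul_BE_comp) (use o X f(1) cf u in simp_all)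
  finally show "emul W (BE A) x y y (eunit W (BE A) y (Dom W f)) f = f" using 1 by simp
  have "emul W (BE A) x x y f (eunit W (BE A) x (Dom W f))
      = emul W (BE A) x x y (H1 (Ide V ?X) \<cdot>\<^bsub>W\<^esub> f) (H1 (eunit V A x ?X) \<cdot>\<^bsub>W\<^esub> f)"
    unfolding 2 using 1 by simp
  also have "\<dots> = H1 (Ide V ?X) \<cdot>\<^bsub>W\<^esub> f"
    by (subst emul_BE_comp) (use o X f(1) cf u in simp_all)
  finally show "emul W (BE A) x x y f (eunit W (BE A) x (Dom W f)) = f" using 1 by simp
qed

end

section \<open>Change of base on enriched functors\<close>

context base_change
begin

lemma base_ecategoryI: "ecategory V A \<Longrightarrow> base_ecategory V W H A"
  by (simp add: base_ecategory_def base_change_axioms)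

lemma BE_small:
  assumes "A \<in> small_ecats small V"
  shows "BE A \<in> small_ecats small W"
proof -
  interpret base_ecategory V W H A by (rule base_ecategoryI) (use assms in \<open>simp add: V.small_ecats_iff\<close>)
  have "extensional_ecat (BE A)" unfolding extensional_ecat_def by (auto simp: base_ecat_def)
  then show ?thesis
    using assms B.ecategory_axioms unfolding W.small_ecats_iff V.small_ecats_iff by simp
qed

text \<open>Composable pairs in \<open>W\<close> factor through the image of the universal pair in
  \<open>V\<close>, for which \<open>F1\<close> is known to preserve composition.\<close>

lemma BE_functor:
  assumes "efunctor V A B F0 F1"
  shows "efunctor W (BE A) (BE B) F0 (\<lambda>x y. H1 (F1 x y))"
proof -
  interpret F: efunctor V A B F0 F1 by fact
  interpret A: base_ecategory V W H A by (rule base_ecategoryI) (rule F.src.ecategory_axioms)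
  interpret B: base_ecategory V W H B by (rule base_ecategoryI) (rule F.tgt.ecategory_axioms)
  show ?thesis
  proof
    fix x y z g f
    assume "x \<in> EObj (BE A)" "y \<in> EObj (BE A)" "z \<in> EObj (BE A)" and a: "g \<in> Arr W" "f \<in> Arr W"
        "Dom W f = Dom W g" and co: "Cod W g = EHom (BE A) y z" "Cod W f = EHom (BE A) x y"
    then have o: "x \<in> EObj A" "y \<in> EObj A" "z \<in> EObj A" by simp_all
    let ?X = "EHom A y z" and ?Y = "EHom A x y"
    have XY: "?X \<in> Obj V" "?Y \<in> Obj V" and co: "Cod W g = H0 ?X" "Cod W f = H0 ?Y" using o co by simp_all
    obtain k where k: "k \<in> Arr W" "Dom W k = Dom W g" "Cod W k = H0 (prd_obj V ?X ?Y)"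
      "H1 (proj1 V ?X ?Y) \<cdot>\<^bsub>W\<^esub> k = g" "H1 (proj2 V ?X ?Y) \<cdot>\<^bsub>W\<^esub> k = f"
      using factor2[OF XY a co] by blast
    let ?p = "proj1 V ?X ?Y" and ?q = "proj2 V ?X ?Y"
    note pq = V.proj[OF XY]
    have "H1 (F1 x z) \<cdot>\<^bsub>W\<^esub> emul W (BE A) x y z g f = H1 (F1 x z) \<cdot>\<^bsub>W\<^esub> (H1 (emul V A x y z ?p ?q) \<cdot>\<^bsub>W\<^esub> k)"
      unfolding k(4,5)[symmetric] by (subst A.emul_BE_comp) (use o pq k(1,3) in simp_all)
    also have "\<dots> = H1 (F1 x z \<cdot>\<^bsub>V\<^esub> emul V A x y z ?p ?q) \<cdot>\<^bsub>W\<^esub> k"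
      using o pq k(1,3) by (simp add: H_comp)
    also have "\<dots> = H1 (emul V B (F0 x) (F0 y) (F0 z) (F1 y z \<cdot>\<^bsub>V\<^esub> ?p) (F1 x y \<cdot>\<^bsub>V\<^esub> ?q)) \<cdot>\<^bsub>W\<^esub> k"
      by (subst F.F1_emul) (use o pq in simp_all)
    also have "\<dots> = emul W (BE B) (F0 x) (F0 y) (F0 z) (H1 (F1 y z \<cdot>\<^bsub>V\<^esub> ?p) \<cdot>\<^bsub>W\<^esub> k) (H1 (F1 x y \<cdot>\<^bsub>V\<^esub> ?q) \<cdot>\<^bsub>W\<^esub> k)"
      by (subst B.emul_BE_comp) (use o pq k(1,3) in simp_all)
    also have "\<dots> = emul W (BE B) (F0 x) (F0 y) (F0 z) (H1 (F1 y z) \<cdot>\<^bsub>W\<^esub> g) (H1 (F1 x y) \<cdot>\<^bsub>W\<^esub> f)"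
      unfolding k(4,5)[symmetric] using o pq k(1,3) by (simp add: H_comp)
    finally show "H1 (F1 x z) \<cdot>\<^bsub>W\<^esub> emul W (BE A) x y z g f
      = emul W (BE B) (F0 x) (F0 y) (F0 z) (H1 (F1 y z) \<cdot>\<^bsub>W\<^esub> g) (H1 (F1 x y) \<cdot>\<^bsub>W\<^esub> f)" .
  next
    fix x assume "x \<in> EObj (BE A)"
    then have o: "x \<in> EObj A" by simp
    note i = W.inv_arrow(1-3)[OF unit_comparison]
    have e: "H1 (F1 x x) \<cdot>\<^bsub>W\<^esub> H1 (EIde A x) = H1 (EIde B (F0 x))"
      using o F.F1_ide[OF o] by (simp add: H_comp[symmetric])
    show "H1 (F1 x x) \<cdot>\<^bsub>W\<^esub> EIde (BE A) x = EIde (BE B) (F0 x)"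
      using o i by (simp add: A.EIde_BE B.EIde_BE W.reassoc[OF e])
  qed (auto simp: Hom_def)
qed

lemma base_eftr_eq:
  assumes F: "F \<in> Arr (ECat small V)"
  shows "base_eftr V W H F = mk_eftr (BE (ESrc F)) (BE (ETgt F)) (EFObj F) (\<lambda>x y. H1 (EFHom F x y))"
proof -
  have "EFObj F = (\<lambda>x\<in>EObj (ESrc F). EFObj F x)"
    using F by (auto simp: ECat_def enriched_functor_def Let_def PiE_iff extensional_def fun_eq_iff)
  then show ?thesis by (simp add: base_eftr_def mk_eftr_def)
qed

abbreviation CB :: "(('u, 'o, 'a) ecat, ('u, 'o, 'a) eftr, ('u, 'p, 'b) ecat, ('u, 'p, 'b) eftr) ftr"
  where "CB \<equiv> change_of_base V W H"

lemma CB_simps: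
  shows [simp]: "FObj CB A = BE A"
    and "F \<in> Arr (ECat small V) \<Longrightarrow> FArr CB F = mk_eftr (BE (ESrc F)) (BE (ETgt F)) (EFObj F) (\<lambda>x y. H1 (EFHom F x y))"
  by (simp_all add: change_of_base_def base_eftr_eq)

lemma CB_fields:
  assumes "F \<in> Arr (ECat small V)"
  shows "ESrc (FArr CB F) = BE (ESrc F)" "ETgt (FArr CB F) = BE (ETgt F)"
    "x \<in> EObj (ESrc F) \<Longrightarrow> EFObj (FArr CB F) x = EFObj F x"
    "x \<in> EObj (ESrc F) \<Longrightarrow> y \<in> EObj (ESrc F) \<Longrightarrow> EFHom (FArr CB F) x y = H1 (EFHom F x y)"
  by (simp_all add: CB_simps(2)[OF assms])

lemma CB_arr:
  assumes F: "F \<in> Arr (ECat small V)"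
  shows "mk_eftr (BE (ESrc F)) (BE (ETgt F)) (EFObj F) (\<lambda>x y. H1 (EFHom F x y)) \<in> Arr (ECat small W)"
  by (rule W.ECat_arrI[OF BE_functor]) (use V.ECat_arrD[OF F] BE_small in auto)

lemma CB_functor: "is_functor (ECat small V) (ECat small W) CB"
  unfolding is_functor_def
proof (intro conjI ballI impI)
  fix F assume F: "F \<in> Arr (ECat small V)"
  show "FArr CB F \<in> Hom (ECat small W) (FObj CB (Dom (ECat small V) F)) (FObj CB (Cod (ECat small V) F))"
    using CB_arr[OF F] by (simp add: CB_simps(2)[OF F] Hom_def)
  interpret F: efunctor V "ESrc F" "ETgt F" "EFObj F" "EFHom F" by (rule V.ECat_arrD[OF F])
  fix G assume G: "G \<in> Arr (ECat small V)" and GF: "Dom (ECat small V) G = Cod (ECat small V) F"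
  interpret G: efunctor V "ESrc G" "ETgt G" "EFObj G" "EFHom G" by (rule V.ECat_arrD[OF G])
  have GF': "ESrc G = ETgt F" using GF by simp
  note GFA = V.ECat_comp_arr[OF F G GF']
  have F0: "EFObj F x \<in> EObj (ESrc G)" if "x \<in> EObj (ESrc F)" for x using F.F0[OF that] GF' by simp
  show "FArr CB (G \<cdot>\<^bsub>ECat small V\<^esub> F) = FArr CB G \<cdot>\<^bsub>ECat small W\<^esub> FArr CB F"
    unfolding CB_simps(2)[OF F] CB_simps(2)[OF G] CB_simps(2)[OF GFA]
  proof (rule eftr_eqI[OF CB_arr[OF GFA] W.ECat_comp_arr[OF CB_arr[OF F] CB_arr[OF G]]])
    fix x y assume "x \<in> EObj (ESrc (mk_eftr (BE (ESrc (G \<cdot>\<^bsub>ECat small V\<^esub> F))) (BE (ETgt (G \<cdot>\<^bsub>ECat small V\<^esub> F)))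
        (EFObj (G \<cdot>\<^bsub>ECat small V\<^esub> F)) (\<lambda>x y. H1 (EFHom (G \<cdot>\<^bsub>ECat small V\<^esub> F) x y))))"
      "y \<in> EObj (ESrc (mk_eftr (BE (ESrc (G \<cdot>\<^bsub>ECat small V\<^esub> F))) (BE (ETgt (G \<cdot>\<^bsub>ECat small V\<^esub> F)))
        (EFObj (G \<cdot>\<^bsub>ECat small V\<^esub> F)) (\<lambda>x y. H1 (EFHom (G \<cdot>\<^bsub>ECat small V\<^esub> F) x y))))"
    then have o: "x \<in> EObj (ESrc F)" "y \<in> EObj (ESrc F)" by simp_all
    note Gxy = G.F1_arr[OF F0[OF o(1)] F0[OF o(2)]] and Fxy = F.F1_arr[OF o]
    have "H1 (EFHom G (EFObj F x) (EFObj F y) \<cdot>\<^bsub>V\<^esub> EFHom F x y) = H1 (EFHom G (EFObj F x) (EFObj F y)) \<cdot>\<^bsub>W\<^esub> H1 (EFHom F x y)"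
      by (rule H_comp) (use Gxy Fxy GF' in simp_all)
    then show "EFHom (mk_eftr (BE (ESrc (G \<cdot>\<^bsub>ECat small V\<^esub> F))) (BE (ETgt (G \<cdot>\<^bsub>ECat small V\<^esub> F)))
        (EFObj (G \<cdot>\<^bsub>ECat small V\<^esub> F)) (\<lambda>x y. H1 (EFHom (G \<cdot>\<^bsub>ECat small V\<^esub> F) x y))) x y
      = EFHom (mk_eftr (BE (ESrc G)) (BE (ETgt G)) (EFObj G) (\<lambda>x y. H1 (EFHom G x y)) \<cdot>\<^bsub>ECat small W\<^esub>
          mk_eftr (BE (ESrc F)) (BE (ETgt F)) (EFObj F) (\<lambda>x y. H1 (EFHom F x y))) x y"
      using o F0 by simp
  qed (use F0 GF' in simp_all)
next
  fix A assume A: "A \<in> Obj (ECat small V)"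
  then have A': "A \<in> small_ecats small V" by simp
  then interpret A: ecategory V A by (simp add: V.small_ecats_iff)
  show "FObj CB A \<in> Obj (ECat small W)" using BE_small[OF A'] by simp
  show "FArr CB (Ide (ECat small V) A) = Ide (ECat small W) (FObj CB A)"
    unfolding CB_simps(2)[OF V.ECat_ide_arr[OF A']] CB_simps(1)
    by (rule eftr_eqI[OF CB_arr[OF V.ECat_ide_arr[OF A']] W.ECat_ide_arr[OF BE_small[OF A']]]) (simp_all add: H_ide)
qed (rule V.category_ECat W.category_ECat)+

text \<open>The hom-arrows of a functor between images lift one by one, because \<open>H\<close> is
  fully faithful. By \<open>emul_BE\<close> the law for composition is the image of the law over
  \<open>V\<close>, and faithfulness reflects it.\<close>

lemma CB_ff: "fully_faithful (ECat small V) (ECat small W) CB"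
  unfolding fully_faithful_def
proof (intro ballI)
  fix A B G
  assume "A \<in> Obj (ECat small V)" "B \<in> Obj (ECat small V)" and G0: "G \<in> Hom (ECat small W) (FObj CB A) (FObj CB B)"
  then have A: "A \<in> small_ecats small V" and B: "B \<in> small_ecats small V" by simp_all
  have G: "G \<in> Arr (ECat small W)" "ESrc G = BE A" "ETgt G = BE B" using G0 by (simp_all add: Hom_def)
  interpret A: base_ecategory V W H A by (rule base_ecategoryI) (use A in \<open>simp add: V.small_ecats_iff\<close>)
  interpret B: base_ecategory V W H B by (rule base_ecategoryI) (use B in \<open>simp add: V.small_ecats_iff\<close>)
  interpret G: efunctor W "BE A" "BE B" "EFObj G" "EFHom G" using W.ecat_arr_cases[OF G] by simp
  have GF0: "EFObj G x \<in> EObj B" if "x \<in> EObj A" for x using G.F0[of x] that by simp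
  have GF1: "EFHom G x y \<in> Arr W" "Dom W (EFHom G x y) = H0 (EHom A x y)"
      "Cod W (EFHom G x y) = H0 (EHom B (EFObj G x) (EFObj G y))" if "x \<in> EObj A" "y \<in> EObj A" for x y
    using G.F1_arr[of x y] that GF0 by simp_all
  have "\<exists>g. g \<in> Arr V \<and> Dom V g = EHom A x y \<and> Cod V g = EHom B (EFObj G x) (EFObj G y) \<and> H1 g = EFHom G x y"
    if "x \<in> EObj A" "y \<in> EObj A" for x y
    by (rule full) (use GF0 GF1[OF that] that in simp_all)
  then obtain g0 where "\<And>x y. x \<in> EObj A \<Longrightarrow> y \<in> EObj A \<Longrightarrow> g0 x y \<in> Arr V \<and> Dom V (g0 x y) = EHom A x y
    \<and> Cod V (g0 x y) = EHom B (EFObj G x) (EFObj G y) \<and> H1 (g0 x y) = EFHom G x y" by metis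
  then have g0: "g0 x y \<in> Arr V" "Dom V (g0 x y) = EHom A x y"
    "Cod V (g0 x y) = EHom B (EFObj G x) (EFObj G y)" "H1 (g0 x y) = EFHom G x y" if "x \<in> EObj A" "y \<in> EObj A" for x y
    using that by blast+
  have E: "efunctor V A B (EFObj G) g0"
  proof
    fix x y z g f
    assume a: "x \<in> EObj A" "y \<in> EObj A" "z \<in> EObj A" "g \<in> Arr V" "f \<in> Arr V"
        "Dom V f = Dom V g" "Cod V g = EHom A y z" "Cod V f = EHom A x y"
    note o = GF0[OF a(1)] GF0[OF a(2)] GF0[OF a(3)]
    note gx = g0[OF a(1,2)] g0[OF a(2,3)] g0[OF a(1,3)]
    have e: "emul V A x y z g f \<in> Arr V" "Dom V (emul V A x y z g f) = Dom V g" "Cod V (emul V A x y z g f) = EHom A x z"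
      using a by simp_all
    have t: "g0 y z \<cdot>\<^bsub>V\<^esub> g \<in> Arr V" "g0 x y \<cdot>\<^bsub>V\<^esub> f \<in> Arr V" "Dom V (g0 x y \<cdot>\<^bsub>V\<^esub> f) = Dom V (g0 y z \<cdot>\<^bsub>V\<^esub> g)"
      "Cod V (g0 y z \<cdot>\<^bsub>V\<^esub> g) = EHom B (EFObj G y) (EFObj G z)" "Cod V (g0 x y \<cdot>\<^bsub>V\<^esub> f) = EHom B (EFObj G x) (EFObj G y)"
      "Dom V (g0 y z \<cdot>\<^bsub>V\<^esub> g) = Dom V g"
      using a gx by simp_all
    show "g0 x z \<cdot>\<^bsub>V\<^esub> emul V A x y z g f = emul V B (EFObj G x) (EFObj G y) (EFObj G z) (g0 y z \<cdot>\<^bsub>V\<^esub> g) (g0 x y \<cdot>\<^bsub>V\<^esub> f)"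
    proof (rule faithful)
      have "H1 (g0 x z \<cdot>\<^bsub>V\<^esub> emul V A x y z g f) = EFHom G x z \<cdot>\<^bsub>W\<^esub> emul W (BE A) x y z (H1 g) (H1 f)"
        using e gx by (simp add: H_comp A.emul_BE[OF a])
      also have "\<dots> = emul W (BE B) (EFObj G x) (EFObj G y) (EFObj G z) (H1 (g0 y z) \<cdot>\<^bsub>W\<^esub> H1 g) (H1 (g0 x y) \<cdot>\<^bsub>W\<^esub> H1 f)"
        unfolding gx(4,8) by (rule G.F1_emul) (use a in simp_all)
      also have "\<dots> = emul W (BE B) (EFObj G x) (EFObj G y) (EFObj G z) (H1 (g0 y z \<cdot>\<^bsub>V\<^esub> g)) (H1 (g0 x y \<cdot>\<^bsub>V\<^esub> f))"
        using a gx(1-3,5-7) by (simp add: H_comp)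
      also have "\<dots> = H1 (emul V B (EFObj G x) (EFObj G y) (EFObj G z) (g0 y z \<cdot>\<^bsub>V\<^esub> g) (g0 x y \<cdot>\<^bsub>V\<^esub> f))"
        by (rule B.emul_BE[OF o t(1-5)])
      finally show "H1 (g0 x z \<cdot>\<^bsub>V\<^esub> emul V A x y z g f) = H1 (emul V B (EFObj G x) (EFObj G y) (EFObj G z) (g0 y z \<cdot>\<^bsub>V\<^esub> g) (g0 x y \<cdot>\<^bsub>V\<^esub> f))" .
    qed (use e t gx o in simp_all)
  next
    fix x assume x: "x \<in> EObj A"
    note gx = g0[OF x x] and o = GF0[OF x] and i = W.inv_arrow(1-5)[OF unit_comparison]
    have "EFHom G x x \<cdot>\<^bsub>W\<^esub> EIde (BE A) x = EIde (BE B) (EFObj G x)" using G.F1_ide x by simp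
    then have c: "(EFHom G x x \<cdot>\<^bsub>W\<^esub> H1 (EIde A x)) \<cdot>\<^bsub>W\<^esub> inv_arrow W (bang W (H0 (trm V)))
        = H1 (EIde B (EFObj G x)) \<cdot>\<^bsub>W\<^esub> inv_arrow W (bang W (H0 (trm V)))"
      unfolding A.EIde_BE[OF x] B.EIde_BE[OF o] using x GF1[OF x x] i(1-3) by simp
    \<comment> \<open>The identities of \<open>BE A\<close> and \<open>BE B\<close> contain the unit
      comparison, which has to be cancelled before faithfulness applies.\<close>
    have "iso_arrow W (inv_arrow W (bang W (H0 (trm V))))"
      by (rule W.iso_arrowI[of _ "trm W" "H0 (trm V)" "bang W (H0 (trm V))"]) (use i in \<open>simp_all add: Hom_def\<close>)
    from W.iso_cancel_right[OF this c] have "EFHom G x x \<cdot>\<^bsub>W\<^esub> H1 (EIde A x) = H1 (EIde B (EFObj G x))"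
      using i(1-3) x o GF1[OF x x] by simp
    then show "g0 x x \<cdot>\<^bsub>V\<^esub> EIde A x = EIde B (EFObj G x)"
      by (intro faithful[of "g0 x x \<cdot>\<^bsub>V\<^esub> EIde A x" "EIde B (EFObj G x)"]) (use gx x o in \<open>simp_all add: H_comp\<close>)
  qed (use GF0 g0 in \<open>auto simp: Hom_def\<close>)
  let ?F = "mk_eftr A B (EFObj G) g0"
  have F: "?F \<in> Arr (ECat small V)" by (rule V.ECat_arrI[OF E A B])
  show "\<exists>!F. F \<in> Hom (ECat small V) A B \<and> FArr CB F = G"
  proof (intro ex1I[of _ ?F] conjI)
    show "?F \<in> Hom (ECat small V) A B" using F by (simp add: Hom_def)
    show "FArr CB ?F = G"
      unfolding CB_simps(2)[OF F] by (rule eftr_eqI[OF CB_arr[OF F] G(1)]) (use G g0 in simp_all)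
    fix F' assume "F' \<in> Hom (ECat small V) A B \<and> FArr CB F' = G"
    then have F': "F' \<in> Arr (ECat small V)" "ESrc F' = A" "ETgt F' = B" and e: "FArr CB F' = G"
      unfolding Hom_def ECat_simps(2,3) by blast+
    note e' = e[unfolded CB_simps(2)[OF F'(1)] F'(2,3)]
    interpret F': efunctor V A B "EFObj F'" "EFHom F'" using V.ecat_arr_cases[OF F'] by simp
    have e0: "EFObj G x = EFObj F' x" if "x \<in> EObj A" for x
      using arg_cong[OF e', of "\<lambda>F. EFObj F x"] that by simp
    have e1: "EFHom G x y = H1 (EFHom F' x y)" if "x \<in> EObj A" "y \<in> EObj A" for x y
      using arg_cong[OF e', of "\<lambda>F. EFHom F x y"] that by simp
    show "F' = ?F"
    proof (rule eftr_eqI[OF F'(1) F])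
      fix x y assume "x \<in> EObj (ESrc F')" "y \<in> EObj (ESrc F')"
      then have o: "x \<in> EObj A" "y \<in> EObj A" using F' by simp_all
      have "EFHom F' x y = g0 x y"
        by (rule faithful) (use o g0[OF o] e0 e1 in simp_all)
      then show "EFHom F' x y = EFHom ?F x y" using o by simp
    qed (use F' e0 in simp_all)
  qed
qed

end

section \<open>Preservation of pullbacks and the essential image of change of base\<close>

context base_change
begin

text \<open>For the explicit pullback, preservation is a matter of hom-objects, where
  \<open>H_pullback\<close> applies. The given square is isomorphic to the explicit one, and
  functors preserve the isomorphism.\<close>

lemma CB_pullback:
  assumes small: "set_universe small" and F: "F \<in> Arr (ECat small V)" and G: "G \<in> Arr (ECat small V)"
    and FG: "ETgt F = ETgt G" and pb: "is_pullback (ECat small V) F G Q R"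
  shows "is_pullback (ECat small W) (FArr CB F) (FArr CB G) (FArr CB Q) (FArr CB R)"
proof -
  interpret EV: category "ECat small V" by (rule V.category_ECat)
  interpret EW: category "ECat small W" by (rule W.category_ECat)
  note CB = is_functorD[OF CB_functor[of small]]
  obtain Q' R' where Q': "Q' \<in> Arr (ECat small V)" and R': "R' \<in> Arr (ECat small V)" and hp: "V.hom_pullback F G Q' R'"
    using V.hom_pullback_ex[OF small F G FG] by blast
  have o: "ESrc R' = ESrc Q'" "ETgt Q' = ESrc F" "ETgt R' = ESrc G"
    and sq: "\<And>z. z \<in> EObj (ESrc Q') \<Longrightarrow> EFObj F (EFObj Q' z) = EFObj G (EFObj R' z)"
    and ob: "\<And>a b. a \<in> EObj (ESrc F) \<Longrightarrow> b \<in> EObj (ESrc G) \<Longrightarrow> EFObj F a = EFObj G b \<Longrightarrow>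
          \<exists>!z. z \<in> EObj (ESrc Q') \<and> EFObj Q' z = a \<and> EFObj R' z = b"
    and ho: "\<And>z z'. z \<in> EObj (ESrc Q') \<Longrightarrow> z' \<in> EObj (ESrc Q') \<Longrightarrow>
          is_pullback V (EFHom F (EFObj Q' z) (EFObj Q' z')) (EFHom G (EFObj R' z) (EFObj R' z')) (EFHom Q' z z') (EFHom R' z z')"
    using hp unfolding V.hom_pullback_def by blast+
  interpret F: efunctor V "ESrc F" "ETgt F" "EFObj F" "EFHom F" by (rule V.ECat_arrD[OF F])
  interpret G: efunctor V "ESrc G" "ETgt G" "EFObj G" "EFHom G" by (rule V.ECat_arrD[OF G])
  interpret Q': efunctor V "ESrc Q'" "ESrc F" "EFObj Q'" "EFHom Q'" using V.ECat_arrD(1)[OF Q'] o by simp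
  interpret R': efunctor V "ESrc Q'" "ESrc G" "EFObj R'" "EFHom R'" using V.ECat_arrD(1)[OF R'] o by simp
  note cF = CB_fields[OF F] and cG = CB_fields[OF G] and cQ = CB_fields[OF Q'] and cR = CB_fields[OF R']
  have "W.hom_pullback (FArr CB F) (FArr CB G) (FArr CB Q') (FArr CB R')"
    unfolding W.hom_pullback_def cF(1) cG(1) cQ(1,2) cR(1,2) BE_simps(1)
  proof (intro conjI ballI impI)
    fix a b assume ab: "a \<in> EObj (ESrc F)" "b \<in> EObj (ESrc G)" "EFObj (FArr CB F) a = EFObj (FArr CB G) b"
    then have "EFObj F a = EFObj G b" by (simp add: cF cG)
    from ob[OF ab(1,2) this]
    obtain z where z: "z \<in> EObj (ESrc Q')" "EFObj Q' z = a" "EFObj R' z = b"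
      and uz: "\<And>y. y \<in> EObj (ESrc Q') \<Longrightarrow> EFObj Q' y = a \<Longrightarrow> EFObj R' y = b \<Longrightarrow> y = z" by blast
    show "\<exists>!z. z \<in> EObj (ESrc Q') \<and> EFObj (FArr CB Q') z = a \<and> EFObj (FArr CB R') z = b"
    proof (rule ex1I[of _ z])
      fix y assume y: "y \<in> EObj (ESrc Q') \<and> EFObj (FArr CB Q') y = a \<and> EFObj (FArr CB R') y = b"
      then have y1: "y \<in> EObj (ESrc Q')" by blast
      show "y = z" by (rule uz) (use y cQ(3)[OF y1] cR(3)[unfolded o, OF y1] in simp_all)
    qed (use z cQ(3)[OF z(1)] cR(3)[unfolded o, OF z(1)] in simp)
  next
    fix z z' assume z: "z \<in> EObj (ESrc Q')" "z' \<in> EObj (ESrc Q')"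
    have "is_pullback W (H1 (EFHom F (EFObj Q' z) (EFObj Q' z'))) (H1 (EFHom G (EFObj R' z) (EFObj R' z'))) (H1 (EFHom Q' z z')) (H1 (EFHom R' z z'))"
      by (rule H_pullback[OF _ _ _ ho[OF z]]) (use z sq FG in simp_all)
    then show "is_pullback W (EFHom (FArr CB F) (EFObj (FArr CB Q') z) (EFObj (FArr CB Q') z'))
        (EFHom (FArr CB G) (EFObj (FArr CB R') z) (EFObj (FArr CB R') z')) (EFHom (FArr CB Q') z z') (EFHom (FArr CB R') z z')"
      using z o by (simp add: cF cG cQ cR)
  qed (use o sq in \<open>simp_all add: cF cG cQ cR\<close>)
  moreover have A: "FArr CB F \<in> Arr (ECat small W)" "FArr CB G \<in> Arr (ECat small W)" "FArr CB Q' \<in> Arr (ECat small W)"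
    "FArr CB R' \<in> Arr (ECat small W)" by (rule CB(4); fact)+
  moreover have "ETgt (FArr CB F) = ETgt (FArr CB G)" using FG by (simp add: cF cG)
  ultimately have pb': "is_pullback (ECat small W) (FArr CB F) (FArr CB G) (FArr CB Q') (FArr CB R')"
    by (intro W.hom_pullback_imp_pullback)
  note b = EV.pullbackD[OF pb]
  \<comment> \<open>The isomorphism from the vertex of the given square to that of the explicit
    one.\<close>
  obtain i j where ij: "i \<in> Arr (ECat small V)" "j \<in> Arr (ECat small V)" "Dom (ECat small V) i = Dom (ECat small V) Q"
    "Cod (ECat small V) i = Dom (ECat small V) Q'" "Dom (ECat small V) j = Dom (ECat small V) Q'" "Cod (ECat small V) j = Dom (ECat small V) Q"
    "Q' \<cdot>\<^bsub>ECat small V\<^esub> i = Q" "R' \<cdot>\<^bsub>ECat small V\<^esub> i = R" "i \<cdot>\<^bsub>ECat small V\<^esub> j = Ide (ECat small V) (Dom (ECat small V) Q')"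
    "j \<cdot>\<^bsub>ECat small V\<^esub> i = Ide (ECat small V) (Dom (ECat small V) Q)"
    using EV.pullback_compare[OF pb V.hom_pullback_imp_pullback[OF F G FG Q' R' hp] F G] by metis
  have src: "Dom (ECat small V) R' = Dom (ECat small V) Q'" using o by simp
  note obs = EV.dom_obj[OF b(1)] EV.dom_obj[OF Q']
  have "is_pullback (ECat small W) (FArr CB F) (FArr CB G) (FArr CB Q' \<cdot>\<^bsub>ECat small W\<^esub> FArr CB i) (FArr CB R' \<cdot>\<^bsub>ECat small W\<^esub> FArr CB i)"
  proof (rule EW.pullback_iso[OF pb' A(1,2) CB(4)[OF ij(1)] CB(4)[OF ij(2)]])
    show "Dom (ECat small W) (FArr CB j) = Cod (ECat small W) (FArr CB i)"
      unfolding CB(5)[OF ij(2)] CB(6)[OF ij(1)] ij(4,5) ..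
    show "Cod (ECat small W) (FArr CB j) = Dom (ECat small W) (FArr CB i)"
      unfolding CB(6)[OF ij(2)] CB(5)[OF ij(1)] ij(3,6) ..
    show "Cod (ECat small W) (FArr CB i) = Dom (ECat small W) (FArr CB Q')"
      unfolding CB(6)[OF ij(1)] CB(5)[OF Q'] ij(4) ..
    show "FArr CB i \<cdot>\<^bsub>ECat small W\<^esub> FArr CB j = Ide (ECat small W) (Cod (ECat small W) (FArr CB i))"
      unfolding CB(6)[OF ij(1)] ij(4) CB(7)[OF obs(2), symmetric] ij(9)[symmetric]
      by (rule CB(8)[symmetric, OF ij(2,1)]) (simp only: ij)
    show "FArr CB j \<cdot>\<^bsub>ECat small W\<^esub> FArr CB i = Ide (ECat small W) (Dom (ECat small W) (FArr CB i))"
      unfolding CB(5)[OF ij(1)] ij(3) CB(7)[OF obs(1), symmetric] ij(10)[symmetric]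
      by (rule CB(8)[symmetric, OF ij(1,2)]) (simp only: ij)
  qed
  moreover have "FArr CB Q' \<cdot>\<^bsub>ECat small W\<^esub> FArr CB i = FArr CB Q"
    unfolding ij(7)[symmetric] by (rule CB(8)[symmetric, OF ij(1) Q']) (simp only: ij(4))
  moreover have "FArr CB R' \<cdot>\<^bsub>ECat small W\<^esub> FArr CB i = FArr CB R"
    unfolding ij(8)[symmetric] by (rule CB(8)[symmetric, OF ij(1) R']) (simp only: src ij(4))
  ultimately show ?thesis by simp
qed

text \<open>Transport of structure: composition and identities of \<open>A'\<close> are conjugated
  by the isomorphisms of hom-objects and then lifted along the full \<open>H\<close>. The laws of
  \<open>A\<close> follow from those of \<open>A'\<close> by faithfulness.\<close>

lemma transport_ecat:
  fixes A' :: "('u, 'p, 'b) ecat"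
  assumes A': "A' \<in> small_ecats small W"
    and i0: "\<And>x y. x \<in> EObj A' \<Longrightarrow> y \<in> EObj A' \<Longrightarrow> \<exists>E\<in>Obj V. \<exists>i\<in>Hom W (H0 E) (EHom A' x y). iso_arrow W i"
  shows "\<exists>A\<in>small_ecats small V. \<exists>I\<in>Hom (ECat small W) (BE A) A'. iso_arrow (ECat small W) I"
proof -
  interpret A': ecategory W A' using A' by (simp add: W.small_ecats_iff)
  have "\<exists>E i j. E \<in> Obj V \<and> i \<in> Hom W (H0 E) (EHom A' x y) \<and> j \<in> Hom W (EHom A' x y) (H0 E)
      \<and> j \<cdot>\<^bsub>W\<^esub> i = Ide W (H0 E) \<and> i \<cdot>\<^bsub>W\<^esub> j = Ide W (EHom A' x y)"
    if xy: "x \<in> EObj A'" "y \<in> EObj A'" for x y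
    using i0[OF xy] by (metis iso_arrow_HomE)
  then obtain E i j where ij0: "\<And>x y. x \<in> EObj A' \<Longrightarrow> y \<in> EObj A' \<Longrightarrow> E x y \<in> Obj V \<and> i x y \<in> Hom W (H0 (E x y)) (EHom A' x y)
      \<and> j x y \<in> Hom W (EHom A' x y) (H0 (E x y)) \<and> j x y \<cdot>\<^bsub>W\<^esub> i x y = Ide W (H0 (E x y)) \<and> i x y \<cdot>\<^bsub>W\<^esub> j x y = Ide W (EHom A' x y)"
    by metis
  have ij: "E x y \<in> Obj V" "i x y \<in> Arr W" "Dom W (i x y) = H0 (E x y)" "Cod W (i x y) = EHom A' x y"
     "j x y \<in> Arr W" "Dom W (j x y) = EHom A' x y" "Cod W (j x y) = H0 (E x y)"
     "j x y \<cdot>\<^bsub>W\<^esub> i x y = Ide W (H0 (E x y))" "i x y \<cdot>\<^bsub>W\<^esub> j x y = Ide W (EHom A' x y)"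
     if "x \<in> EObj A'" "y \<in> EObj A'" for x y using ij0[OF that] by (auto simp: Hom_def)
  let ?p = "\<lambda>x y z. proj1 V (E y z) (E x y)" and ?q = "\<lambda>x y z. proj2 V (E y z) (E x y)"
  \<comment> \<open>The composition of \<open>A\<close> lifts the composite in \<open>A'\<close> of
    the universal pair, carried into \<open>A'\<close> by \<open>i\<close> and back by
    \<open>j\<close>.\<close>
  have "\<exists>c. c \<in> Arr V \<and> Dom V c = prd_obj V (E y z) (E x y) \<and> Cod V c = E x z
    \<and> H1 c = j x z \<cdot>\<^bsub>W\<^esub> emul W A' x y z (i y z \<cdot>\<^bsub>W\<^esub> H1 (?p x y z)) (i x y \<cdot>\<^bsub>W\<^esub> H1 (?q x y z))"
    if o: "x \<in> EObj A'" "y \<in> EObj A'" "z \<in> EObj A'" for x y z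
    by (rule full) (use o ij(1-7)[OF o(1,2)] ij(1-7)[OF o(2,3)] ij(1-7)[OF o(1,3)] in simp_all)
  then obtain c where c0: "\<And>x y z. x \<in> EObj A' \<Longrightarrow> y \<in> EObj A' \<Longrightarrow> z \<in> EObj A' \<Longrightarrow> c x y z \<in> Arr V
    \<and> Dom V (c x y z) = prd_obj V (E y z) (E x y) \<and> Cod V (c x y z) = E x z
    \<and> H1 (c x y z) = j x z \<cdot>\<^bsub>W\<^esub> emul W A' x y z (i y z \<cdot>\<^bsub>W\<^esub> H1 (?p x y z)) (i x y \<cdot>\<^bsub>W\<^esub> H1 (?q x y z))" by metis
  have c: "c x y z \<in> Arr V" "Dom V (c x y z) = prd_obj V (E y z) (E x y)" "Cod V (c x y z) = E x z"
    "H1 (c x y z) = j x z \<cdot>\<^bsub>W\<^esub> emul W A' x y z (i y z \<cdot>\<^bsub>W\<^esub> H1 (?p x y z)) (i x y \<cdot>\<^bsub>W\<^esub> H1 (?q x y z))"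
    if "x \<in> EObj A'" "y \<in> EObj A'" "z \<in> EObj A'" for x y z using c0[OF that] by blast+
  have "\<exists>u. u \<in> Arr V \<and> Dom V u = trm V \<and> Cod V u = E x x \<and> H1 u = j x x \<cdot>\<^bsub>W\<^esub> eunit W A' x (H0 (trm V))"
    if o: "x \<in> EObj A'" for x
    by (rule full) (use o ij(1-7)[OF o o] in simp_all)
  then obtain u where u0: "\<And>x. x \<in> EObj A' \<Longrightarrow> u x \<in> Arr V \<and> Dom V (u x) = trm V \<and> Cod V (u x) = E x x
    \<and> H1 (u x) = j x x \<cdot>\<^bsub>W\<^esub> eunit W A' x (H0 (trm V))" by metis
  have u: "u x \<in> Arr V" "Dom V (u x) = trm V" "Cod V (u x) = E x x" "H1 (u x) = j x x \<cdot>\<^bsub>W\<^esub> eunit W A' x (H0 (trm V))"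
    if "x \<in> EObj A'" for x using u0[OF that] by blast+
  define Z where "Z = EObj A'"
  define A :: "('u, 'o, 'a) ecat" where "A = \<lparr>EObj = Z, EHom = (\<lambda>x y. if x \<in> Z \<and> y \<in> Z then E x y else undefined),
    EComp = (\<lambda>x y z. if x \<in> Z \<and> y \<in> Z \<and> z \<in> Z then c x y z else undefined),
    EIde = (\<lambda>x. if x \<in> Z then u x else undefined)\<rparr>"
  have A_simps [simp]: "EObj A = EObj A'" "x \<in> EObj A' \<Longrightarrow> y \<in> EObj A' \<Longrightarrow> EHom A x y = E x y"
    "x \<in> EObj A' \<Longrightarrow> y \<in> EObj A' \<Longrightarrow> z \<in> EObj A' \<Longrightarrow> EComp A x y z = c x y z" "x \<in> EObj A' \<Longrightarrow> EIde A x = u x" for x y z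
    by (simp_all add: A_def Z_def)
  interpret A: precat V A by unfold_locales (use c u ij in \<open>auto simp: Hom_def\<close>)
  \<comment> \<open>The isomorphisms \<open>i\<close> carry composition in \<open>A\<close> to
    composition in \<open>A'\<close>; with \<open>i_unit\<close> and \<open>cancel\<close> this
    reduces every law of \<open>A\<close> to one of \<open>A'\<close>.\<close>
  have i_emul: "i x z \<cdot>\<^bsub>W\<^esub> H1 (emul V A x y z g f) = emul W A' x y z (i y z \<cdot>\<^bsub>W\<^esub> H1 g) (i x y \<cdot>\<^bsub>W\<^esub> H1 f)"
    if o: "x \<in> EObj A'" "y \<in> EObj A'" "z \<in> EObj A'" and gf: "g \<in> Arr V" "f \<in> Arr V" "Dom V f = Dom V g" "Cod V g = E y z" "Cod V f = E x y"
    for x y z g f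
  proof -
    note c = c[OF o] and ix = ij[OF o(1,2)] and iy = ij[OF o(2,3)] and iz = ij[OF o(1,3)]
    let ?m = "emul W A' x y z (i y z \<cdot>\<^bsub>W\<^esub> H1 (?p x y z)) (i x y \<cdot>\<^bsub>W\<^esub> H1 (?q x y z))"
    have pq: "H1 (?p x y z) \<in> Arr W" "Dom W (H1 (?p x y z)) = H0 (prd_obj V (E y z) (E x y))" "Cod W (H1 (?p x y z)) = H0 (E y z)"
      "H1 (?q x y z) \<in> Arr W" "Dom W (H1 (?q x y z)) = H0 (prd_obj V (E y z) (E x y))" "Cod W (H1 (?q x y z)) = H0 (E x y)"
      using ix(1) iy(1) by simp_all
    have m: "?m \<in> Arr W" "Dom W ?m = H0 (prd_obj V (E y z) (E x y))" "Cod W ?m = EHom A' x z"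
      using o pq ix(2-4) iy(2-4) by simp_all
    have w: "pairing V g f \<in> Arr V" "Dom V (pairing V g f) = Dom V g" "Cod V (pairing V g f) = prd_obj V (E y z) (E x y)"
      "H1 (pairing V g f) \<in> Arr W" "Cod W (H1 (pairing V g f)) = H0 (prd_obj V (E y z) (E x y))"
      using gf by simp_all
    have pw: "H1 (?p x y z) \<cdot>\<^bsub>W\<^esub> H1 (pairing V g f) = H1 g" "H1 (?q x y z) \<cdot>\<^bsub>W\<^esub> H1 (pairing V g f) = H1 f"
      using gf w ix(1) iy(1) by (simp_all add: H_comp[symmetric])
    have "i x z \<cdot>\<^bsub>W\<^esub> H1 (emul V A x y z g f) = i x z \<cdot>\<^bsub>W\<^esub> ((j x z \<cdot>\<^bsub>W\<^esub> ?m) \<cdot>\<^bsub>W\<^esub> H1 (pairing V g f))"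
      unfolding emul_def[of V A] c(4)[symmetric] using o c(1-3) w(1-3) by (simp add: H_comp)
    also have "\<dots> = ?m \<cdot>\<^bsub>W\<^esub> H1 (pairing V g f)"
      using m w(4,5) iz(1-7) by (simp add: W.reassoc[OF iz(9)])
    also have "\<dots> = emul W A' x y z (i y z \<cdot>\<^bsub>W\<^esub> H1 g) (i x y \<cdot>\<^bsub>W\<^esub> H1 f)"
      by (subst A'.emul_comp) (use o pq w(4,5) ix(2-4) iy(2-4) pw in simp_all)
    finally show ?thesis .
  qed
  have i_unit: "i x x \<cdot>\<^bsub>W\<^esub> H1 (eunit V A x w) = eunit W A' x (H0 w)" if o: "x \<in> EObj A'" and w: "w \<in> Obj V" for x w
  proof -
    note u = u[OF o] and ix = ij[OF o o]
    have e: "eunit W A' x (H0 (trm V)) \<in> Arr W" "Dom W (eunit W A' x (H0 (trm V))) = H0 (trm V)" "Cod W (eunit W A' x (H0 (trm V))) = EHom A' x x"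
      using o by simp_all
    have b: "H1 (bang V w) \<in> Arr W" "Dom W (H1 (bang V w)) = H0 w" "Cod W (H1 (bang V w)) = H0 (trm V)" using w by simp_all
    have "i x x \<cdot>\<^bsub>W\<^esub> H1 (eunit V A x w) = i x x \<cdot>\<^bsub>W\<^esub> ((j x x \<cdot>\<^bsub>W\<^esub> eunit W A' x (H0 (trm V))) \<cdot>\<^bsub>W\<^esub> H1 (bang V w))"
      unfolding eunit_def[of V A] u(4)[symmetric] using o u(1-3) w by (simp add: H_comp)
    also have "\<dots> = eunit W A' x (H0 (trm V)) \<cdot>\<^bsub>W\<^esub> H1 (bang V w)"
      using e b ix(1-7) by (simp add: W.reassoc[OF ix(9)])
    also have "\<dots> = eunit W A' x (H0 w)"
      using A'.eunit_comp[OF o b(1,3)] b(2) by simp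
    finally show ?thesis .
  qed
  have cancel: "s = t" if o: "x \<in> EObj A'" "y \<in> EObj A'" and st: "s \<in> Arr V" "t \<in> Arr V" "Dom V s = Dom V t" "Cod V s = E x y" "Cod V t = E x y"
    "i x y \<cdot>\<^bsub>W\<^esub> H1 s = i x y \<cdot>\<^bsub>W\<^esub> H1 t" for x y s t
  proof (rule faithful)
    note ix = ij[OF o]
    have "iso_arrow W (i x y)" by (rule W.iso_arrowI[of _ "H0 (E x y)" "EHom A' x y" "j x y"]) (use ix in \<open>simp_all add: Hom_def\<close>)
    from W.iso_cancel_left[OF this st(6)] show "H1 s = H1 t" using st(1-5) ix(2,3) by simp
  qed (use st in simp_all)
  interpret A: ecategory V A
  proof
    fix w x y z h g f
    assume "w \<in> EObj A" "x \<in> EObj A" "y \<in> EObj A" "z \<in> EObj A"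
      and a: "h \<in> Arr V" "g \<in> Arr V" "f \<in> Arr V" "Dom V g = Dom V h" "Dom V f = Dom V h"
      and co: "Cod V h = EHom A y z" "Cod V g = EHom A x y" "Cod V f = EHom A w x"
    then have o: "w \<in> EObj A'" "x \<in> EObj A'" "y \<in> EObj A'" "z \<in> EObj A'" by simp_all
    then have co: "Cod V h = E y z" "Cod V g = E x y" "Cod V f = E w x" using co by simp_all
    have hg: "emul V A x y z h g \<in> Arr V" "Dom V (emul V A x y z h g) = Dom V h" "Cod V (emul V A x y z h g) = E x z"
      and gf: "emul V A w x y g f \<in> Arr V" "Dom V (emul V A w x y g f) = Dom V h" "Cod V (emul V A w x y g f) = E w y"
      using a co o by simp_all
    have l: "emul V A w x z (emul V A x y z h g) f \<in> Arr V" "Dom V (emul V A w x z (emul V A x y z h g) f) = Dom V h"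
        "Cod V (emul V A w x z (emul V A x y z h g) f) = E w z"
      and r: "emul V A w y z h (emul V A w x y g f) \<in> Arr V" "Dom V (emul V A w y z h (emul V A w x y g f)) = Dom V h"
        "Cod V (emul V A w y z h (emul V A w x y g f)) = E w z"
      using a co o hg gf by simp_all
    have ia: "i y z \<cdot>\<^bsub>W\<^esub> H1 h \<in> Arr W" "Dom W (i y z \<cdot>\<^bsub>W\<^esub> H1 h) = H0 (Dom V h)" "Cod W (i y z \<cdot>\<^bsub>W\<^esub> H1 h) = EHom A' y z"
      "i x y \<cdot>\<^bsub>W\<^esub> H1 g \<in> Arr W" "Dom W (i x y \<cdot>\<^bsub>W\<^esub> H1 g) = H0 (Dom V h)" "Cod W (i x y \<cdot>\<^bsub>W\<^esub> H1 g) = EHom A' x y"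
      "i w x \<cdot>\<^bsub>W\<^esub> H1 f \<in> Arr W" "Dom W (i w x \<cdot>\<^bsub>W\<^esub> H1 f) = H0 (Dom V h)" "Cod W (i w x \<cdot>\<^bsub>W\<^esub> H1 f) = EHom A' w x"
      using a co ij(1-4)[OF o(3,4)] ij(1-4)[OF o(2,3)] ij(1-4)[OF o(1,2)] by simp_all
    show "emul V A w x z (emul V A x y z h g) f = emul V A w y z h (emul V A w x y g f)"
      by (rule cancel[OF o(1,4) l(1) r(1)])
        (use l r a co o hg gf ia in \<open>simp_all add: i_emul A'.emul_assoc\<close>)
  next
    fix x y f
    assume "x \<in> EObj A" "y \<in> EObj A" and f: "f \<in> Arr V" "Cod V f = EHom A x y"
    then have o: "x \<in> EObj A'" "y \<in> EObj A'" by simp_all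
    then have co: "Cod V f = E x y" "Dom V f \<in> Obj V" using f by simp_all
    note ix = ij[OF o]
    have iF: "i x y \<cdot>\<^bsub>W\<^esub> H1 f \<in> Arr W" "Dom W (i x y \<cdot>\<^bsub>W\<^esub> H1 f) = H0 (Dom V f)" "Cod W (i x y \<cdot>\<^bsub>W\<^esub> H1 f) = EHom A' x y"
      using f(1) co ix(1-4) by simp_all
    note e = A'.emul_eunit[OF o iF(1,3), unfolded iF(2)]
    have ux: "eunit V A x (Dom V f) \<in> Arr V" "Dom V (eunit V A x (Dom V f)) = Dom V f" "Cod V (eunit V A x (Dom V f)) = E x x"
      "eunit V A y (Dom V f) \<in> Arr V" "Dom V (eunit V A y (Dom V f)) = Dom V f" "Cod V (eunit V A y (Dom V f)) = E y y"
      using co o by simp_all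
    have uf: "emul V A x y y (eunit V A y (Dom V f)) f \<in> Arr V" "Dom V (emul V A x y y (eunit V A y (Dom V f)) f) = Dom V f"
        "Cod V (emul V A x y y (eunit V A y (Dom V f)) f) = E x y"
      "emul V A x x y f (eunit V A x (Dom V f)) \<in> Arr V" "Dom V (emul V A x x y f (eunit V A x (Dom V f))) = Dom V f"
        "Cod V (emul V A x x y f (eunit V A x (Dom V f))) = E x y"
      using f(1) co o ux by simp_all
    show "emul V A x y y (eunit V A y (Dom V f)) f = f"
      by (rule cancel[OF o]) (use uf f(1) co o ux e in \<open>simp_all add: i_emul i_unit\<close>)
    show "emul V A x x y f (eunit V A x (Dom V f)) = f"
      by (rule cancel[OF o]) (use uf f(1) co o ux e in \<open>simp_all add: i_emul i_unit\<close>)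
  qed
  have A: "A \<in> small_ecats small V"
    unfolding V.small_ecats_iff using A' A.ecategory_axioms
    by (auto simp: W.small_ecats_iff extensional_ecat_def A_def Z_def)
  interpret B: base_ecategory V W H A by (rule base_ecategoryI) (rule A.ecategory_axioms)
  have I: "efunctor W (BE A) A' (\<lambda>x. x) i"
  proof
    fix x y z g f
    assume "x \<in> EObj (BE A)" "y \<in> EObj (BE A)" "z \<in> EObj (BE A)" and a: "g \<in> Arr W" "f \<in> Arr W"
        "Dom W f = Dom W g" and co: "Cod W g = EHom (BE A) y z" "Cod W f = EHom (BE A) x y"
    then have o: "x \<in> EObj A'" "y \<in> EObj A'" "z \<in> EObj A'" by simp_all
    have XY: "E y z \<in> Obj V" "E x y \<in> Obj V" using o ij by simp_all
    have co: "Cod W g = H0 (E y z)" "Cod W f = H0 (E x y)" using o co by simp_all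
    obtain k where k: "k \<in> Arr W" "Dom W k = Dom W g" "Cod W k = H0 (prd_obj V (E y z) (E x y))"
      "H1 (?p x y z) \<cdot>\<^bsub>W\<^esub> k = g" "H1 (?q x y z) \<cdot>\<^bsub>W\<^esub> k = f"
      using factor2[OF XY a co] by blast
    note pq = V.proj[OF XY] and ix = ij(2-4)[OF o(1,2)] and iy = ij(2-4)[OF o(2,3)] and iz = ij(2-4)[OF o(1,3)]
    have m: "emul V A x y z (?p x y z) (?q x y z) \<in> Arr V" "Dom V (emul V A x y z (?p x y z) (?q x y z)) = prd_obj V (E y z) (E x y)"
      "Cod V (emul V A x y z (?p x y z) (?q x y z)) = E x z" using o pq by simp_all
    have "i x z \<cdot>\<^bsub>W\<^esub> emul W (BE A) x y z g f = i x z \<cdot>\<^bsub>W\<^esub> (H1 (emul V A x y z (?p x y z) (?q x y z)) \<cdot>\<^bsub>W\<^esub> k)"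
      unfolding k(4,5)[symmetric] by (subst B.emul_BE_comp) (use o pq k(1,3) in simp_all)
    also have "\<dots> = (i x z \<cdot>\<^bsub>W\<^esub> H1 (emul V A x y z (?p x y z) (?q x y z))) \<cdot>\<^bsub>W\<^esub> k"
      using m k(1,3) iz by simp
    also have "\<dots> = emul W A' x y z (i y z \<cdot>\<^bsub>W\<^esub> H1 (?p x y z)) (i x y \<cdot>\<^bsub>W\<^esub> H1 (?q x y z)) \<cdot>\<^bsub>W\<^esub> k"
      by (subst i_emul) (use o pq in simp_all)
    also have "\<dots> = emul W A' x y z (i y z \<cdot>\<^bsub>W\<^esub> g) (i x y \<cdot>\<^bsub>W\<^esub> f)"
      unfolding k(4,5)[symmetric] by (subst A'.emul_comp) (use o pq k(1,3) ix iy in simp_all)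
    finally show "i x z \<cdot>\<^bsub>W\<^esub> emul W (BE A) x y z g f = emul W A' x y z (i y z \<cdot>\<^bsub>W\<^esub> g) (i x y \<cdot>\<^bsub>W\<^esub> f)" .
  next
    fix x assume "x \<in> EObj (BE A)"
    then have o: "x \<in> EObj A'" by simp
    note v = W.inv_arrow[OF unit_comparison]
    have e: "i x x \<cdot>\<^bsub>W\<^esub> H1 (EIde A x) = eunit W A' x (H0 (trm V))"
      using i_unit[OF o V.trm_obj] A.eide_eq_eunit[of x] o by simp
    have "i x x \<cdot>\<^bsub>W\<^esub> EIde (BE A) x = (i x x \<cdot>\<^bsub>W\<^esub> H1 (EIde A x)) \<cdot>\<^bsub>W\<^esub> inv_arrow W (bang W (H0 (trm V)))"
      using o v(1-3) ij(1-4)[OF o o] u(1-3)[OF o] B.EIde_BE[of x] by simp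
    also have "\<dots> = EIde A' x"
      unfolding e eunit_def using o v by simp
    finally show "i x x \<cdot>\<^bsub>W\<^esub> EIde (BE A) x = EIde A' x" .
  qed (use ij in \<open>auto simp: Hom_def\<close>)
  have "iso_arrow (ECat small W) (mk_eftr (BE A) A' (\<lambda>x. x) i)"
    by (rule W.iso_eftr[OF I BE_small[OF A] A', of j]) (use ij in \<open>simp_all add: Hom_def\<close>)
  moreover have "mk_eftr (BE A) A' (\<lambda>x. x) i \<in> Hom (ECat small W) (BE A) A'"
    using W.ECat_arrI[OF I BE_small[OF A] A'] by (simp add: Hom_def)
  ultimately show ?thesis using A by blast
qed

text \<open>Surjectivity of \<open>F\<close> on objects exhibits every hom-object of the domain of \<open>G\<close> as a side of a
  pullback square, to which the assumption on hom-objects applies.\<close>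

theorem base_change_reflects_descent:
  assumes small: "set_universe small" and F: "F \<in> Arr (ECat small V)"
    and eff: "effective_descent (ECat small W) (FArr CB F)"
    and ess: "\<And>f g q r c j t. f \<in> Arr V \<Longrightarrow> g \<in> Arr W \<Longrightarrow> Cod W g = H0 (Cod V f) \<Longrightarrow> is_pullback W (H1 f) g q r \<Longrightarrow>
      c \<in> Obj V \<Longrightarrow> j \<in> Hom W (Dom W r) (H0 c) \<Longrightarrow> t \<in> Hom W (H0 c) (Dom W g) \<Longrightarrow> t \<cdot>\<^bsub>W\<^esub> j = r \<Longrightarrow>
      \<exists>E\<in>Obj V. \<exists>i\<in>Hom W (H0 E) (Dom W g). iso_arrow W i"
  shows "effective_descent (ECat small V) F"
proof -
  interpret EV: category "ECat small V" by (rule V.category_ECat)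
  interpret EW: category "ECat small W" by (rule W.category_ECat)
  note CB = is_functorD[OF CB_functor[of small]]
  have dW: "descent_ff (ECat small W) (FArr CB F)" "descent_es (ECat small W) (FArr CB F)"
    using eff unfolding effective_descent_iff by blast+
  have pbV: "has_pullbacks (ECat small V)" by (rule V.has_pullbacks_ECat[OF small])
  interpret T: descent_transfer "ECat small V" "ECat small W" CB F
    by (rule descent_transfer.intro[OF CB_functor CB_ff F pbV CB_pullback[OF small]]) simp_all
  interpret F: efunctor V "ESrc F" "ETgt F" "EFObj F" "EFHom F" by (rule V.ECat_arrD[OF F])
  note cF = CB_fields[OF F]
  have surj: "\<exists>e\<in>EObj (ESrc F). EFObj F e = b" if b: "b \<in> EObj (ETgt F)" for b
  proof -
    have "\<exists>e\<in>EObj (ESrc (FArr CB F)). EFObj (FArr CB F) e = b"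
      by (rule W.descent_ff_imp_surj[OF small CB(4)[OF F] dW(1)]) (use b in \<open>simp add: cF\<close>)
    then show ?thesis by (auto simp: cF)
  qed
  have "descent_es (ECat small V) F"
  proof (rule T.transfer_descent_es[OF dW(2)])
    fix G R T
    assume G: "G \<in> Arr (ECat small W)" "Cod (ECat small W) G = FObj CB (Cod (ECat small V) F)"
      and R: "R \<in> Arr (ECat small V)" "Cod (ECat small V) R = Dom (ECat small V) F"
      and pb: "is_pullback (ECat small W) (FArr CB F) G (FArr CB R) T"
    have G': "ETgt G = BE (ETgt F)" and R': "ETgt R = ESrc F" using G(2) R(2) by simp_all
    note b = EW.pullbackD[OF pb, unfolded ECat_simps(2,3)]
    have CF: "ESrc (FArr CB F) = BE (ESrc F)" "ETgt (FArr CB F) = BE (ETgt F)" "ESrc (FArr CB R) = BE (ESrc R)"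
      using CB_fields[OF R(1)] cF by simp_all
    \<comment> \<open>The given square is known by its universal property alone. An explicit
      pullback of the same cospan exposes squares of hom-objects.\<close>
    obtain Q' R' where QR': "Q' \<in> Arr (ECat small W)" "R' \<in> Arr (ECat small W)" "W.hom_pullback (FArr CB F) G Q' R'"
      using W.hom_pullback_ex[OF small CB(4)[OF F] G(1)] CF G' by auto
    have pb': "is_pullback (ECat small W) (FArr CB F) G Q' R'"
      by (rule W.hom_pullback_imp_pullback[OF CB(4)[OF F] G(1) _ QR']) (simp only: CF G')
    note b' = EW.pullbackD[OF pb', unfolded ECat_simps(2,3)]
    \<comment> \<open>The comparison \<open>J\<close> factors \<open>R'\<close> through the source
      of \<open>T\<close>, a category in the image of \<open>CB\<close>. On hom-objects this is the
      factorization of \<open>r\<close> through an object \<open>H0 c\<close> that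
      \<open>ess\<close> asks for.\<close>
    have "\<exists>h. h \<in> Arr (ECat small W) \<and> Dom (ECat small W) h = ESrc Q' \<and> Cod (ECat small W) h = Dom (ECat small W) (FArr CB R) \<and>
        FArr CB R \<cdot>\<^bsub>ECat small W\<^esub> h = Q' \<and> T \<cdot>\<^bsub>ECat small W\<^esub> h = R'"
      by (rule EW.pullback_ex[OF pb QR'(1,2)]) (simp_all only: ECat_simps(2,3) b')
    then obtain J where J: "J \<in> Arr (ECat small W)" "ESrc J = ESrc Q'" "ETgt J = BE (ESrc R)" "T \<cdot>\<^bsub>ECat small W\<^esub> J = R'"
      unfolding ECat_simps(2,3) CF by blast
    interpret G: efunctor W "ESrc G" "BE (ETgt F)" "EFObj G" "EFHom G" using W.ecat_arr_cases[OF G(1) refl G'] by simp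
    interpret J: efunctor W "ESrc Q'" "BE (ESrc R)" "EFObj J" "EFHom J" using W.ecat_arr_cases[OF J(1-3)] by simp
    interpret T: efunctor W "BE (ESrc R)" "ESrc G" "EFObj T" "EFHom T"
      using W.ecat_arr_cases[OF b(3)] b(4,5) CF by simp
    have ob: "\<exists>z. z \<in> EObj (ESrc Q') \<and> EFObj Q' z = a \<and> EFObj R' z = b"
      if "a \<in> EObj (ESrc F)" "b \<in> EObj (ESrc G)" "EFObj F a = EFObj G b" for a b
      using QR'(3) that unfolding W.hom_pullback_def cF(1) BE_simps(1) by (metis cF(3))
    have ho: "is_pullback W (EFHom (FArr CB F) (EFObj Q' z) (EFObj Q' z')) (EFHom G (EFObj R' z) (EFObj R' z')) (EFHom Q' z z') (EFHom R' z z')"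
      if "z \<in> EObj (ESrc Q')" "z' \<in> EObj (ESrc Q')" for z z'
      using QR'(3) that unfolding W.hom_pullback_def by blast
    have "\<exists>E\<in>Obj V. \<exists>i\<in>Hom W (H0 E) (EHom (ESrc G) y y'). iso_arrow W i" if y: "y \<in> EObj (ESrc G)" "y' \<in> EObj (ESrc G)" for y y'
    proof -
      have Gy: "EFObj G y \<in> EObj (ETgt F)" "EFObj G y' \<in> EObj (ETgt F)" using G.F0[OF y(1)] G.F0[OF y(2)] by simp_all
      \<comment> \<open>Both ends of the hom-object need a preimage under \<open>F\<close>;
        otherwise no square of the pullback lies over it.\<close>
      obtain e e' where e: "e \<in> EObj (ESrc F)" "EFObj F e = EFObj G y" and e': "e' \<in> EObj (ESrc F)" "EFObj F e' = EFObj G y'"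
        using surj[OF Gy(1)] surj[OF Gy(2)] by blast
      obtain z z' where z: "z \<in> EObj (ESrc Q')" "EFObj Q' z = e" "EFObj R' z = y"
        and z': "z' \<in> EObj (ESrc Q')" "EFObj Q' z' = e'" "EFObj R' z' = y'"
        using ob[OF e(1) y(1) e(2)] ob[OF e'(1) y(2) e'(2)] by blast
      have pbh: "is_pullback W (H1 (EFHom F e e')) (EFHom G y y') (EFHom Q' z z') (EFHom R' z z')"
        using ho[OF z(1) z'(1)] unfolding z z' cF(4)[OF e(1) e'(1)] .
      have T0: "EFObj T (EFObj J z) = y" "EFObj T (EFObj J z') = y'"
        and T1: "EFHom T (EFObj J z) (EFObj J z') \<cdot>\<^bsub>W\<^esub> EFHom J z z' = EFHom R' z z'"
        using arg_cong[OF J(4), of "\<lambda>H. EFObj H z"] arg_cong[OF J(4), of "\<lambda>H. EFObj H z'"]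
          arg_cong[OF J(4), of "\<lambda>H. EFHom H z z'"] z z' J(2) by simp_all
      have Jz: "EFObj J z \<in> EObj (ESrc R)" "EFObj J z' \<in> EObj (ESrc R)" using J.F0[OF z(1)] J.F0[OF z'(1)] by simp_all
      interpret R: efunctor V "ESrc R" "ETgt R" "EFObj R" "EFHom R" by (rule V.ECat_arrD[OF R(1)])
      interpret R': efunctor W "ESrc Q'" "ESrc G" "EFObj R'" "EFHom R'"
        using W.ecat_arr_cases[OF QR'(2)] b' by simp
      note Jh = J.F1[OF z(1) z'(1), unfolded BE_simps(2)[OF Jz]]
      note Th = T.F1[unfolded BE_simps(1), OF Jz, unfolded BE_simps(2)[OF Jz] T0]
      have "\<exists>E\<in>Obj V. \<exists>i\<in>Hom W (H0 E) (Dom W (EFHom G y y')). iso_arrow W i"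
      proof (rule ess[OF _ _ _ pbh _ _ _ T1])
        show "EHom (ESrc R) (EFObj J z) (EFObj J z') \<in> Obj V" using Jz by simp
        show "EFHom J z z' \<in> Hom W (Dom W (EFHom R' z z')) (H0 (EHom (ESrc R) (EFObj J z) (EFObj J z')))"
          using Jh R'.F1_arr[OF z(1) z'(1)] by simp
        show "EFHom T (EFObj J z) (EFObj J z') \<in> Hom W (H0 (EHom (ESrc R) (EFObj J z) (EFObj J z'))) (Dom W (EFHom G y y'))"
          using Th G.F1_arr[OF y] by simp
        show "Cod W (EFHom G y y') = H0 (Cod V (EFHom F e e'))"
          using G.F1_arr[OF y] F.F1_arr[OF e(1) e'(1)] Gy e(2) e'(2) by simp
      qed (use F.F1_arr[OF e(1) e'(1)] G.F1_arr[OF y] in simp_all)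
      then show ?thesis using G.F1_arr[OF y] by simp
    qed
    from transport_ecat[OF W.ECat_arrD(2)[OF G(1)] this]
    show "\<exists>y\<in>Obj (ECat small V). \<exists>i\<in>Hom (ECat small W) (FObj CB y) (Dom (ECat small W) G). iso_arrow (ECat small W) i"
      by simp
  qed
  then show ?thesis
    unfolding effective_descent_iff using V.category_ECat pbV F T.transfer_descent_ff[OF dW(1)] by blast
qed

end

section \<open>Terminal objects and pullbacks from finite limits\<close>

lemma finite_limits_terminal:
  assumes "category C" "has_finite_limits C"
  shows "\<exists>t. is_terminal C t"
proof -
  let ?J = "\<lparr>Obj = {}, Arr = {}, Dom = (\<lambda>_. 0), Cod = (\<lambda>_. 0), Ide = (\<lambda>_. 0), Comp = (\<lambda>_ _. 0)\<rparr> :: (nat, nat) cat"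
  let ?D = "\<lparr>FObj = (\<lambda>_. undefined), FArr = (\<lambda>_. undefined)\<rparr>"
  have "category ?J" by unfold_locales (auto simp: Hom_def)
  then have "is_functor ?J C ?D" using assms(1) by (simp add: is_functor_def)
  then obtain l p where "is_limit ?J C ?D l p" using assms(2) unfolding has_finite_limits_def by fastforce
  then have "is_terminal C l" unfolding is_limit_def is_cone_def is_terminal_def by simp
  then show ?thesis by blast
qed

text \<open>The shape \<open>0 \<rightarrow> 2 \<leftarrow> 1\<close>: arrows \<open>0\<close>,
  \<open>1\<close>, \<open>2\<close> are the identities, \<open>3\<close> and \<open>4\<close> the
  two legs. A leg can only be preceded by an identity, whence the value \<open>g\<close> in
  \<open>Comp\<close>.\<close>

definition cospan_shape :: "(nat, nat) cat" where
  "cospan_shape = \<lparr>Obj = {0, 1, 2}, Arr = {0, 1, 2, 3, 4}, Dom = (\<lambda>k. if k = 3 then 0 else if k = 4 then 1 else k),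
     Cod = (\<lambda>k. if k = 3 \<or> k = 4 then 2 else k), Ide = (\<lambda>x. x), Comp = (\<lambda>g f. if g < 3 then f else g)\<rparr>"

lemma category_cospan_shape: "category cospan_shape"
  by unfold_locales (auto simp: cospan_shape_def Hom_def split: if_splits)

lemma finite_limits_pullbacks:
  fixes C :: "('o, 'a) cat" (structure)
  assumes "category C" "has_finite_limits C"
  shows "has_pullbacks C"
  unfolding has_pullbacks_def
proof (intro ballI impI)
  fix f g assume f: "f \<in> Arr C" and g: "g \<in> Arr C" and fg: "Cod C f = Cod C g"
  interpret category C by fact
  let ?D = "\<lparr>FObj = (\<lambda>x. if x = 0 then Dom C f else if x = 1 then Dom C g else Cod C f),
    FArr = (\<lambda>k. if k = 0 then Ide C (Dom C f) else if k = 1 then Ide C (Dom C g) else if k = 2 then Ide C (Cod C f)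
      else if k = 3 then f else g)\<rparr> :: (nat, nat, 'o, 'a) ftr"
  have "is_functor cospan_shape C ?D"
    unfolding is_functor_def using category_cospan_shape category_axioms f g fg
    by (auto simp: cospan_shape_def Hom_def)
  then obtain l p where lim: "is_limit cospan_shape C ?D l p"
    using assms(2) unfolding has_finite_limits_def by (fastforce simp: cospan_shape_def)
  have cone: "is_cone cospan_shape C ?D x c \<longleftrightarrow> x \<in> Obj C \<and> c 0 \<in> Hom C x (Dom C f) \<and> c 1 \<in> Hom C x (Dom C g)
      \<and> f \<cdot> c 0 = c 2 \<and> g \<cdot> c 1 = c 2" for x c
  proof
    assume "is_cone cospan_shape C ?D x c"
    then show "x \<in> Obj C \<and> c 0 \<in> Hom C x (Dom C f) \<and> c 1 \<in> Hom C x (Dom C g) \<and> f \<cdot> c 0 = c 2 \<and> g \<cdot> c 1 = c 2"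
      unfolding is_cone_def cospan_shape_def by simp
  next
    assume a: "x \<in> Obj C \<and> c 0 \<in> Hom C x (Dom C f) \<and> c 1 \<in> Hom C x (Dom C g) \<and> f \<cdot> c 0 = c 2 \<and> g \<cdot> c 1 = c 2"
    then have c: "c 0 \<in> Arr C" "Dom C (c 0) = x" "Cod C (c 0) = Dom C f" "c 1 \<in> Arr C" "Dom C (c 1) = x" "Cod C (c 1) = Dom C g"
      by (auto simp: Hom_def)
    then have "f \<cdot> c 0 \<in> Arr C" "Dom C (f \<cdot> c 0) = x" "Cod C (f \<cdot> c 0) = Cod C f" using f by simp_all
    then have "c 2 \<in> Arr C" "Dom C (c 2) = x" "Cod C (c 2) = Cod C f" using a by simp_all
    then show "is_cone cospan_shape C ?D x c" unfolding is_cone_def cospan_shape_def using a c by (simp add: Hom_def)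
  qed
  have lp: "p 0 \<in> Hom C l (Dom C f)" "p 1 \<in> Hom C l (Dom C g)" "f \<cdot> p 0 = p 2" "g \<cdot> p 1 = p 2"
    using lim cone unfolding is_limit_def by blast+
  have "is_pullback C f g (p 0) (p 1)"
    unfolding is_pullback_def
  proof (intro conjI allI impI)
    show "f \<cdot> p 0 = g \<cdot> p 1" using lp by simp
    show "p 0 \<in> Hom C (Dom C (p 0)) (Dom C f)" "p 1 \<in> Hom C (Dom C (p 0)) (Dom C g)" using lp by (auto simp: Hom_def)
    fix w u v assume a: "u \<in> Hom C w (Dom C f) \<and> v \<in> Hom C w (Dom C g) \<and> f \<cdot> u = g \<cdot> v"
    \<comment> \<open>The component at the tip of the cospan is forced to be the common
      composite.\<close>
    let ?c = "\<lambda>i::nat. if i = 0 then u else if i = 1 then v else f \<cdot> u"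
    have "is_cone cospan_shape C ?D w ?c" unfolding cone using a by (auto simp: Hom_def)
    then have "\<exists>!h. h \<in> Hom C w l \<and> (\<forall>i\<in>Obj cospan_shape. p i \<cdot> h = ?c i)"
      using lim unfolding is_limit_def by blast
    moreover have "(\<forall>i\<in>Obj cospan_shape. p i \<cdot> h = ?c i) \<longleftrightarrow> p 0 \<cdot> h = u \<and> p 1 \<cdot> h = v" if h: "h \<in> Hom C w l" for h
    proof -
      have "p 2 \<cdot> h = f \<cdot> (p 0 \<cdot> h)"
        unfolding lp(3)[symmetric] using lp(1) f h by (simp add: Hom_def)
      then show ?thesis by (auto simp: cospan_shape_def)
    qed
    moreover have "Dom C (p 0) = l" using lp by (simp add: Hom_def)
    ultimately show "\<exists>!h. h \<in> Hom C w (Dom C (p 0)) \<and> p 0 \<cdot> h = u \<and> p 1 \<cdot> h = v" by metis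
  qed
  then show "\<exists>q r. is_pullback C f g q r" by blast
qed

section \<open>Limits in the free coproduct completion\<close>

definition mk_fam :: "('u, 'o) fam \<Rightarrow> ('u, 'o) fam \<Rightarrow> ('u \<Rightarrow> 'u) \<Rightarrow> ('u \<Rightarrow> 'a) \<Rightarrow> ('u, 'o, 'a) fam_arr" where
  "mk_fam X Y i a = \<lparr>Src = X, Tgt = Y, IFun = (\<lambda>j\<in>Idx X. i j), AFun = (\<lambda>j\<in>Idx X. a j)\<rparr>"

lemma mk_fam_simps [simp]:
  "Src (mk_fam X Y i a) = X" "Tgt (mk_fam X Y i a) = Y"
  "j \<in> Idx X \<Longrightarrow> IFun (mk_fam X Y i a) j = i j" "j \<in> Idx X \<Longrightarrow> AFun (mk_fam X Y i a) j = a j"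
  by (simp_all add: mk_fam_def)

lemma Fam_simps [simp]:
  "Obj (Fam small V) = families small V" "Dom (Fam small V) = Src" "Cod (Fam small V) = Tgt"
  "Ide (Fam small V) X = mk_fam X X (\<lambda>j. j) (\<lambda>j. Ide V (Mem X j))"
  "G \<cdot>\<^bsub>Fam small V\<^esub> F = mk_fam (Src F) (Tgt G) (\<lambda>j. IFun G (IFun F j)) (\<lambda>j. AFun G (IFun F j) \<cdot>\<^bsub>V\<^esub> AFun F j)"
  by (simp_all add: Fam_def mk_fam_def)

lemma one_member_simps [simp]: "Idx (one_member x) = {undefined}" "Mem (one_member x) undefined = x"
  by (simp_all add: one_member_def)

lemma fam_eta_simps [simp]:
  "FObj (fam_eta V) x = one_member x"
  "FArr (fam_eta V) f = mk_fam (one_member (Dom V f)) (one_member (Cod V f)) (\<lambda>j. j) (\<lambda>j. f)"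
  by (simp_all add: fam_eta_def mk_fam_def)

lemma Fam_arrD:
  assumes "F \<in> Arr (Fam small V)"
  shows "Src F \<in> families small V" "Tgt F \<in> families small V" "j \<in> Idx (Src F) \<Longrightarrow> IFun F j \<in> Idx (Tgt F)"
    "j \<in> Idx (Src F) \<Longrightarrow> AFun F j \<in> Arr V" "j \<in> Idx (Src F) \<Longrightarrow> Dom V (AFun F j) = Mem (Src F) j"
    "j \<in> Idx (Src F) \<Longrightarrow> Cod V (AFun F j) = Mem (Tgt F) (IFun F j)"
  using assms by (auto simp: Fam_def PiE_iff Hom_def)

lemma mk_fam_arr:
  assumes "X \<in> families small V" "Y \<in> families small V" "\<And>j. j \<in> Idx X \<Longrightarrow> i j \<in> Idx Y"
    "\<And>j. j \<in> Idx X \<Longrightarrow> a j \<in> Hom V (Mem X j) (Mem Y (i j))"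
  shows "mk_fam X Y i a \<in> Arr (Fam small V)"
  using assms by (auto simp: Fam_def mk_fam_def)

lemma Fam_eqI:
  assumes "F \<in> Arr (Fam small V)" "G \<in> Arr (Fam small V)" "Src F = Src G" "Tgt F = Tgt G"
    "\<And>j. j \<in> Idx (Src F) \<Longrightarrow> IFun F j = IFun G j" "\<And>j. j \<in> Idx (Src F) \<Longrightarrow> AFun F j = AFun G j"
  shows "F = G"
proof -
  have "IFun F \<in> extensional (Idx (Src F))" "IFun G \<in> extensional (Idx (Src F))"
    "AFun F \<in> extensional (Idx (Src F))" "AFun G \<in> extensional (Idx (Src F))"
    using assms(1-3) by (simp_all add: Fam_def PiE_iff)
  then have "IFun F = IFun G" "AFun F = AFun G"
    using assms(5,6) by (auto intro: extensionalityI)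
  then show ?thesis using assms(3,4) by simp
qed

locale fam_setting = V: finitely_complete V + set_universe small
  for V :: "('o, 'a) cat" and small :: "'u set \<Rightarrow> bool"
begin

abbreviation Fm where "Fm \<equiv> Fam small V"

lemma families_obj: "X \<in> families small V \<Longrightarrow> j \<in> Idx X \<Longrightarrow> Mem X j \<in> Obj V"
  by (auto simp: families_def)

lemma Fam_comp_arr:
  assumes F: "F \<in> Arr Fm" and G: "G \<in> Arr Fm" and FG: "Src G = Tgt F"
  shows "G \<cdot>\<^bsub>Fm\<^esub> F \<in> Arr Fm"
  unfolding Fam_simps
  by (rule mk_fam_arr) (use Fam_arrD[OF F] Fam_arrD[OF G] FG in \<open>auto simp: Hom_def\<close>)

lemma Fam_ide_arr: "X \<in> families small V \<Longrightarrow> Ide Fm X \<in> Arr Fm"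
  unfolding Fam_simps by (rule mk_fam_arr) (auto simp: Hom_def families_obj)

lemma category_Fam: "category Fm"
proof
  fix F A B G X H Y
  assume "F \<in> Hom Fm A B"
  then have F: "F \<in> Arr Fm" "Src F = A" "Tgt F = B" by (auto simp: Hom_def)
  note F' = Fam_arrD[OF F(1)]
  have AB: "A \<in> families small V" "B \<in> families small V" using F' F by auto
  have a: "F \<cdot>\<^bsub>Fm\<^esub> Ide Fm A \<in> Arr Fm" "Ide Fm B \<cdot>\<^bsub>Fm\<^esub> F \<in> Arr Fm"
    using Fam_comp_arr[OF Fam_ide_arr[OF AB(1)] F(1)] Fam_comp_arr[OF F(1) Fam_ide_arr[OF AB(2)]] F(2,3) by simp_all
  show "F \<cdot>\<^bsub>Fm\<^esub> Ide Fm A = F"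
    by (rule Fam_eqI[OF a(1) F(1)]) (use F F' in simp_all)
  show "Ide Fm B \<cdot>\<^bsub>Fm\<^esub> F = F"
    by (rule Fam_eqI[OF a(2) F(1)]) (use F F' in simp_all)
  assume "G \<in> Hom Fm B X"
  then have G: "G \<in> Arr Fm" "Src G = B" "Tgt G = X" by (auto simp: Hom_def)
  note G' = Fam_arrD[OF G(1)]
  have GF: "G \<cdot>\<^bsub>Fm\<^esub> F \<in> Arr Fm" by (rule Fam_comp_arr[OF F(1) G(1)]) (use F G in simp)
  then show "G \<cdot>\<^bsub>Fm\<^esub> F \<in> Hom Fm A X" using F G by (simp add: Hom_def)
  assume "H \<in> Hom Fm X Y"
  then have H: "H \<in> Arr Fm" "Src H = X" "Tgt H = Y" by (auto simp: Hom_def)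
  note H' = Fam_arrD[OF H(1)]
  have HG: "H \<cdot>\<^bsub>Fm\<^esub> G \<in> Arr Fm" by (rule Fam_comp_arr[OF G(1) H(1)]) (use H G in simp)
  show "(H \<cdot>\<^bsub>Fm\<^esub> G) \<cdot>\<^bsub>Fm\<^esub> F = H \<cdot>\<^bsub>Fm\<^esub> (G \<cdot>\<^bsub>Fm\<^esub> F)"
  proof (rule Fam_eqI)
    show "(H \<cdot>\<^bsub>Fm\<^esub> G) \<cdot>\<^bsub>Fm\<^esub> F \<in> Arr Fm" by (rule Fam_comp_arr[OF F(1) HG]) (use F G in simp)
    show "H \<cdot>\<^bsub>Fm\<^esub> (G \<cdot>\<^bsub>Fm\<^esub> F) \<in> Arr Fm" by (rule Fam_comp_arr[OF GF H(1)]) (use H G in simp)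
  qed (use F F' G G' H H' in simp_all)
next
  fix F assume "F \<in> Arr Fm"
  then show "Dom Fm F \<in> Obj Fm" "Cod Fm F \<in> Obj Fm" using Fam_arrD(1,2)[of F small V] by auto
next
  fix X assume "X \<in> Obj Fm"
  then show "Ide Fm X \<in> Hom Fm X X" using Fam_ide_arr[of X] by (simp add: Hom_def)
qed

lemma one_member: "x \<in> Obj V \<Longrightarrow> one_member x \<in> families small V"
proof -
  assume x: "x \<in> Obj V"
  \<comment> \<open>A constant function maps any nonempty small set onto
    \<open>{undefined}\<close>.\<close>
  from small_two obtain a b :: 'u where "small {a, b}" by (elim exE conjE)
  from small_image[OF this, of "\<lambda>_. undefined"] have "small {undefined}" by simp
  then show ?thesis using x by (simp add: families_def one_member_def)
qed

lemma one_member_terminal: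
  assumes t: "is_terminal V t"
  shows "is_terminal Fm (one_member t)"
  unfolding is_terminal_def
proof (intro conjI ballI)
  have tO: "t \<in> Obj V" using t by (simp add: is_terminal_def)
  show "one_member t \<in> Obj Fm" using one_member[OF tO] by simp
  fix X assume "X \<in> Obj Fm"
  then have X: "X \<in> families small V" by simp
  have "\<forall>j\<in>Idx X. \<exists>h. h \<in> Hom V (Mem X j) t"
    using t families_obj[OF X] unfolding is_terminal_def by blast
  then obtain h where h: "\<And>j. j \<in> Idx X \<Longrightarrow> h j \<in> Hom V (Mem X j) t" by metis
  let ?H = "mk_fam X (one_member t) (\<lambda>_. undefined) h"
  have H: "?H \<in> Arr Fm" by (rule mk_fam_arr[OF X one_member[OF tO]]) (use h in simp_all)
  show "\<exists>!h. h \<in> Hom Fm X (one_member t)"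
  proof (rule ex1I[of _ ?H])
    show "?H \<in> Hom Fm X (one_member t)" using H by (simp add: Hom_def)
    fix G assume "G \<in> Hom Fm X (one_member t)"
    then have G: "G \<in> Arr Fm" "Src G = X" "Tgt G = one_member t" by (auto simp: Hom_def)
    note G' = Fam_arrD[OF G(1)]
    show "G = ?H"
    proof (rule Fam_eqI[OF G(1) H])
      fix j assume j: "j \<in> Idx (Src G)"
      show i: "IFun G j = IFun ?H j" using G'(3)[OF j] G j by simp
      show "AFun G j = AFun ?H j"
        by (rule V.terminal_unique[OF t]) (use G'(3-6)[OF j] h[of j] j G in \<open>simp_all add: Hom_def\<close>)
    qed (use G in simp_all)
  qed
qed

text \<open>Mediating arrows arise in two layers: the index function from the pullback of index
  sets, then over each index a member arrow from the pullback in \<open>V\<close>. The criterion is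
  the analogue of \<open>hom_pullback\<close> for families.\<close>

lemma Fam_pullbackI:
  assumes arr: "F \<in> Arr Fm" "G \<in> Arr Fm" "Q \<in> Arr Fm" "R \<in> Arr Fm"
    and o: "Tgt G = Tgt F" "Src R = Src Q" "Tgt Q = Src F" "Tgt R = Src G"
    and sq: "\<And>z. z \<in> Idx (Src Q) \<Longrightarrow> IFun F (IFun Q z) = IFun G (IFun R z)"
    and ob: "\<And>i j. i \<in> Idx (Src F) \<Longrightarrow> j \<in> Idx (Src G) \<Longrightarrow> IFun F i = IFun G j \<Longrightarrow>
      \<exists>!z. z \<in> Idx (Src Q) \<and> IFun Q z = i \<and> IFun R z = j"
    and ho: "\<And>z. z \<in> Idx (Src Q) \<Longrightarrow> is_pullback V (AFun F (IFun Q z)) (AFun G (IFun R z)) (AFun Q z) (AFun R z)"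
  shows "is_pullback Fm F G Q R"
proof -
  interpret Fm: category Fm by (rule category_Fam)
  note F = Fam_arrD[OF arr(1)] and G = Fam_arrD[OF arr(2)] and Q = Fam_arrD[OF arr(3), unfolded o] and R = Fam_arrD[OF arr(4), unfolded o]
  note joint = V.pullback_unique[OF ho]
  show ?thesis
  proof (rule Fm.pullbackI)
    show "F \<cdot>\<^bsub>Fm\<^esub> Q = G \<cdot>\<^bsub>Fm\<^esub> R"
    proof (rule Fam_eqI)
      show "F \<cdot>\<^bsub>Fm\<^esub> Q \<in> Arr Fm" "G \<cdot>\<^bsub>Fm\<^esub> R \<in> Arr Fm" by (rule Fam_comp_arr; use arr o in simp)+
      fix z assume "z \<in> Idx (Src (F \<cdot>\<^bsub>Fm\<^esub> Q))"
      then have z: "z \<in> Idx (Src Q)" by simp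
      show "IFun (F \<cdot>\<^bsub>Fm\<^esub> Q) z = IFun (G \<cdot>\<^bsub>Fm\<^esub> R) z" using z sq o by simp
      show "AFun (F \<cdot>\<^bsub>Fm\<^esub> Q) z = AFun (G \<cdot>\<^bsub>Fm\<^esub> R) z" using z V.pullbackD(6)[OF ho[OF z]] o by simp
    qed (use o in simp_all)
    fix U W
    assume a: "U \<in> Arr Fm" "W \<in> Arr Fm" "Dom Fm W = Dom Fm U" "Cod Fm U = Dom Fm F" "Cod Fm W = Dom Fm G"
      and eq: "F \<cdot>\<^bsub>Fm\<^esub> U = G \<cdot>\<^bsub>Fm\<^esub> W"
    have o': "Src W = Src U" "Tgt U = Src F" "Tgt W = Src G" using a by simp_all
    note U = Fam_arrD[OF a(1), unfolded o'] and W = Fam_arrD[OF a(2), unfolded o']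
    have e0: "IFun F (IFun U j) = IFun G (IFun W j)"
      and e1: "AFun F (IFun U j) \<cdot>\<^bsub>V\<^esub> AFun U j = AFun G (IFun W j) \<cdot>\<^bsub>V\<^esub> AFun W j" if "j \<in> Idx (Src U)" for j
      using arg_cong[OF eq, of "\<lambda>H. IFun H j"] arg_cong[OF eq, of "\<lambda>H. AFun H j"] that o' by simp_all
    have "\<exists>z. z \<in> Idx (Src Q) \<and> IFun Q z = IFun U j \<and> IFun R z = IFun W j" if "j \<in> Idx (Src U)" for j
      using ob[OF U(3)[OF that] W(3)[OF that] e0[OF that]] by blast
    then obtain h where h: "\<And>j. j \<in> Idx (Src U) \<Longrightarrow> h j \<in> Idx (Src Q)" "\<And>j. j \<in> Idx (Src U) \<Longrightarrow> IFun Q (h j) = IFun U j"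
      "\<And>j. j \<in> Idx (Src U) \<Longrightarrow> IFun R (h j) = IFun W j" by metis
    have "\<exists>k. k \<in> Arr V \<and> Dom V k = Mem (Src U) j \<and> Cod V k = Dom V (AFun Q (h j))
        \<and> AFun Q (h j) \<cdot>\<^bsub>V\<^esub> k = AFun U j \<and> AFun R (h j) \<cdot>\<^bsub>V\<^esub> k = AFun W j" if j: "j \<in> Idx (Src U)" for j
      by (rule V.pullback_ex[OF ho[OF h(1)[OF j]]])
        (use j U(3-6)[OF j] W(3-6)[OF j] F(4-6) G(4-6) e1[OF j] in \<open>simp_all add: h\<close>)
    then obtain k where k0: "\<And>j. j \<in> Idx (Src U) \<Longrightarrow> k j \<in> Arr V \<and> Dom V (k j) = Mem (Src U) j \<and> Cod V (k j) = Dom V (AFun Q (h j))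
        \<and> AFun Q (h j) \<cdot>\<^bsub>V\<^esub> k j = AFun U j \<and> AFun R (h j) \<cdot>\<^bsub>V\<^esub> k j = AFun W j" by metis
    let ?H = "mk_fam (Src U) (Src Q) h k"
    have H: "?H \<in> Arr Fm"
      by (rule mk_fam_arr[OF U(1) Q(1)]) (use h k0 Q in \<open>simp_all add: Hom_def\<close>)
    have "Q \<cdot>\<^bsub>Fm\<^esub> ?H = U"
      by (rule Fam_eqI[OF Fam_comp_arr[OF H arr(3)] a(1)]) (use o o' h k0 in simp_all)
    moreover have "R \<cdot>\<^bsub>Fm\<^esub> ?H = W"
      by (rule Fam_eqI[OF Fam_comp_arr[OF H arr(4)] a(2)]) (use o o' h k0 in simp_all)
    ultimately show "\<exists>h. h \<in> Arr Fm \<and> Dom Fm h = Dom Fm U \<and> Cod Fm h = Dom Fm Q \<and> Q \<cdot>\<^bsub>Fm\<^esub> h = U \<and> R \<cdot>\<^bsub>Fm\<^esub> h = W"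
      using H by (intro exI[of _ ?H]) (simp del: Fam_simps(5))
  next
    fix H K
    assume a: "H \<in> Arr Fm" "K \<in> Arr Fm" "Dom Fm K = Dom Fm H" "Cod Fm H = Dom Fm Q" "Cod Fm K = Dom Fm Q"
      and eq: "Q \<cdot>\<^bsub>Fm\<^esub> H = Q \<cdot>\<^bsub>Fm\<^esub> K" "R \<cdot>\<^bsub>Fm\<^esub> H = R \<cdot>\<^bsub>Fm\<^esub> K"
    have o': "Src K = Src H" "Tgt H = Src Q" "Tgt K = Src Q" using a by simp_all
    note H = Fam_arrD[OF a(1), unfolded o'] and K = Fam_arrD[OF a(2), unfolded o']
    have e: "IFun H j = IFun K j" if j: "j \<in> Idx (Src H)" for j
    proof -
      have "IFun Q (IFun H j) = IFun Q (IFun K j)" "IFun R (IFun H j) = IFun R (IFun K j)"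
        using arg_cong[OF eq(1), of "\<lambda>H. IFun H j"] arg_cong[OF eq(2), of "\<lambda>H. IFun H j"] j o' by simp_all
      moreover have "IFun Q (IFun H j) \<in> Idx (Src F)" "IFun R (IFun H j) \<in> Idx (Src G)"
        using Q(3)[OF H(3)[OF j]] R(3)[OF H(3)[OF j]] by simp_all
      ultimately show ?thesis
        using ob[OF _ _ sq[OF H(3)[OF j]]] H(3)[OF j] K(3)[OF j] by metis
    qed
    show "H = K"
    proof (rule Fam_eqI[OF a(1,2)])
      fix j assume j: "j \<in> Idx (Src H)"
      have "AFun Q (IFun H j) \<cdot>\<^bsub>V\<^esub> AFun H j = AFun Q (IFun H j) \<cdot>\<^bsub>V\<^esub> AFun K j"
        "AFun R (IFun H j) \<cdot>\<^bsub>V\<^esub> AFun H j = AFun R (IFun H j) \<cdot>\<^bsub>V\<^esub> AFun K j"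
        using arg_cong[OF eq(1), of "\<lambda>H. AFun H j"] arg_cong[OF eq(2), of "\<lambda>H. AFun H j"] j o' e[OF j] by simp_all
      then show "AFun H j = AFun K j"
        by (intro joint[OF H(3)[OF j], of "AFun H j" "AFun K j"])
          (use H(3-6)[OF j] K(3-6)[OF j] Q(3-6)[OF H(3)[OF j]] R(3-6)[OF H(3)[OF j]] F(4) G(4) e[OF j] in simp_all)
    qed (use o' e in simp_all)
  qed (use arr o in simp_all)
qed

text \<open>Compatible pairs of indices are coded in the universe, and over each code a pullback in
  \<open>V\<close> supplies the member.\<close>

lemma has_pullbacks_Fam: "has_pullbacks Fm"
  unfolding has_pullbacks_def
proof (intro ballI impI)
  fix F G assume arr: "F \<in> Arr Fm" "G \<in> Arr Fm" and "Cod Fm F = Cod Fm G"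
  then have FG: "Tgt F = Tgt G" by simp
  note F = Fam_arrD[OF arr(1)] and G = Fam_arrD[OF arr(2)]
  let ?D = "Sigma (Idx (Src F)) (\<lambda>i. {j \<in> Idx (Src G). IFun F i = IFun G j})"
  obtain e where e: "inj_on e ?D" "small (e ` ?D)"
    using set_universe_pairs[OF set_universe_axioms, of "Idx (Src F)" "Idx (Src G)" "\<lambda>i j. IFun F i = IFun G j"] F(1) G(1)
    by (auto simp: families_def)
  define Z where "Z = e ` ?D"
  define d1 d2 where "d1 z = fst (inv_into ?D e z)" and "d2 z = snd (inv_into ?D e z)" for z
  have d: "d1 z \<in> Idx (Src F)" "d2 z \<in> Idx (Src G)" "IFun F (d1 z) = IFun G (d2 z)" "e (d1 z, d2 z) = z" if "z \<in> Z" for z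
  proof -
    have "inv_into ?D e z \<in> ?D" "e (inv_into ?D e z) = z"
      using that unfolding Z_def by (auto intro: inv_into_into f_inv_into_f)
    then show "d1 z \<in> Idx (Src F)" "d2 z \<in> Idx (Src G)" "IFun F (d1 z) = IFun G (d2 z)" "e (d1 z, d2 z) = z"
      unfolding d1_def d2_def by (auto simp: mem_Sigma_iff split: prod.splits)
  qed
  have ed: "e (i, j) \<in> Z" "d1 (e (i, j)) = i" "d2 (e (i, j)) = j"
    if "i \<in> Idx (Src F)" "j \<in> Idx (Src G)" "IFun F i = IFun G j" for i j
  proof -
    have ab: "(i, j) \<in> ?D" using that by simp
    then show "e (i, j) \<in> Z" unfolding Z_def by blast
    show "d1 (e (i, j)) = i" "d2 (e (i, j)) = j"
      unfolding d1_def d2_def by (simp_all only: inv_into_f_f[OF e(1) ab] fst_conv snd_conv)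
  qed
  have "\<exists>q r. is_pullback V (AFun F (d1 z)) (AFun G (d2 z)) q r" if z: "z \<in> Z" for z
    using V.pbs F(4,6)[OF d(1)[OF z]] G(4,6)[OF d(2)[OF z]] d(3)[OF z] FG unfolding has_pullbacks_def by simp
  then obtain q r where qr: "\<And>z. z \<in> Z \<Longrightarrow> is_pullback V (AFun F (d1 z)) (AFun G (d2 z)) (q z) (r z)" by metis
  note qr' = V.pullbackD[OF qr]
  define P where "P = \<lparr>Idx = Z, Mem = (\<lambda>z\<in>Z. Dom V (q z))\<rparr>"
  have P_simps [simp]: "Idx P = Z" "z \<in> Z \<Longrightarrow> Mem P z = Dom V (q z)" for z by (simp_all add: P_def)
  have P: "P \<in> families small V" using e(2) qr'(1) by (auto simp: families_def P_def Z_def[symmetric])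
  have Q: "mk_fam P (Src F) d1 q \<in> Arr Fm"
    by (rule mk_fam_arr[OF P F(1)]) (use d qr' F(5) in \<open>simp_all add: Hom_def\<close>)
  have R: "mk_fam P (Src G) d2 r \<in> Arr Fm"
    by (rule mk_fam_arr[OF P G(1)]) (use d qr' G(5) in \<open>simp_all add: Hom_def\<close>)
  have "is_pullback Fm F G (mk_fam P (Src F) d1 q) (mk_fam P (Src G) d2 r)"
  proof (rule Fam_pullbackI[OF arr Q R])
    fix i j assume "i \<in> Idx (Src F)" "j \<in> Idx (Src G)" "IFun F i = IFun G j"
    note ed = ed[OF this]
    show "\<exists>!z. z \<in> Idx (Src (mk_fam P (Src F) d1 q)) \<and> IFun (mk_fam P (Src F) d1 q) z = i \<and> IFun (mk_fam P (Src G) d2 r) z = j"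
      by (rule ex1I[of _ "e (i, j)"]) (use ed d in auto)
  qed (use FG d qr in simp_all)
  then show "\<exists>q r. is_pullback Fm F G q r" by blast
qed

section \<open>The inclusion by one-member families\<close>

lemma eta_arr: "f \<in> Arr V \<Longrightarrow> FArr (fam_eta V) f \<in> Arr Fm"
  unfolding fam_eta_simps by (rule mk_fam_arr) (auto simp: one_member Hom_def)

lemma eta_functor: "is_functor V Fm (fam_eta V)"
  unfolding is_functor_def
proof (intro conjI ballI impI)
  fix f assume f: "f \<in> Arr V"
  show "FArr (fam_eta V) f \<in> Hom Fm (FObj (fam_eta V) (Dom V f)) (FObj (fam_eta V) (Cod V f))"
    using eta_arr[OF f] by (simp add: Hom_def)
  fix g assume g: "g \<in> Arr V" and gf: "Dom V g = Cod V f"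
  have gfA: "g \<cdot>\<^bsub>V\<^esub> f \<in> Arr V" using f g gf by simp
  show "FArr (fam_eta V) (g \<cdot>\<^bsub>V\<^esub> f) = FArr (fam_eta V) g \<cdot>\<^bsub>Fm\<^esub> FArr (fam_eta V) f"
    by (rule Fam_eqI[OF eta_arr[OF gfA] Fam_comp_arr[OF eta_arr[OF f] eta_arr[OF g]]]) (use f g gf in simp_all)
next
  fix x assume x: "x \<in> Obj V"
  show "FObj (fam_eta V) x \<in> Obj Fm" using one_member[OF x] by simp
  show "FArr (fam_eta V) (Ide V x) = Ide Fm (FObj (fam_eta V) x)"
    using x by (simp add: mk_fam_def restrict_def fun_eq_iff)
qed (rule V.category_axioms category_Fam)+

lemma eta_ff: "fully_faithful V Fm (fam_eta V)"
  unfolding fully_faithful_def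
proof (intro ballI)
  fix x y G assume x: "x \<in> Obj V" "y \<in> Obj V" and "G \<in> Hom Fm (FObj (fam_eta V) x) (FObj (fam_eta V) y)"
  then have G: "G \<in> Arr Fm" "Src G = one_member x" "Tgt G = one_member y" by (simp_all add: Hom_def)
  note G' = Fam_arrD(3-6)[OF G(1), of undefined, unfolded G(2,3), simplified]
  have f: "AFun G undefined \<in> Arr V" "Dom V (AFun G undefined) = x" "Cod V (AFun G undefined) = y"
    using G' by simp_all
  show "\<exists>!f. f \<in> Hom V x y \<and> FArr (fam_eta V) f = G"
  proof (rule ex1I[of _ "AFun G undefined"], intro conjI)
    show "AFun G undefined \<in> Hom V x y" using f by (simp add: Hom_def)
    show "FArr (fam_eta V) (AFun G undefined) = G"
      by (rule Fam_eqI[OF eta_arr[OF f(1)] G(1)]) (use f G G' in simp_all)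
    fix f assume "f \<in> Hom V x y \<and> FArr (fam_eta V) f = G"
    then have "G = FArr (fam_eta V) f" by simp
    then show "f = AFun G undefined" by simp
  qed
qed

lemma eta_pullback:
  assumes f: "f \<in> Arr V" "g \<in> Arr V" "Cod V f = Cod V g" and pb: "is_pullback V f g q r"
  shows "is_pullback Fm (FArr (fam_eta V) f) (FArr (fam_eta V) g) (FArr (fam_eta V) q) (FArr (fam_eta V) r)"
proof -
  note qr = V.pullbackD[OF pb]
  show ?thesis
    by (rule Fam_pullbackI[OF eta_arr[OF f(1)] eta_arr[OF f(2)] eta_arr[OF qr(1)] eta_arr[OF qr(3)]])
      (use f qr(1-5) pb in auto)
qed

sublocale eta: base_change V Fm "fam_eta V"
proof -
  interpret Fm: category Fm by (rule category_Fam)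
  interpret Fm: finitely_complete Fm
    by unfold_locales (use has_pullbacks_Fam one_member_terminal[OF V.trm] in blast)+
  show "base_change V Fm (fam_eta V)"
    by unfold_locales (use eta_functor eta_ff one_member_terminal[OF V.trm] eta_pullback in \<open>simp_all del: fam_eta_simps(2)\<close>)
qed

text \<open>An element \<open>z\<close> of the index set of \<open>Z\<close> gives a test arrow from a one-member family into the
  pullback, so that \<open>r\<close> is surjective on indices; as it factors through a one-member family,
  \<open>Z\<close> has a single member.\<close>

lemma one_member_pullback:
  assumes f: "f \<in> Arr V" and g: "g \<in> Arr Fm" "Cod Fm g = FObj (fam_eta V) (Cod V f)"
    and pb: "is_pullback Fm (FArr (fam_eta V) f) g q r"
    and c: "j \<in> Hom Fm (Dom Fm r) (FObj (fam_eta V) c)" "t \<in> Hom Fm (FObj (fam_eta V) c) (Dom Fm g)"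
      "t \<cdot>\<^bsub>Fm\<^esub> j = r"
  shows "\<exists>E\<in>Obj V. \<exists>i\<in>Hom Fm (FObj (fam_eta V) E) (Dom Fm g). iso_arrow Fm i"
proof -
  define Z where "Z = Src g"
  have gZ: "Src g = Z" "Tgt g = one_member (Cod V f)" using g by (simp_all add: Z_def)
  have jt: "j \<in> Arr Fm" "Src j = Src r" "Tgt j = one_member c" "t \<in> Arr Fm" "Src t = one_member c" "Tgt t = Z"
    using c(1,2) by (simp_all add: Hom_def Z_def)
  have tj: "t \<cdot>\<^bsub>Fm\<^esub> j = r" by (fact c(3))
  note g' = Fam_arrD[OF g(1), unfolded gZ, simplified] and pb' = eta.W.pullbackD(1-5)[OF pb]
  \<comment> \<open>The value of \<open>t\<close> at the only index of its source. It shows that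
    \<open>Z\<close> has at least one member.\<close>
  define z0 where "z0 = IFun t undefined"
  have z0: "z0 \<in> Idx Z" using Fam_arrD(3)[OF jt(4), of undefined] jt(5,6) by (simp add: z0_def)
  have single: "z = z0" if z: "z \<in> Idx Z" for z
  proof -
    obtain u v where uv: "is_pullback V f (AFun g z) u v"
      using V.pbs[unfolded has_pullbacks_def, rule_format, OF f, of "AFun g z"] g'(3-6)[OF z] by auto
    note uv' = V.pullbackD[OF uv]
    let ?d = "Dom V u" and ?v = "mk_fam (one_member (Dom V u)) Z (\<lambda>_. z) (\<lambda>_. v)"
    have d: "one_member ?d \<in> families small V" using uv'(1) by (intro one_member) simp
    have v: "?v \<in> Arr Fm" by (rule mk_fam_arr[OF d g'(1)]) (use z uv' g'(5)[OF z] in \<open>simp_all add: Hom_def\<close>)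
    have e: "FArr (fam_eta V) f \<cdot>\<^bsub>Fm\<^esub> FArr (fam_eta V) u = g \<cdot>\<^bsub>Fm\<^esub> ?v"
      by (rule Fam_eqI[OF Fam_comp_arr[OF eta_arr[OF uv'(1)] eta_arr[OF f]] Fam_comp_arr[OF v g(1)]])
        (use gZ uv' g'(3)[OF z] in simp_all)
    obtain h where h: "h \<in> Arr Fm" "Src h = one_member ?d" "Tgt h = Src q" "r \<cdot>\<^bsub>Fm\<^esub> h = ?v"
      using eta.W.pullback_ex[OF pb eta_arr[OF uv'(1)] v _ _ _ _ e, of "one_member ?d"] gZ uv' by auto
    have h0: "IFun h undefined \<in> Idx (Src r)" using Fam_arrD(3)[OF h(1), of undefined] h(2,3) pb'(4) by simp
    have "z = IFun r (IFun h undefined)"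
      using arg_cong[OF h(4), of "\<lambda>H. IFun H undefined"] h(2) by simp
    also have "\<dots> = IFun t (IFun j (IFun h undefined))"
      using arg_cong[OF tj, of "\<lambda>H. IFun H (IFun h undefined)"] h0 jt(2) by simp
    \<comment> \<open>The target of \<open>j\<close> has a single index, so the value of
      \<open>r\<close> does not depend on \<open>h\<close> and hence not on
      \<open>z\<close>.\<close>
    also have "IFun j (IFun h undefined) = undefined"
      using Fam_arrD(3)[OF jt(1), of "IFun h undefined"] h0 jt(2,3) by simp
    finally show ?thesis unfolding z0_def .
  qed
  let ?E = "Mem Z z0"
  have E: "?E \<in> Obj V" by (rule families_obj[OF g'(1) z0])
  note o = one_member[OF E]
  have Z: "Idx Z = {z0}" using z0 single by blast
  let ?i = "mk_fam (one_member ?E) Z (\<lambda>_. z0) (\<lambda>_. Ide V ?E)" and ?k = "mk_fam Z (one_member ?E) (\<lambda>_. undefined) (\<lambda>_. Ide V ?E)"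
  have i: "?i \<in> Arr Fm" by (rule mk_fam_arr[OF o g'(1)]) (use E z0 in \<open>simp_all add: Hom_def\<close>)
  have k: "?k \<in> Arr Fm" by (rule mk_fam_arr[OF g'(1) o]) (use E Z in \<open>simp_all add: Hom_def\<close>)
  have "iso_arrow Fm ?i"
  proof (rule eta.W.iso_arrowI[of _ "one_member ?E" Z ?k])
    show "?k \<cdot>\<^bsub>Fm\<^esub> ?i = Ide Fm (one_member ?E)"
      by (rule Fam_eqI[OF Fam_comp_arr[OF i k] Fam_ide_arr[OF o]]) (use E Z in simp_all)
    show "?i \<cdot>\<^bsub>Fm\<^esub> ?k = Ide Fm Z"
      by (rule Fam_eqI[OF Fam_comp_arr[OF k i] Fam_ide_arr[OF g'(1)]]) (use E Z in simp_all)
  qed (use i k in \<open>simp_all add: Hom_def\<close>)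
  then show ?thesis using E i gZ by (intro bexI[of _ ?E] bexI[of _ ?i]) (simp_all add: Hom_def)
qed

end

theorem theorem1p2p1:
  fixes small :: "'u set \<Rightarrow> bool"
    and V :: "('o, 'a) cat"
    and F :: "('u, 'o, 'a) eftr"
  assumes "set_universe small"
    and "category V"
    and "has_finite_limits V"
    and "F \<in> Arr (ECat small V)"
    and "effective_descent (ECat small (Fam small V))
           (FArr (change_of_base V (Fam small V) (fam_eta V)) F)"
  shows "effective_descent (ECat small V) F"
proof -
  interpret fam_setting V small
    using assms(1,2) finite_limits_terminal[OF assms(2,3)] finite_limits_pullbacks[OF assms(2,3)]
    by (simp add: fam_setting_def finitely_complete_def finitely_complete_axioms_def)
  \<comment> \<open>The condition on hom-objects in the general result is the point where the
    structure of families enters.\<close>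
  show ?thesis
    using eta.base_change_reflects_descent[OF assms(1,4,5)] one_member_pullback by blast
qed

end
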